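(* Let $\Omega\subset\mathbb{R}^N$ ($N>1$) be a bounded domain with $C^2$ boundary. For $i=1,2$ let $p_i\in C^1(\overline{\Omega})$ with $1<p_i^-\le p_i^+<N$, let $r_i,q_i\in L^\infty(\Omega)$ with essential infimum $\ge1$, and let $\alpha_i\in L^\infty(\Omega)$ be nonnegative a.e. Let $\theta_1,\theta_2>0$ and let $f_i:[0,\infty)\to\mathbb{R}$, $i=1,2$, satisfy: $f_i\in C^0([0,\theta_i],\mathbb{R})$; $f_i(0)=f_i(\theta_i)=0$ and $f_i(t)>0$ for $t\in(0,\theta_i)$. Let $\mathcal{A}:\overline{\Omega}\times[0,\infty)\to\mathbb{R}$ be continuous with $\mathcal{A}(x,t)>0$ in $\overline{\Omega}\times(0,\max\{|\theta_1|_{L^{r_2(x)}},|\theta_2|_{L^{r_1(x)}}\}]$ (here $\theta_i$ denotes the constant function). Then there exists $\lambda_0>0$ such that for every $\lambda\ge\lambda_0$ the problem $$-\mathcal{A}(x,|v|_{L^{r_1(x)}})\Delta_{p_1(x)}u=\lambda f_1(u)|v|_{L^{q_1(x)}}^{\alpha_1(x)}\ \text{in }\Omega,$$ $$-\mathcal{A}(x,|u|_{L^{r_2(x)}})\Delta_{p_2(x)}v=\lambda f_2(v)|u|_{L^{q_2(x)}}^{\alpha_2(x)}\ \text{in }\Omega,\qquad u=v=0\ \text{on }\partial\Omega$$ has a positive weak solution.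
   Context: For $m\in L^\infty(\Omega)$, $m^+=\operatorname{ess\,sup}_\Omega m$, $m^-=\operatorname{ess\,inf}_\Omega m$. $|\cdot|_{L^{m(x)}}$ is the Luxemburg norm of the variable exponent Lebesgue space $L^{m(x)}(\Omega)$: $|u|_{L^{m(x)}}=\inf\{\lambda>0:\int_\Omega|u/\lambda|^{m(x)}\le1\}$. $W_0^{1,p(x)}(\Omega)$ is the closure of $C_0^\infty(\Omega)$ in the variable exponent Sobolev space $W^{1,p(x)}(\Omega)$, and $\Delta_{p(x)}u=\operatorname{div}(|\nabla u|^{p(x)-2}\nabla u)$. A positive weak solution is a pair $(u,v)$ with $u\in W_0^{1,p_1(x)}(\Omega)\cap L^\infty(\Omega)$, $v\in W_0^{1,p_2(x)}(\Omega)\cap L^\infty(\Omega)$, $u,v>0$ in $\Omega$, such that for all $\varphi$ in the respective spaces $\int_\Omega|\nabla u|^{p_1(x)-2}\nabla u\nabla\varphi=\int_\Omega\frac{\lambda f_1(u)|v|_{L^{q_1(x)}}^{\alpha_1(x)}}{\mathcal{A}(x,|v|_{L^{r_1(x)}})}\varphi$ and $\int_\Omega|\nabla v|^{p_2(x)-2}\nabla v\nabla\varphi=\int_\Omega\frac{\lambda f_2(v)|u|_{L^{q_2(x)}}^{\alpha_2(x)}}{\mathcal{A}(x,|u|_{L^{r_2(x)}})}\varphi$. *)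

theory Defs
  imports "HOL-Analysis.Analysis"
begin

fun piter :: "'a::euclidean_space list \<Rightarrow> ('a \<Rightarrow> real) \<Rightarrow> 'a \<Rightarrow> real" where
  "piter [] f = f"
| "piter (b # bs) f = (\<lambda>x. frechet_derivative (piter bs f) (at x) b)"

definition grad :: "('a::euclidean_space \<Rightarrow> real) \<Rightarrow> 'a \<Rightarrow> 'a" where
  "grad f x = (\<Sum>b\<in>Basis. frechet_derivative f (at x) b *\<^sub>R b)"

definition Ck_on :: "nat \<Rightarrow> 'a::euclidean_space set \<Rightarrow> ('a \<Rightarrow> real) \<Rightarrow> bool" where
  "Ck_on k U f \<longleftrightarrow> open U \<and>
     (\<forall>bs. set bs \<subseteq> Basis \<longrightarrow> length bs < k \<longrightarrow> (\<forall>x\<in>U. piter bs f differentiable (at x))) \<and>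
     (\<forall>bs. set bs \<subseteq> Basis \<longrightarrow> length bs \<le> k \<longrightarrow> continuous_on U (piter bs f))"

definition C1_closure :: "'a::euclidean_space set \<Rightarrow> ('a \<Rightarrow> real) \<Rightarrow> bool" where
  "C1_closure \<Omega> p \<longleftrightarrow> (\<exists>U P. open U \<and> closure \<Omega> \<subseteq> U \<and> Ck_on 1 U P \<and> (\<forall>x\<in>closure \<Omega>. P x = p x))"

definition smooth_fn :: "('a::euclidean_space \<Rightarrow> real) \<Rightarrow> bool" where
  "smooth_fn f \<longleftrightarrow> (\<forall>bs. set bs \<subseteq> Basis \<longrightarrow> (\<forall>x. piter bs f differentiable (at x)))"

definition test_fn :: "'a::euclidean_space set \<Rightarrow> ('a \<Rightarrow> real) \<Rightarrow> bool" where
  "test_fn \<Omega> \<phi> \<longleftrightarrow> smooth_fn \<phi> \<and> compact (closure {x. \<phi> x \<noteq> 0}) \<and> closure {x. \<phi> x \<noteq> 0} \<subseteq> \<Omega>"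

definition C2_boundary :: "'a::euclidean_space set \<Rightarrow> bool" where
  "C2_boundary \<Omega> \<longleftrightarrow> (\<forall>z\<in>frontier \<Omega>. \<exists>r>0. \<exists>\<psi>. Ck_on 2 (ball z r) \<psi> \<and> grad \<psi> z \<noteq> 0 \<and>
       \<Omega> \<inter> ball z r = {x \<in> ball z r. \<psi> x < 0})"

definition modular :: "'a::euclidean_space set \<Rightarrow> ('a \<Rightarrow> real) \<Rightarrow> ('a \<Rightarrow> real) \<Rightarrow> ennreal" where
  "modular \<Omega> m u = (\<integral>\<^sup>+ x. indicator \<Omega> x * ennreal (\<bar>u x\<bar> powr m x) \<partial>lebesgue)"

definition in_Lvar :: "'a::euclidean_space set \<Rightarrow> ('a \<Rightarrow> real) \<Rightarrow> ('a \<Rightarrow> real) \<Rightarrow> bool" where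
  "in_Lvar \<Omega> m u \<longleftrightarrow> set_borel_measurable lebesgue \<Omega> u \<and> modular \<Omega> m u < \<infinity>"

definition lux :: "'a::euclidean_space set \<Rightarrow> ('a \<Rightarrow> real) \<Rightarrow> ('a \<Rightarrow> real) \<Rightarrow> real" where
  "lux \<Omega> m u = Inf {l. 0 < l \<and> modular \<Omega> m (\<lambda>x. u x / l) \<le> 1}"

definition in_Linf :: "'a::euclidean_space set \<Rightarrow> ('a \<Rightarrow> real) \<Rightarrow> bool" where
  "in_Linf \<Omega> u \<longleftrightarrow> set_borel_measurable lebesgue \<Omega> u \<and> (\<exists>B. AE x in lebesgue. x \<in> \<Omega> \<longrightarrow> \<bar>u x\<bar> \<le> B)"

definition weak_grad :: "'a::euclidean_space set \<Rightarrow> ('a \<Rightarrow> real) \<Rightarrow> ('a \<Rightarrow> 'a) \<Rightarrow> bool" where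
  "weak_grad \<Omega> u g \<longleftrightarrow> set_integrable lebesgue \<Omega> u \<and> set_integrable lebesgue \<Omega> g \<and>
     (\<forall>\<phi>. test_fn \<Omega> \<phi> \<longrightarrow> (\<forall>b\<in>Basis.
        (LINT x:\<Omega>|lebesgue. u x * (grad \<phi> x \<bullet> b)) = - (LINT x:\<Omega>|lebesgue. (g x \<bullet> b) * \<phi> x)))"

definition W0 :: "'a::euclidean_space set \<Rightarrow> ('a \<Rightarrow> real) \<Rightarrow> ('a \<Rightarrow> real) \<Rightarrow> ('a \<Rightarrow> 'a) \<Rightarrow> bool" where
  "W0 \<Omega> p u g \<longleftrightarrow> in_Lvar \<Omega> p u \<and> set_borel_measurable lebesgue \<Omega> g \<and>
     in_Lvar \<Omega> p (\<lambda>x. norm (g x)) \<and> weak_grad \<Omega> u g \<and>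
     (\<exists>\<phi>. (\<forall>n. test_fn \<Omega> (\<phi> n)) \<and>
        (\<lambda>n. lux \<Omega> p (\<lambda>x. \<phi> n x - u x) + lux \<Omega> p (\<lambda>x. norm (grad (\<phi> n) x - g x))) \<longlonglongrightarrow> 0)"

definition weak_eq :: "'a::euclidean_space set \<Rightarrow> ('a \<Rightarrow> real) \<Rightarrow> ('a \<Rightarrow> 'a) \<Rightarrow> ('a \<Rightarrow> real)
    \<Rightarrow> ('a \<Rightarrow> real) \<Rightarrow> ('a \<Rightarrow> 'a) \<Rightarrow> bool" where
  "weak_eq \<Omega> p gu G \<phi> g\<phi> \<longleftrightarrow>
     set_integrable lebesgue \<Omega> (\<lambda>x. norm (gu x) powr (p x - 2) * (gu x \<bullet> g\<phi> x)) \<and>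
     set_integrable lebesgue \<Omega> (\<lambda>x. G x * \<phi> x) \<and>
     (LINT x:\<Omega>|lebesgue. norm (gu x) powr (p x - 2) * (gu x \<bullet> g\<phi> x)) = (LINT x:\<Omega>|lebesgue. G x * \<phi> x)"

definition pos_weak_solution ::
  "'a::euclidean_space set \<Rightarrow> ('a \<Rightarrow> real) \<Rightarrow> ('a \<Rightarrow> real) \<Rightarrow> ('a \<Rightarrow> real) \<Rightarrow> ('a \<Rightarrow> real)
   \<Rightarrow> ('a \<Rightarrow> real) \<Rightarrow> ('a \<Rightarrow> real) \<Rightarrow> ('a \<Rightarrow> real) \<Rightarrow> ('a \<Rightarrow> real)
   \<Rightarrow> ('a \<Rightarrow> real \<Rightarrow> real) \<Rightarrow> (real \<Rightarrow> real) \<Rightarrow> (real \<Rightarrow> real) \<Rightarrow> real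
   \<Rightarrow> ('a \<Rightarrow> real) \<Rightarrow> ('a \<Rightarrow> real) \<Rightarrow> bool" where
  "pos_weak_solution \<Omega> p1 p2 q1 q2 r1 r2 \<alpha>1 \<alpha>2 A f1 f2 lam u v \<longleftrightarrow>
     (\<exists>gu gv. W0 \<Omega> p1 u gu \<and> W0 \<Omega> p2 v gv \<and> in_Linf \<Omega> u \<and> in_Linf \<Omega> v \<and>
        (\<forall>x\<in>\<Omega>. 0 < u x \<and> 0 < v x) \<and>
        (\<forall>\<phi> g\<phi>. W0 \<Omega> p1 \<phi> g\<phi> \<longrightarrow>
           weak_eq \<Omega> p1 gu (\<lambda>x. lam * f1 (u x) * lux \<Omega> q1 v powr \<alpha>1 x / A x (lux \<Omega> r1 v)) \<phi> g\<phi>) \<and>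
        (\<forall>\<phi> g\<phi>. W0 \<Omega> p2 \<phi> g\<phi> \<longrightarrow>
           weak_eq \<Omega> p2 gv (\<lambda>x. lam * f2 (v x) * lux \<Omega> q2 u powr \<alpha>2 x / A x (lux \<Omega> r2 u)) \<phi> g\<phi>))"

end

theory Submission
  imports Defs "HOL-Library.Diagonal_Subsequence"
begin

text \<open>The nonlinearity is truncated from below by a positive barrier \<open>w\<close> supported in a ball of \<open>\<Omega>\<close>
  and from above by \<open>\<theta>\<close>. The norms \<open>|v|\<close> then lie between two positive constants, so the right-hand side
  is bounded and the coefficient \<open>lux \<Omega> q v powr \<alpha> / A\<close> is bounded below. The truncated system is solved
  by a fixed point argument: for a given bounded right-hand side the \<open>p(x)\<close>-Laplace equation is solved by
  minimizing the energy, the right-hand side is evaluated at averages over cubes of side \<open>1/k\<close> so that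
  Brouwer's theorem applies to finitely many averages, and \<open>k\<close> tends to infinity by Rellich compactness.
  For large \<open>lam\<close> the barrier is a subsolution: it is radial about \<open>x0\<close>, flat near \<open>x0\<close>,
  \<open>p(x)\<close>-subharmonic outside a smaller ball, and inside that ball \<open>lam f(w)\<close> dominates its bounded
  \<open>p(x)\<close>-Laplacian. Comparison gives \<open>w \<le> u \<le> \<theta>\<close>, so the truncation is inactive. Comparison with further barriers
  spreads positivity over the connected set \<open>\<Omega>\<close>.\<close>

section \<open>Uniform monotonicity of the \<open>p\<close>-Laplacian vector field\<close>

text \<open>The obstacle that shapes the proof is the variable exponent. The modular is not
  homogeneous, so no scaling argument is available after integration, and a radial barrier picks up
  the gradient of \<open>p\<close> times the logarithm of its slope. Inequalities are therefore kept
  pointwise, with constants that depend only on the bounds \<open>pm\<close> and \<open>pp\<close>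
  of the exponent, and convergence of gradients is measured by the modular \<open>rho\<close>. The
  functions themselves are controlled in L1 only, through translation estimates. Convexity or
  monotonicity with an arbitrarily small error term treats exponents below and above 2 alike, and
  yields existence, stability and comparison. The analysis is done for Borel functions on the whole
  space that vanish off \<Omega>, approximated by C1 functions of compact support, because these
  survive composition with C1 truncations. Smooth test functions, completed measure and Luxemburg
  norms enter when the result is translated into the given notions. The barrier has a second
  purpose: since \<open>f 0 = 0\<close>, a fixed point of a system truncated only from above could
  vanish identically.\<close>

definition Vp :: "real \<Rightarrow> 'a::real_inner \<Rightarrow> 'a" where
  "Vp p a = norm a powr (p - 2) *\<^sub>R a"

abbreviation L1norm :: "('a::euclidean_space \<Rightarrow> real) \<Rightarrow> real" where
  "L1norm u \<equiv> (LBINT x. \<bar>u x\<bar>)"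

lemma Vp_0 [simp]: "Vp p 0 = 0"
  by (simp add: Vp_def)

section \<open>Power inequalities with constants uniform in the exponent\<close>

lemma powr_mult_self: "0 \<le> s \<Longrightarrow> s powr (p - 1) * s = s powr p" for s p :: real
  by (cases "s = 0") (simp_all add: powr_diff)

text \<open>At \<open>a = 0\<close> both sides vanish because \<open>0 powr y = 0\<close> for every
  real \<open>y\<close>. This convention lets exponents \<open>p < 2\<close> be treated without a
  separate case.\<close>

lemma norm_Vp: "norm (Vp p a) = norm a powr (p - 1)"
  using powr_mult_self[of "norm a" "p - 1"] by (simp add: Vp_def)

lemma Vp_inner_self: "Vp p a \<bullet> a = norm a powr p"
proof (cases "a = 0")
  case False
  have "norm a powr (p - 2) * (norm a)\<^sup>2 = norm a powr p"
    using False by (simp add: powr_diff)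
  then show ?thesis by (simp add: Vp_def dot_square_norm)
qed simp

lemma Vp_inner_le: "Vp p a \<bullet> b \<le> norm a powr (p - 1) * norm b"
  using norm_cauchy_schwarz[of "Vp p a" b] by (simp add: norm_Vp)

lemma abs_Vp_inner_le: "\<bar>Vp p a \<bullet> b\<bar> \<le> norm a powr (p - 1) * norm b"
  using Cauchy_Schwarz_ineq2[of "Vp p a" b] by (simp add: norm_Vp)

text \<open>Young's inequality without the sharp constant: if \<open>t \<le> \<epsilon> * s\<close>
  the first term dominates, otherwise \<open>s < t / \<epsilon>\<close> and the second does. The
  bound \<open>\<epsilon> powr (1 - pp)\<close> does not see \<open>p\<close>, so the inequality can
  be integrated when \<open>p\<close> varies with the point.\<close>

lemma young_eps:
  fixes s t :: real
  assumes "0 < \<epsilon>" "\<epsilon> \<le> 1" "1 \<le> p" "p \<le> pp" "0 \<le> s" "0 \<le> t"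
  shows "s powr (p - 1) * t \<le> \<epsilon> * s powr p + \<epsilon> powr (1 - pp) * t powr p"
proof (cases "t \<le> \<epsilon> * s")
  case True
  have "s powr (p - 1) * t \<le> s powr (p - 1) * (\<epsilon> * s)"
    using True by (intro mult_left_mono) auto
  also have "\<dots> = \<epsilon> * s powr p" using powr_mult_self[of s p] assms by (simp add: mult_ac)
  finally show ?thesis by (smt (verit) mult_nonneg_nonneg powr_ge_zero)
next
  case False
  then have "s \<le> t / \<epsilon>" using assms by (simp add: field_simps)
  then have "s powr (p - 1) * t \<le> (t / \<epsilon>) powr (p - 1) * t"
    using assms by (intro mult_right_mono powr_mono2) auto
  also have "\<dots> = \<epsilon> powr (1 - p) * t powr p"
    using assms powr_mult_self[of t p] by (simp add: powr_divide powr_diff field_simps)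
  also have "\<dots> \<le> \<epsilon> powr (1 - pp) * t powr p"
    using assms by (intro mult_right_mono powr_mono') auto
  finally show ?thesis using assms by (smt (verit) mult_nonneg_nonneg powr_ge_zero)
qed

text \<open>Here the power carries the small factor: a linear load is absorbed by the energy. The
  threshold is the \<open>t\<close> at which \<open>\<delta> * t powr (pm - 1)\<close> reaches 1;
  the maximum with 1 allows \<open>pm\<close> to be replaced by \<open>p\<close>.\<close>

lemma linear_le_powr_large:
  fixes t :: real
  assumes "0 < \<delta>" "1 < pm" "pm \<le> p" "0 \<le> t"
  shows "t \<le> max 1 (\<delta> powr (- 1 / (pm - 1))) + \<delta> * t powr p"
proof (cases "t \<le> max 1 (\<delta> powr (- 1 / (pm - 1)))")
  case True
  then show ?thesis using assms by (smt (verit) mult_nonneg_nonneg powr_ge_zero)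
next
  case False
  then have t: "1 \<le> t" "\<delta> powr (- 1 / (pm - 1)) \<le> t" by auto
  have "1 / \<delta> = (\<delta> powr (- 1 / (pm - 1))) powr (pm - 1)"
    using assms by (simp add: powr_powr)
  also have "\<dots> \<le> t powr (pm - 1)" using t assms by (intro powr_mono2) auto
  also have "\<dots> \<le> t powr (p - 1)" using t assms by (intro powr_mono) auto
  finally have "1 \<le> \<delta> * t powr (p - 1)" using assms by (simp add: field_simps)
  then have "1 * t \<le> \<delta> * t powr (p - 1) * t" using assms by (intro mult_right_mono) auto
  then have "t \<le> \<delta> * t powr p" using powr_mult_self[of t p] assms by (simp add: mult.assoc)
  then show ?thesis by (smt (verit))
qed

text \<open>Here the constant term is small: after integration over a bounded set, convergence of
  the modular to 0 forces convergence in L1.\<close>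

lemma linear_le_powr_small:
  fixes t :: real
  assumes "0 < \<delta>" "\<delta> \<le> 1" "1 \<le> p" "p \<le> pp" "0 \<le> t"
  shows "t \<le> \<delta> + \<delta> powr (1 - pp) * t powr p"
proof (cases "t \<le> \<delta>")
  case True
  then show ?thesis by (smt (verit) mult_nonneg_nonneg powr_ge_zero)
next
  case False
  have "\<delta> powr (p - 1) * t \<le> t powr (p - 1) * t"
    using False assms by (intro mult_right_mono powr_mono2) auto
  also have "\<dots> = t powr p" using powr_mult_self assms by simp
  finally have "\<delta> powr (p - 1) * t \<le> t powr p" .
  then have "t \<le> \<delta> powr (1 - p) * t powr p"
    using assms by (simp add: powr_diff field_simps)
  also have "\<dots> \<le> \<delta> powr (1 - pp) * t powr p"
    using assms by (intro mult_right_mono powr_mono') auto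
  finally show ?thesis using assms by simp
qed

lemma powr_add_le:
  fixes s t :: real
  assumes "0 \<le> p" "p \<le> pp" "0 \<le> s" "0 \<le> t"
  shows "(s + t) powr p \<le> 2 powr pp * (s powr p + t powr p)"
proof -
  have "(s + t) powr p \<le> (2 * max s t) powr p" using assms by (intro powr_mono2) auto
  also have "\<dots> = 2 powr p * (max s t) powr p" using assms by (simp add: powr_mult)
  also have "\<dots> \<le> 2 powr pp * (s powr p + t powr p)"
    using assms by (intro mult_mono powr_mono) (auto simp: max_def)
  finally show ?thesis .
qed

lemma norm_add_powr_le:
  assumes "0 \<le> p" "p \<le> pp"
  shows "norm (a + b) powr p \<le> 2 powr pp * (norm a powr p + norm b powr p)"
proof -
  have "norm (a + b) powr p \<le> (norm a + norm b) powr p"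
    using assms norm_triangle_ineq by (intro powr_mono2) auto
  then show ?thesis using powr_add_le[OF assms, of "norm a" "norm b"] by simp
qed

lemma norm_diff_powr_le:
  assumes "0 \<le> p" "p \<le> pp"
  shows "norm (a - b) powr p \<le> 2 powr pp * (norm a powr p + norm b powr p)"
  using norm_add_powr_le[OF assms, of a "- b"] by simp

text \<open>Strict Bernoulli inequality. The mean value theorem between \<open>t\<close> and 1
  compares a slope \<open>p * z powr (p - 1)\<close> with its value \<open>p\<close> at 1; the
  derivative rule for \<open>powr\<close> asks for a positive base, hence the separate case
  \<open>t = 0\<close>.\<close>

lemma powr_gt_tangent:
  fixes t p :: real
  assumes "1 < p" "0 \<le> t" "t \<noteq> 1"
  shows "1 + p * (t - 1) < t powr p"
proof -
  consider "t = 0" | "0 < t" "t < 1" | "1 < t" using assms by linarith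
  then show ?thesis
  proof cases
    case 1 then show ?thesis using assms by simp
  next
    case 2
    have "\<exists>z>t. z < 1 \<and> 1 powr p - t powr p = (1 - t) * (p * z powr (p - 1))"
      using 2 by (intro MVT2) (auto intro!: has_real_derivative_powr)
    then obtain z where z: "t < z" "z < 1" "1 - t powr p = (1 - t) * (p * z powr (p - 1))" by auto
    have "z powr (p - 1) < 1 powr (p - 1)" using z 2 assms by (intro powr_less_mono2) auto
    then have "(1 - t) * (p * z powr (p - 1)) < (1 - t) * (p * 1)"
      using 2 assms by (intro mult_strict_left_mono) auto
    then show ?thesis using z by (simp add: algebra_simps)
  next
    case 3
    have "\<exists>z>1. z < t \<and> t powr p - 1 powr p = (t - 1) * (p * z powr (p - 1))"
      using 3 by (intro MVT2) (auto intro!: has_real_derivative_powr)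
    then obtain z where z: "1 < z" "z < t" "t powr p - 1 = (t - 1) * (p * z powr (p - 1))" by auto
    have "1 powr (p - 1) < z powr (p - 1)" using z 3 assms by (intro powr_less_mono2) auto
    then have "(t - 1) * (p * 1) < (t - 1) * (p * z powr (p - 1))"
      using 3 assms by (intro mult_strict_left_mono) auto
    then show ?thesis using z by (simp add: algebra_simps)
  qed
qed

text \<open>Cauchy-Schwarz reduces the claim to the norms, where Bernoulli for
  \<open>t = norm b / norm a\<close> is strict unless the norms agree. If they agree, strictness
  comes from Cauchy-Schwarz itself: \<open>norm (b - a)\<close> is positive, so
  \<open>a \<bullet> b\<close> is smaller than the square of \<open>norm a\<close>.\<close>

lemma norm_powr_strict_convex:
  fixes a b :: "'a::real_inner"
  assumes "1 < p" "a \<noteq> b"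
  shows "norm a powr p + p * (Vp p a \<bullet> (b - a)) < norm b powr p"
proof (cases "a = 0")
  case True
  then show ?thesis using assms by simp
next
  case False
  define t where "t = norm b / norm a"
  have tb: "norm b powr p = norm a powr p * t powr p"
    using False by (simp add: t_def powr_divide)
  have le: "Vp p a \<bullet> (b - a) \<le> norm a powr (p - 1) * (norm b - norm a)"
    using Vp_inner_le[of p a b] powr_mult_self[of "norm a" p]
    by (simp add: inner_diff_right Vp_inner_self algebra_simps)
  have eq: "norm a powr p + p * (norm a powr (p - 1) * (norm b - norm a)) = norm a powr p * (1 + p * (t - 1))"
    using False powr_mult_self[of "norm a" p] unfolding t_def
    by (simp add: field_simps powr_diff)
  show ?thesis
  proof (cases "t = 1")
    case t: False
    have "norm a powr p * (1 + p * (t - 1)) < norm b powr p"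
      unfolding tb using powr_gt_tangent[OF assms(1) _ t] False by (simp add: t_def)
    moreover have "p * (Vp p a \<bullet> (b - a)) \<le> p * (norm a powr (p - 1) * (norm b - norm a))"
      using le assms by (intro mult_left_mono) auto
    ultimately show ?thesis using eq by linarith
  next
    case t: True
    then have ab: "norm b = norm a" using False by (simp add: t_def)
    have "0 < (norm (b - a))\<^sup>2" using assms by simp
    also have "(norm (b - a))\<^sup>2 = 2 * ((norm a)\<^sup>2 - a \<bullet> b)"
      by (simp add: power2_norm_eq_inner inner_diff inner_commute)
        (metis ab power2_norm_eq_inner)
    finally have "a \<bullet> (b - a) < 0" by (simp add: inner_diff power2_norm_eq_inner)
    then have "Vp p a \<bullet> (b - a) < 0" using False by (simp add: Vp_def mult_pos_neg)
    then show ?thesis using ab assms by (simp add: mult_pos_neg)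
  qed
qed

lemma norm_powr_convex:
  fixes a b :: "'a::real_inner"
  assumes "1 < p"
  shows "norm a powr p + p * (Vp p a \<bullet> (b - a)) \<le> norm b powr p"
  using norm_powr_strict_convex[OF assms, of a b] by (cases "a = b") auto

text \<open>At a zero of the limit the factor \<open>norm a powr (p - 2)\<close> may blow up; there
  the norm of the flux is \<open>norm a powr (p - 1)\<close>, which tends to 0.\<close>

lemma Vp_tendsto:
  assumes "(f \<longlongrightarrow> a) F" "1 < p"
  shows "((\<lambda>x. Vp p (f x)) \<longlongrightarrow> Vp p a) F"
proof (cases "a = 0")
  case False
  then show ?thesis using assms unfolding Vp_def by (intro tendsto_intros) auto
next
  case True
  have "((\<lambda>x. norm (f x) powr (p - 1)) \<longlongrightarrow> norm a powr (p - 1)) F"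
    using assms by (intro tendsto_powr' tendsto_intros) auto
  then have "((\<lambda>x. norm (Vp p (f x))) \<longlongrightarrow> 0) F" using True assms by (simp add: norm_Vp)
  then show ?thesis using True by (simp add: tendsto_norm_zero_iff)
qed

section \<open>The midpoint convexity gap and uniform monotonicity\<close>

definition cgap :: "real \<Rightarrow> 'a::real_inner \<Rightarrow> 'a \<Rightarrow> real" where
  "cgap p a b = (norm a powr p + norm b powr p) / 2 - norm ((1/2) *\<^sub>R (a + b)) powr p"

text \<open>The tangent inequality at the midpoint \<open>m\<close> is applied towards
  \<open>a\<close> and towards \<open>b\<close>; the two linear terms cancel because
  \<open>a - m\<close> and \<open>b - m\<close> are opposite.\<close>

lemma cgap_pos:
  assumes "1 < p" "a \<noteq> b"
  shows "0 < cgap p a b"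
proof -
  define m where "m = (1/2) *\<^sub>R (a + b)"
  have mm: "a - m = (1/2) *\<^sub>R (a - b)" "b - m = - (1/2) *\<^sub>R (a - b)"
  proof -
    have "a = (1/2) *\<^sub>R (a + a)" "b = (1/2) *\<^sub>R (b + b)" by (simp_all flip: scaleR_2)
    then show "a - m = (1/2) *\<^sub>R (a - b)" "b - m = - (1/2) *\<^sub>R (a - b)"
      unfolding m_def by (simp_all add: algebra_simps)
  qed
  then have ne: "m \<noteq> a" "m \<noteq> b" using assms by auto
  have "Vp p m \<bullet> (a - m) + Vp p m \<bullet> (b - m) = 0" unfolding mm by simp
  moreover define x y where "x = Vp p m \<bullet> (a - m)" and "y = Vp p m \<bullet> (b - m)"
  ultimately have "y = - x" by simp
  moreover have "norm m powr p + p * x < norm a powr p" "norm m powr p + p * y < norm b powr p"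
    unfolding x_def y_def using norm_powr_strict_convex[OF assms(1)] ne by auto
  ultimately show ?thesis unfolding cgap_def m_def[symmetric] by (simp add: field_simps)
qed

lemma cgap_nonneg: "1 < p \<Longrightarrow> 0 \<le> cgap p a b"
  using cgap_pos[of p a b] by (cases "a = b") (auto simp: cgap_def simp flip: scaleR_2)

lemma cgap_scale:
  assumes "0 < s"
  shows "cgap p (s *\<^sub>R a) (s *\<^sub>R b) = s powr p * cgap p a b"
proof -
  have "(1/2) *\<^sub>R (s *\<^sub>R a + s *\<^sub>R b) = s *\<^sub>R ((1/2) *\<^sub>R (a + b))" by (simp add: algebra_simps)
  then have "norm ((1/2) *\<^sub>R (s *\<^sub>R a + s *\<^sub>R b)) powr p = s powr p * norm ((1/2) *\<^sub>R (a + b)) powr p"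
    using assms by (simp only: norm_scaleR powr_mult)
  then show ?thesis unfolding cgap_def using assms
    by (simp add: powr_mult algebra_simps add_divide_distrib)
qed

text \<open>Both sides are homogeneous of degree \<open>p\<close>, so it suffices to bound the gap from below on the
  compact set where \<open>max |a| |b| = 1\<close> and the estimate is not already trivial.\<close>

lemma uniform_convexity:
  fixes \<epsilon> pm pp :: real
  assumes "1 < pm" "0 < \<epsilon>"
  obtains C where "0 \<le> C" "\<And>p (a::'a::euclidean_space) b. pm \<le> p \<Longrightarrow> p \<le> pp \<Longrightarrow>
    norm (a - b) powr p \<le> \<epsilon> * (norm a powr p + norm b powr p) + C * cgap p a b"
proof -
  \<comment> \<open>The maximum with \<open>pm\<close> keeps the exponent positive on the whole
    space, so that \<open>f\<close> and \<open>h\<close> are continuous everywhere and not only on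
    \<open>B\<close>.\<close>
  define q where "q p = max pm p" for p :: real
  define B where "B = {z::'a\<times>'a\<times>real. norm (fst z) \<le> 1 \<and> norm (fst (snd z)) \<le> 1 \<and> pm \<le> snd (snd z) \<and> snd (snd z) \<le> pp}"
  define f where "f z = norm (fst z - fst (snd z)) powr q (snd (snd z))
      - \<epsilon> * (norm (fst z) powr q (snd (snd z)) + norm (fst (snd z)) powr q (snd (snd z)))" for z :: "'a\<times>'a\<times>real"
  define h where "h z = (norm (fst z) powr q (snd (snd z)) + norm (fst (snd z)) powr q (snd (snd z)))/2
    - norm ((1/2) *\<^sub>R (fst z + fst (snd z))) powr q (snd (snd z))" for z :: "'a\<times>'a\<times>real"
  have qpos: "0 < q p" for p using assms by (simp add: q_def max_def)
  have contf: "continuous_on UNIV f" "continuous_on UNIV h"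
    unfolding f_def h_def q_def
    using assms by (auto intro!: continuous_intros continuous_on_powr' simp: less_max_iff_disj)
  have Beq: "B = cball 0 1 \<times> (cball 0 1 \<times> {pm..pp})"
    unfolding B_def by (auto simp: mem_cball)
  have "compact B" unfolding Beq by (intro compact_Times) auto
  moreover have "closed {z. 0 \<le> f z \<and> 1 \<le> max (norm (fst z)) (norm (fst (snd z)))}"
    using contf by (intro closed_Collect_conj closed_Collect_le continuous_intros) auto
  ultimately have cK: "compact (B \<inter> {z. 0 \<le> f z \<and> 1 \<le> max (norm (fst z)) (norm (fst (snd z)))})" (is "compact ?K")
    by (rule compact_Int_closed)
  have hpos: "0 < h z" if "z \<in> ?K" for z
  proof -
    obtain a b p where z: "z = (a, b, p)" by (cases z)
    have p: "q p = p" "1 < p" using that assms by (auto simp: z B_def q_def)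
    \<comment> \<open>On the diagonal \<open>f\<close> equals minus twice
      \<open>\<epsilon> * norm a powr p\<close>, which is negative since
      \<open>norm a \<ge> 1\<close>. The condition \<open>0 \<le> f\<close> thus keeps the compact
      set away from the zeros of the gap.\<close>
    have "a \<noteq> b"
    proof
      assume "a = b"
      then have "\<epsilon> * (2 * norm a powr p) \<le> 0" and a: "1 \<le> norm a" using that p by (auto simp: z f_def)
      moreover have "0 < norm a powr p" using a by auto
      ultimately show False using assms by (simp add: mult_le_0_iff)
    qed
    then show ?thesis using cgap_pos[OF p(2)] by (simp add: h_def z p cgap_def)
  qed
  obtain m where m: "0 < m" "\<And>z. z \<in> ?K \<Longrightarrow> m \<le> h z"
  proof (cases "?K = {}")
    case True then show ?thesis using that[of 1] by auto
  next
    case False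
    then obtain z0 where "z0 \<in> ?K" "\<forall>z\<in>?K. h z0 \<le> h z"
      using continuous_attains_inf[OF cK False continuous_on_subset[OF contf(2)]] by auto
    then show ?thesis using that[of "h z0"] hpos by auto
  qed
  show thesis
  proof
    \<comment> \<open>After scaling by \<open>s\<close>, the larger of the two norms, the gap is at
      least \<open>m * s powr p\<close>, while \<open>norm (a - b) \<le> 2 * s\<close>.\<close>
    show "0 \<le> 2 powr pp / m" using m by simp
    fix p and a b :: 'a assume p: "pm \<le> p" "p \<le> pp"
    have p1: "1 < p" "q p = p" using p assms by (auto simp: q_def)
    have g0: "0 \<le> cgap p a b" using cgap_nonneg p1 by auto
    have rhs0: "0 \<le> \<epsilon> * (norm a powr p + norm b powr p)" using assms by simp
    show "norm (a - b) powr p \<le> \<epsilon> * (norm a powr p + norm b powr p) + 2 powr pp / m * cgap p a b"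
    proof (cases "norm (a - b) powr p \<le> \<epsilon> * (norm a powr p + norm b powr p)")
      case True
      then show ?thesis using g0 m by (smt (verit) divide_nonneg_nonneg mult_nonneg_nonneg powr_ge_zero)
    next
      case False
      define s where "s = max (norm a) (norm b)"
      have s: "0 < s"
      proof (rule ccontr)
        assume "\<not> 0 < s" then have "a = 0" "b = 0" unfolding s_def by (auto simp: max_def split: if_splits)
        then show False using False by simp
      qed
      define a' b' where "a' = (1/s) *\<^sub>R a" and "b' = (1/s) *\<^sub>R b"
      have ab: "a = s *\<^sub>R a'" "b = s *\<^sub>R b'" using s by (auto simp: a'_def b'_def)
      have n: "norm a = s * norm a'" "norm b = s * norm b'" "norm (a - b) = s * norm (a' - b')"
        using s by (simp_all add: ab flip: scaleR_diff_right)
      have mx: "max (norm a') (norm b') = 1" "norm a' \<le> 1" "norm b' \<le> 1"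
        using s unfolding a'_def b'_def by (auto simp: s_def max_def field_simps split: if_splits)
      have "s powr p * (\<epsilon> * (norm a' powr p + norm b' powr p)) \<le> s powr p * norm (a' - b') powr p"
        using False s unfolding n by (simp add: powr_mult algebra_simps)
      then have "\<epsilon> * (norm a' powr p + norm b' powr p) \<le> norm (a' - b') powr p"
        using s by simp
      then have "(a', b', p) \<in> ?K" using mx p p1 by (auto simp: B_def f_def)
      then have "m \<le> cgap p a' b'" using m(2) by (fastforce simp: h_def cgap_def p1)
      then have "s powr p * m \<le> cgap p a b" unfolding ab cgap_scale[OF s] by (simp add: mult_left_mono)
      moreover have "norm (a - b) powr p \<le> (2 * s) powr p"
        using p1 norm_triangle_ineq4[of a b] by (intro powr_mono2) (auto simp: s_def)
      moreover have "(2 * s) powr p \<le> 2 powr pp * s powr p"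
        using s p by (simp add: powr_mult)
      ultimately have "m * norm (a - b) powr p \<le> 2 powr pp * cgap p a b"
        using m(1) by (smt (verit) mult.commute mult.left_commute mult_left_mono powr_ge_zero)
      then have "norm (a - b) powr p \<le> 2 powr pp / m * cgap p a b" using m(1) by (simp add: field_simps)
      then show ?thesis using rhs0 by linarith
    qed
  qed
qed

text \<open>Average of the two tangent inequalities at \<open>a\<close> and at \<open>b\<close>,
  both evaluated at the midpoint. This turns convexity of the energy density into monotonicity of
  the flux.\<close>

lemma cgap_le_monotone:
  assumes "1 < p"
  shows "cgap p a b \<le> p / 4 * ((Vp p a - Vp p b) \<bullet> (a - b))"
proof -
  define m where "m = (1/2) *\<^sub>R (a + b)"
  have "a = (1/2) *\<^sub>R (a + a)" "b = (1/2) *\<^sub>R (b + b)" by (simp_all flip: scaleR_2)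
  then have mm: "m - a = (1/2) *\<^sub>R (b - a)" "m - b = (1/2) *\<^sub>R (a - b)"
    unfolding m_def by (metis add_diff_cancel_left scaleR_diff_right, metis add_diff_cancel_right scaleR_diff_right)
  have "norm a powr p + p * (Vp p a \<bullet> (m - a)) \<le> norm m powr p"
    "norm b powr p + p * (Vp p b \<bullet> (m - b)) \<le> norm m powr p"
    by (rule norm_powr_convex[OF assms])+
  then show ?thesis unfolding cgap_def m_def[symmetric] unfolding mm
    by (simp add: inner_diff field_simps)
qed

lemma Vp_monotone:
  assumes "1 < p"
  shows "0 \<le> (Vp p a - Vp p b) \<bullet> (a - b)"
proof -
  have "0 \<le> p / 4 * ((Vp p a - Vp p b) \<bullet> (a - b))"
    using cgap_le_monotone[OF assms] cgap_nonneg[OF assms] by (rule order_trans[rotated])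
  then show ?thesis using assms by (simp add: zero_le_mult_iff)
qed

text \<open>If the energies stay bounded and the monotonicity integral tends to 0, letting
  \<open>\<epsilon>\<close> tend to 0 last gives strong convergence of gradients. The error term is
  what permits one statement for all exponents in the range.\<close>

lemma uniform_monotonicity:
  fixes \<epsilon> pm pp :: real
  assumes "1 < pm" "0 < \<epsilon>"
  obtains C where "0 \<le> C" "\<And>p (a::'a::euclidean_space) b. pm \<le> p \<Longrightarrow> p \<le> pp \<Longrightarrow>
    norm (a - b) powr p \<le> \<epsilon> * (norm a powr p + norm b powr p) + C * ((Vp p a - Vp p b) \<bullet> (a - b))"
proof -
  obtain C where C: "0 \<le> C" "\<And>p (a::'a) b. pm \<le> p \<Longrightarrow> p \<le> pp \<Longrightarrow>
    norm (a - b) powr p \<le> \<epsilon> * (norm a powr p + norm b powr p) + C * cgap p a b"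
    using uniform_convexity[OF assms, where 'a='a and pp=pp] by blast
  show thesis
  proof
    show "0 \<le> C * (\<bar>pp\<bar> / 4)" using C by simp
    fix p and a b :: 'a assume p: "pm \<le> p" "p \<le> pp"
    then have p1: "1 < p" using assms by simp
    have le: "cgap p a b \<le> p / 4 * ((Vp p a - Vp p b) \<bullet> (a - b))" by (rule cgap_le_monotone[OF p1])
    have "p / 4 * ((Vp p a - Vp p b) \<bullet> (a - b)) \<le> \<bar>pp\<bar> / 4 * ((Vp p a - Vp p b) \<bullet> (a - b))"
      using p Vp_monotone[OF p1] by (intro mult_right_mono) auto
    with le have "cgap p a b \<le> \<bar>pp\<bar> / 4 * ((Vp p a - Vp p b) \<bullet> (a - b))" by linarith
    then have "C * cgap p a b \<le> C * (\<bar>pp\<bar> / 4) * ((Vp p a - Vp p b) \<bullet> (a - b))"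
      using C(1) mult_left_mono[of _ _ C] by (fastforce simp: mult.assoc)
    then show "norm (a - b) powr p \<le> \<epsilon> * (norm a powr p + norm b powr p)
        + C * (\<bar>pp\<bar> / 4) * ((Vp p a - Vp p b) \<bullet> (a - b))"
      using C(2)[OF p, of a b] by linarith
  qed
qed

section \<open>Integration and compactly supported \<open>C\<^sup>1\<close> functions\<close>

text \<open>Compactness gives limits along subsequences only; when the limit is known in advance,
  this recovers the whole sequence.\<close>

lemma tendsto_by_subseq:
  fixes a :: "nat \<Rightarrow> 'b::metric_space"
  assumes "\<And>r :: nat \<Rightarrow> nat. strict_mono r \<Longrightarrow> \<exists>s :: nat \<Rightarrow> nat. strict_mono s \<and> (\<lambda>n. a (r (s n))) \<longlonglongrightarrow> L"
  shows "a \<longlonglongrightarrow> L"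
proof (rule ccontr)
  assume "\<not> a \<longlonglongrightarrow> L"
  then obtain e where e: "0 < e" "\<not> eventually (\<lambda>n. dist (a n) L < e) sequentially"
    unfolding tendsto_iff by auto
  have "infinite {n. \<not> dist (a n) L < e}"
  proof
    assume "finite {n. \<not> dist (a n) L < e}"
    then have "eventually (\<lambda>n. dist (a n) L < e) cofinite" by (simp add: eventually_cofinite)
    then show False using e(2) by (simp add: cofinite_eq_sequentially)
  qed
  then obtain r :: "nat \<Rightarrow> nat" where r: "strict_mono r" "\<And>n. r n \<in> {n. \<not> dist (a n) L < e}"
    using infinite_enumerate by blast
  obtain s where "(\<lambda>n. a (r (s n))) \<longlonglongrightarrow> L" using assms[OF r(1)] by blast
  then have "eventually (\<lambda>n. dist (a (r (s n))) L < e) sequentially" using e(1) unfolding tendsto_iff by blast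
  then show False using r(2) by (auto simp: eventually_sequentially)
qed

text \<open>Along indices with integrals below a geometric sequence the functions are summable
  almost everywhere. The sum is an integrable majorant and its terms tend to 0.\<close>

lemma dominated_subseq:
  fixes h :: "nat \<Rightarrow> 'b \<Rightarrow> real"
  assumes int: "\<And>n. integrable M (h n)" and nn: "\<And>n x. 0 \<le> h n x"
    and lim: "(\<lambda>n. \<integral>x. h n x \<partial>M) \<longlonglongrightarrow> 0"
  obtains r :: "nat \<Rightarrow> nat" and g where "strict_mono r" "integrable M g"
    "AE x in M. (\<forall>k. h (r k) x \<le> g x) \<and> (\<lambda>k. h (r k) x) \<longlonglongrightarrow> 0"
proof -
  have "\<exists>r. \<forall>n. (\<integral>x. h (r n) x \<partial>M) < (1/2)^n \<and> r (Suc n) > r n"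
  proof (intro dependent_nat_choice)
    have "eventually (\<lambda>n. (\<integral>x. h n x \<partial>M) < (1/2)^0) sequentially"
      using order_tendstoD(2)[OF lim] by simp
    then show "\<exists>x. (\<integral>y. h x y \<partial>M) < (1/2)^0" by (auto simp: eventually_sequentially)
    fix x n
    have "eventually (\<lambda>m. (\<integral>x. h m x \<partial>M) < (1/2)^(Suc n)) sequentially"
      by (rule order_tendstoD(2)[OF lim]) simp
    with eventually_gt_at_top[of x] have "eventually (\<lambda>m. (\<integral>x. h m x \<partial>M) < (1/2)^(Suc n) \<and> x < m) sequentially"
      by eventually_elim auto
    then show "\<exists>y. (\<integral>x. h y x \<partial>M) < (1/2)^(Suc n) \<and> y > x" by (auto simp: eventually_sequentially)
  qed
  then obtain r where r: "\<And>n. (\<integral>x. h (r n) x \<partial>M) < (1/2)^n" "\<And>n. r (Suc n) > r n" by auto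
  have meas[measurable]: "\<And>n. h n \<in> borel_measurable M" using int by auto
  have sI: "summable (\<lambda>n. \<integral>x. h (r n) x \<partial>M)"
  proof (rule summable_comparison_test'[where g="\<lambda>n. (1/2)^n"])
    show "summable (\<lambda>n. (1/2 :: real)^n)" by (rule summable_geometric) simp
    show "norm (\<integral>x. h (r n) x \<partial>M) \<le> (1/2)^n" if "0 \<le> n" for n
      using r(1)[of n] nn by (simp add: integral_nonneg_AE)
  qed
  have "(\<integral>\<^sup>+x. (\<Sum>n. ennreal (h (r n) x)) \<partial>M) = (\<Sum>n. \<integral>\<^sup>+x. ennreal (h (r n) x) \<partial>M)"
    by (intro nn_integral_suminf) auto
  also have "\<dots> = (\<Sum>n. ennreal (\<integral>x. h (r n) x \<partial>M))"
    using int nn by (intro suminf_cong nn_integral_eq_integral) auto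
  also have "\<dots> \<noteq> \<infinity>"
    by (subst suminf_ennreal2[OF _ sI]) (simp_all add: Bochner_Integration.integral_nonneg nn)
  finally have "AE x in M. (\<Sum>n. ennreal (h (r n) x)) \<noteq> \<infinity>"
    by (intro nn_integral_PInf_AE) auto
  then have AEs: "AE x in M. summable (\<lambda>n. h (r n) x)"
    by eventually_elim (auto intro: summable_suminf_not_top nn)
  show thesis
  proof
    show "strict_mono r" using r(2) by (simp add: strict_mono_Suc_iff)
    show "integrable M (\<lambda>x. \<Sum>n. h (r n) x)"
      using int nn AEs sI by (intro integrable_suminf) auto
    show "AE x in M. (\<forall>k. h (r k) x \<le> (\<Sum>n. h (r n) x)) \<and> (\<lambda>k. h (r k) x) \<longlonglongrightarrow> 0"
      using AEs
    proof eventually_elim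
      case (elim x)
      have "h (r k) x \<le> (\<Sum>n. h (r n) x)" for k
        using sum_le_suminf[OF elim, of "{k}"] nn by auto
      then show ?case using summable_LIMSEQ_zero[OF elim] by auto
    qed
  qed
qed

text \<open>A subsequence converges almost everywhere; Fatou's lemma along it bounds the distance of
  every late member of the sequence to the pointwise limit.\<close>

lemma L1_complete:
  fixes s :: "nat \<Rightarrow> 'b \<Rightarrow> 'c::{banach, second_countable_topology}"
  assumes int: "\<And>n. integrable M (s n)"
    and cau: "\<And>e. e > 0 \<Longrightarrow> \<exists>N. \<forall>i\<ge>N. \<forall>j\<ge>N. (\<integral>x. norm (s i x - s j x) \<partial>M) < e"
  obtains f where "integrable M f" "(\<lambda>n. \<integral>x. norm (s n x - f x) \<partial>M) \<longlonglongrightarrow> 0"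
proof -
  obtain r where r: "strict_mono r" "AE x in M. Cauchy (\<lambda>i. s (r i) x)"
    using cauchy_L1_AE_cauchy_subseq[OF int cau] by blast
  define f where "f x = lim (\<lambda>i. s (r i) x)" for x
  have [measurable]: "\<And>n. s n \<in> borel_measurable M" using int by auto
  have fm[measurable]: "f \<in> borel_measurable M" unfolding f_def by measurable
  have conv: "AE x in M. (\<lambda>i. s (r i) x) \<longlonglongrightarrow> f x"
    using r(2) by eventually_elim (simp add: f_def Cauchy_convergent_iff convergent_LIMSEQ_iff)
  have key: "(\<integral>\<^sup>+x. ennreal (norm (s n x - f x)) \<partial>M) \<le> ennreal e"
    if e: "\<And>j. j \<ge> N \<Longrightarrow> (\<integral>x. norm (s n x - s j x) \<partial>M) < e" for n N e
  proof -
    have "(\<integral>\<^sup>+x. ennreal (norm (s n x - f x)) \<partial>M) = (\<integral>\<^sup>+x. liminf (\<lambda>i. ennreal (norm (s n x - s (r i) x))) \<partial>M)"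
      using conv
      by (intro nn_integral_cong_AE, eventually_elim)
         (intro lim_imp_Liminf[symmetric] tendsto_ennrealI tendsto_norm tendsto_diff tendsto_const, auto)
    also have "\<dots> \<le> liminf (\<lambda>i. \<integral>\<^sup>+x. ennreal (norm (s n x - s (r i) x)) \<partial>M)"
      by (intro nn_integral_liminf) auto
    also have "\<dots> \<le> ennreal e"
    proof (rule Liminf_le)
      have "(\<integral>\<^sup>+x. ennreal (norm (s n x - s (r i) x)) \<partial>M) \<le> ennreal e" if "N \<le> i" for i
      proof -
        have "r i \<ge> N" using that r(1) seq_suble[of r i] by linarith
        then have "(\<integral>x. norm (s n x - s (r i) x) \<partial>M) \<le> e" using e by (simp add: less_imp_le)
        then show ?thesis using int by (subst nn_integral_eq_integral) (auto intro!: ennreal_leI)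
      qed
      then show "eventually (\<lambda>i. (\<integral>\<^sup>+x. ennreal (norm (s n x - s (r i) x)) \<partial>M) \<le> ennreal e) sequentially"
        by (auto simp: eventually_sequentially)
    qed simp
    finally show ?thesis .
  qed
  have fint: "integrable M (\<lambda>x. s n x - f x) \<and> (\<integral>x. norm (s n x - f x) \<partial>M) \<le> e"
    if "\<And>j. j \<ge> N \<Longrightarrow> (\<integral>x. norm (s n x - s j x) \<partial>M) < e" "0 < e" for n N e
  proof -
    have k: "(\<integral>\<^sup>+x. ennreal (norm (s n x - f x)) \<partial>M) \<le> ennreal e" by (rule key[OF that(1)])
    have "(\<integral>\<^sup>+x. ennreal (norm (s n x - f x)) \<partial>M) < \<infinity>" by (rule le_less_trans[OF k]) simp
    then have I: "integrable M (\<lambda>x. s n x - f x)" by (intro integrableI_bounded) auto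
    then have "ennreal (\<integral>x. norm (s n x - f x) \<partial>M) \<le> ennreal e"
      using k by (subst (asm) nn_integral_eq_integral) auto
    then show ?thesis using I that(2) by (simp add: ennreal_le_iff)
  qed
  show thesis
  proof
    obtain N where N: "\<And>i j. i \<ge> N \<Longrightarrow> j \<ge> N \<Longrightarrow> (\<integral>x. norm (s i x - s j x) \<partial>M) < 1"
      using cau[of 1] by auto
    have "integrable M (\<lambda>x. s N x - (s N x - f x))"
      by (rule Bochner_Integration.integrable_diff[OF int]) (use fint[of N N 1] N in auto)
    moreover have "(\<lambda>x. s N x - (s N x - f x)) = f" by auto
    ultimately show "integrable M f" by metis
    show "(\<lambda>n. \<integral>x. norm (s n x - f x) \<partial>M) \<longlonglongrightarrow> 0"
    proof (rule LIMSEQ_I)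
      fix e :: real assume e: "0 < e"
      obtain N where N: "\<And>i j. i \<ge> N \<Longrightarrow> j \<ge> N \<Longrightarrow> (\<integral>x. norm (s i x - s j x) \<partial>M) < e/2"
        using cau[of "e/2"] e by auto
      have "norm ((\<integral>x. norm (s n x - f x) \<partial>M) - 0) < e" if "n \<ge> N" for n
        using fint[of N n "e/2"] N that e by auto
      then show "\<exists>no. \<forall>n\<ge>no. norm ((\<integral>x. norm (s n x - f x) \<partial>M) - 0) < e" by blast
    qed
  qed
qed

section \<open>Translations and difference quotients\<close>

lemma
  fixes f :: "'a::euclidean_space \<Rightarrow> 'b::{banach, second_countable_topology}"
  assumes [measurable]: "f \<in> borel_measurable borel"
  shows lborel_integral_translation: "(LBINT x. f (x + h)) = (LBINT x. f x)"
    and lborel_integrable_translation: "integrable lborel (\<lambda>x. f (x + h)) \<longleftrightarrow> integrable lborel f"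
proof -
  have "(LBINT x. f x) = (\<integral>x. f x \<partial>distr lborel borel ((+) h))" by (simp add: lborel_distr_plus)
  also have "\<dots> = (LBINT x. f (x + h))" by (subst integral_distr) (auto simp: add.commute)
  finally show "(LBINT x. f (x + h)) = (LBINT x. f x)" by simp
  have "integrable lborel f \<longleftrightarrow> integrable (distr lborel borel ((+) h)) f" by (simp add: lborel_distr_plus)
  also have "\<dots> \<longleftrightarrow> integrable lborel (\<lambda>x. f (x + h))" by (subst integrable_distr_eq) (auto simp: add.commute)
  finally show "integrable lborel (\<lambda>x. f (x + h)) \<longleftrightarrow> integrable lborel f" by simp
qed

lemma integrable_scaled_indicator:
  fixes S :: "'a::euclidean_space set" and c :: real
  assumes "bounded S" "S \<in> sets borel"
  shows "integrable lborel (\<lambda>x. c * indicator S x)"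
  by (rule integrable_mult_right) (use assms emeasure_bounded_finite in \<open>simp add: integrable_indicator_iff\<close>)

lemma integrable_bounded_support:
  fixes f :: "'a::euclidean_space \<Rightarrow> 'b::{banach, second_countable_topology}"
  assumes [measurable]: "f \<in> borel_measurable borel" and "bounded S" "\<And>x. x \<notin> S \<Longrightarrow> f x = 0" "\<And>x. norm (f x) \<le> B"
  shows "integrable lborel f"
proof -
  obtain R where R: "S \<subseteq> cball 0 R" using bounded_subset_ballD[OF assms(2), of 0] ball_subset_cball by blast
  have I: "integrable lborel (\<lambda>x::'a. B * indicator (cball 0 R) x)"
    by (rule integrable_scaled_indicator) auto
  have N: "norm (f x) \<le> norm (B * indicator (cball 0 R) x)" for x
  proof (cases "x \<in> S")
    case True
    then have "x \<in> cball 0 R" using R by blast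
    then show ?thesis using assms(4)[of x] by simp
  qed (simp add: assms(3))
  show ?thesis by (rule Bochner_Integration.integrable_bound[OF I _ AE_I2[OF N]]) simp
qed

text \<open>Translation invariance kills the integral of every difference quotient; dominated convergence
  passes this on to the derivative, without integrating along lines.\<close>

lemma difference_quotient_integral:
  fixes F :: "'a::euclidean_space \<Rightarrow> real"
  assumes der: "\<And>x. (F has_derivative (\<lambda>h. D x \<bullet> h)) (at x)" and bd: "\<And>x. norm (D x) \<le> L"
    and S: "bounded S" "\<And>x. x \<notin> S \<Longrightarrow> F x = 0"
  shows "integrable lborel (\<lambda>x. D x \<bullet> h)" "(LBINT x. D x \<bullet> h) = 0"
    "L1norm (\<lambda>x. F (x + h) - F x) \<le> L1norm (\<lambda>x. D x \<bullet> h)"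
proof -
  have contF: "continuous_on UNIV F"
    by (intro continuous_at_imp_continuous_on ballI has_derivative_continuous[OF der])
  then have [measurable]: "F \<in> borel_measurable borel" by (rule borel_measurable_continuous_onI)
  have L0: "0 \<le> L" using bd[of 0] norm_ge_zero order_trans by blast
  have lip: "\<bar>F y - F x\<bar> \<le> L * norm (y - x)" for x y
  proof -
    have "norm (F y - F x) \<le> L * norm (y - x)"
    proof (rule differentiable_bound[where S=UNIV and f'="\<lambda>x h. D x \<bullet> h"])
      show "onorm (\<lambda>h. D x \<bullet> h) \<le> L" for x
      proof (rule onorm_le)
        fix h
        have "norm (D x \<bullet> h) \<le> norm (D x) * norm h" using Cauchy_Schwarz_ineq2[of "D x" h] by simp
        also have "\<dots> \<le> L * norm h" using bd[of x] by (intro mult_right_mono) auto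
        finally show "norm (D x \<bullet> h) \<le> L * norm h" .
      qed
    qed (auto intro: der)
    then show ?thesis by simp
  qed
  obtain R where R: "S \<subseteq> cball 0 R" using bounded_subset_ballD[OF S(1), of 0] ball_subset_cball by blast
  have Fint: "integrable lborel F"
  proof -
    have "compact (cball (0::'a) R)" by simp
    then have "bounded (F ` cball 0 R)" using contF
      by (intro compact_imp_bounded compact_continuous_image) (auto intro: continuous_on_subset)
    then obtain B where "\<forall>y\<in>F ` cball 0 R. norm y \<le> B" unfolding bounded_iff by blast
    then have "norm (F x) \<le> max B 0" if "x \<in> cball 0 R" for x
      using that by (meson imageI max.coboundedI1)
    then have "norm (F x) \<le> max B 0" for x using S(2)[of x] R by (cases "x \<in> S") auto
    then show ?thesis by (intro integrable_bounded_support[OF _ S(1)] S(2)) auto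
  qed
  define q where "q n x = real (Suc n) * (F (x + h /\<^sub>R real (Suc n)) - F x)" for n x
  have [measurable]: "q n \<in> borel_measurable borel" for n unfolding q_def by measurable
  \<comment> \<open>The step of every difference quotient has length at most \<open>norm h\<close>,
    so all quotients vanish outside the ball enlarged by \<open>norm h\<close>. \<open>W\<close> is
    their common majorant.\<close>
  define W where "W x = (L * norm h) * indicator (cball 0 (R + norm h)) x" for x :: 'a
  have Wint: "integrable lborel W" unfolding W_def
    by (rule integrable_scaled_indicator) auto
  have qlim: "(\<lambda>n. q n x) \<longlonglongrightarrow> D x \<bullet> h" for x
  proof (cases "h = 0")
    case True then show ?thesis by (simp add: q_def)
  next
    case False
    have "((\<lambda>t. F (x + t *\<^sub>R h)) has_derivative (\<lambda>t. D x \<bullet> (t *\<^sub>R h))) (at 0)"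
      by (rule has_derivative_compose[where f="\<lambda>t. x + t *\<^sub>R h" and g=F])
        (use der[of x] in \<open>auto intro!: derivative_eq_intros\<close>)
    then have "((\<lambda>t. F (x + t *\<^sub>R h)) has_real_derivative (D x \<bullet> h)) (at 0)"
      by (rule has_derivative_imp_has_field_derivative) auto
    then have "((\<lambda>t. (F (x + t *\<^sub>R h) - F x) / t) \<longlongrightarrow> D x \<bullet> h) (at 0)"
      by (simp add: has_field_derivative_iff)
    moreover have "filterlim (\<lambda>n. inverse (real (Suc n))) (at 0) sequentially"
      unfolding filterlim_at using LIMSEQ_inverse_real_of_nat by auto
    ultimately have "(\<lambda>n. (F (x + inverse (real (Suc n)) *\<^sub>R h) - F x) / inverse (real (Suc n))) \<longlonglongrightarrow> D x \<bullet> h"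
      by (rule filterlim_compose)
    then show ?thesis unfolding q_def by (simp add: divide_inverse mult.commute)
  qed
  have qbd: "norm (q n x) \<le> W x" for n x
  proof (cases "x \<in> cball 0 (R + norm h)")
    case True
    have "norm (q n x) = real (Suc n) * \<bar>F (x + h /\<^sub>R real (Suc n)) - F x\<bar>" by (simp add: q_def abs_mult)
    also have "\<dots> \<le> real (Suc n) * (L * norm (h /\<^sub>R real (Suc n)))"
      using lip[of "x + h /\<^sub>R real (Suc n)" x] by (intro mult_left_mono) auto
    also have "\<dots> = L * norm h" by (simp add: field_simps)
    finally show ?thesis using True by (simp add: W_def)
  next
    case False
    have "norm (h /\<^sub>R real (Suc n)) \<le> norm h" by (simp add: field_simps)
    then have "norm x - norm h \<le> norm (x + h /\<^sub>R real (Suc n))" using norm_triangle_ineq4[of "x + h /\<^sub>R real (Suc n)" "h /\<^sub>R real (Suc n)"] by simp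
    then have "x \<notin> cball 0 R" "x + h /\<^sub>R real (Suc n) \<notin> cball 0 R"
      using False norm_ge_zero[of h] by (auto simp: mem_cball simp del: norm_ge_zero)
    then have "F x = 0" "F (x + h /\<^sub>R real (Suc n)) = 0" using R S(2) by blast+
    then show ?thesis using False by (simp add: q_def W_def)
  qed
  have Dm[measurable]: "(\<lambda>x. D x \<bullet> h) \<in> borel_measurable borel"
    by (rule borel_measurable_LIMSEQ_metric[where f=q]) (auto intro: qlim)
  note dc = Wint AE_I2[OF qlim] AE_I2[OF qbd[unfolded real_norm_def]]
  show "integrable lborel (\<lambda>x. D x \<bullet> h)"
    by (rule integrable_dominated_convergence[where s=q and w=W]) (auto intro: dc)
  have "(\<lambda>n. LBINT x. q n x) \<longlonglongrightarrow> (LBINT x. D x \<bullet> h)"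
    by (rule integral_dominated_convergence[where w=W]) (auto intro: dc)
  moreover have "(LBINT x. q n x) = 0" for n
    unfolding q_def using Fint lborel_integrable_translation[of F] lborel_integral_translation[of F]
    by (subst integral_mult_right_zero, subst Bochner_Integration.integral_diff) auto
  ultimately show "(LBINT x. D x \<bullet> h) = 0" by (simp add: LIMSEQ_const_iff)
  have tr: "integrable lborel (\<lambda>x. F (x + k))" for k using Fint lborel_integrable_translation[of F] by auto
  \<comment> \<open>The translation by \<open>h\<close> is split into \<open>Suc n\<close>
    translations by \<open>k\<close>; by translation invariance each contributes the same L1 norm,
    and the sum of these is the norm of the quotient \<open>q n\<close>.\<close>
  have "L1norm (\<lambda>x. F (x + h) - F x) \<le> L1norm (q n)" for n
  proof -
    define k where "k = h /\<^sub>R real (Suc n)"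
    have it: "L1norm (\<lambda>x. F (x + real m *\<^sub>R k) - F x) \<le> real m * L1norm (\<lambda>x. F (x + k) - F x)" for m
    proof (induction m)
      case (Suc m)
      have ms: "(x + real m *\<^sub>R k) + k = x + real (Suc m) *\<^sub>R k" for x by (simp add: algebra_simps)
      have I: "integrable lborel (\<lambda>x. \<bar>F (x + real (Suc m) *\<^sub>R k) - F (x + real m *\<^sub>R k)\<bar>)"
        "integrable lborel (\<lambda>x. \<bar>F (x + real j *\<^sub>R k) - F x\<bar>)" for j
        by (rule integrable_abs, rule Bochner_Integration.integrable_diff, rule tr, (rule tr | rule Fint))+
      have "L1norm (\<lambda>x. F (x + real (Suc m) *\<^sub>R k) - F x)
         \<le> (LBINT x. \<bar>F (x + real (Suc m) *\<^sub>R k) - F (x + real m *\<^sub>R k)\<bar> + \<bar>F (x + real m *\<^sub>R k) - F x\<bar>)"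
        by (rule integral_mono[OF I(2) Bochner_Integration.integrable_add[OF I]]) linarith
      also have "\<dots> = L1norm (\<lambda>x. F (x + real (Suc m) *\<^sub>R k) - F (x + real m *\<^sub>R k))
           + L1norm (\<lambda>x. F (x + real m *\<^sub>R k) - F x)"
        by (rule Bochner_Integration.integral_add[OF I])
      also have "L1norm (\<lambda>x. F (x + real (Suc m) *\<^sub>R k) - F (x + real m *\<^sub>R k)) = L1norm (\<lambda>x. F (x + k) - F x)"
        unfolding ms[symmetric] by (rule lborel_integral_translation) measurable
      finally show ?case using Suc by (simp add: algebra_simps)
    qed simp
    have "L1norm (\<lambda>x. F (x + h) - F x) \<le> real (Suc n) * L1norm (\<lambda>x. F (x + k) - F x)"
      using it[of "Suc n"] by (simp add: k_def del: of_nat_Suc)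
    also have "\<dots> = L1norm (q n)"
      by (simp add: q_def k_def abs_mult del: of_nat_Suc)
    finally show ?thesis .
  qed
  moreover have "(\<lambda>n. L1norm (q n)) \<longlonglongrightarrow> (L1norm (\<lambda>x. D x \<bullet> h))"
    by (rule integral_dominated_convergence[where w=W]) (use Wint qlim qbd in \<open>auto intro!: tendsto_rabs AE_I2\<close>)
  ultimately show "L1norm (\<lambda>x. F (x + h) - F x) \<le> L1norm (\<lambda>x. D x \<bullet> h)"
    by (intro LIMSEQ_le_const) auto
qed

section \<open>C1 functions with compact support, carried together with their gradient\<close>

definition C1c :: "'a::euclidean_space set \<Rightarrow> ('a \<Rightarrow> real) \<Rightarrow> ('a \<Rightarrow> 'a) \<Rightarrow> bool" where
  "C1c \<Omega> \<psi> D \<longleftrightarrow> (\<forall>x. (\<psi> has_derivative (\<lambda>h. D x \<bullet> h)) (at x)) \<and> continuous_on UNIV D \<and>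
     (\<exists>K. compact K \<and> K \<subseteq> \<Omega> \<and> (\<forall>x. x \<notin> K \<longrightarrow> \<psi> x = 0))"

lemma C1cD:
  assumes "C1c \<Omega> \<psi> D"
  shows "(\<psi> has_derivative (\<lambda>h. D x \<bullet> h)) (at x)" "continuous_on UNIV D" "continuous_on UNIV \<psi>"
    "D \<in> borel_measurable borel" "\<psi> \<in> borel_measurable borel"
proof -
  show "(\<psi> has_derivative (\<lambda>h. D x \<bullet> h)) (at x)" "continuous_on UNIV D" using assms by (auto simp: C1c_def)
  show "continuous_on UNIV \<psi>"
    using assms unfolding C1c_def by (intro continuous_at_imp_continuous_on ballI) (metis has_derivative_continuous)
  then show "\<psi> \<in> borel_measurable borel" by (rule borel_measurable_continuous_onI)
  show "D \<in> borel_measurable borel" using assms by (auto simp: C1c_def intro: borel_measurable_continuous_onI)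
qed

text \<open>One compact set serves the function and its gradient: its complement is open, and the
  function is locally constant there.\<close>

lemma C1c_support:
  assumes "C1c \<Omega> \<psi> D"
  obtains K where "compact K" "K \<subseteq> \<Omega>" "\<forall>x. x \<notin> K \<longrightarrow> \<psi> x = 0" "\<forall>x. x \<notin> K \<longrightarrow> D x = 0"
proof -
  obtain K where K: "compact K" "K \<subseteq> \<Omega>" "\<And>x. x \<notin> K \<Longrightarrow> \<psi> x = 0" using assms by (auto simp: C1c_def)
  have "D x = 0" if "x \<notin> K" for x
  proof -
    have "open (- K)" using K compact_imp_closed by blast
    then have "((\<lambda>_. 0) has_derivative (\<lambda>h. D x \<bullet> h)) (at x)"
      using C1cD(1)[OF assms, of x] that K(3)
      by (intro has_derivative_transform_within_open[OF C1cD(1)[OF assms, of x]]) auto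
    then have "(\<lambda>h. D x \<bullet> h) = (\<lambda>h. 0)" using has_derivative_unique has_derivative_const by blast
    then have "D x \<bullet> D x = 0" by meson
    then show ?thesis by simp
  qed
  then show thesis using that K by blast
qed

lemma C1c_outside:
  assumes "C1c \<Omega> \<psi> D" "x \<notin> \<Omega>"
  shows "\<psi> x = 0" "D x = 0"
  using assms(2) by (rule_tac C1c_support[OF assms(1)], blast)+

lemma C1c_bounded:
  assumes "C1c \<Omega> \<psi> D"
  obtains B where "0 \<le> B" "\<forall>x. \<bar>\<psi> x\<bar> \<le> B" "\<forall>x. norm (D x) \<le> B"
proof -
  obtain K where K: "compact K" "K \<subseteq> \<Omega>" "\<forall>x. x \<notin> K \<longrightarrow> \<psi> x = 0" "\<forall>x. x \<notin> K \<longrightarrow> D x = 0"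
    by (rule C1c_support[OF assms])
  have "bounded (\<psi> ` K)" "bounded (D ` K)"
    using C1cD(2,3)[OF assms] K(1) by (auto intro!: compact_imp_bounded compact_continuous_image intro: continuous_on_subset)
  then obtain B1 B2 where "\<forall>x\<in>K. norm (\<psi> x) \<le> B1" "\<forall>x\<in>K. norm (D x) \<le> B2" unfolding bounded_iff by auto
  then have "\<bar>\<psi> x\<bar> \<le> max 0 (max B1 B2)" "norm (D x) \<le> max 0 (max B1 B2)" for x
    using K(3,4) by (cases "x \<in> K"; force)+
  then show thesis using that[of "max 0 (max B1 B2)"] by auto
qed

lemma C1c_integrable:
  assumes "bounded \<Omega>" "C1c \<Omega> \<psi> D"
  shows "integrable lborel \<psi>" "integrable lborel D"
proof -
  obtain B where "0 \<le> B" "\<forall>x. \<bar>\<psi> x\<bar> \<le> B" "\<forall>x. norm (D x) \<le> B"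
    by (rule C1c_bounded[OF assms(2)])
  then show "integrable lborel \<psi>" "integrable lborel D"
    by (auto intro!: integrable_bounded_support[OF _ assms(1)] C1cD[OF assms(2)] C1c_outside[OF assms(2)])
qed

lemma C1c_zero: "C1c \<Omega> (\<lambda>_. 0) (\<lambda>_. 0)"
  unfolding C1c_def by (auto intro!: exI[of _ "{}"] has_derivative_eq_rhs[OF has_derivative_const])

lemma C1c_add:
  assumes "C1c \<Omega> \<psi> D" "C1c \<Omega> \<phi> E"
  shows "C1c \<Omega> (\<lambda>x. \<psi> x + \<phi> x) (\<lambda>x. D x + E x)"
proof -
  obtain K where K: "compact K" "K \<subseteq> \<Omega>" "\<forall>x. x \<notin> K \<longrightarrow> \<psi> x = 0" using assms by (auto simp: C1c_def)
  obtain K' where K': "compact K'" "K' \<subseteq> \<Omega>" "\<forall>x. x \<notin> K' \<longrightarrow> \<phi> x = 0" using assms by (auto simp: C1c_def)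
  show ?thesis unfolding C1c_def
    using C1cD[OF assms(1)] C1cD[OF assms(2)] K K'
    by (auto intro!: derivative_eq_intros continuous_intros exI[of _ "K \<union> K'"] simp: inner_add_left)
qed

lemma C1c_scale:
  assumes "C1c \<Omega> \<psi> D"
  shows "C1c \<Omega> (\<lambda>x. c * \<psi> x) (\<lambda>x. c *\<^sub>R D x)"
proof -
  obtain K where K: "compact K" "K \<subseteq> \<Omega>" "\<And>x. x \<notin> K \<Longrightarrow> \<psi> x = 0" using assms by (auto simp: C1c_def)
  show ?thesis unfolding C1c_def
    using C1cD[OF assms(1)] K
    by (auto intro!: derivative_eq_intros continuous_intros exI[of _ K])
qed

text \<open>This L1 modulus of continuity is the only way in which the gradient controls the
  function. It passes to limits and gives both Poincare's inequality and compactness.\<close>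

lemma C1c_translation:
  assumes "bounded \<Omega>" "C1c \<Omega> \<psi> D"
  shows "L1norm (\<lambda>x. \<psi> (x + h) - \<psi> x) \<le> norm h * (LBINT x. norm (D x))"
proof -
  obtain B where "0 \<le> B" "\<forall>x. \<bar>\<psi> x\<bar> \<le> B" and B: "\<forall>x. norm (D x) \<le> B"
    by (rule C1c_bounded[OF assms(2)])
  have "L1norm (\<lambda>x. \<psi> (x + h) - \<psi> x) \<le> L1norm (\<lambda>x. D x \<bullet> h)"
    by (rule difference_quotient_integral[OF C1cD(1)[OF assms(2)] B[rule_format] assms(1)]) (rule C1c_outside[OF assms(2)])
  also have "\<dots> \<le> (LBINT x. norm h * norm (D x))"
  proof (rule integral_mono)
    have "integrable lborel (\<lambda>x. D x \<bullet> h)"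
      by (rule difference_quotient_integral(1)[OF C1cD(1)[OF assms(2)] B[rule_format] assms(1)]) (rule C1c_outside[OF assms(2)])
    then show "integrable lborel (\<lambda>x. \<bar>D x \<bullet> h\<bar>)" by (rule integrable_abs)
    show "integrable lborel (\<lambda>x. norm h * norm (D x))"
      using C1c_integrable(2)[OF assms] by simp
    show "\<bar>D x \<bullet> h\<bar> \<le> norm h * norm (D x)" for x
      using Cauchy_Schwarz_ineq2[of "D x" h] by (simp add: mult.commute)
  qed
  finally show ?thesis by simp
qed

text \<open>Translate by the diameter of the ball in a coordinate direction. The function and its
  translate are then never nonzero at the same point, so the L1 norm of their difference is twice
  the norm of the function, and the translation estimate bounds it.\<close>

lemma C1c_poincare:
  fixes \<Omega> :: "'a::euclidean_space set"
  assumes R: "\<Omega> \<subseteq> ball 0 R" and c: "C1c \<Omega> \<psi> D"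
  shows "L1norm \<psi> \<le> \<bar>R\<bar> * (LBINT x. norm (D x))"
proof -
  have bO: "bounded \<Omega>" using R bounded_subset[OF bounded_ball] by blast
  obtain b :: 'a where b: "b \<in> Basis" using nonempty_Basis by blast
  define h where "h = (2 * \<bar>R\<bar>) *\<^sub>R b"
  have nh: "norm h = 2 * \<bar>R\<bar>" using b by (simp add: h_def)
  have i: "integrable lborel \<psi>" "\<psi> \<in> borel_measurable borel" using C1c_integrable[OF bO c] by auto
  have "\<bar>\<psi> (x + h) - \<psi> x\<bar> = \<bar>\<psi> (x + h)\<bar> + \<bar>\<psi> x\<bar>" for x
  proof -
    have "x \<notin> \<Omega> \<or> x + h \<notin> \<Omega>"
    proof (rule ccontr)
      assume "\<not> ?thesis"
      then have "norm x < R" "norm (x + h) < R" using R by auto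
      then have "norm h < 2 * R" using norm_triangle_ineq4[of "x + h" x] by simp
      then show False using nh by linarith
    qed
    then show ?thesis using C1c_outside[OF c] by auto
  qed
  then have "L1norm (\<lambda>x. \<psi> (x + h) - \<psi> x) = (LBINT x. \<bar>\<psi> (x + h)\<bar> + \<bar>\<psi> x\<bar>)" by simp
  also have "\<dots> = L1norm (\<lambda>x. \<psi> (x + h)) + L1norm \<psi>"
    using i lborel_integrable_translation[of \<psi> h] by (intro Bochner_Integration.integral_add integrable_abs) auto
  also have "L1norm (\<lambda>x. \<psi> (x + h)) = L1norm \<psi>"
    using i by (intro lborel_integral_translation) measurable
  finally show ?thesis using C1c_translation[OF bO c, of h] nh by simp
qed

section \<open>Variable exponent spaces\<close>

text \<open>The exponent is a Borel function on the whole space with its bounds valid everywhere.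
  Integrals over \<open>lborel\<close> of functions vanishing off \<Omega> then carry no restriction
  to \<Omega>.\<close>

locale pspace =
  fixes \<Omega> :: "'a::euclidean_space set" and p :: "'a \<Rightarrow> real" and pm pp :: real
  assumes open_domain: "open \<Omega>" and bounded_domain: "bounded \<Omega>"
    and p_measurable [measurable]: "p \<in> borel_measurable borel"
    and pm_gt_1: "1 < pm" and pm_le_p: "\<And>x. pm \<le> p x" and p_le_pp: "\<And>x. p x \<le> pp"
begin

lemma p_gt_1: "1 < p x" using pm_gt_1 pm_le_p[of x] by linarith

lemma domain_measurable [measurable]: "\<Omega> \<in> sets borel" using open_domain by (rule borel_open)

lemma pp_gt_1: "1 < pp" using pm_gt_1 pm_le_p[of undefined] p_le_pp[of undefined] by linarith

definition Lp :: "('a \<Rightarrow> 'b::euclidean_space) \<Rightarrow> bool" where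
  "Lp G \<longleftrightarrow> G \<in> borel_measurable borel \<and> (\<forall>x. x \<notin> \<Omega> \<longrightarrow> G x = 0) \<and> integrable lborel (\<lambda>x. norm (G x) powr p x)"

text \<open>The modular replaces the Luxemburg norm throughout the analysis; for bounded exponents
  the two tend to 0 together, which is proved where the given Sobolev space is reached.\<close>

definition rho :: "('a \<Rightarrow> 'b::euclidean_space) \<Rightarrow> real" where
  "rho G = (LBINT x. norm (G x) powr p x)"

lemma LpD:
  assumes "Lp G"
  shows "G \<in> borel_measurable borel" "x \<notin> \<Omega> \<Longrightarrow> G x = 0" "integrable lborel (\<lambda>x. norm (G x) powr p x)"
  using assms by (auto simp: Lp_def)

lemma rho_nonneg [simp]: "0 \<le> rho G"
  by (simp add: rho_def)

lemma Lp_add: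
  assumes "Lp G" "Lp H"
  shows "Lp (\<lambda>x. G x + H x)" "rho (\<lambda>x. G x + H x) \<le> 2 powr pp * (rho G + rho H)"
proof -
  note [measurable] = LpD(1)[OF assms(1)] LpD(1)[OF assms(2)]
  have pt: "norm (G x + H x) powr p x \<le> 2 powr pp * (norm (G x) powr p x + norm (H x) powr p x)" for x
    using p_gt_1[of x] p_le_pp by (intro norm_add_powr_le) auto
  have I: "integrable lborel (\<lambda>x. 2 powr pp * (norm (G x) powr p x + norm (H x) powr p x))"
    using LpD(3)[OF assms(1)] LpD(3)[OF assms(2)] by simp
  have J: "integrable lborel (\<lambda>x. norm (G x + H x) powr p x)"
    by (rule Bochner_Integration.integrable_bound[OF I]) (use pt in auto)
  then show "Lp (\<lambda>x. G x + H x)"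
    using LpD(2)[OF assms(1)] LpD(2)[OF assms(2)] by (simp add: Lp_def)
  have "rho (\<lambda>x. G x + H x) \<le> (LBINT x. 2 powr pp * (norm (G x) powr p x + norm (H x) powr p x))"
    unfolding rho_def by (rule integral_mono[OF J I pt])
  also have "\<dots> = 2 powr pp * (rho G + rho H)"
    using LpD(3)[OF assms(1)] LpD(3)[OF assms(2)] by (simp add: rho_def)
  finally show "rho (\<lambda>x. G x + H x) \<le> 2 powr pp * (rho G + rho H)" .
qed

lemma Lp_scale:
  assumes "Lp G"
  shows "Lp (\<lambda>x. c *\<^sub>R G x)"
proof -
  note [measurable] = LpD(1)[OF assms]
  have "norm (c *\<^sub>R G x) powr p x \<le> (max 1 \<bar>c\<bar>) powr pp * norm (G x) powr p x" for x
  proof -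
    have "\<bar>c\<bar> powr p x \<le> (max 1 \<bar>c\<bar>) powr p x" using p_gt_1[of x] by (intro powr_mono2) auto
    also have "\<dots> \<le> (max 1 \<bar>c\<bar>) powr pp" using p_le_pp by (intro powr_mono) auto
    finally show ?thesis by (simp add: powr_mult mult_right_mono)
  qed
  then have "integrable lborel (\<lambda>x. norm (c *\<^sub>R G x) powr p x)"
    by (intro Bochner_Integration.integrable_bound[OF integrable_mult_right[OF LpD(3)[OF assms], of "(max 1 \<bar>c\<bar>) powr pp"]])
      auto
  then show ?thesis using LpD(2)[OF assms] by (simp add: Lp_def)
qed

lemma Lp_uminus: "Lp G \<Longrightarrow> Lp (\<lambda>x. - G x)" "rho (\<lambda>x. - G x) = rho G"
  by (auto simp: Lp_def rho_def)

lemma Lp_diff: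
  assumes "Lp G" "Lp H"
  shows "Lp (\<lambda>x. G x - H x)" "rho (\<lambda>x. G x - H x) \<le> 2 powr pp * (rho G + rho H)"
  using Lp_add[OF assms(1) Lp_uminus(1)[OF assms(2)]] by (simp_all add: Lp_uminus(2))

lemma rho_commute: "rho (\<lambda>x. G x - H x) = rho (\<lambda>x. H x - G x)"
  by (simp add: rho_def norm_minus_commute)

lemma Lp_bounded:
  assumes "G \<in> borel_measurable borel" "\<And>x. x \<notin> \<Omega> \<Longrightarrow> G x = 0" "\<And>x. norm (G x) \<le> B"
  shows "Lp G"
proof -
  note [measurable] = assms(1)
  have B: "0 \<le> B" using assms(3)[of undefined] norm_ge_zero order_trans by blast
  have "norm (G x) powr p x \<le> (max 1 B) powr pp" for x
  proof -
    have "norm (G x) powr p x \<le> (max 1 B) powr p x"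
      using p_gt_1[of x] assms(3)[of x] by (intro powr_mono2) auto
    also have "\<dots> \<le> (max 1 B) powr pp" using p_le_pp by (intro powr_mono) auto
    finally show ?thesis .
  qed
  then have "integrable lborel (\<lambda>x. norm (G x) powr p x)"
    using assms(2) by (intro integrable_bounded_support[OF _ bounded_domain, where B="(max 1 B) powr pp"]) auto
  then show ?thesis using assms by (simp add: Lp_def)
qed

lemma C1c_Lp:
  assumes "C1c \<Omega> \<psi> D" shows "Lp D" "Lp \<psi>"
proof -
  obtain B where "0 \<le> B" "\<forall>x. \<bar>\<psi> x\<bar> \<le> B" "\<forall>x. norm (D x) \<le> B" by (rule C1c_bounded[OF assms])
  then show "Lp D" "Lp \<psi>"
    by (auto intro!: Lp_bounded[where B=B] C1cD[OF assms] C1c_outside[OF assms])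
qed

definition vol :: real where "vol = measure lborel \<Omega>"

lemma vol_nonneg [simp]: "0 \<le> vol" by (simp add: vol_def)

lemma domain_indicator: "integrable lborel (\<lambda>x. c * indicator \<Omega> x :: real)" "(LBINT x. c * indicator \<Omega> x) = c * vol"
  using integrable_scaled_indicator[OF bounded_domain, of c] by (simp_all add: vol_def)

lemma Lp_integrable:
  assumes "Lp G"
  shows "integrable lborel G"
    and "\<lbrakk>0 < \<delta>; \<delta> \<le> 1\<rbrakk> \<Longrightarrow> (LBINT x. norm (G x)) \<le> \<delta> * vol + \<delta> powr (1 - pp) * rho G"
proof -
  note [measurable] = LpD(1)[OF assms]
  have pt: "norm (G x) \<le> \<delta> * indicator \<Omega> x + \<delta> powr (1 - pp) * norm (G x) powr p x"
    if "0 < \<delta>" "\<delta> \<le> 1" for \<delta> x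
    using linear_le_powr_small[OF that, of "p x" pp "norm (G x)"] p_gt_1[of x] p_le_pp[of x] LpD(2)[OF assms, of x]
    by (cases "x \<in> \<Omega>") auto
  have I: "integrable lborel (\<lambda>x. \<delta> * indicator \<Omega> x + \<delta> powr (1 - pp) * norm (G x) powr p x)" for \<delta>
    using domain_indicator(1)[of \<delta>] LpD(3)[OF assms] by simp
  show J: "integrable lborel G"
    by (rule Bochner_Integration.integrable_bound[OF I[of 1]]) (use pt[of 1] in auto)
  assume d: "0 < \<delta>" "\<delta> \<le> 1"
  have "(LBINT x. norm (G x)) \<le> (LBINT x. \<delta> * indicator \<Omega> x + \<delta> powr (1 - pp) * norm (G x) powr p x)"
    using J by (intro integral_mono I pt d) simp
  also have "\<dots> = \<delta> * vol + \<delta> powr (1 - pp) * rho G"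
    using domain_indicator[of \<delta>] LpD(3)[OF assms] by (simp add: rho_def)
  finally show "(LBINT x. norm (G x)) \<le> \<delta> * vol + \<delta> powr (1 - pp) * rho G" .
qed

lemma Lp_L1_large:
  assumes "Lp G" "0 < \<delta>"
  shows "(LBINT x. norm (G x)) \<le> max 1 (\<delta> powr (- 1 / (pm - 1))) * vol + \<delta> * rho G"
proof -
  note [measurable] = LpD(1)[OF assms(1)]
  define K where "K = max 1 (\<delta> powr (- 1 / (pm - 1)))"
  have pt: "norm (G x) \<le> K * indicator \<Omega> x + \<delta> * norm (G x) powr p x" for x
    using linear_le_powr_large[OF assms(2) pm_gt_1 pm_le_p, of "norm (G x)" x] LpD(2)[OF assms(1), of x]
    by (cases "x \<in> \<Omega>") (auto simp: K_def)
  have "(LBINT x. norm (G x)) \<le> (LBINT x. K * indicator \<Omega> x + \<delta> * norm (G x) powr p x)"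
    using domain_indicator(1)[of K] LpD(3)[OF assms(1)] Lp_integrable(1)[OF assms(1)]
    by (intro integral_mono pt) auto
  also have "\<dots> = K * vol + \<delta> * rho G"
    using domain_indicator[of K] LpD(3)[OF assms(1)] by (simp add: rho_def)
  finally show ?thesis by (simp add: K_def)
qed

text \<open>The constant \<open>C\<close> is chosen after \<open>\<delta>\<close> and may blow up as
  \<open>\<delta>\<close> tends to 0. Young's inequality and uniform monotonicity produce estimates
  of exactly this shape.\<close>

lemma squeeze_by_eps:
  fixes a b :: "nat \<Rightarrow> real"
  assumes "\<And>n. 0 \<le> a n" "b \<longlonglongrightarrow> 0" "0 \<le> V"
    and "\<And>\<delta>. 0 < \<delta> \<Longrightarrow> \<delta> \<le> 1 \<Longrightarrow> \<exists>C. \<forall>n. a n \<le> \<delta> * V + C * b n"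
  shows "a \<longlonglongrightarrow> 0"
proof (rule LIMSEQ_I)
  fix e :: real assume e: "0 < e"
  define \<delta> where "\<delta> = min 1 (e / (2 * (V + 1)))"
  have d: "0 < \<delta>" "\<delta> \<le> 1" using e assms(3) by (auto simp: \<delta>_def)
  have "\<delta> * V \<le> e / (2 * (V + 1)) * V" using assms(3) by (intro mult_right_mono) (auto simp: \<delta>_def)
  also have "\<dots> < e" using e assms(3) by (simp add: field_simps) (smt (verit) mult_nonneg_nonneg)
  finally have dV: "0 < e - \<delta> * V" by simp
  obtain C where C: "\<And>n. a n \<le> \<delta> * V + C * b n" using assms(4)[OF d] by blast
  have "(\<lambda>n. C * b n) \<longlonglongrightarrow> 0" using tendsto_mult_right_zero[OF assms(2)] by simp
  then have "eventually (\<lambda>n. C * b n < e - \<delta> * V) sequentially" using dV by (rule order_tendstoD)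
  then obtain N where N: "\<And>n. n \<ge> N \<Longrightarrow> C * b n < e - \<delta> * V" unfolding eventually_sequentially by blast
  have "norm (a n - 0) < e" if "n \<ge> N" for n
    using N[OF that] C[of n] assms(1)[of n] by simp
  then show "\<exists>no. \<forall>n\<ge>no. norm (a n - 0) < e" by blast
qed

lemma rho_tendsto_L1:
  assumes "\<And>n. Lp (G n)" "(\<lambda>n. rho (G n)) \<longlonglongrightarrow> 0"
  shows "(\<lambda>n. LBINT x. norm (G n x)) \<longlonglongrightarrow> 0"
proof (rule squeeze_by_eps[OF _ assms(2) vol_nonneg])
  show "\<exists>C. \<forall>n. (LBINT x. norm (G n x)) \<le> \<delta> * vol + C * rho (G n)" if "0 < \<delta>" "\<delta> \<le> 1" for \<delta>
    using Lp_integrable(2)[OF assms(1) that] by blast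
qed simp

lemma Vp_measurable [measurable (raw)]:
  assumes "G \<in> borel_measurable M" "p' \<in> borel_measurable M"
  shows "(\<lambda>x. Vp (p' x) (G x :: 'b::euclidean_space)) \<in> borel_measurable M"
  unfolding Vp_def using assms by measurable

text \<open>Young's inequality integrated. It plays the part of Hoelder's inequality and keeps
  everything in terms of modulars.\<close>

lemma Vp_pairing:
  fixes G H :: "'a \<Rightarrow> 'b::euclidean_space"
  assumes "Lp G" "Lp H"
  shows "integrable lborel (\<lambda>x. Vp (p x) (G x) \<bullet> H x)"
    and "\<lbrakk>0 < \<epsilon>; \<epsilon> \<le> 1\<rbrakk> \<Longrightarrow> \<bar>LBINT x. Vp (p x) (G x) \<bullet> H x\<bar> \<le> \<epsilon> * rho G + \<epsilon> powr (1 - pp) * rho H"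
proof -
  note [measurable] = LpD(1)[OF assms(1)] LpD(1)[OF assms(2)]
  have pt: "\<bar>Vp (p x) (G x) \<bullet> H x\<bar> \<le> \<epsilon> * norm (G x) powr p x + \<epsilon> powr (1 - pp) * norm (H x) powr p x"
    if "0 < \<epsilon>" "\<epsilon> \<le> 1" for \<epsilon> x
  proof -
    have "\<bar>Vp (p x) (G x) \<bullet> H x\<bar> \<le> norm (G x) powr (p x - 1) * norm (H x)" by (rule abs_Vp_inner_le)
    also have "\<dots> \<le> \<epsilon> * norm (G x) powr p x + \<epsilon> powr (1 - pp) * norm (H x) powr p x"
      using p_gt_1[of x] p_le_pp[of x] by (intro young_eps that) auto
    finally show ?thesis .
  qed
  have I: "integrable lborel (\<lambda>x. \<epsilon> * norm (G x) powr p x + \<epsilon> powr (1 - pp) * norm (H x) powr p x)" for \<epsilon>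
    using LpD(3)[OF assms(1)] LpD(3)[OF assms(2)] by simp
  show J: "integrable lborel (\<lambda>x. Vp (p x) (G x) \<bullet> H x)"
    by (rule Bochner_Integration.integrable_bound[OF I[of 1]]) (use pt[of 1] in auto)
  assume e: "0 < \<epsilon>" "\<epsilon> \<le> 1"
  have "\<bar>LBINT x. Vp (p x) (G x) \<bullet> H x\<bar> \<le> L1norm (\<lambda>x. Vp (p x) (G x) \<bullet> H x)"
    by (rule integral_abs_bound)
  also have "\<dots> \<le> (LBINT x. \<epsilon> * norm (G x) powr p x + \<epsilon> powr (1 - pp) * norm (H x) powr p x)"
    using J by (intro integral_mono I pt e integrable_abs)
  also have "\<dots> = \<epsilon> * rho G + \<epsilon> powr (1 - pp) * rho H"
    using LpD(3)[OF assms(1)] LpD(3)[OF assms(2)] by (simp add: rho_def)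
  finally show "\<bar>LBINT x. Vp (p x) (G x) \<bullet> H x\<bar> \<le> \<epsilon> * rho G + \<epsilon> powr (1 - pp) * rho H" .
qed

lemma Vp_pairing_tendsto:
  fixes G :: "'a \<Rightarrow> 'b::euclidean_space"
  assumes "Lp G" "Lp H" "\<And>n. Lp (K n)" "(\<lambda>n. rho (\<lambda>x. K n x - H x)) \<longlonglongrightarrow> 0"
  shows "(\<lambda>n. LBINT x. Vp (p x) (G x) \<bullet> K n x) \<longlonglongrightarrow> (LBINT x. Vp (p x) (G x) \<bullet> H x)"
proof -
  have "(\<lambda>n. \<bar>LBINT x. Vp (p x) (G x) \<bullet> (K n x - H x)\<bar>) \<longlonglongrightarrow> 0"
  proof (rule squeeze_by_eps[OF _ assms(4) rho_nonneg[of G]])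
    fix \<delta> :: real assume "0 < \<delta>" "\<delta> \<le> 1"
    then show "\<exists>C. \<forall>n. \<bar>LBINT x. Vp (p x) (G x) \<bullet> (K n x - H x)\<bar> \<le> \<delta> * rho G + C * rho (\<lambda>x. K n x - H x)"
      using Vp_pairing(2)[OF assms(1) Lp_diff(1)[OF assms(3) assms(2)]] by blast
  qed simp
  then have "(\<lambda>n. LBINT x. Vp (p x) (G x) \<bullet> (K n x - H x)) \<longlonglongrightarrow> 0"
    by (simp add: tendsto_rabs_zero_iff)
  moreover have "(LBINT x. Vp (p x) (G x) \<bullet> (K n x - H x))
    = (LBINT x. Vp (p x) (G x) \<bullet> K n x) - (LBINT x. Vp (p x) (G x) \<bullet> H x)" for n
    using Vp_pairing(1)[OF assms(1) assms(2)] Vp_pairing(1)[OF assms(1) assms(3)]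
    by (simp add: inner_diff_right)
  ultimately show ?thesis by (simp add: LIM_zero_iff)
qed

text \<open>The Sobolev space with zero boundary values, as a closure: L1 convergence of the
  functions, modular convergence of the gradients. No integrability of \<open>u\<close> beyond L1 is
  demanded, so the L1 form of Poincare's inequality is enough to work in it; for bounded
  \<open>u\<close> membership implies membership in the given space \<open>W0\<close>.\<close>

definition W :: "('a \<Rightarrow> real) \<Rightarrow> ('a \<Rightarrow> 'a) \<Rightarrow> bool" where
  "W u G \<longleftrightarrow> integrable lborel u \<and> u \<in> borel_measurable borel \<and> (\<forall>x. x \<notin> \<Omega> \<longrightarrow> u x = 0) \<and> Lp G \<and>
     (\<exists>\<psi> D. (\<forall>n. C1c \<Omega> (\<psi> n) (D n)) \<and> (\<lambda>n. L1norm (\<lambda>x. \<psi> n x - u x)) \<longlonglongrightarrow> 0 \<and>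
        (\<lambda>n. rho (\<lambda>x. D n x - G x)) \<longlonglongrightarrow> (0 :: real))"

lemma WD:
  assumes "W u G"
  shows "integrable lborel u" "u \<in> borel_measurable borel" "x \<notin> \<Omega> \<Longrightarrow> u x = 0" "Lp G"
    "x \<notin> \<Omega> \<Longrightarrow> G x = 0" "G \<in> borel_measurable borel"
  using assms by (auto simp: W_def Lp_def)

lemma C1c_W:
  assumes "C1c \<Omega> \<psi> D" shows "W \<psi> D"
  unfolding W_def using assms C1c_Lp[OF assms] C1c_integrable[OF bounded_domain assms] C1c_outside[OF assms] C1cD(5)[OF assms]
  by (auto intro!: exI[of _ "\<lambda>_. \<psi>"] exI[of _ "\<lambda>_. D"] simp: rho_def)

lemma W_add_scale:
  assumes "W u G" "W v H"
  shows "W (\<lambda>x. u x + c * v x) (\<lambda>x. G x + c *\<^sub>R H x)"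
proof -
  obtain \<psi> D where 1: "\<forall>n. C1c \<Omega> (\<psi> n) (D n)" "(\<lambda>n. L1norm (\<lambda>x. \<psi> n x - u x)) \<longlonglongrightarrow> 0"
     "(\<lambda>n. rho (\<lambda>x. D n x - G x)) \<longlonglongrightarrow> 0" using assms(1) by (auto simp: W_def)
  obtain \<phi> E where 2: "\<forall>n. C1c \<Omega> (\<phi> n) (E n)" "(\<lambda>n. L1norm (\<lambda>x. \<phi> n x - v x)) \<longlonglongrightarrow> 0"
     "(\<lambda>n. rho (\<lambda>x. E n x - H x)) \<longlonglongrightarrow> 0" using assms(2) by (auto simp: W_def)
  have c: "C1c \<Omega> (\<lambda>x. \<psi> n x + c * \<phi> n x) (\<lambda>x. D n x + c *\<^sub>R E n x)" for n
    using 1 2 C1c_add C1c_scale by blast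
  define C where "C = (max 1 \<bar>c\<bar>) powr pp"
  have sc: "rho (\<lambda>x. c *\<^sub>R F x) \<le> C * rho F" if "Lp F" for F :: "'a \<Rightarrow> 'a"
  proof -
    have "norm (c *\<^sub>R F x) powr p x \<le> C * norm (F x) powr p x" for x
    proof -
      have "\<bar>c\<bar> powr p x \<le> (max 1 \<bar>c\<bar>) powr p x" using p_gt_1[of x] by (intro powr_mono2) auto
      also have "\<dots> \<le> (max 1 \<bar>c\<bar>) powr pp" using p_le_pp by (intro powr_mono) auto
      finally show ?thesis by (simp add: powr_mult mult_right_mono C_def)
    qed
    then have "rho (\<lambda>x. c *\<^sub>R F x) \<le> (LBINT x. C * norm (F x) powr p x)"
      unfolding rho_def using LpD(3)[OF Lp_scale[OF that, of c]] LpD(3)[OF that] by (intro integral_mono) auto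
    then show ?thesis by (simp add: rho_def)
  qed
  have i: "integrable lborel (\<lambda>x. \<bar>\<psi> n x - u x\<bar>)" "integrable lborel (\<lambda>x. \<bar>\<phi> n x - v x\<bar>)"
      "integrable lborel (\<lambda>x. \<bar>(\<psi> n x + c * \<phi> n x) - (u x + c * v x)\<bar>)" for n
    using WD(1)[OF assms(1)] WD(1)[OF assms(2)] C1c_integrable(1)[OF bounded_domain 1(1)[rule_format]]
      C1c_integrable(1)[OF bounded_domain 2(1)[rule_format]] by auto
  have b1: "L1norm (\<lambda>x. (\<psi> n x + c * \<phi> n x) - (u x + c * v x))
      \<le> L1norm (\<lambda>x. \<psi> n x - u x) + \<bar>c\<bar> * L1norm (\<lambda>x. \<phi> n x - v x)" for n
  proof -
    have pt: "\<bar>(\<psi> n x + c * \<phi> n x) - (u x + c * v x)\<bar> \<le> \<bar>\<psi> n x - u x\<bar> + \<bar>c\<bar> * \<bar>\<phi> n x - v x\<bar>" for x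
    proof -
      have "(\<psi> n x + c * \<phi> n x) - (u x + c * v x) = (\<psi> n x - u x) + c * (\<phi> n x - v x)" by (simp add: algebra_simps)
      then show ?thesis using abs_triangle_ineq[of "\<psi> n x - u x" "c * (\<phi> n x - v x)"] by (simp only: abs_mult)
    qed
    have "L1norm (\<lambda>x. (\<psi> n x + c * \<phi> n x) - (u x + c * v x))
       \<le> (LBINT x. \<bar>\<psi> n x - u x\<bar> + \<bar>c\<bar> * \<bar>\<phi> n x - v x\<bar>)"
      by (rule integral_mono[OF i(3) _ pt]) (intro Bochner_Integration.integrable_add integrable_mult_right i)
    also have "\<dots> = L1norm (\<lambda>x. \<psi> n x - u x) + \<bar>c\<bar> * L1norm (\<lambda>x. \<phi> n x - v x)"
      by (subst Bochner_Integration.integral_add[OF i(1) integrable_mult_right[OF i(2)]]) simp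
    finally show ?thesis .
  qed
  have l1: "Lp (\<lambda>x. D n x - G x)" "Lp (\<lambda>x. E n x - H x)" for n
    using Lp_diff(1) C1c_Lp(1) 1(1) 2(1) WD(4)[OF assms(1)] WD(4)[OF assms(2)] by blast+
  have b2: "rho (\<lambda>x. (D n x + c *\<^sub>R E n x) - (G x + c *\<^sub>R H x))
      \<le> 2 powr pp * (rho (\<lambda>x. D n x - G x) + C * rho (\<lambda>x. E n x - H x))" for n
  proof -
    have "(\<lambda>x. (D n x + c *\<^sub>R E n x) - (G x + c *\<^sub>R H x)) = (\<lambda>x. (D n x - G x) + c *\<^sub>R (E n x - H x))"
      by (auto simp: algebra_simps)
    then show ?thesis
      using order_trans[OF Lp_add(2)[OF l1(1)[of n] Lp_scale[OF l1(2)[of n], of c]]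
          mult_left_mono[OF add_left_mono[OF sc[OF l1(2)[of n]]] powr_ge_zero]] by simp
  qed
  have t1: "(\<lambda>n. L1norm (\<lambda>x. (\<psi> n x + c * \<phi> n x) - (u x + c * v x))) \<longlonglongrightarrow> 0"
  proof (rule tendsto_sandwich[OF _ _ tendsto_const])
    show "(\<lambda>n. (L1norm (\<lambda>x. \<psi> n x - u x)) + \<bar>c\<bar> * L1norm (\<lambda>x. \<phi> n x - v x)) \<longlonglongrightarrow> 0"
      using tendsto_add[OF 1(2) tendsto_mult_left[OF 2(2), of "\<bar>c\<bar>"]] by simp
  qed (use b1 in auto)
  have t2: "(\<lambda>n. rho (\<lambda>x. (D n x + c *\<^sub>R E n x) - (G x + c *\<^sub>R H x))) \<longlonglongrightarrow> 0"
  proof (rule tendsto_sandwich[OF _ _ tendsto_const])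
    show "(\<lambda>n. 2 powr pp * (rho (\<lambda>x. D n x - G x) + C * rho (\<lambda>x. E n x - H x))) \<longlonglongrightarrow> 0"
      using tendsto_mult_left[OF tendsto_add[OF 1(3) tendsto_mult_left[OF 2(3), of C]], of "2 powr pp"] by simp
  qed (use b2 in auto)
  note [measurable] = WD(2)[OF assms(1)] WD(2)[OF assms(2)]
  have "Lp (\<lambda>x. G x + c *\<^sub>R H x)" by (rule Lp_add(1)[OF WD(4)[OF assms(1)] Lp_scale[OF WD(4)[OF assms(2)]]])
  then show ?thesis unfolding W_def
    using WD(1,3)[OF assms(1)] WD(1,3)[OF assms(2)] c t1 t2
    by (auto intro!: exI[of _ "\<lambda>n x. \<psi> n x + c * \<phi> n x"] exI[of _ "\<lambda>n x. D n x + c *\<^sub>R E n x"])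
qed

lemma W_diff: "W u G \<Longrightarrow> W v H \<Longrightarrow> W (\<lambda>x. u x - v x) (\<lambda>x. G x - H x)"
  using W_add_scale[of u G v H "-1"] by simp

lemma L1_norm_tendsto:
  fixes s :: "nat \<Rightarrow> 'a \<Rightarrow> 'b::{banach, second_countable_topology}"
  assumes "\<And>n. integrable lborel (s n)" "integrable lborel f" "(\<lambda>n. LBINT x. norm (s n x - f x)) \<longlonglongrightarrow> 0"
  shows "(\<lambda>n. LBINT x. norm (s n x)) \<longlonglongrightarrow> (LBINT x. norm (f x))"
proof (rule Lim_null_comparison[where g="\<lambda>n. (LBINT x. norm (s n x - f x))", THEN LIM_zero_cancel])
  show "eventually (\<lambda>n. norm ((LBINT x. norm (s n x)) - (LBINT x. norm (f x)))
      \<le> (LBINT x. norm (s n x - f x))) sequentially"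
  proof (rule always_eventually, rule allI)
    fix n
    have "(LBINT x. norm (s n x)) - (LBINT x. norm (f x)) = (LBINT x. norm (s n x) - norm (f x))"
      using assms by (subst Bochner_Integration.integral_diff) auto
    then have "norm ((LBINT x. norm (s n x)) - (LBINT x. norm (f x))) \<le> L1norm (\<lambda>x. norm (s n x) - norm (f x))"
      using integral_abs_bound[of lborel "\<lambda>x. norm (s n x) - norm (f x)"] by simp
    also have "\<dots> \<le> (LBINT x. norm (s n x - f x))"
      using assms by (intro integral_mono) (auto simp: norm_triangle_ineq3)
    finally show "norm ((LBINT x. norm (s n x)) - (LBINT x. norm (f x))) \<le> (LBINT x. norm (s n x - f x))" .
  qed
qed (rule assms(3))

text \<open>The sum \<open>h\<close> of the two error densities has integral tending to 0, so a
  single subsequence gives one integrable majorant and pointwise convergence for functions and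
  gradients at once.\<close>

lemma W_approx:
  assumes "W u G"
  obtains \<psi> D g where "\<forall>n. C1c \<Omega> (\<psi> n) (D n)" "(\<lambda>n. L1norm (\<lambda>x. \<psi> n x - u x)) \<longlonglongrightarrow> 0"
    "(\<lambda>n. rho (\<lambda>x. D n x - G x)) \<longlonglongrightarrow> 0" "(\<lambda>n. LBINT x. norm (D n x - G x)) \<longlonglongrightarrow> 0"
    "integrable lborel g"
    "AE x in lborel. (\<forall>n. \<bar>\<psi> n x - u x\<bar> \<le> g x \<and> norm (D n x - G x) powr p x \<le> g x) \<and>
        (\<lambda>n. \<psi> n x) \<longlonglongrightarrow> u x \<and> (\<lambda>n. D n x) \<longlonglongrightarrow> G x"
proof -
  obtain \<psi> D where 1: "\<And>n. C1c \<Omega> (\<psi> n) (D n)" "(\<lambda>n. L1norm (\<lambda>x. \<psi> n x - u x)) \<longlonglongrightarrow> 0"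
     "(\<lambda>n. rho (\<lambda>x. D n x - G x)) \<longlonglongrightarrow> 0" using assms by (auto simp: W_def)
  define h where "h n x = \<bar>\<psi> n x - u x\<bar> + norm (D n x - G x) powr p x" for n x
  have l: "Lp (\<lambda>x. D n x - G x)" for n using Lp_diff(1) C1c_Lp(1) 1(1) WD(4)[OF assms] by blast
  have i: "integrable lborel (\<lambda>x. \<bar>\<psi> n x - u x\<bar>)" "integrable lborel (\<lambda>x. norm (D n x - G x) powr p x)" for n
    using WD(1)[OF assms] C1c_integrable(1)[OF bounded_domain 1(1)] LpD(3)[OF l] by auto
  have hi: "integrable lborel (h n)" for n unfolding h_def by (intro Bochner_Integration.integrable_add i)
  have "(LBINT x. h n x) = L1norm (\<lambda>x. \<psi> n x - u x) + rho (\<lambda>x. D n x - G x)" for n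
    unfolding h_def rho_def by (intro Bochner_Integration.integral_add i)
  then have "(\<lambda>n. LBINT x. h n x) \<longlonglongrightarrow> 0" using tendsto_add[OF 1(2,3)] by simp
  then have hl: "(\<lambda>n. LBINT x. h n x) \<longlonglongrightarrow> 0" .
  have h0: "0 \<le> h n x" for n x by (simp add: h_def)
  obtain r g where r: "strict_mono r" "integrable lborel g"
      "AE x in lborel. (\<forall>k. h (r k) x \<le> g x) \<and> (\<lambda>k. h (r k) x) \<longlonglongrightarrow> 0"
    by (rule dominated_subseq[OF hi h0 hl])
  have sub: "(\<lambda>n. L1norm (\<lambda>x. \<psi> (r n) x - u x)) \<longlonglongrightarrow> 0" "(\<lambda>n. rho (\<lambda>x. D (r n) x - G x)) \<longlonglongrightarrow> 0"
    using LIMSEQ_subseq_LIMSEQ[OF 1(2) r(1)] LIMSEQ_subseq_LIMSEQ[OF 1(3) r(1)] by (auto simp: o_def)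
  have AEc: "AE x in lborel. (\<forall>n. \<bar>\<psi> (r n) x - u x\<bar> \<le> g x \<and> norm (D (r n) x - G x) powr p x \<le> g x) \<and>
        (\<lambda>n. \<psi> (r n) x) \<longlonglongrightarrow> u x \<and> (\<lambda>n. D (r n) x) \<longlonglongrightarrow> G x"
    using r(3)
  proof eventually_elim
    case (elim x)
    have le: "\<bar>\<psi> (r n) x - u x\<bar> \<le> h (r n) x" "norm (D (r n) x - G x) powr p x \<le> h (r n) x" for n
      by (auto simp: h_def)
    have h0: "(\<lambda>k. h (r k) x) \<longlonglongrightarrow> 0" using elim by blast
    have "(\<lambda>n. \<psi> (r n) x - u x) \<longlonglongrightarrow> 0"
      by (rule Lim_null_comparison[OF _ h0]) (simp add: le)
    moreover have "(\<lambda>n. norm (D (r n) x - G x) powr p x) \<longlonglongrightarrow> 0"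
      by (rule Lim_null_comparison[OF _ h0]) (simp add: le)
    \<comment> \<open>Taking the root of order \<open>p x\<close> at the fixed point
      \<open>x\<close> turns modular density into the norm itself.\<close>
    then have "(\<lambda>n. (norm (D (r n) x - G x) powr p x) powr (1 / p x)) \<longlonglongrightarrow> 0 powr (1 / p x)"
      using p_gt_1[of x] by (intro tendsto_powr') auto
    then have "(\<lambda>n. norm (D (r n) x - G x)) \<longlonglongrightarrow> 0"
      using p_gt_1[of x] by (simp add: powr_powr)
    then have "(\<lambda>n. D (r n) x - G x) \<longlonglongrightarrow> 0" by (rule tendsto_norm_zero_cancel)
    ultimately show ?case using elim le order_trans by (blast intro: LIM_zero_cancel)
  qed
  show thesis
    by (rule that[OF _ sub _ r(2) AEc]) (use 1(1) rho_tendsto_L1[OF l sub(2)] in auto)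
qed

lemma W_translation:
  assumes "W u G"
  shows "L1norm (\<lambda>x. u (x + h) - u x) \<le> norm h * (LBINT x. norm (G x))"
proof -
  obtain \<psi> D g where 1: "\<forall>n. C1c \<Omega> (\<psi> n) (D n)" "(\<lambda>n. L1norm (\<lambda>x. \<psi> n x - u x)) \<longlonglongrightarrow> 0"
    "(\<lambda>n. rho (\<lambda>x. D n x - G x)) \<longlonglongrightarrow> 0" "(\<lambda>n. LBINT x. norm (D n x - G x)) \<longlonglongrightarrow> 0"
    "integrable lborel g"
    "AE x in lborel. (\<forall>n. \<bar>\<psi> n x - u x\<bar> \<le> g x \<and> norm (D n x - G x) powr p x \<le> g x) \<and>
        (\<lambda>n. \<psi> n x) \<longlonglongrightarrow> u x \<and> (\<lambda>n. D n x) \<longlonglongrightarrow> G x"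
    by (rule W_approx[OF assms])
  note ci = C1c_integrable[OF bounded_domain 1(1)[rule_format]]
  note [measurable] = WD(2)[OF assms] C1cD(5)[OF 1(1)[rule_format]]
  have ti: "integrable lborel (\<lambda>x. \<psi> n (x + h))" "integrable lborel (\<lambda>x. u (x + h))" for n
    using lborel_integrable_translation[of "\<psi> n" h] lborel_integrable_translation[of u h] ci WD(1)[OF assms] by auto
  have t: "L1norm (\<lambda>x. u (x + h) - u x)
     \<le> 2 * L1norm (\<lambda>x. \<psi> n x - u x) + norm h * (LBINT x. norm (D n x))" for n
  proof -
    have ii: "integrable lborel (\<lambda>x. \<bar>\<psi> n (x + h) - u (x + h)\<bar>)" "integrable lborel (\<lambda>x. \<bar>\<psi> n x - u x\<bar>)"
       "integrable lborel (\<lambda>x. \<bar>\<psi> n (x + h) - \<psi> n x\<bar>)" "integrable lborel (\<lambda>x. \<bar>u (x + h) - u x\<bar>)"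
      using ti ci WD(1)[OF assms] by auto
    have "L1norm (\<lambda>x. u (x + h) - u x)
        \<le> (LBINT x. (\<bar>\<psi> n (x + h) - u (x + h)\<bar> + \<bar>\<psi> n x - u x\<bar>) + \<bar>\<psi> n (x + h) - \<psi> n x\<bar>)"
      by (intro integral_mono ii Bochner_Integration.integrable_add) linarith
    also have "\<dots> = (L1norm (\<lambda>x. \<psi> n (x + h) - u (x + h)) + L1norm (\<lambda>x. \<psi> n x - u x))
        + L1norm (\<lambda>x. \<psi> n (x + h) - \<psi> n x)"
      using ii by (simp add: Bochner_Integration.integral_add)
    also have "L1norm (\<lambda>x. \<psi> n (x + h) - u (x + h)) = L1norm (\<lambda>x. \<psi> n x - u x)"
      by (rule lborel_integral_translation) measurable
    finally show ?thesis using C1c_translation[OF bounded_domain 1(1)[rule_format, of n], of h] by linarith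
  qed
  have "(\<lambda>n. 2 * L1norm (\<lambda>x. \<psi> n x - u x) + norm h * (LBINT x. norm (D n x)))
     \<longlonglongrightarrow> 2 * 0 + norm h * (LBINT x. norm (G x))"
    by (intro tendsto_intros 1(2) L1_norm_tendsto ci Lp_integrable(1) WD(4)[OF assms] 1(4))
  then show ?thesis using t by (intro LIMSEQ_le_const) auto
qed

lemma W_poincare:
  assumes "W u G" and R: "\<Omega> \<subseteq> ball 0 R"
  shows "L1norm u \<le> \<bar>R\<bar> * (LBINT x. norm (G x))"
proof -
  obtain \<psi> D g where 1: "\<forall>n. C1c \<Omega> (\<psi> n) (D n)" "(\<lambda>n. L1norm (\<lambda>x. \<psi> n x - u x)) \<longlonglongrightarrow> 0"
    "(\<lambda>n. rho (\<lambda>x. D n x - G x)) \<longlonglongrightarrow> 0" "(\<lambda>n. LBINT x. norm (D n x - G x)) \<longlonglongrightarrow> 0"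
    "integrable lborel g"
    "AE x in lborel. (\<forall>n. \<bar>\<psi> n x - u x\<bar> \<le> g x \<and> norm (D n x - G x) powr p x \<le> g x) \<and>
        (\<lambda>n. \<psi> n x) \<longlonglongrightarrow> u x \<and> (\<lambda>n. D n x) \<longlonglongrightarrow> G x"
    by (rule W_approx[OF assms(1)])
  note ci = C1c_integrable[OF bounded_domain 1(1)[rule_format]]
  have l1: "(\<lambda>n. LBINT x. norm (\<psi> n x)) \<longlonglongrightarrow> (LBINT x. norm (u x))"
    by (rule L1_norm_tendsto) (use ci WD(1)[OF assms(1)] 1(2) in auto)
  have l2: "(\<lambda>n. \<bar>R\<bar> * (LBINT x. norm (D n x))) \<longlonglongrightarrow> \<bar>R\<bar> * (LBINT x. norm (G x))"
    by (intro tendsto_intros L1_norm_tendsto ci Lp_integrable(1) WD(4)[OF assms(1)] 1(4))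
  have "(LBINT x. norm (\<psi> n x)) \<le> \<bar>R\<bar> * (LBINT x. norm (D n x))" for n
    using C1c_poincare[OF R 1(1)[rule_format, of n]] by simp
  then have "(LBINT x. norm (u x)) \<le> \<bar>R\<bar> * (LBINT x. norm (G x))"
    by (intro LIMSEQ_le[OF l1 l2]) auto
  then show ?thesis by simp
qed

text \<open>For each \<open>n\<close> an admissible pair is chosen within
  \<open>inverse (Suc n)\<close> of the \<open>n\<close>-th member in both senses; the modular
  satisfies the triangle inequality up to the factor \<open>2 powr pp\<close>.\<close>

lemma W_closed:
  assumes W: "\<And>n. W (u n) (G n)" and u: "integrable lborel v" "v \<in> borel_measurable borel" "\<And>x. x \<notin> \<Omega> \<Longrightarrow> v x = 0"
    and H: "Lp H" and l: "(\<lambda>n. L1norm (\<lambda>x. u n x - v x)) \<longlonglongrightarrow> 0" "(\<lambda>n. rho (\<lambda>x. G n x - H x)) \<longlonglongrightarrow> 0"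
  shows "W v H"
proof -
  have "\<exists>\<psi> D. C1c \<Omega> \<psi> D \<and> (L1norm (\<lambda>x. \<psi> x - u n x)) < inverse (real (Suc n)) \<and> rho (\<lambda>x. D x - G n x) < inverse (real (Suc n))" for n
  proof -
    obtain \<psi> D where 1: "\<And>n. C1c \<Omega> (\<psi> n) (D n)" "(\<lambda>k. L1norm (\<lambda>x. \<psi> k x - u n x)) \<longlonglongrightarrow> 0"
       "(\<lambda>k. rho (\<lambda>x. D k x - G n x)) \<longlonglongrightarrow> 0" using W[of n] by (auto simp: W_def)
    have "eventually (\<lambda>k. (L1norm (\<lambda>x. \<psi> k x - u n x)) < inverse (real (Suc n)) \<and> rho (\<lambda>x. D k x - G n x) < inverse (real (Suc n))) sequentially"
      by (intro eventually_conj order_tendstoD(2)[OF 1(2)] order_tendstoD(2)[OF 1(3)]) auto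
    then show ?thesis using 1(1) by (auto simp: eventually_sequentially)
  qed
  then obtain \<psi> D where 1: "\<And>n. C1c \<Omega> (\<psi> n) (D n)" "\<And>n. (L1norm (\<lambda>x. \<psi> n x - u n x)) < inverse (real (Suc n))"
    "\<And>n. rho (\<lambda>x. D n x - G n x) < inverse (real (Suc n))" by metis
  have i: "integrable lborel (\<lambda>x. \<bar>\<psi> n x - u n x\<bar>)" "integrable lborel (\<lambda>x. \<bar>u n x - v x\<bar>)" "integrable lborel (\<lambda>x. \<bar>\<psi> n x - v x\<bar>)" for n
    using WD(1)[OF W] u(1) C1c_integrable(1)[OF bounded_domain 1(1)] by auto
  have b1: "L1norm (\<lambda>x. \<psi> n x - v x) \<le> inverse (real (Suc n)) + L1norm (\<lambda>x. u n x - v x)" for n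
  proof -
    have "L1norm (\<lambda>x. \<psi> n x - v x) \<le> (LBINT x. \<bar>\<psi> n x - u n x\<bar> + \<bar>u n x - v x\<bar>)"
      by (intro integral_mono i Bochner_Integration.integrable_add) linarith
    also have "\<dots> = L1norm (\<lambda>x. \<psi> n x - u n x) + L1norm (\<lambda>x. u n x - v x)"
      by (intro Bochner_Integration.integral_add i)
    finally show ?thesis using 1(2)[of n] by linarith
  qed
  have b2: "rho (\<lambda>x. D n x - H x) \<le> 2 powr pp * (inverse (real (Suc n)) + rho (\<lambda>x. G n x - H x))" for n
  proof -
    have "(\<lambda>x. D n x - H x) = (\<lambda>x. (D n x - G n x) + (G n x - H x))" by auto
    then have "rho (\<lambda>x. D n x - H x) \<le> 2 powr pp * (rho (\<lambda>x. D n x - G n x) + rho (\<lambda>x. G n x - H x))"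
      using Lp_add(2)[OF Lp_diff(1)[OF C1c_Lp(1)[OF 1(1)[of n]] WD(4)[OF W[of n]]] Lp_diff(1)[OF WD(4)[OF W[of n]] H]] by simp
    also have "\<dots> \<le> 2 powr pp * (inverse (real (Suc n)) + rho (\<lambda>x. G n x - H x))"
      using 1(3)[of n] by (intro mult_left_mono) auto
    finally show ?thesis .
  qed
  have t1: "(\<lambda>n. L1norm (\<lambda>x. \<psi> n x - v x)) \<longlonglongrightarrow> 0"
  proof (rule tendsto_sandwich[OF _ _ tendsto_const])
    show "(\<lambda>n. inverse (real (Suc n)) + L1norm (\<lambda>x. u n x - v x)) \<longlonglongrightarrow> 0"
      using tendsto_add[OF LIMSEQ_inverse_real_of_nat l(1)] by simp
  qed (use b1 in auto)
  have t2: "(\<lambda>n. rho (\<lambda>x. D n x - H x)) \<longlonglongrightarrow> 0"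
  proof (rule tendsto_sandwich[OF _ _ tendsto_const])
    show "(\<lambda>n. 2 powr pp * (inverse (real (Suc n)) + rho (\<lambda>x. G n x - H x))) \<longlonglongrightarrow> 0"
      using tendsto_mult_left[OF tendsto_add[OF LIMSEQ_inverse_real_of_nat l(2)], of "2 powr pp"] by simp
  qed (use b2 in auto)
  show ?thesis unfolding W_def using u H 1(1) t1 t2 by blast
qed

end

section \<open>The Dirichlet problem with bounded right-hand side\<close>

lemma half_fraction_le:
  fixes e v :: real
  assumes "0 \<le> v" "0 \<le> e"
  shows "e / (2 * (v + 1)) * v \<le> e / 2"
  using assms by (simp add: field_simps)

lemma integrable_bounded_mult:
  fixes g u :: "'a::euclidean_space \<Rightarrow> real"
  assumes [measurable]: "g \<in> borel_measurable borel" and "\<And>x. \<bar>g x\<bar> \<le> C" "integrable lborel u"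
  shows "integrable lborel (\<lambda>x. g x * u x)" "\<bar>LBINT x. g x * u x\<bar> \<le> C * L1norm u"
proof -
  have [measurable]: "u \<in> borel_measurable borel" using assms(3) by auto
  have C: "0 \<le> C" using assms(2)[of undefined] by linarith
  have pt: "\<bar>g x * u x\<bar> \<le> C * \<bar>u x\<bar>" for x
    using assms(2)[of x] by (simp add: abs_mult mult_right_mono)
  have I: "integrable lborel (\<lambda>x. C * \<bar>u x\<bar>)" using assms(3) by simp
  show J: "integrable lborel (\<lambda>x. g x * u x)"
    by (rule Bochner_Integration.integrable_bound[OF I]) (use pt C in \<open>auto simp: abs_mult\<close>)
  have "\<bar>LBINT x. g x * u x\<bar> \<le> L1norm (\<lambda>x. g x * u x)" by (rule integral_abs_bound)
  also have "\<dots> \<le> (LBINT x. C * \<bar>u x\<bar>)" using J by (intro integral_mono I pt integrable_abs)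
  finally show "\<bar>LBINT x. g x * u x\<bar> \<le> C * L1norm u" by simp
qed

lemma bounded_mult_tendsto:
  fixes g u :: "'a::euclidean_space \<Rightarrow> real"
  assumes "g \<in> borel_measurable borel" "\<And>x. \<bar>g x\<bar> \<le> C" "integrable lborel u" "\<And>n. integrable lborel (\<psi> n)"
    "(\<lambda>n. L1norm (\<lambda>x. \<psi> n x - u x)) \<longlonglongrightarrow> 0"
  shows "(\<lambda>n. LBINT x. g x * \<psi> n x) \<longlonglongrightarrow> (LBINT x. g x * u x)"
proof -
  have "(LBINT x. g x * \<psi> n x) - (LBINT x. g x * u x) = (LBINT x. g x * (\<psi> n x - u x))" for n
    using integrable_bounded_mult(1)[OF assms(1,2)] assms(3,4) by (simp add: right_diff_distrib)
  then have "norm ((LBINT x. g x * \<psi> n x) - (LBINT x. g x * u x)) \<le> C * L1norm (\<lambda>x. \<psi> n x - u x)" for n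
    using integrable_bounded_mult(2)[OF assms(1,2), of "\<lambda>x. \<psi> n x - u x"] assms(3,4) by simp
  then have "eventually (\<lambda>n. norm ((LBINT x. g x * \<psi> n x) - (LBINT x. g x * u x))
      \<le> C * L1norm (\<lambda>x. \<psi> n x - u x)) sequentially" by simp
  from Lim_null_comparison[OF this tendsto_mult_right_zero[OF assms(5), of C]]
  show ?thesis by (rule LIM_zero_cancel)
qed

context pspace begin

text \<open>A Cauchy sequence for the modular is Cauchy in L1, hence has an almost everywhere
  convergent subsequence; Fatou's lemma then gives the modular distance to the limit.\<close>

lemma Lp_complete:
  fixes D :: "nat \<Rightarrow> 'a \<Rightarrow> 'b::euclidean_space"
  assumes L: "\<And>n. Lp (D n)"
    and cau: "\<And>e. e > 0 \<Longrightarrow> \<exists>N. \<forall>i\<ge>N. \<forall>j\<ge>N. rho (\<lambda>x. D i x - D j x) < e"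
  obtains G where "Lp G" "(\<lambda>n. rho (\<lambda>x. D n x - G x)) \<longlonglongrightarrow> 0"
proof -
  have cauL1: "\<exists>N. \<forall>i\<ge>N. \<forall>j\<ge>N. (LBINT x. norm (D i x - D j x)) < e" if e: "0 < e" for e
  proof -
    \<comment> \<open>Half of \<open>e\<close> is spent on the constant term
      \<open>\<delta> * vol\<close>. The \<open>+ 1\<close> avoids division by a zero
      volume.\<close>
    define \<delta> where "\<delta> = min 1 (e / (2 * (vol + 1)))"
    have v1: "0 < vol + 1" using vol_nonneg by linarith
    then have d: "0 < \<delta>" "\<delta> \<le> 1" using e by (auto simp: \<delta>_def)
    have "\<delta> * vol \<le> e / (2 * (vol + 1)) * vol" using vol_nonneg by (intro mult_right_mono) (auto simp: \<delta>_def)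
    also have "\<dots> \<le> e / 2" using e by (intro half_fraction_le) auto
    finally have dv: "\<delta> * vol \<le> e / 2" .
    define K where "K = \<delta> powr (1 - pp)"
    have K: "0 < K" using d by (simp add: K_def)
    obtain N where N: "\<And>i j. i \<ge> N \<Longrightarrow> j \<ge> N \<Longrightarrow> rho (\<lambda>x. D i x - D j x) < e / (2 * K)"
      using cau[of "e / (2 * K)"] e K by auto
    have "(LBINT x. norm (D i x - D j x)) < e" if "i \<ge> N" "j \<ge> N" for i j
    proof -
      have "(LBINT x. norm (D i x - D j x)) \<le> \<delta> * vol + K * rho (\<lambda>x. D i x - D j x)"
        unfolding K_def by (rule Lp_integrable(2)[OF Lp_diff(1)[OF L L] d])
      moreover have "K * rho (\<lambda>x. D i x - D j x) < e / 2" using N[OF that] K by (simp add: field_simps)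
      ultimately show ?thesis using dv by linarith
    qed
    then show ?thesis by blast
  qed
  obtain r where r: "strict_mono r" "AE x in lborel. Cauchy (\<lambda>i. D (r i) x)"
    using cauchy_L1_AE_cauchy_subseq[OF Lp_integrable(1)[OF L] cauL1] by blast
  define G where "G x = lim (\<lambda>i. D (r i) x)" for x
  have [measurable]: "\<And>n. D n \<in> borel_measurable borel" using LpD(1)[OF L] .
  have Gm[measurable]: "G \<in> borel_measurable borel" unfolding G_def by measurable
  have G0: "G x = 0" if "x \<notin> \<Omega>" for x unfolding G_def using LpD(2)[OF L that] by (simp add: lim_def[symmetric] limI)
  have conv: "AE x in lborel. (\<lambda>i. D (r i) x) \<longlonglongrightarrow> G x"
    using r(2) by eventually_elim (simp add: G_def Cauchy_convergent_iff convergent_LIMSEQ_iff)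
  have key: "integrable lborel (\<lambda>x. norm (D n x - G x) powr p x) \<and> rho (\<lambda>x. D n x - G x) \<le> e"
    if e: "\<And>j. j \<ge> N \<Longrightarrow> rho (\<lambda>x. D n x - D j x) < e" "0 < e" for n N e
  proof -
    have "(\<integral>\<^sup>+x. ennreal (norm (D n x - G x) powr p x) \<partial>lborel)
        = (\<integral>\<^sup>+x. liminf (\<lambda>i. ennreal (norm (D n x - D (r i) x) powr p x)) \<partial>lborel)"
    proof (intro nn_integral_cong_AE, use conv in eventually_elim)
      fix x assume c: "(\<lambda>i. D (r i) x) \<longlonglongrightarrow> G x"
      have "(\<lambda>i. norm (D n x - D (r i) x) powr p x) \<longlonglongrightarrow> norm (D n x - G x) powr p x"
        using p_gt_1[of x] by (intro tendsto_powr' tendsto_norm tendsto_diff tendsto_const c) auto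
      then show "ennreal (norm (D n x - G x) powr p x) = liminf (\<lambda>i. ennreal (norm (D n x - D (r i) x) powr p x))"
        by (intro lim_imp_Liminf[symmetric] tendsto_ennrealI) auto
    qed
    also have "\<dots> \<le> liminf (\<lambda>i. \<integral>\<^sup>+x. ennreal (norm (D n x - D (r i) x) powr p x) \<partial>lborel)"
      by (intro nn_integral_liminf) auto
    also have "\<dots> \<le> ennreal e"
    proof (rule Liminf_le)
      have "(\<integral>\<^sup>+x. ennreal (norm (D n x - D (r i) x) powr p x) \<partial>lborel) \<le> ennreal e" if "N \<le> i" for i
      proof -
        have "r i \<ge> N" using that r(1) seq_suble[of r i] by linarith
        then have "rho (\<lambda>x. D n x - D (r i) x) \<le> e" using e(1) by (simp add: less_imp_le)
        then show ?thesis unfolding rho_def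
          by (subst nn_integral_eq_integral[OF LpD(3)[OF Lp_diff(1)[OF L L]]]) (auto intro: ennreal_leI)
      qed
      then show "eventually (\<lambda>i. (\<integral>\<^sup>+x. ennreal (norm (D n x - D (r i) x) powr p x) \<partial>lborel) \<le> ennreal e) sequentially"
        by (auto simp: eventually_sequentially)
    qed simp
    finally have k: "(\<integral>\<^sup>+x. ennreal (norm (D n x - G x) powr p x) \<partial>lborel) \<le> ennreal e" .
    have "(\<integral>\<^sup>+x. ennreal (norm (D n x - G x) powr p x) \<partial>lborel) < \<infinity>" by (rule le_less_trans[OF k]) simp
    then have I: "integrable lborel (\<lambda>x. norm (D n x - G x) powr p x)" by (intro integrableI_nonneg) auto
    then have "ennreal (rho (\<lambda>x. D n x - G x)) \<le> ennreal e"
      using k unfolding rho_def by (subst (asm) nn_integral_eq_integral) auto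
    then show ?thesis using I e(2) by (simp add: ennreal_le_iff)
  qed
  show thesis
  proof
    obtain N where N: "\<And>i j. i \<ge> N \<Longrightarrow> j \<ge> N \<Longrightarrow> rho (\<lambda>x. D i x - D j x) < 1"
      using cau[of 1] by auto
    have "Lp (\<lambda>x. D N x - G x)" using key[of N N 1] N G0 LpD(2)[OF L] unfolding Lp_def by simp
    from Lp_diff(1)[OF L[of N] this] show "Lp G" by simp
    show "(\<lambda>n. rho (\<lambda>x. D n x - G x)) \<longlonglongrightarrow> 0"
    proof (rule LIMSEQ_I)
      fix e :: real assume e: "0 < e"
      obtain N where N: "\<And>i j. i \<ge> N \<Longrightarrow> j \<ge> N \<Longrightarrow> rho (\<lambda>x. D i x - D j x) < e/2"
        using cau[of "e/2"] e by auto
      have "norm (rho (\<lambda>x. D n x - G x) - 0) < e" if "n \<ge> N" for n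
        using key[of N n "e/2"] N that e by auto
      then show "\<exists>no. \<forall>n\<ge>no. norm (rho (\<lambda>x. D n x - G x) - 0) < e" by blast
    qed
  qed
qed

section \<open>The energy and its Euler-Lagrange equation\<close>

definition energy :: "('a \<Rightarrow> 'a) \<Rightarrow> real" where
  "energy G = (LBINT x. norm (G x) powr p x / p x)"

lemma energy_integrable: "Lp G \<Longrightarrow> integrable lborel (\<lambda>x. norm (G x) powr p x / p x)"
proof -
  assume L: "Lp G"
  note [measurable] = LpD(1)[OF L]
  have "norm (norm (G x) powr p x / p x) \<le> norm (norm (G x) powr p x)" for x
  proof -
    have "norm (G x) powr p x / p x \<le> norm (G x) powr p x / 1"
      using p_gt_1[of x] by (intro divide_left_mono) auto
    then show ?thesis using p_gt_1[of x] by simp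
  qed
  then show ?thesis by (intro Bochner_Integration.integrable_bound[OF LpD(3)[OF L]] AE_I2) simp_all
qed

lemma rho_le_energy: "Lp G \<Longrightarrow> rho G \<le> pp * energy G"
proof -
  assume L: "Lp G"
  have "rho G \<le> (LBINT x. pp * (norm (G x) powr p x / p x))"
    unfolding rho_def
  proof (rule integral_mono[OF LpD(3)[OF L]])
    show "integrable lborel (\<lambda>x. pp * (norm (G x) powr p x / p x))"
      by (rule integrable_mult_right[OF energy_integrable[OF L]])
    show "norm (G x) powr p x \<le> pp * (norm (G x) powr p x / p x)" for x
      using p_gt_1[of x] p_le_pp[of x] by (simp add: field_simps mult_right_mono)
  qed
  then show ?thesis unfolding energy_def integral_mult_right_zero .
qed

text \<open>The pointwise tangent inequality at \<open>H\<close>, divided by \<open>p x\<close> and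
  integrated. It bounds energy differences by the flux at the endpoint and stands in for
  differentiating the energy.\<close>

lemma energy_diff_le:
  assumes "Lp G" "Lp H"
  shows "energy H - energy G \<le> (LBINT x. Vp (p x) (H x) \<bullet> (H x - G x))"
proof -
  have "energy H - energy G = (LBINT x. norm (H x) powr p x / p x - norm (G x) powr p x / p x)"
    unfolding energy_def using energy_integrable assms by (subst Bochner_Integration.integral_diff) auto
  also have "\<dots> \<le> (LBINT x. Vp (p x) (H x) \<bullet> (H x - G x))"
  proof (rule integral_mono)
    show "norm (H x) powr p x / p x - norm (G x) powr p x / p x \<le> Vp (p x) (H x) \<bullet> (H x - G x)" for x
      using norm_powr_convex[OF p_gt_1[of x], of "H x" "G x"] p_gt_1[of x]
      by (simp add: inner_diff_right field_simps)
  qed (intro Bochner_Integration.integrable_diff energy_integrable assms Vp_pairing(1) Lp_diff(1))+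
  finally show ?thesis .
qed

text \<open>The tangent bound is used in both directions. Each pairing is estimated by Young's
  inequality, with the small factor on the energies, which stay below \<open>V\<close>.\<close>

lemma energy_tendsto:
  assumes "\<And>n. Lp (K n)" "Lp G" "(\<lambda>n. rho (\<lambda>x. K n x - G x)) \<longlonglongrightarrow> 0"
  shows "(\<lambda>n. energy (K n)) \<longlonglongrightarrow> energy G"
proof -
  obtain B where B: "\<And>n. rho (\<lambda>x. K n x - G x) \<le> B"
  proof -
    have "Bseq (\<lambda>n. rho (\<lambda>x. K n x - G x))" using assms(3) convergentI convergent_imp_Bseq by blast
    then show ?thesis using that unfolding Bseq_def by (metis abs_le_D1 real_norm_def)
  qed
  have B0: "0 \<le> B" using B[of 0] rho_nonneg order_trans by blast
  define V where "V = 2 powr pp * (B + rho G) + rho G"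
  have KB: "rho (K n) \<le> 2 powr pp * (B + rho G)" for n
  proof -
    have "rho (K n) \<le> 2 powr pp * (rho (\<lambda>x. K n x - G x) + rho G)"
      using Lp_add(2)[OF Lp_diff(1)[OF assms(1)[of n] assms(2)] assms(2)] by simp
    also have "\<dots> \<le> 2 powr pp * (B + rho G)" using B[of n] by (intro mult_left_mono) auto
    finally show ?thesis .
  qed
  have V0: "0 \<le> V" "rho G \<le> V" "rho (K n) \<le> V" for n
  proof -
    have "0 \<le> 2 powr pp * (B + rho G)" using B0 by simp
    then show "0 \<le> V" "rho G \<le> V" "rho (K n) \<le> V"
      using KB[of n] rho_nonneg[of G] unfolding V_def by linarith+
  qed
  have "(\<lambda>n. \<bar>energy (K n) - energy G\<bar>) \<longlonglongrightarrow> 0"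
  proof (rule squeeze_by_eps[OF _ assms(3) V0(1)])
    fix \<delta> :: real assume d: "0 < \<delta>" "\<delta> \<le> 1"
    have "\<bar>energy (K n) - energy G\<bar> \<le> \<delta> * V + \<delta> powr (1 - pp) * rho (\<lambda>x. K n x - G x)" for n
    proof -
      have "energy (K n) - energy G \<le> \<delta> * rho (K n) + \<delta> powr (1 - pp) * rho (\<lambda>x. K n x - G x)"
        using energy_diff_le[OF assms(2) assms(1)[of n]]
          Vp_pairing(2)[OF assms(1)[of n] Lp_diff(1)[OF assms(1)[of n] assms(2)] d] by linarith
      moreover have "energy G - energy (K n) \<le> \<delta> * rho G + \<delta> powr (1 - pp) * rho (\<lambda>x. K n x - G x)"
        using energy_diff_le[OF assms(1)[of n] assms(2)]
          Vp_pairing(2)[OF assms(2) Lp_diff(1)[OF assms(2) assms(1)[of n]] d] unfolding rho_commute[of G "K n"] by linarith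
      moreover have "\<delta> * rho G \<le> \<delta> * V" "\<delta> * rho (K n) \<le> \<delta> * V" using V0 d by auto
      ultimately show ?thesis by linarith
    qed
    then show "\<exists>C. \<forall>n. \<bar>energy (K n) - energy G\<bar> \<le> \<delta> * V + C * rho (\<lambda>x. K n x - G x)" by blast
  qed simp
  then show ?thesis by (simp add: tendsto_rabs_zero_iff LIM_zero_iff)
qed

definition EL :: "('a \<Rightarrow> real) \<Rightarrow> ('a \<Rightarrow> 'a) \<Rightarrow> ('a \<Rightarrow> real) \<Rightarrow> bool" where
  "EL u G g \<longleftrightarrow> W u G \<and> (\<forall>\<psi> D. C1c \<Omega> \<psi> D \<longrightarrow>
      (LBINT x. Vp (p x) (G x) \<bullet> D x) = (LBINT x. g x * \<psi> x))"

text \<open>The flux pairs continuously with modular convergence of gradients, and a bounded load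
  pairs continuously with L1 convergence of functions; these are the two convergences in
  \<open>W\<close>.\<close>

lemma EL_test:
  assumes "EL u G g" and g: "g \<in> borel_measurable borel" "\<And>x. \<bar>g x\<bar> \<le> C" and "W \<phi> H"
  shows "(LBINT x. Vp (p x) (G x) \<bullet> H x) = (LBINT x. g x * \<phi> x)"
proof -
  obtain \<psi> D g' where 1: "\<forall>n. C1c \<Omega> (\<psi> n) (D n)" "(\<lambda>n. L1norm (\<lambda>x. \<psi> n x - \<phi> x)) \<longlonglongrightarrow> 0"
    "(\<lambda>n. rho (\<lambda>x. D n x - H x)) \<longlonglongrightarrow> 0" "(\<lambda>n. LBINT x. norm (D n x - H x)) \<longlonglongrightarrow> 0"
    "integrable lborel g'"
    "AE x in lborel. (\<forall>n. \<bar>\<psi> n x - \<phi> x\<bar> \<le> g' x \<and> norm (D n x - H x) powr p x \<le> g' x) \<and>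
        (\<lambda>n. \<psi> n x) \<longlonglongrightarrow> \<phi> x \<and> (\<lambda>n. D n x) \<longlonglongrightarrow> H x"
    by (rule W_approx[OF assms(4)])
  have "W u G" using assms(1) by (simp add: EL_def)
  then have "(\<lambda>n. LBINT x. Vp (p x) (G x) \<bullet> D n x) \<longlonglongrightarrow> (LBINT x. Vp (p x) (G x) \<bullet> H x)"
    by (intro Vp_pairing_tendsto WD(4)[OF assms(4)] C1c_Lp(1)[OF 1(1)[rule_format]] 1(3)) (rule WD(4))
  moreover have "(\<lambda>n. LBINT x. g x * \<psi> n x) \<longlonglongrightarrow> (LBINT x. g x * \<phi> x)"
    using 1(1) by (intro bounded_mult_tendsto[OF g] WD(1)[OF assms(4)] 1(2) C1c_integrable(1)[OF bounded_domain]) auto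
  moreover have "(LBINT x. Vp (p x) (G x) \<bullet> D n x) = (LBINT x. g x * \<psi> n x)" for n
    using assms(1) 1(1) by (auto simp: EL_def)
  ultimately show ?thesis using LIMSEQ_unique by simp
qed

definition radius :: real where "radius = (SOME R. 0 < R \<and> \<Omega> \<subseteq> ball 0 R)"

lemma radius: "0 < radius" "\<Omega> \<subseteq> ball 0 radius"
  using someI_ex[OF bounded_subset_ballD[OF bounded_domain, of 0]] by (auto simp: radius_def)

lemma poincare: "W u G \<Longrightarrow> (L1norm u) \<le> radius * (LBINT x. norm (G x))"
  using W_poincare[OF _ radius(2)] radius(1) by simp

text \<open>Poincare's inequality bounds the load by the L1 norm of the gradient, of which an
  arbitrarily small multiple of the modular plus a constant is a majorant. This gives
  coercivity.\<close>

lemma load_bound: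
  assumes g: "g \<in> borel_measurable borel" "\<And>x. \<bar>g x\<bar> \<le> C" and "0 < \<epsilon>"
  obtains K where "0 \<le> K" "\<forall>u G. W u G \<longrightarrow> \<bar>LBINT x. g x * u x\<bar> \<le> K + \<epsilon> * rho G"
proof -
  have C: "0 \<le> C" using g(2)[of undefined] by linarith
  \<comment> \<open>Chosen so that \<open>C * radius * \<delta> \<le> \<epsilon>\<close>.\<close>
  define \<delta> where "\<delta> = \<epsilon> / (C * radius + 1)"
  have cr: "0 \<le> C * radius" using C radius(1) by simp
  then have d: "0 < \<delta>" using assms(3) by (simp add: \<delta>_def add_nonneg_pos)
  have "C * radius * \<delta> \<le> (C * radius + 1) * \<delta>" using d by simp
  also have "\<dots> = \<epsilon>" using cr by (simp add: \<delta>_def field_simps)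
  finally have cd: "C * radius * \<delta> \<le> \<epsilon>" .
  define K where "K = max 1 (\<delta> powr (- 1 / (pm - 1))) * vol"
  show thesis
  proof
    show "0 \<le> C * radius * K" using cr vol_nonneg by (auto simp: K_def intro!: mult_nonneg_nonneg)
    show "\<forall>u G. W u G \<longrightarrow> \<bar>LBINT x. g x * u x\<bar> \<le> C * radius * K + \<epsilon> * rho G"
    proof (intro allI impI)
      fix u G assume W: "W u G"
      have "\<bar>LBINT x. g x * u x\<bar> \<le> C * L1norm u"
        by (rule integrable_bounded_mult(2)[OF g WD(1)[OF W]])
      also have "\<dots> \<le> C * (radius * (K + \<delta> * rho G))"
        using poincare[OF W] Lp_L1_large[OF WD(4)[OF W] d] radius(1) C
        by (intro mult_left_mono) (auto simp: K_def intro: order_trans mult_left_mono)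
      also have "\<dots> \<le> C * radius * K + \<epsilon> * rho G"
        using mult_right_mono[OF cd rho_nonneg[of G]] by (simp add: algebra_simps)
      finally show "\<bar>LBINT x. g x * u x\<bar> \<le> C * radius * K + \<epsilon> * rho G" .
    qed
  qed
qed

end

context pspace begin

text \<open>The energy density has the weight \<open>1 / p x\<close>, the gap does not; the factor
  \<open>pp\<close> pays for the difference because the gap is nonnegative.\<close>

lemma cgap_integrable:
  fixes G H :: "'a \<Rightarrow> 'a"
  assumes "Lp G" "Lp H"
  shows "integrable lborel (\<lambda>x. cgap (p x) (G x) (H x))"
    "(LBINT x. cgap (p x) (G x) (H x))
      \<le> pp * ((energy G + energy H) / 2 - energy (\<lambda>x. (1/2) *\<^sub>R (G x + H x)))"
proof -
  note LM = Lp_scale[OF Lp_add(1)[OF assms], of "1/2"]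
  note LG = LpD(3)[OF assms(1)] and LH = LpD(3)[OF assms(2)] and LMi = LpD(3)[OF LM]
  show I: "integrable lborel (\<lambda>x. cgap (p x) (G x) (H x))"
    unfolding cgap_def using LG LH LMi by (intro Bochner_Integration.integrable_diff) auto
  note E = energy_integrable[OF assms(1)] energy_integrable[OF assms(2)] energy_integrable[OF LM]
  have eq: "cgap (p x) (G x) (H x) / p x = (norm (G x) powr p x / p x + norm (H x) powr p x / p x) / 2
       - norm ((1/2) *\<^sub>R (G x + H x)) powr p x / p x" for x
    by (simp only: cgap_def diff_divide_distrib add_divide_distrib) simp
  have J: "integrable lborel (\<lambda>x. cgap (p x) (G x) (H x) / p x)"
    unfolding eq using E by (intro Bochner_Integration.integrable_diff) auto
  have "(LBINT x. cgap (p x) (G x) (H x)) \<le> (LBINT x. pp * (cgap (p x) (G x) (H x) / p x))"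
  proof (rule integral_mono[OF I])
    show "integrable lborel (\<lambda>x. pp * (cgap (p x) (G x) (H x) / p x))" by (rule integrable_mult_right[OF J])
    show "cgap (p x) (G x) (H x) \<le> pp * (cgap (p x) (G x) (H x) / p x)" for x
      using p_gt_1[of x] p_le_pp[of x] cgap_nonneg[OF p_gt_1[of x], of "G x" "H x"]
      by (simp add: field_simps mult_right_mono)
  qed
  also have "\<dots> = pp * (LBINT x. cgap (p x) (G x) (H x) / p x)" by (rule integral_mult_right_zero)
  also have "(LBINT x. cgap (p x) (G x) (H x) / p x) = (energy G + energy H) / 2 - energy (\<lambda>x. (1/2) *\<^sub>R (G x + H x))"
    unfolding eq energy_def using E by (subst Bochner_Integration.integral_diff) auto
  finally show "(LBINT x. cgap (p x) (G x) (H x))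
      \<le> pp * ((energy G + energy H) / 2 - energy (\<lambda>x. (1/2) *\<^sub>R (G x + H x)))" .
qed

text \<open>Uniform convexity makes minimizing sequences of the energy Cauchy, so no weak compactness is needed.\<close>

lemma minimizing_Cauchy:
  fixes D :: "nat \<Rightarrow> 'a \<Rightarrow> 'a"
  assumes L: "\<And>n. Lp (D n)" and B: "\<And>n. rho (D n) \<le> B"
    and gap: "\<And>i j. (energy (D i) + energy (D j)) / 2 - energy (\<lambda>x. (1/2) *\<^sub>R (D i x + D j x)) \<le> a i + a j"
    and a: "a \<longlonglongrightarrow> 0" and e: "0 < e"
  shows "\<exists>N. \<forall>i\<ge>N. \<forall>j\<ge>N. rho (\<lambda>x. D i x - D j x) < e"
proof -
  have B0: "0 \<le> B" using B[of 0] rho_nonneg order_trans by blast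
  \<comment> \<open>The energy term \<open>\<epsilon> * (2 * B)\<close> is then at most
    \<open>e / 2\<close>; each of the two gap terms gets \<open>e / 4\<close>.\<close>
  define \<epsilon> where "\<epsilon> = e / (4 * (B + 1))"
  have eps: "0 < \<epsilon>" using e B0 by (simp add: \<epsilon>_def)
  obtain C where C: "0 \<le> C" "\<And>p (a::'a) b. pm \<le> p \<Longrightarrow> p \<le> pp \<Longrightarrow>
    norm (a - b) powr p \<le> \<epsilon> * (norm a powr p + norm b powr p) + C * cgap p a b"
    using uniform_convexity[OF pm_gt_1 eps, where 'a='a and pp=pp] by blast
  have bd: "rho (\<lambda>x. D i x - D j x) \<le> \<epsilon> * (2 * B) + C * (pp * (a i + a j))" for i j
  proof -
    have "rho (\<lambda>x. D i x - D j x) \<le> (LBINT x. \<epsilon> * (norm (D i x) powr p x + norm (D j x) powr p x) + C * cgap (p x) (D i x) (D j x))"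
      unfolding rho_def
    proof (rule integral_mono[OF LpD(3)[OF Lp_diff(1)[OF L L]]])
      show "integrable lborel (\<lambda>x. \<epsilon> * (norm (D i x) powr p x + norm (D j x) powr p x) + C * cgap (p x) (D i x) (D j x))"
        using LpD(3)[OF L[of i]] LpD(3)[OF L[of j]] cgap_integrable(1)[OF L[of i] L[of j]] by simp
    qed (rule C(2)[OF pm_le_p p_le_pp])
    also have "\<dots> = \<epsilon> * (rho (D i) + rho (D j)) + C * (LBINT x. cgap (p x) (D i x) (D j x))"
      unfolding rho_def using LpD(3)[OF L[of i]] LpD(3)[OF L[of j]] cgap_integrable(1)[OF L[of i] L[of j]] by simp
    also have "\<dots> \<le> \<epsilon> * (2 * B) + C * (pp * (a i + a j))"
    proof (intro add_mono mult_left_mono)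
      show "rho (D i) + rho (D j) \<le> 2 * B" using B[of i] B[of j] by linarith
      show "(LBINT x. cgap (p x) (D i x) (D j x)) \<le> pp * (a i + a j)"
        using cgap_integrable(2)[OF L[of i] L[of j]] mult_left_mono[OF gap[of i j], of pp] pp_gt_1 by linarith
    qed (use eps C in auto)
    finally show ?thesis .
  qed
  have "\<epsilon> * (2 * B) \<le> e / 2" using e B0 by (simp add: \<epsilon>_def field_simps)
  moreover
  have "(\<lambda>n. C * (pp * a n)) \<longlonglongrightarrow> 0"
    using tendsto_mult_left[OF tendsto_mult_left[OF a, of pp], of C] by simp
  then have "eventually (\<lambda>n. C * (pp * a n) < e / 4) sequentially" by (rule order_tendstoD) (use e in simp)
  then obtain N where N: "\<And>n. n \<ge> N \<Longrightarrow> C * (pp * a n) < e / 4" unfolding eventually_sequentially by blast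
  ultimately have "rho (\<lambda>x. D i x - D j x) < e" if "i \<ge> N" "j \<ge> N" for i j
    using bd[of i j] N[OF that(1)] N[OF that(2)] by (simp add: distrib_left)
  then show ?thesis by blast
qed

text \<open>Only the gradients are assumed Cauchy: Poincare's inequality makes the functions Cauchy
  in L1.\<close>

lemma W_complete:
  assumes W: "\<And>n. W (u n) (G n)"
    and cau: "\<And>e. e > 0 \<Longrightarrow> \<exists>N. \<forall>i\<ge>N. \<forall>j\<ge>N. rho (\<lambda>x. G i x - G j x) < e"
  obtains v H where "W v H" "(\<lambda>n. L1norm (\<lambda>x. u n x - v x)) \<longlonglongrightarrow> 0" "(\<lambda>n. rho (\<lambda>x. G n x - H x)) \<longlonglongrightarrow> 0"
proof -
  obtain H where H: "Lp H" "(\<lambda>n. rho (\<lambda>x. G n x - H x)) \<longlonglongrightarrow> 0"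
    by (rule Lp_complete[OF WD(4)[OF W] cau])
  have GL: "(\<lambda>n. LBINT x. norm (G n x - H x)) \<longlonglongrightarrow> 0"
    by (rule rho_tendsto_L1[OF Lp_diff(1)[OF WD(4)[OF W] H(1)] H(2)])
  have cL: "\<exists>N. \<forall>i\<ge>N. \<forall>j\<ge>N. (LBINT x. norm (u i x - u j x)) < e" if e: "0 < e" for e
  proof -
    have "eventually (\<lambda>n. (LBINT x. norm (G n x - H x)) < e / (2 * radius)) sequentially"
      by (rule order_tendstoD(2)[OF GL]) (use e radius(1) in simp)
    then obtain N where N: "\<And>n. n \<ge> N \<Longrightarrow> (LBINT x. norm (G n x - H x)) < e / (2 * radius)"
      unfolding eventually_sequentially by blast
    have "(LBINT x. norm (u i x - u j x)) < e" if "i \<ge> N" "j \<ge> N" for i j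
    proof -
      have I: "integrable lborel (\<lambda>x. norm (G n x - H x))" for n
        using Lp_integrable(1)[OF WD(4)[OF W[of n]]] Lp_integrable(1)[OF H(1)] by simp
      have I': "integrable lborel (\<lambda>x. norm (G i x - G j x))"
        using Lp_integrable(1)[OF WD(4)[OF W]] by simp
      have "(LBINT x. norm (u i x - u j x)) \<le> radius * (LBINT x. norm (G i x - G j x))"
        using poincare[OF W_diff[OF W W]] by simp
      also have "\<dots> \<le> radius * (LBINT x. norm (G i x - H x) + norm (G j x - H x))"
      proof (intro mult_left_mono integral_mono I' Bochner_Integration.integrable_add I)
        show "norm (G i x - G j x) \<le> norm (G i x - H x) + norm (G j x - H x)" for x
          using norm_triangle_ineq4[of "G i x - H x" "G j x - H x"] by simp
      qed (use radius(1) in simp)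
      also have "\<dots> = radius * ((LBINT x. norm (G i x - H x)) + (LBINT x. norm (G j x - H x)))"
        using I by simp
      also have "\<dots> < radius * (e / (2 * radius) + e / (2 * radius))"
        using radius(1) N[OF that(1)] N[OF that(2)] by (intro mult_strict_left_mono) auto
      also have "\<dots> = e" using radius(1) by (simp add: field_simps)
      finally show ?thesis .
    qed
    then show ?thesis by blast
  qed
  obtain v0 where v0: "integrable lborel v0" "(\<lambda>n. LBINT x. norm (u n x - v0 x)) \<longlonglongrightarrow> 0"
    by (rule L1_complete[OF WD(1)[OF W] cL])
  \<comment> \<open>An L1 limit is fixed only up to null sets; multiplying by the indicator makes it
    vanish at every point off \<Omega>, as \<open>W\<close> demands.\<close>
  define v where "v x = indicator \<Omega> x * v0 x" for x
  have [measurable]: "v0 \<in> borel_measurable borel" using v0(1) by auto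
  have vm: "v \<in> borel_measurable borel" unfolding v_def by measurable
  have vi: "integrable lborel v" unfolding v_def
    by (rule integrable_bounded_mult(1)[where C=1]) (use v0(1) in \<open>auto simp: indicator_def\<close>)
  have le: "L1norm (\<lambda>x. u n x - v x) \<le> (LBINT x. norm (u n x - v0 x))" for n
  proof (rule integral_mono)
    show "\<bar>u n x - v x\<bar> \<le> norm (u n x - v0 x)" for x using WD(3)[OF W[of n]] by (simp add: v_def indicator_def)
  qed (use WD(1)[OF W[of n]] vi v0(1) in auto)
  have vl: "(\<lambda>n. L1norm (\<lambda>x. u n x - v x)) \<longlonglongrightarrow> 0"
    by (rule tendsto_sandwich[OF _ _ tendsto_const v0(2)]) (use le in auto)
  have "W v H" by (rule W_closed[OF W vi vm _ H(1) vl H(2)]) (simp add: v_def)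
  then show thesis using that vl H(2) by blast
qed

text \<open>Direct method for the functional \<open>J\<close>, energy minus load. Since the load is
  linear, the convexity gap along a minimizing sequence is controlled by the excess over the
  infimum.\<close>

lemma EL_exists:
  assumes g: "g \<in> borel_measurable borel" "\<And>x. \<bar>g x\<bar> \<le> C"
  shows "\<exists>u G. EL u G g"
proof -
  define J where "J u G = energy G - (LBINT x. g x * u x)" for u G
  \<comment> \<open>The energy is at least \<open>rho G / pp\<close>; letting the load take half of
    this leaves \<open>rho G / (2 * pp)\<close>.\<close>
  have "0 < 1 / (2 * pp)" using pp_gt_1 by simp
  then obtain K where K: "0 \<le> K" "\<forall>u G. W u G \<longrightarrow> \<bar>LBINT x. g x * u x\<bar> \<le> K + 1 / (2 * pp) * rho G"
    by (rule load_bound[OF g])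
  have coer: "rho G \<le> 2 * pp * (J u G + K)" if "W u G" for u G
  proof -
    have "rho G / pp \<le> energy G" using rho_le_energy[OF WD(4)[OF that]] pp_gt_1 by (simp add: field_simps)
    moreover have "\<bar>LBINT x. g x * u x\<bar> \<le> K + 1 / (2 * pp) * rho G" using K(2) that by blast
    ultimately have "rho G / (2 * pp) \<le> J u G + K" unfolding J_def by (simp add: abs_le_iff)
    then show ?thesis using pp_gt_1 by (simp add: field_simps)
  qed
  \<comment> \<open>The infimum is taken over C1 pairs; it is also a lower bound on all of
    \<open>W\<close>, because \<open>J\<close> is continuous along the approximations that define
    \<open>W\<close>.\<close>
  define S where "S = {J \<psi> D | \<psi> D. C1c \<Omega> \<psi> D}"
  have Sne: "S \<noteq> {}" unfolding S_def using C1c_zero by blast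
  have Sbd: "bdd_below S"
  proof (rule bdd_belowI[of _ "- K"])
    fix y assume "y \<in> S"
    then obtain \<psi> D where y: "y = J \<psi> D" "C1c \<Omega> \<psi> D" by (auto simp: S_def)
    have "0 \<le> 2 * pp * (J \<psi> D + K)" using coer[OF C1c_W[OF y(2)]] rho_nonneg[of D] by linarith
    then show "- K \<le> y" using pp_gt_1 by (simp add: y zero_le_mult_iff)
  qed
  define m where "m = Inf S"
  have mle: "m \<le> J \<psi> D" if "C1c \<Omega> \<psi> D" for \<psi> D
    unfolding m_def using that by (intro cInf_lower Sbd) (auto simp: S_def)
  have "\<exists>\<psi> D. C1c \<Omega> \<psi> D \<and> J \<psi> D < m + inverse (real (Suc n))" for n
  proof -
    have "Inf S < m + inverse (real (Suc n))" by (simp add: m_def)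
    then obtain y where "y \<in> S" "y < m + inverse (real (Suc n))" using cInf_lessD[OF Sne] by blast
    then show ?thesis by (auto simp: S_def)
  qed
  then obtain \<psi> D where c: "\<And>n. C1c \<Omega> (\<psi> n) (D n)" and Jn: "\<And>n. J (\<psi> n) (D n) < m + inverse (real (Suc n))"
    by metis
  have B: "rho (D n) \<le> 2 * pp * (m + 1 + K)" for n
  proof -
    have "inverse (real (Suc n)) \<le> 1" by (simp add: inverse_le_1_iff)
    then have "J (\<psi> n) (D n) + K \<le> m + 1 + K" using Jn[of n] by linarith
    then have "2 * pp * (J (\<psi> n) (D n) + K) \<le> 2 * pp * (m + 1 + K)" using pp_gt_1 by (intro mult_left_mono) auto
    then show ?thesis using coer[OF C1c_W[OF c[of n]]] by linarith
  qed
  have gap: "(energy (D i) + energy (D j)) / 2 - energy (\<lambda>x. (1/2) *\<^sub>R (D i x + D j x))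
      \<le> inverse (real (Suc i)) + inverse (real (Suc j))" for i j
  proof -
    \<comment> \<open>The midpoint of two members of the minimizing sequence is again a C1 pair,
      hence not below the infimum.\<close>
    have "m \<le> J (\<lambda>x. (1/2) * (\<psi> i x + \<psi> j x)) (\<lambda>x. (1/2) *\<^sub>R (D i x + D j x))"
      by (rule mle[OF C1c_scale[OF C1c_add[OF c c]]])
    moreover have "(LBINT x. g x * ((1/2) * (\<psi> i x + \<psi> j x)))
        = ((LBINT x. g x * \<psi> i x) + (LBINT x. g x * \<psi> j x)) / 2"
    proof -
      have i: "integrable lborel (\<lambda>x. g x * \<psi> n x)" for n
        by (rule integrable_bounded_mult(1)[OF g C1c_integrable(1)[OF bounded_domain c]])
      have "(LBINT x. g x * ((1/2) * (\<psi> i x + \<psi> j x))) = (LBINT x. (g x * \<psi> i x + g x * \<psi> j x) / 2)"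
        by (simp add: algebra_simps add_divide_distrib)
      then show ?thesis using i by simp
    qed
    ultimately have "m \<le> energy (\<lambda>x. (1/2) *\<^sub>R (D i x + D j x)) - ((LBINT x. g x * \<psi> i x) + (LBINT x. g x * \<psi> j x)) / 2"
      unfolding J_def by metis
    moreover have "0 < inverse (real (Suc i))" "0 < inverse (real (Suc j))" by auto
    ultimately show ?thesis using Jn[of i] Jn[of j] unfolding J_def by argo
  qed
  have cau: "\<exists>N. \<forall>i\<ge>N. \<forall>j\<ge>N. rho (\<lambda>x. D i x - D j x) < e" if "0 < e" for e
    by (rule minimizing_Cauchy[OF C1c_Lp(1)[OF c] B gap LIMSEQ_inverse_real_of_nat that])
  obtain u G where uG: "W u G" "(\<lambda>n. L1norm (\<lambda>x. \<psi> n x - u x)) \<longlonglongrightarrow> 0" "(\<lambda>n. rho (\<lambda>x. D n x - G x)) \<longlonglongrightarrow> 0"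
    by (rule W_complete[OF C1c_W[OF c] cau])
  have Jlim: "(\<lambda>n. J (\<phi> n) (E n)) \<longlonglongrightarrow> J w H"
    if "\<And>n. C1c \<Omega> (\<phi> n) (E n)" "W w H" "(\<lambda>n. L1norm (\<lambda>x. \<phi> n x - w x)) \<longlonglongrightarrow> 0" "(\<lambda>n. rho (\<lambda>x. E n x - H x)) \<longlonglongrightarrow> 0"
    for \<phi> E w H unfolding J_def
    by (intro tendsto_diff energy_tendsto bounded_mult_tendsto[OF g] that C1c_Lp(1)[OF that(1)] WD(4)[OF that(2)]
        WD(1)[OF that(2)] C1c_integrable(1)[OF bounded_domain that(1)])
  have min: "m \<le> J w H" if Ww: "W w H" for w H
  proof -
    obtain \<phi> E where e: "\<And>n. C1c \<Omega> (\<phi> n) (E n)" "(\<lambda>n. L1norm (\<lambda>x. \<phi> n x - w x)) \<longlonglongrightarrow> 0" "(\<lambda>n. rho (\<lambda>x. E n x - H x)) \<longlonglongrightarrow> 0"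
      using Ww by (auto simp: W_def)
    show ?thesis by (rule LIMSEQ_le_const[OF Jlim[OF e(1) Ww e(2,3)]]) (use mle e(1) in blast)
  qed
  have Jm: "J u G \<le> m"
  proof (rule LIMSEQ_le[OF Jlim[OF c uG(1-3)]])
    show "(\<lambda>n. m + inverse (real (Suc n))) \<longlonglongrightarrow> m" using tendsto_add[OF tendsto_const LIMSEQ_inverse_real_of_nat, of m] by simp
  qed (use Jn less_imp_le in blast)
  have ge: "(LBINT x. g x * \<phi> x) \<le> (LBINT x. Vp (p x) (G x) \<bullet> E x)" if "C1c \<Omega> \<phi> E" for \<phi> E
  proof -
    note LG = WD(4)[OF uG(1)] and LE = C1c_Lp(1)[OF that]
    note [measurable] = LpD(1)[OF LG] LpD(1)[OF LE]
    have Lt: "Lp (\<lambda>x. G x + t *\<^sub>R E x)" for t by (rule Lp_add(1)[OF LG Lp_scale[OF LE]])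
    \<comment> \<open>Minimality along \<open>G + t E\<close> is combined with the tangent
      inequality at the perturbed point, so that division by \<open>t\<close> already leaves the
      flux there. Its limit as \<open>t\<close> tends to 0 is taken by dominated
      convergence.\<close>
    have q: "(LBINT x. g x * \<phi> x) \<le> (LBINT x. Vp (p x) (G x + t *\<^sub>R E x) \<bullet> E x)" if t: "0 < t" for t
    proof -
      have "J u G \<le> J (\<lambda>x. u x + t * \<phi> x) (\<lambda>x. G x + t *\<^sub>R E x)"
        using Jm min[OF W_add_scale[OF uG(1) C1c_W[OF \<open>C1c \<Omega> \<phi> E\<close>], of t]] by linarith
      moreover have "(LBINT x. g x * (u x + t * \<phi> x)) = (LBINT x. g x * u x) + t * (LBINT x. g x * \<phi> x)"
      proof -
        have i: "integrable lborel (\<lambda>x. g x * u x)" "integrable lborel (\<lambda>x. t * (g x * \<phi> x))"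
          by (rule integrable_bounded_mult(1)[OF g WD(1)[OF uG(1)]],
              rule integrable_mult_right[OF integrable_bounded_mult(1)[OF g C1c_integrable(1)[OF bounded_domain \<open>C1c \<Omega> \<phi> E\<close>]]])
        have "(LBINT x. g x * (u x + t * \<phi> x)) = (LBINT x. g x * u x + t * (g x * \<phi> x))"
          by (simp add: algebra_simps)
        then show ?thesis using Bochner_Integration.integral_add[OF i] by simp
      qed
      moreover have "energy (\<lambda>x. G x + t *\<^sub>R E x) - energy G \<le> (LBINT x. Vp (p x) (G x + t *\<^sub>R E x) \<bullet> ((G x + t *\<^sub>R E x) - G x))"
        by (rule energy_diff_le[OF LG Lt])
      moreover have "(LBINT x. Vp (p x) (G x + t *\<^sub>R E x) \<bullet> ((G x + t *\<^sub>R E x) - G x))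
          = t * (LBINT x. Vp (p x) (G x + t *\<^sub>R E x) \<bullet> E x)" by simp
      ultimately have "t * (LBINT x. g x * \<phi> x) \<le> t * (LBINT x. Vp (p x) (G x + t *\<^sub>R E x) \<bullet> E x)"
        unfolding J_def by linarith
      then show ?thesis using t by simp
    qed
    define w where "w x = 2 powr pp * (norm (G x) powr p x + norm (E x) powr p x) + norm (E x) powr p x" for x
    have wi: "integrable lborel w" unfolding w_def using LpD(3)[OF LG] LpD(3)[OF LE] by simp
    have "(\<lambda>n. LBINT x. Vp (p x) (G x + inverse (real (Suc n)) *\<^sub>R E x) \<bullet> E x) \<longlonglongrightarrow> (LBINT x. Vp (p x) (G x) \<bullet> E x)"
    proof (rule integral_dominated_convergence[where w=w])
      show "AE x in lborel. (\<lambda>n. Vp (p x) (G x + inverse (real (Suc n)) *\<^sub>R E x) \<bullet> E x) \<longlonglongrightarrow> Vp (p x) (G x) \<bullet> E x"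
      proof (rule AE_I2)
        fix x
        have "(\<lambda>n. G x + inverse (real (Suc n)) *\<^sub>R E x) \<longlonglongrightarrow> G x + 0 *\<^sub>R E x"
          by (intro tendsto_intros LIMSEQ_inverse_real_of_nat)
        then show "(\<lambda>n. Vp (p x) (G x + inverse (real (Suc n)) *\<^sub>R E x) \<bullet> E x) \<longlonglongrightarrow> Vp (p x) (G x) \<bullet> E x"
          by (intro tendsto_inner Vp_tendsto[OF _ p_gt_1] tendsto_const) simp
      qed
      show "AE x in lborel. norm (Vp (p x) (G x + inverse (real (Suc n)) *\<^sub>R E x) \<bullet> E x) \<le> w x" for n
      proof (rule AE_I2)
        fix x
        define t where "t = inverse (real (Suc n))"
        have t: "0 \<le> t" "t \<le> 1" by (auto simp: t_def inverse_le_1_iff)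
        have p0: "1 \<le> p x" "0 \<le> p x" using p_gt_1[of x] by auto
        have "\<bar>Vp (p x) (G x + t *\<^sub>R E x) \<bullet> E x\<bar> \<le> norm (G x + t *\<^sub>R E x) powr (p x - 1) * norm (E x)"
          by (rule abs_Vp_inner_le)
        also have "\<dots> \<le> 1 * norm (G x + t *\<^sub>R E x) powr p x + 1 powr (1 - pp) * norm (E x) powr p x"
          by (rule young_eps) (use p0 p_le_pp in auto)
        also have "\<dots> = norm (G x + t *\<^sub>R E x) powr p x + norm (E x) powr p x" by simp
        also have "norm (G x + t *\<^sub>R E x) powr p x \<le> 2 powr pp * (norm (G x) powr p x + norm (t *\<^sub>R E x) powr p x)"
          by (rule norm_add_powr_le[OF p0(2) p_le_pp])
        also have "norm (t *\<^sub>R E x) powr p x \<le> norm (E x) powr p x"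
          using t p0 by (intro powr_mono2) (auto intro: mult_left_le_one_le)
        finally show "norm (Vp (p x) (G x + inverse (real (Suc n)) *\<^sub>R E x) \<bullet> E x) \<le> w x"
          by (simp add: w_def t_def)
      qed
    qed (use wi in measurable)
    then show ?thesis using q by (intro LIMSEQ_le_const) auto
  qed
  have "EL u G g" unfolding EL_def
  proof (intro conjI uG(1) allI impI antisym)
    fix \<phi> E assume c: "C1c \<Omega> \<phi> E"
    show "(LBINT x. g x * \<phi> x) \<le> (LBINT x. Vp (p x) (G x) \<bullet> E x)" by (rule ge[OF c])
    \<comment> \<open>The one-sided inequality, applied to the negative of the test function, gives
      the other side.\<close>
    show "(LBINT x. Vp (p x) (G x) \<bullet> E x) \<le> (LBINT x. g x * \<phi> x)"
      using ge[OF C1c_scale[OF c, of "-1"]] by simp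
  qed
  then show ?thesis by blast
qed

text \<open>Testing with the solution itself makes its modular equal to the load. \<open>K\<close>
  depends on the bound \<open>C\<close> alone, not on \<open>g\<close>: this uniformity feeds the
  compactness and the fixed point argument.\<close>

lemma EL_energy_bound:
  assumes "0 \<le> C"
  obtains K where "0 \<le> K" "\<forall>u G g. g \<in> borel_measurable borel \<longrightarrow> (\<forall>x. \<bar>g x\<bar> \<le> C) \<longrightarrow> EL u G g \<longrightarrow> rho G \<le> K"
proof -
  obtain K where K: "0 \<le> K" "\<forall>u G. W u G \<longrightarrow> \<bar>LBINT x. C * \<bar>u x\<bar>\<bar> \<le> K + 1 / 2 * rho G"
  proof -
    \<comment> \<open>With this value half of the modular is absorbed into the left-hand
      side.\<close>
    define \<delta> where "\<delta> = 1 / (2 * (C * radius + 1))"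
    have cr: "0 \<le> C * radius" using assms radius(1) by simp
    then have d: "0 < \<delta>" by (simp add: \<delta>_def add_nonneg_pos)
    have cd: "C * radius * \<delta> \<le> 1 / 2" using cr by (simp add: \<delta>_def field_simps)
    define K where "K = max 1 (\<delta> powr (- 1 / (pm - 1))) * vol"
    have "\<bar>LBINT x. C * \<bar>u x\<bar>\<bar> \<le> C * radius * K + 1 / 2 * rho G" if W: "W u G" for u G
    proof -
      have "\<bar>LBINT x. C * \<bar>u x\<bar>\<bar> = C * L1norm u"
        using assms by (simp add: abs_mult)
      also have "\<dots> \<le> C * (radius * (K + \<delta> * rho G))"
        using poincare[OF W] Lp_L1_large[OF WD(4)[OF W] d] radius(1) assms
        by (intro mult_left_mono) (auto simp: K_def intro: order_trans mult_left_mono)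
      also have "\<dots> \<le> C * radius * K + 1 / 2 * rho G"
        using mult_right_mono[OF cd rho_nonneg[of G]] by (simp add: algebra_simps)
      finally show ?thesis .
    qed
    moreover have "0 \<le> C * radius * K" using cr vol_nonneg by (auto simp: K_def intro!: mult_nonneg_nonneg)
    ultimately show thesis using that by blast
  qed
  have "rho G \<le> 2 * K" if g: "g \<in> borel_measurable borel" "\<forall>x. \<bar>g x\<bar> \<le> C" and e: "EL u G g" for u G g
  proof -
    have W: "W u G" using e by (simp add: EL_def)
    have "rho G = (LBINT x. g x * u x)"
      using EL_test[OF e g(1) g(2)[rule_format] W] by (simp add: rho_def Vp_inner_self)
    also have "\<dots> \<le> C * L1norm u"
      using integrable_bounded_mult(2)[OF g(1) g(2)[rule_format] WD(1)[OF W]] by linarith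
    also have "\<dots> = (LBINT x. C * \<bar>u x\<bar>)" by simp
    also have "\<dots> \<le> K + 1 / 2 * rho G" using K(2) W by (meson abs_le_D1)
    finally show ?thesis by simp
  qed
  then show thesis using that[of "2 * K"] K(1) by auto
qed

text \<open>Both equations are tested with the difference of the solutions, so the monotonicity
  integral equals the pairing of the load difference with that difference. Its convergence to 0 and
  the uniform energy bound give convergence of gradients, and Poincare's inequality that of
  functions.\<close>

lemma EL_stable:
  assumes EL: "\<And>n. EL (u n) (G n) (g n)" "EL v H h"
    and g: "\<And>n. g n \<in> borel_measurable borel" "\<And>n x. \<bar>g n x\<bar> \<le> C" "h \<in> borel_measurable borel" "\<And>x. \<bar>h x\<bar> \<le> C"
    and lim: "(\<lambda>n. LBINT x. (g n x - h x) * (u n x - v x)) \<longlonglongrightarrow> 0"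
  shows "(\<lambda>n. rho (\<lambda>x. G n x - H x)) \<longlonglongrightarrow> 0" "(\<lambda>n. L1norm (\<lambda>x. u n x - v x)) \<longlonglongrightarrow> 0"
proof -
  have W: "W (u n) (G n)" "W v H" for n using EL by (auto simp: EL_def)
  note L = WD(4)[OF W(1)] WD(4)[OF W(2)]
  have C: "0 \<le> C" using g(4)[of undefined] by linarith
  obtain K where K: "0 \<le> K" "\<forall>u G g. g \<in> borel_measurable borel \<longrightarrow> (\<forall>x. \<bar>g x\<bar> \<le> C) \<longrightarrow> EL u G g \<longrightarrow> rho G \<le> K"
    by (rule EL_energy_bound[OF C])
  have KB: "rho (G n) \<le> K" "rho H \<le> K" for n using K(2) EL g by blast+
  have mono: "(LBINT x. (Vp (p x) (G n x) - Vp (p x) (H x)) \<bullet> (G n x - H x)) = (LBINT x. (g n x - h x) * (u n x - v x))"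
    "integrable lborel (\<lambda>x. (Vp (p x) (G n x) - Vp (p x) (H x)) \<bullet> (G n x - H x))" for n
  proof -
    have Wd: "W (\<lambda>x. u n x - v x) (\<lambda>x. G n x - H x)" by (rule W_diff[OF W])
    have a: "integrable lborel (\<lambda>x. Vp (p x) (G n x) \<bullet> (G n x - H x))" "integrable lborel (\<lambda>x. Vp (p x) (H x) \<bullet> (G n x - H x))"
      by (rule Vp_pairing(1)[OF L(1) WD(4)[OF Wd]], rule Vp_pairing(1)[OF L(2) WD(4)[OF Wd]])
    have b: "integrable lborel (\<lambda>x. g n x * (u n x - v x))" "integrable lborel (\<lambda>x. h x * (u n x - v x))"
      by (rule integrable_bounded_mult(1)[OF g(1,2) WD(1)[OF Wd]], rule integrable_bounded_mult(1)[OF g(3,4) WD(1)[OF Wd]])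
    show "integrable lborel (\<lambda>x. (Vp (p x) (G n x) - Vp (p x) (H x)) \<bullet> (G n x - H x))"
      unfolding inner_diff_left[of _ _ "G n _ - H _"] by (rule Bochner_Integration.integrable_diff[OF a])
    show "(LBINT x. (Vp (p x) (G n x) - Vp (p x) (H x)) \<bullet> (G n x - H x)) = (LBINT x. (g n x - h x) * (u n x - v x))"
      unfolding inner_diff_left[of _ _ "G n _ - H _"] left_diff_distrib[of _ _ "u n _ - v _"]
        Bochner_Integration.integral_diff[OF a] Bochner_Integration.integral_diff[OF b]
      using EL_test[OF EL(1) g(1,2) Wd] EL_test[OF EL(2) g(3,4) Wd] by simp
  qed
  show r: "(\<lambda>n. rho (\<lambda>x. G n x - H x)) \<longlonglongrightarrow> 0"
  proof (rule squeeze_by_eps[OF _ lim])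
    show "0 \<le> 2 * K" using K by simp
    fix \<delta> :: real assume d: "0 < \<delta>"
    obtain M where M: "0 \<le> M" "\<And>p (a::'a) b. pm \<le> p \<Longrightarrow> p \<le> pp \<Longrightarrow>
      norm (a - b) powr p \<le> \<delta> * (norm a powr p + norm b powr p) + M * ((Vp p a - Vp p b) \<bullet> (a - b))"
      using uniform_monotonicity[OF pm_gt_1 d, where 'a='a and pp=pp] by blast
    have "rho (\<lambda>x. G n x - H x) \<le> \<delta> * (2 * K) + M * (LBINT x. (g n x - h x) * (u n x - v x))" for n
    proof -
      have "rho (\<lambda>x. G n x - H x) \<le> (LBINT x. \<delta> * (norm (G n x) powr p x + norm (H x) powr p x)
          + M * ((Vp (p x) (G n x) - Vp (p x) (H x)) \<bullet> (G n x - H x)))"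
        unfolding rho_def
      proof (rule integral_mono[OF LpD(3)[OF Lp_diff(1)[OF L]]])
        show "integrable lborel (\<lambda>x. \<delta> * (norm (G n x) powr p x + norm (H x) powr p x)
          + M * ((Vp (p x) (G n x) - Vp (p x) (H x)) \<bullet> (G n x - H x)))"
          by (intro Bochner_Integration.integrable_add integrable_mult_right mono(2) LpD(3) L)
      qed (rule M(2)[OF pm_le_p p_le_pp])
      also have "\<dots> = \<delta> * (rho (G n) + rho H) + M * (LBINT x. (g n x - h x) * (u n x - v x))"
        unfolding rho_def mono(1)[symmetric]
        by (subst Bochner_Integration.integral_add) (use mono(2) LpD(3)[OF L(1)[of n]] LpD(3)[OF L(2)] in auto)
      also have "\<dots> \<le> \<delta> * (2 * K) + M * (LBINT x. (g n x - h x) * (u n x - v x))"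
        using KB(1)[of n] KB(2) d by (intro add_right_mono mult_left_mono) auto
      finally show ?thesis .
    qed
    then show "\<exists>C. \<forall>n. rho (\<lambda>x. G n x - H x) \<le> \<delta> * (2 * K) + C * (LBINT x. (g n x - h x) * (u n x - v x))" by blast
  qed simp
  have t: "(\<lambda>n. radius * (LBINT x. norm (G n x - H x))) \<longlonglongrightarrow> 0"
    using tendsto_mult_left[OF rho_tendsto_L1[OF Lp_diff(1)[OF L] r], of radius] by simp
  show "(\<lambda>n. L1norm (\<lambda>x. u n x - v x)) \<longlonglongrightarrow> 0"
    by (rule tendsto_sandwich[OF _ _ tendsto_const t]) (use poincare[OF W_diff[OF W]] in auto)
qed

lemma W_rho_zero:
  assumes "W u G" "rho G = 0"
  shows "AE x in lborel. u x = 0"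
proof -
  have "(LBINT x. norm (G x)) = 0"
  proof -
    have "(\<lambda>n::nat. rho G) \<longlonglongrightarrow> 0" by (simp add: assms(2))
    then have "(\<lambda>n::nat. (LBINT x. norm (G x))) \<longlonglongrightarrow> 0" by (intro rho_tendsto_L1 WD(4)[OF assms(1)])
    then show ?thesis by (simp add: LIMSEQ_const_iff)
  qed
  then have "(LBINT x. norm (u x)) = 0" using poincare[OF assms(1)] by (simp add: order_antisym)
  then show ?thesis using iffD1[OF integral_nonneg_eq_0_iff_AE[OF integrable_norm[OF WD(1)[OF assms(1)]]]] by simp
qed

end

section \<open>Fixed points and compactness\<close>

text \<open>Bolzano-Weierstrass at each index of an enumeration, followed by the diagonal
  sequence.\<close>

lemma pointwise_bounded_subseq:
  fixes f :: "nat \<Rightarrow> 'i \<Rightarrow> real"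
  assumes "countable S" "\<And>i. i \<in> S \<Longrightarrow> \<exists>B. \<forall>n. \<bar>f n i\<bar> \<le> B"
  obtains r :: "nat \<Rightarrow> nat" and l where "strict_mono r" "\<forall>i\<in>S. (\<lambda>n. f (r n) i) \<longlonglongrightarrow> l i"
proof (cases "S = {}")
  case True
  then show ?thesis using that[of id] by (auto simp: strict_mono_def)
next
  case False
  then obtain e :: "nat \<Rightarrow> 'i" where e: "range e = S" using assms(1) uncountable_def by metis
  interpret subseqs "\<lambda>n s. convergent (\<lambda>k. f (s k) (e n))"
  proof
    fix n and s :: "nat \<Rightarrow> nat" assume "strict_mono s"
    have "e n \<in> S" using e by blast
    then obtain B where B: "\<And>k. \<bar>f k (e n)\<bar> \<le> B" using assms(2) by blast
    have "bounded (range (\<lambda>k. f (s k) (e n)))" using B by (auto simp: bounded_iff)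
    then obtain l r where r: "strict_mono r" "((\<lambda>k. f (s k) (e n)) \<circ> r) \<longlonglongrightarrow> l"
      using bounded_imp_convergent_subsequence by blast
    then show "\<exists>r'. strict_mono r' \<and> convergent (\<lambda>k. f ((s \<circ> r') k) (e n))"
      by (auto simp: convergent_def o_def)
  qed
  define r where "r = diagseq"
  have "convergent (\<lambda>k. f (r k) (e n))" for n
  proof -
    have "convergent (\<lambda>k. f ((diagseq \<circ> ((+) (Suc n))) k) (e n))"
    proof (rule diagseq_holds)
      fix r s :: "nat \<Rightarrow> nat" and n
      assume "strict_mono r" "convergent (\<lambda>k. f (s k) (e n))"
      then show "convergent (\<lambda>k. f ((s \<circ> r) k) (e n))"
        using convergent_subseq_convergent[of "\<lambda>k. f (s k) (e n)" r] by (simp add: o_def)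
    qed
    then have "convergent (\<lambda>k. f (r (k + Suc n)) (e n))" by (simp add: r_def o_def add.commute)
    then show ?thesis using convergent_ignore_initial_segment[of "\<lambda>k. f (r k) (e n)" "Suc n"] by simp
  qed
  then have "\<exists>l. (\<lambda>n. f (r n) i) \<longlonglongrightarrow> l" if "i \<in> S" for i
    using that e by (auto simp: convergent_def)
  then obtain l where "\<forall>i\<in>S. (\<lambda>n. f (r n) i) \<longlonglongrightarrow> l i" by metis
  moreover have "strict_mono r" unfolding r_def by (rule subseq_diagseq)
  ultimately show ?thesis using that by blast
qed

text \<open>Kuhn's combinatorial lemma is used directly: the dimension \<open>n\<close> is a term here, so the
  type-based Brouwer theorem does not apply.\<close>

lemma brouwer_unit_cube:
  fixes F :: "(nat \<Rightarrow> real) \<Rightarrow> nat \<Rightarrow> real"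
  assumes maps: "\<And>c i. \<forall>j. 0 \<le> c j \<and> c j \<le> 1 \<Longrightarrow> i < n \<Longrightarrow> 0 \<le> F c i \<and> F c i \<le> 1"
    and cont: "\<And>cs c i. \<forall>k j. 0 \<le> cs k j \<and> cs k j \<le> 1 \<Longrightarrow> \<forall>j. (\<lambda>k. cs k j) \<longlonglongrightarrow> c j \<Longrightarrow> i < n
        \<Longrightarrow> (\<lambda>k. F (cs k) i) \<longlonglongrightarrow> F c i"
  shows "\<exists>c. (\<forall>j. 0 \<le> c j \<and> c j \<le> 1) \<and> (\<forall>i<n. F c i = c i)"
proof -
  \<comment> \<open>Grid of mesh \<open>inverse (Suc m)\<close>. The minimum with 1 and the value 0
    beyond the dimension keep all coordinates in the unit interval, for every
    \<open>x\<close>.\<close>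
  define pt where "pt m x j = (if j < n then min 1 (real (x j) / real (Suc m)) else 0)" for m and x :: "nat \<Rightarrow> nat" and j
  have pt01: "0 \<le> pt m x j" "pt m x j \<le> 1" for m x j by (auto simp: pt_def)
  \<comment> \<open>Label 0 says that \<open>F\<close> does not decrease the \<open>i\<close>-th
    coordinate. On the top face the label is forced to be 1, as Kuhn's lemma prescribes; the
    inequality belonging to label 1 holds there because the coordinate is already 1.\<close>
  define label where "label m x i = (if x i < Suc m \<and> pt m x i \<le> F (pt m x) i then 0 else 1 :: nat)" for m x i
  have lab0: "pt m x i \<le> F (pt m x) i" if "label m x i = 0" for m x i
    using that by (auto simp: label_def split: if_splits)
  have lab1: "F (pt m x) i \<le> pt m x i" if "label m x i \<noteq> 0" "i < n" for m x i
  proof (cases "x i < Suc m")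
    case True
    then show ?thesis using that by (auto simp: label_def split: if_splits)
  next
    case False
    then have "pt m x i = 1" using that by (simp add: pt_def min_def field_simps)
    then show ?thesis using maps[of "pt m x" i] pt01 that by auto
  qed
  define near where "near q r \<longleftrightarrow> (\<forall>j<n. q j \<le> r j \<and> r j \<le> q j + 1)" for q r :: "nat \<Rightarrow> nat"
  have ex: "\<exists>q. \<forall>i<n. q i < Suc m \<and> (\<exists>r s. near q r \<and> near q s \<and> label m r i \<noteq> label m s i)" for m
  proof (rule kuhn_lemma[of "Suc m" n "label m"])
    fix q assume "\<forall>i<n. q i < Suc m" "\<forall>i<n. \<exists>r s. (\<forall>j<n. q j \<le> r j \<and> r j \<le> q j + 1) \<and>
      (\<forall>j<n. q j \<le> s j \<and> s j \<le> q j + 1) \<and> label m r i \<noteq> label m s i"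
    then have "\<forall>i<n. q i < Suc m \<and> (\<exists>r s. near q r \<and> near q s \<and> label m r i \<noteq> label m s i)"
      unfolding near_def by blast
    then show "\<exists>q. \<forall>i<n. q i < Suc m \<and> (\<exists>r s. near q r \<and> near q s \<and> label m r i \<noteq> label m s i)"
      by (rule exI[of _ q])
  next
    show "\<forall>x. (\<forall>i<n. x i \<le> Suc m) \<longrightarrow> (\<forall>i<n. x i = 0 \<longrightarrow> label m x i = 0)"
    proof (intro allI impI)
      fix x :: "nat \<Rightarrow> nat" and i assume "i < n" "x i = 0"
      moreover from this have "pt m x i = 0" by (simp add: pt_def)
      ultimately show "label m x i = 0" using maps[of "pt m x" i] pt01 by (simp add: label_def)
    qed
  qed (auto simp: label_def)
  from choice[OF allI, of "\<lambda>m q. \<forall>i<n. q i < Suc m \<and> (\<exists>r s. near q r \<and> near q s \<and> label m r i \<noteq> label m s i)", OF ex]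
  obtain q where q: "\<forall>m. \<forall>i<n. q m i < Suc m \<and> (\<exists>r s. near (q m) r \<and> near (q m) s \<and> label m r i \<noteq> label m s i)" ..
  have q2: "\<exists>r s. near (q m) r \<and> near (q m) s \<and> label m r i \<noteq> label m s i" if "i < n" for m i
    using q that by blast
  \<comment> \<open>Two vertices of one small cube with different labels in direction
    \<open>i\<close> give opposite inequalities for \<open>F\<close>. The guard \<open>i < n\<close>
    makes the statement total, so that \<open>r\<close> and \<open>s\<close> can be chosen for all
    indices.\<close>
  have q3: "\<exists>r s. near (q m) r \<and> near (q m) s \<and> (i < n \<longrightarrow> pt m r i \<le> F (pt m r) i \<and> F (pt m s) i \<le> pt m s i)" for m i
  proof (cases "i < n")
    case i: True
    obtain r s where rs: "near (q m) r" "near (q m) s" "label m r i \<noteq> label m s i" using q2[OF i] by blast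
    show ?thesis
    proof (cases "label m r i = 0")
      case True
      then have "label m s i \<noteq> 0" using rs by simp
      then show ?thesis using rs True lab0 lab1 i by blast
    next
      case False
      then have "label m s i = 0" using rs(3) by (auto simp: label_def split: if_splits)
      then show ?thesis using rs False lab0 lab1 i by blast
    qed
  qed (auto simp: near_def)
  then obtain r s where rs: "\<And>m i. near (q m) (r m i)" "\<And>m i. near (q m) (s m i)"
      "\<And>m i. i < n \<Longrightarrow> pt m (r m i) i \<le> F (pt m (r m i)) i" "\<And>m i. i < n \<Longrightarrow> F (pt m (s m i)) i \<le> pt m (s m i) i"
    by metis
  have "\<exists>B. \<forall>m. \<bar>pt m (q m) j\<bar> \<le> B" for j using pt01 by (metis abs_of_nonneg)
  then obtain t c where t: "strict_mono t" "\<forall>j\<in>UNIV. (\<lambda>m. pt (t m) (q (t m)) j) \<longlonglongrightarrow> c j"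
    by (rule_tac pointwise_bounded_subseq[of UNIV "\<lambda>m. pt m (q m)"]) auto
  \<comment> \<open>Vertices of the cube at \<open>q m\<close> differ from its corner by at most one
    mesh width in each coordinate, so all of them share the limit of the corners.\<close>
  have lim: "(\<lambda>m. pt (t m) (x (t m)) j) \<longlonglongrightarrow> c j"
    if x: "\<And>m. near (q m) (x m)" for x j
  proof -
    have b: "\<bar>pt m (x m) j - pt m (q m) j\<bar> \<le> inverse (real (Suc m))" for m
    proof (cases "j < n")
      case True
      then have "real (q m j) \<le> real (x m j)" "real (x m j) \<le> real (q m j) + 1"
        using x[of m] True by (force simp: near_def)+
      then have "real (q m j) / real (Suc m) \<le> real (x m j) / real (Suc m)"
         "real (x m j) / real (Suc m) \<le> (real (q m j) + 1) / real (Suc m)"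
        by (auto intro: divide_right_mono)
      then have "real (q m j) / real (Suc m) \<le> real (x m j) / real (Suc m)"
         "real (x m j) / real (Suc m) \<le> real (q m j) / real (Suc m) + inverse (real (Suc m))"
        by (simp_all only: add_divide_distrib inverse_eq_divide)
      moreover have "0 < inverse (real (Suc m))" by simp
      ultimately show ?thesis using True unfolding pt_def if_P[OF True] by linarith
    qed (simp add: pt_def)
    have "(\<lambda>m. inverse (real (Suc (t m)))) \<longlonglongrightarrow> 0"
      using LIMSEQ_subseq_LIMSEQ[OF LIMSEQ_inverse_real_of_nat t(1)] by (simp add: o_def)
    then have "(\<lambda>m. pt (t m) (x (t m)) j - pt (t m) (q (t m)) j) \<longlonglongrightarrow> 0"
      by (rule Lim_null_comparison[rotated]) (use b in auto)
    from tendsto_add[OF this t(2)[rule_format, of j]] show ?thesis by simp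
  qed
  have c01: "0 \<le> c j \<and> c j \<le> 1" for j
    using LIMSEQ_le_const[OF t(2)[rule_format, of j], of 0] LIMSEQ_le_const2[OF t(2)[rule_format, of j], of 1] pt01 by auto
  have "F c i = c i" if i: "i < n" for i
  proof (rule antisym)
    have lr: "(\<lambda>m. pt (t m) (r (t m) i) j) \<longlonglongrightarrow> c j" "(\<lambda>m. pt (t m) (s (t m) i) j) \<longlonglongrightarrow> c j" for j
      using lim[of "\<lambda>m. r m i"] lim[of "\<lambda>m. s m i"] rs(1,2) by auto
    have "(\<lambda>m. F (pt (t m) (r (t m) i)) i) \<longlonglongrightarrow> F c i" by (rule cont) (use pt01 lr i in auto)
    then show "c i \<le> F c i" by (rule LIMSEQ_le[OF lr(1)]) (use rs(3)[OF i] in auto)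
    have "(\<lambda>m. F (pt (t m) (s (t m) i)) i) \<longlonglongrightarrow> F c i" by (rule cont) (use pt01 lr i in auto)
    then show "F c i \<le> c i" by (rule LIMSEQ_le[OF _ lr(2)]) (use rs(4)[OF i] in auto)
  qed
  then show ?thesis using c01 by blast
qed

section \<open>Averages over the cubes of a grid\<close>

definition cell :: "nat \<Rightarrow> 'a::euclidean_space \<Rightarrow> 'a" where
  "cell m x = (\<Sum>b\<in>Basis. of_int \<lfloor>real m * (x \<bullet> b)\<rfloor> *\<^sub>R b)"

lemma cell_inner: "b \<in> Basis \<Longrightarrow> cell m x \<bullet> b = of_int \<lfloor>real m * (x \<bullet> b)\<rfloor>"
  unfolding cell_def by (simp add: inner_sum_left inner_Basis if_distrib sum.delta cong: if_cong)

lemma cell_eq_iff: "cell m x = cell m y \<longleftrightarrow> (\<forall>b\<in>Basis. \<lfloor>real m * (x \<bullet> b)\<rfloor> = \<lfloor>real m * (y \<bullet> b)\<rfloor>)"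
  by (subst euclidean_eq_iff) (auto simp: cell_inner)

lemma cell_measurable [measurable]: "cell m \<in> borel_measurable borel"
  unfolding cell_def by measurable

lemma finite_cells:
  assumes "bounded S"
  shows "finite (cell m ` S)"
proof -
  obtain R where R: "\<And>x. x \<in> S \<Longrightarrow> norm x \<le> R" using assms by (auto simp: bounded_iff)
  define k where "k = \<lceil>real m * R\<rceil> + 1"
  have "cell m ` S \<subseteq> (\<lambda>f. \<Sum>b\<in>Basis. of_int (f b) *\<^sub>R b) ` (PiE Basis (\<lambda>_. {-k..k}))"
  proof
    fix c assume "c \<in> cell m ` S"
    then obtain x where x: "x \<in> S" "c = cell m x" by auto
    define f where "f = restrict (\<lambda>b. \<lfloor>real m * (x \<bullet> b)\<rfloor>) Basis"
    have "c = (\<Sum>b\<in>Basis. of_int (f b) *\<^sub>R b)" unfolding x(2) cell_def f_def by (intro sum.cong) auto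
    moreover have "f \<in> PiE Basis (\<lambda>_. {-k..k})"
    proof -
      have "\<lfloor>real m * (x \<bullet> b)\<rfloor> \<in> {-k..k}" if "b \<in> Basis" for b
      proof -
        have "\<bar>x \<bullet> b\<bar> \<le> R" using Basis_le_norm[OF that, of x] R[OF x(1)] by linarith
        then have "real m * \<bar>x \<bullet> b\<bar> \<le> real m * R" by (intro mult_left_mono) auto
        then have "\<bar>real m * (x \<bullet> b)\<bar> \<le> real m * R" by (simp add: abs_mult)
        then show ?thesis unfolding k_def by (simp add: abs_le_iff) linarith
      qed
      then show ?thesis by (auto simp: f_def)
    qed
    ultimately show "c \<in> (\<lambda>f. \<Sum>b\<in>Basis. of_int (f b) *\<^sub>R b) ` (PiE Basis (\<lambda>_. {-k..k}))" by blast
  qed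
  then show ?thesis by (rule finite_subset) (intro finite_imageI finite_PiE, auto)
qed

lemma cell_close:
  assumes "cell (Suc k) x = cell (Suc k) y"
  shows "y - x \<in> cbox (- (inverse (real (Suc k))) *\<^sub>R One) (inverse (real (Suc k)) *\<^sub>R One)"
proof -
  have "- inverse (real (Suc k)) \<le> (y - x) \<bullet> b \<and> (y - x) \<bullet> b \<le> inverse (real (Suc k))" if b: "b \<in> Basis" for b
  proof -
    have "\<lfloor>real (Suc k) * (x \<bullet> b)\<rfloor> = \<lfloor>real (Suc k) * (y \<bullet> b)\<rfloor>" using assms b by (simp add: cell_eq_iff)
    then have "\<bar>real (Suc k) * (y \<bullet> b) - real (Suc k) * (x \<bullet> b)\<bar> \<le> 1" by linarith
    moreover have "real (Suc k) * (y \<bullet> b) - real (Suc k) * (x \<bullet> b) = real (Suc k) * ((y - x) \<bullet> b)"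
      by (simp add: inner_diff_left right_diff_distrib del: of_nat_Suc)
    ultimately have "real (Suc k) * \<bar>(y - x) \<bullet> b\<bar> \<le> 1" by (simp add: abs_mult del: of_nat_Suc)
    then have "\<bar>(y - x) \<bullet> b\<bar> \<le> inverse (real (Suc k))" by (simp add: field_simps)
    then show ?thesis by linarith
  qed
  then show ?thesis by (simp add: mem_box)
qed

text \<open>The half-open cube lies between an open and a closed box with the same edges, and these
  have equal volume.\<close>

lemma cell_volume:
  "integrable lborel (\<lambda>y::'a::euclidean_space. indicator {y. cell (Suc k) y = cell (Suc k) x} y :: real)"
  "(LBINT y. indicator {y. cell (Suc k) y = cell (Suc k) x} y) = inverse (real (Suc k)) ^ DIM('a)"
proof -
  define h where "h = inverse (real (Suc k))"
  have h: "0 < h" "real (Suc k) * h = 1" by (auto simp: h_def)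
  define Q where "Q = {y::'a. cell (Suc k) y = cell (Suc k) x}"
  define l where "l = h *\<^sub>R cell (Suc k) x"
  have inQ: "y \<in> Q \<longleftrightarrow> (\<forall>b\<in>Basis. cell (Suc k) x \<bullet> b \<le> real (Suc k) * (y \<bullet> b) \<and> real (Suc k) * (y \<bullet> b) < cell (Suc k) x \<bullet> b + 1)" for y
    unfolding Q_def mem_Collect_eq cell_eq_iff by (auto simp: cell_inner floor_eq_iff simp del: of_nat_Suc)
  have sc: "l \<bullet> b \<le> y \<bullet> b \<longleftrightarrow> cell (Suc k) x \<bullet> b \<le> real (Suc k) * (y \<bullet> b)"
     "l \<bullet> b < y \<bullet> b \<longleftrightarrow> cell (Suc k) x \<bullet> b < real (Suc k) * (y \<bullet> b)"
     "y \<bullet> b \<le> l \<bullet> b + h \<longleftrightarrow> real (Suc k) * (y \<bullet> b) \<le> cell (Suc k) x \<bullet> b + 1"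
     "y \<bullet> b < l \<bullet> b + h \<longleftrightarrow> real (Suc k) * (y \<bullet> b) < cell (Suc k) x \<bullet> b + 1" for y b
    by (simp_all add: l_def h_def field_simps del: of_nat_Suc)
  have sub: "box l (l + h *\<^sub>R One) \<subseteq> Q" "Q \<subseteq> cbox l (l + h *\<^sub>R One)"
    by (auto simp: mem_box inQ inner_add_left sc less_imp_le)
  have "closed_cells": "Q \<in> sets borel" unfolding Q_def by measurable
  then have Qm: "Q \<in> sets lborel" by simp
  have m: "measure lborel (box l (l + h *\<^sub>R One)) = h ^ DIM('a)" "measure lborel (cbox l (l + h *\<^sub>R One)) = h ^ DIM('a)"
    using h by (auto simp: measure_lborel_box_eq measure_lborel_cbox_eq inner_add_left)
  have fin: "emeasure lborel Q < \<infinity>"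
    using emeasure_mono[OF sub(2), of lborel] emeasure_lborel_cbox_finite[of l "l + h *\<^sub>R One"] by (simp add: le_less_trans)
  show I: "integrable lborel (\<lambda>y. indicator {y. cell (Suc k) y = cell (Suc k) x} y :: real)"
    unfolding Q_def[symmetric] using fin Qm by (simp add: integrable_indicator_iff)
  have "measure lborel Q \<le> h ^ DIM('a)"
    unfolding m(2)[symmetric] by (rule measure_mono_fmeasurable[OF sub(2)]) (use Qm in auto)
  moreover have "h ^ DIM('a) \<le> measure lborel Q"
    unfolding m(1)[symmetric] by (rule measure_mono_fmeasurable[OF sub(1)]) (use Qm fin in \<open>auto simp: fmeasurable_def\<close>)
  ultimately have "measure lborel Q = h ^ DIM('a)" by simp
  then show "(LBINT y. indicator {y. cell (Suc k) y = cell (Suc k) x} y) = inverse (real (Suc k)) ^ DIM('a)"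
    unfolding Q_def[symmetric] h_def[symmetric] using Qm by simp
qed

definition cell_avg :: "nat \<Rightarrow> ('a::euclidean_space \<Rightarrow> real) \<Rightarrow> 'a \<Rightarrow> real" where
  "cell_avg k u c = real (Suc k) ^ DIM('a) * (LBINT y. indicator {y. cell (Suc k) y = c} y * u y)"

lemma cell_indicator_integrable:
  assumes "integrable lborel u"
  shows "integrable lborel (\<lambda>y. indicator {y. cell k y = c} y * u y :: real)"
  by (rule integrable_bounded_mult(1)[where C=1, OF _ _ assms]) (auto simp: indicator_def)

lemma cell_avg_le:
  assumes "integrable lborel (u :: 'a::euclidean_space \<Rightarrow> real)"
  shows "\<bar>cell_avg k u c\<bar> \<le> real (Suc k) ^ DIM('a) * L1norm u"
proof -
  have "\<bar>LBINT y. indicator {y. cell (Suc k) y = c} y * u y\<bar> \<le> 1 * L1norm u"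
    by (rule integrable_bounded_mult(2)[OF _ _ assms]) (auto simp: indicator_def)
  then show ?thesis unfolding cell_avg_def by (simp add: abs_mult mult_left_mono)
qed

text \<open>Two points of one cube differ by a vector of the box \<open>B\<close>. The error at
  \<open>x\<close> is thus at most an average over translations \<open>z\<close> in \<open>B\<close>
  of \<open>\<bar>u (x + z) - u x\<bar>\<close>, and exchanging the integrals leaves the translation
  estimate.\<close>

lemma cell_avg_error:
  fixes u :: "'a::euclidean_space \<Rightarrow> real"
  assumes u: "integrable lborel u" "u \<in> borel_measurable borel"
    and tr: "\<And>h. (L1norm (\<lambda>x. u (x + h) - u x)) \<le> norm h * M" and M: "0 \<le> M"
  shows "(\<integral>\<^sup>+x. ennreal \<bar>u x - cell_avg k u (cell (Suc k) x)\<bar> \<partial>lborel)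
     \<le> ennreal (2 ^ DIM('a) * real DIM('a) * M * inverse (real (Suc k)))"
proof -
  note [measurable] = u(2)
  define h where "h = inverse (real (Suc k))"
  have h: "0 < h" by (simp add: h_def)
  define N where "N = DIM('a)"
  have kh: "real (Suc k) ^ N * h ^ N = 1" by (simp add: h_def power_mult_distrib[symmetric] del: of_nat_Suc)
  define B where "B = cbox (- h *\<^sub>R One) (h *\<^sub>R One :: 'a)"
  have pt: "ennreal \<bar>u x - cell_avg k u (cell (Suc k) x)\<bar>
      \<le> ennreal (real (Suc k) ^ N) * (\<integral>\<^sup>+z. indicator B z * ennreal \<bar>u (x + z) - u x\<bar> \<partial>lborel)" for x
  proof -
    let ?i = "\<lambda>y. indicator {y. cell (Suc k) y = cell (Suc k) x} y :: real"
    have i: "integrable lborel (\<lambda>y. ?i y * u y)" "integrable lborel (\<lambda>y. ?i y * u x)"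
      using cell_indicator_integrable[OF u(1)] cell_volume(1)[of k x] by auto
    have m: "(\<lambda>y. ?i y * (u x - u y)) \<in> borel_measurable borel" by measurable
    have ii: "integrable lborel (\<lambda>y. ?i y * (u x - u y))"
      using Bochner_Integration.integrable_diff[OF i(2,1)] by (simp add: right_diff_distrib)
    have "u x = real (Suc k) ^ N * (LBINT y. ?i y * u x)"
      using cell_volume(2)[of k x] kh by (simp add: N_def h_def mult.assoc[symmetric] del: of_nat_Suc)
    then have "u x - cell_avg k u (cell (Suc k) x) = real (Suc k) ^ N * ((LBINT y. ?i y * u x) - (LBINT y. ?i y * u y))"
      unfolding cell_avg_def N_def[symmetric] right_diff_distrib[of "real (Suc k) ^ N"] by argo
    also have "\<dots> = real (Suc k) ^ N * (LBINT y. ?i y * (u x - u y))"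
      unfolding Bochner_Integration.integral_diff[OF i(2,1), symmetric] right_diff_distrib[of "?i _"] ..
    finally have "\<bar>u x - cell_avg k u (cell (Suc k) x)\<bar> \<le> real (Suc k) ^ N * L1norm (\<lambda>y. ?i y * (u x - u y))"
      using integral_abs_bound[of lborel "\<lambda>y. ?i y * (u x - u y)"] by (simp add: abs_mult mult_left_mono del: of_nat_Suc)
    then have "ennreal \<bar>u x - cell_avg k u (cell (Suc k) x)\<bar> \<le> ennreal (real (Suc k) ^ N * L1norm (\<lambda>y. ?i y * (u x - u y)))"
      by (rule ennreal_leI)
    also have "\<dots> = ennreal (real (Suc k) ^ N) * (\<integral>\<^sup>+y. ennreal \<bar>?i y * (u x - u y)\<bar> \<partial>lborel)"
      using ii by (subst nn_integral_eq_integral) (auto simp: ennreal_mult)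
    also have "(\<integral>\<^sup>+y. ennreal \<bar>?i y * (u x - u y)\<bar> \<partial>lborel) \<le> (\<integral>\<^sup>+y. indicator B (y - x) * ennreal \<bar>u y - u x\<bar> \<partial>lborel)"
    proof (rule nn_integral_mono)
      fix y
      have "y - x \<in> B" if "cell (Suc k) y = cell (Suc k) x"
        using cell_close[OF that[symmetric]] unfolding B_def h_def .
      then show "ennreal \<bar>?i y * (u x - u y)\<bar> \<le> indicator B (y - x) * ennreal \<bar>u y - u x\<bar>"
        by (auto simp: indicator_def abs_minus_commute)
    qed
    also have "(\<integral>\<^sup>+y. indicator B (y - x) * ennreal \<bar>u y - u x\<bar> \<partial>lborel)
        = (\<integral>\<^sup>+y. indicator B (y - x) * ennreal \<bar>u y - u x\<bar> \<partial>distr lborel borel ((+) x))"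
      by (simp add: lborel_distr_plus)
    also have "\<dots> = (\<integral>\<^sup>+z. indicator B z * ennreal \<bar>u (x + z) - u x\<bar> \<partial>lborel)"
      by (subst nn_integral_distr) (auto simp: B_def)
    finally show ?thesis by (simp add: mult_left_mono)
  qed
  have Bm[measurable]: "B \<in> sets borel" by (simp add: B_def)
  \<comment> \<open>A vector of \<open>B\<close> has length at most the sum of its coordinates, that
    is, the dimension times \<open>h\<close>.\<close>
  have inner: "indicator B z * (\<integral>\<^sup>+x. ennreal \<bar>u (x + z) - u x\<bar> \<partial>lborel) \<le> ennreal (real N * h * M) * indicator B z" for z
  proof (cases "z \<in> B")
    case True
    have "norm z \<le> (\<Sum>b\<in>Basis. \<bar>z \<bullet> b\<bar>)" by (rule norm_le_l1)
    also have "\<dots> \<le> (\<Sum>b\<in>(Basis::'a set). h)"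
      using True by (intro sum_mono) (auto simp: B_def mem_box abs_le_iff)
    finally have nz: "norm z \<le> real N * h" by (simp add: N_def)
    have I: "integrable lborel (\<lambda>x. \<bar>u (x + z) - u x\<bar>)"
      using u lborel_integrable_translation[OF u(2), of z] by simp
    have "(\<integral>\<^sup>+x. ennreal \<bar>u (x + z) - u x\<bar> \<partial>lborel) = ennreal (L1norm (\<lambda>x. u (x + z) - u x))"
      by (rule nn_integral_eq_integral[OF I]) simp
    also have "\<dots> \<le> ennreal (real N * h * M)"
      using tr[of z] mult_right_mono[OF nz M] by (intro ennreal_leI) linarith
    finally show ?thesis using True by simp
  qed simp
  have "(\<integral>\<^sup>+x. ennreal \<bar>u x - cell_avg k u (cell (Suc k) x)\<bar> \<partial>lborel)
      \<le> (\<integral>\<^sup>+x. ennreal (real (Suc k) ^ N) * (\<integral>\<^sup>+z. indicator B z * ennreal \<bar>u (x + z) - u x\<bar> \<partial>lborel) \<partial>lborel)"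
    by (rule nn_integral_mono) (rule pt)
  also have "\<dots> = ennreal (real (Suc k) ^ N) * (\<integral>\<^sup>+x. (\<integral>\<^sup>+z. indicator B z * ennreal \<bar>u (x + z) - u x\<bar> \<partial>lborel) \<partial>lborel)"
    by (rule nn_integral_cmult) measurable
  also have "(\<integral>\<^sup>+x. (\<integral>\<^sup>+z. indicator B z * ennreal \<bar>u (x + z) - u x\<bar> \<partial>lborel) \<partial>lborel)
      = (\<integral>\<^sup>+z. (\<integral>\<^sup>+x. indicator B z * ennreal \<bar>u (x + z) - u x\<bar> \<partial>lborel) \<partial>lborel)"
    by (rule lborel_pair.Fubini') measurable
  also have "\<dots> = (\<integral>\<^sup>+z. indicator B z * (\<integral>\<^sup>+x. ennreal \<bar>u (x + z) - u x\<bar> \<partial>lborel) \<partial>lborel)"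
    by (intro nn_integral_cong nn_integral_cmult) measurable
  also have "\<dots> \<le> (\<integral>\<^sup>+z. ennreal (real N * h * M) * indicator B z \<partial>lborel)"
    by (rule nn_integral_mono) (rule inner)
  also have "\<dots> = ennreal (real N * h * M) * emeasure lborel B"
    by (rule nn_integral_cmult_indicator) simp
  also have "emeasure lborel B = ennreal ((2 * h) ^ N)"
  proof -
    have "emeasure lborel B = ennreal (\<Prod>b\<in>Basis. (h *\<^sub>R One - (- h *\<^sub>R One :: 'a)) \<bullet> b)"
      unfolding B_def using h by (intro emeasure_lborel_cbox) auto
    also have "(\<Prod>b\<in>Basis. (h *\<^sub>R One - (- h *\<^sub>R One :: 'a)) \<bullet> b) = (\<Prod>b\<in>(Basis :: 'a set). 2 * h)"
      by (intro prod.cong) (auto simp: inner_diff_left inner_add_left)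
    finally show ?thesis by (simp add: N_def)
  qed
  \<comment> \<open>The volume of \<open>B\<close> is \<open>2 ^ N\<close> times that of a cube, so
    the reciprocal volume cancels and one factor \<open>h\<close> from the translation length
    survives.\<close>
  also have "ennreal (real (Suc k) ^ N) * (ennreal (real N * h * M) * ennreal ((2 * h) ^ N))
     = ennreal (2 ^ N * real N * M * h)"
  proof -
    have "real (Suc k) ^ N * ((real N * h * M) * ((2 * h) ^ N)) = (real (Suc k) ^ N * h ^ N) * (2 ^ N * real N * M * h)"
      by (simp only: power_mult_distrib mult_ac)
    then have "real (Suc k) ^ N * ((real N * h * M) * ((2 * h) ^ N)) = 2 ^ N * real N * M * h" unfolding kh by simp
    then show ?thesis using h M by (simp add: ennreal_mult[symmetric] del: of_nat_Suc)
  qed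
  finally show ?thesis by (simp add: N_def h_def mult_left_mono)
qed

context pspace begin

text \<open>At each scale a function has finitely many averages over the cubes that meet \<Omega>,
  so a diagonal subsequence makes all averages at all scales converge. The averaging error is
  uniform in \<open>n\<close> because it depends only on the L1 bound for the gradients; hence the
  subsequence is Cauchy in L1.\<close>

lemma rellich:
  assumes W: "\<And>n. W (u n) (G n)" and K: "\<And>n. rho (G n) \<le> K"
  obtains r :: "nat \<Rightarrow> nat" and v where "strict_mono r" "integrable lborel v"
    "(\<lambda>n. L1norm (\<lambda>x. u (r n) x - v x)) \<longlonglongrightarrow> 0"
proof -
  define M where "M = vol + K"
  have GM: "(LBINT x. norm (G n x)) \<le> M" for n
    using Lp_integrable(2)[OF WD(4)[OF W[of n]], of 1] K[of n] by (simp add: M_def)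
  have M0: "0 \<le> M" by (rule order_trans[OF _ GM[of 0]]) simp
  have uM: "L1norm (u n) \<le> radius * M" for n
    using poincare[OF W[of n]] mult_left_mono[OF GM[of n], of radius] radius(1) by linarith
  have err: "(\<integral>\<^sup>+x. ennreal \<bar>u n x - cell_avg k (u n) (cell (Suc k) x)\<bar> \<partial>lborel)
     \<le> ennreal (2 ^ DIM('a) * real DIM('a) * M * inverse (real (Suc k)))" for n k
  proof (rule cell_avg_error[OF WD(1)[OF W] WD(2)[OF W] _ M0])
    show "L1norm (\<lambda>x. u n (x + h) - u n x) \<le> norm h * M" for h
      using W_translation[OF W[of n], of h] mult_left_mono[OF GM[of n], of "norm h"] by simp
  qed
  define S where "S = (\<Union>k. {k} \<times> cell (Suc k) ` \<Omega>)"
  have "countable S" unfolding S_def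
    by (intro countable_UN countable_SIGMA) (auto intro: countable_finite finite_cells[OF bounded_domain])
  moreover have "\<exists>B. \<forall>n. \<bar>cell_avg (fst i) (u n) (snd i)\<bar> \<le> B" for i
    using order_trans[OF cell_avg_le[OF WD(1)[OF W]] mult_left_mono[OF uM]] by (metis of_nat_0_le_iff zero_le_power)
  ultimately obtain r l where r: "strict_mono r" "\<forall>i\<in>S. (\<lambda>n. cell_avg (fst i) (u (r n)) (snd i)) \<longlonglongrightarrow> l i"
    using pointwise_bounded_subseq[of S "\<lambda>n i. cell_avg (fst i) (u n) (snd i)"] by blast
  have cau: "\<exists>N. \<forall>i\<ge>N. \<forall>j\<ge>N. (LBINT x. norm (u (r i) x - u (r j) x)) < e" if e: "0 < e" for e
  proof -
    define C where "C = 2 ^ DIM('a) * real DIM('a) * M"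
    have C0: "0 \<le> C" using M0 by (simp add: C_def)
    have "(\<lambda>k. C * inverse (real (Suc k))) \<longlonglongrightarrow> 0"
      using tendsto_mult_left[OF LIMSEQ_inverse_real_of_nat, of C] by simp
    then have "eventually (\<lambda>k. C * inverse (real (Suc k)) < e / 4) sequentially"
      by (rule order_tendstoD) (use e in simp)
    then obtain k where k: "C * inverse (real (Suc k)) < e / 4" by (auto simp: eventually_sequentially)
    define I where "I = cell (Suc k) ` \<Omega>"
    have finI: "finite I" unfolding I_def by (rule finite_cells[OF bounded_domain])
    define a where "a n c = cell_avg k (u (r n)) c" for n c
    have conv: "Cauchy (\<lambda>n. a n c)" if "c \<in> I" for c
    proof -
      have "(k, c) \<in> S" using that by (auto simp: S_def I_def)
      then have "(\<lambda>n. a n c) \<longlonglongrightarrow> l (k, c)" using r(2) unfolding a_def by fastforce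
      then show ?thesis by (rule LIMSEQ_imp_Cauchy)
    qed
    \<comment> \<open>Tolerance for the averages: integrated over \<Omega> it contributes at most
      \<open>e / 4\<close>, and the averaging errors of the two functions contribute less than
      \<open>e / 4\<close> each.\<close>
    define \<eta> where "\<eta> = e / (4 * (vol + 1) * (real (card I) + 1))"
    have v1: "0 < vol + 1" "0 < real (card I) + 1" using vol_nonneg by linarith+
    have eta: "0 < \<eta>" using e v1 by (simp add: \<eta>_def)
    have "\<forall>c\<in>I. \<exists>N. \<forall>i\<ge>N. \<forall>j\<ge>N. \<bar>a i c - a j c\<bar> < \<eta>"
      using conv eta unfolding Cauchy_iff by fastforce
    then obtain Nf where Nf: "\<And>c i j. c \<in> I \<Longrightarrow> i \<ge> Nf c \<Longrightarrow> j \<ge> Nf c \<Longrightarrow> \<bar>a i c - a j c\<bar> < \<eta>" by metis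
    define N where "N = Max (insert 0 (Nf ` I))"
    have N: "\<bar>a i c - a j c\<bar> < \<eta>" if "c \<in> I" "i \<ge> N" "j \<ge> N" for c i j
    proof (rule Nf[OF that(1)])
      have "Nf c \<le> N" unfolding N_def using finI that(1) by (intro Max_ge) auto
      then show "Nf c \<le> i" "Nf c \<le> j" using that by auto
    qed
    have "(LBINT x. norm (u (r i) x - u (r j) x)) < e" if ij: "i \<ge> N" "j \<ge> N" for i j
    proof -
      note [measurable] = WD(2)[OF W]
      have pt: "ennreal (norm (u (r i) x - u (r j) x)) \<le> (ennreal \<bar>u (r i) x - a i (cell (Suc k) x)\<bar>
          + ennreal \<bar>u (r j) x - a j (cell (Suc k) x)\<bar>) + ennreal \<eta> * indicator \<Omega> x" for x
      proof (cases "x \<in> \<Omega>")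
        case True
        then have "cell (Suc k) x \<in> I" by (auto simp: I_def)
        from N[OF this ij] have "norm (u (r i) x - u (r j) x) \<le> (\<bar>u (r i) x - a i (cell (Suc k) x)\<bar>
          + \<bar>u (r j) x - a j (cell (Suc k) x)\<bar>) + \<eta>" by simp
        then show ?thesis using True eta by (simp add: ennreal_plus[symmetric] ennreal_leI del: ennreal_plus)
      next
        case False
        then show ?thesis using WD(3)[OF W False] by simp
      qed
      have am: "(\<lambda>x. a n (cell (Suc k) x)) \<in> borel_measurable borel" for n
        unfolding a_def cell_avg_def by measurable
      note [measurable] = am
      have "(\<integral>\<^sup>+x. ennreal (norm (u (r i) x - u (r j) x)) \<partial>lborel)
        \<le> (\<integral>\<^sup>+x. (ennreal \<bar>u (r i) x - a i (cell (Suc k) x)\<bar> + ennreal \<bar>u (r j) x - a j (cell (Suc k) x)\<bar>)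
            + ennreal \<eta> * indicator \<Omega> x \<partial>lborel)" by (rule nn_integral_mono) (rule pt)
      also have "\<dots> = ((\<integral>\<^sup>+x. ennreal \<bar>u (r i) x - a i (cell (Suc k) x)\<bar> \<partial>lborel)
          + (\<integral>\<^sup>+x. ennreal \<bar>u (r j) x - a j (cell (Suc k) x)\<bar> \<partial>lborel)) + ennreal \<eta> * emeasure lborel \<Omega>"
        by (simp add: nn_integral_add nn_integral_cmult_indicator)
      also have "\<dots> \<le> (ennreal (C * inverse (real (Suc k))) + ennreal (C * inverse (real (Suc k)))) + ennreal \<eta> * ennreal vol"
        unfolding a_def C_def vol_def
        using emeasure_bounded_finite[OF bounded_domain]
        by (intro add_mono err mult_left_mono) (auto simp: emeasure_eq_ennreal_measure)
      also have "\<dots> = ennreal (2 * (C * inverse (real (Suc k))) + \<eta> * vol)"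
        using eta C0 by (simp add: ennreal_plus[symmetric] ennreal_mult[symmetric] del: ennreal_plus of_nat_Suc)
      finally have n: "(\<integral>\<^sup>+x. ennreal (norm (u (r i) x - u (r j) x)) \<partial>lborel) \<le> ennreal (2 * (C * inverse (real (Suc k))) + \<eta> * vol)" .
      have "integrable lborel (\<lambda>x. norm (u (r i) x - u (r j) x))" using WD(1)[OF W] by simp
      then have "ennreal (LBINT x. norm (u (r i) x - u (r j) x)) \<le> ennreal (2 * (C * inverse (real (Suc k))) + \<eta> * vol)"
        using n by (subst (asm) nn_integral_eq_integral) auto
      then have "(LBINT x. norm (u (r i) x - u (r j) x)) \<le> 2 * (C * inverse (real (Suc k))) + \<eta> * vol"
        using C0 eta by (subst (asm) ennreal_le_iff) (auto intro!: add_nonneg_nonneg mult_nonneg_nonneg)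
      moreover have "\<eta> * vol < e / 2"
      proof -
        have "\<eta> \<le> e / (4 * (vol + 1))" unfolding \<eta>_def using e v1 by (intro divide_left_mono) auto
        then have "\<eta> * vol \<le> e / (4 * (vol + 1)) * (vol + 1)" using eta v1 by (intro mult_mono) auto
        also have "\<dots> = e / 4" using v1 by (simp add: field_simps)
        finally show ?thesis using e by simp
      qed
      ultimately show ?thesis using k by linarith
    qed
    then show ?thesis by blast
  qed
  obtain v where "integrable lborel v" "(\<lambda>n. LBINT x. norm (u (r n) x - v x)) \<longlonglongrightarrow> 0"
    by (rule L1_complete[OF WD(1)[OF W] cau])
  then show thesis using that r(1) by simp
qed

end

context pspace begin

text \<open>Almost everywhere convergence of bounded loads suffices. Along a subsequence the
  solutions converge in L1 to some \<open>w\<close>; against \<open>w - v\<close> the loads converge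
  by domination, and the remainder is small because the loads are bounded.\<close>

lemma EL_stable_AE:
  assumes EL: "\<And>n. EL (u n) (G n) (g n)" "EL v H h"
    and g: "\<And>n. g n \<in> borel_measurable borel" "\<And>n x. \<bar>g n x\<bar> \<le> C" "h \<in> borel_measurable borel" "\<And>x. \<bar>h x\<bar> \<le> C"
    and lim: "AE x in lborel. (\<lambda>n. g n x) \<longlonglongrightarrow> h x"
  shows "(\<lambda>n. L1norm (\<lambda>x. u n x - v x)) \<longlonglongrightarrow> 0"
proof (rule tendsto_by_subseq)
  fix r :: "nat \<Rightarrow> nat" assume r: "strict_mono r"
  have W: "W (u n) (G n)" "W v H" for n using EL by (auto simp: EL_def)
  note [measurable] = g(1,3)
  have C: "0 \<le> C" using g(4)[of undefined] by linarith
  obtain K where K: "0 \<le> K" "\<forall>u G g. g \<in> borel_measurable borel \<longrightarrow> (\<forall>x. \<bar>g x\<bar> \<le> C) \<longrightarrow> EL u G g \<longrightarrow> rho G \<le> K"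
    by (rule EL_energy_bound[OF C])
  have KB: "rho (G n) \<le> K" for n using K(2) EL g by blast
  obtain s w where s: "strict_mono s" "integrable lborel w" "(\<lambda>n. L1norm (\<lambda>x. u (r (s n)) x - w x)) \<longlonglongrightarrow> 0"
    by (rule rellich[of "\<lambda>n. u (r n)" "\<lambda>n. G (r n)", OF W(1) KB])
  define t where "t n = r (s n)" for n
  have t: "strict_mono t" using r s(1) unfolding t_def by (simp add: strict_mono_def)
  note [measurable] = borel_measurable_integrable[OF s(2)] borel_measurable_integrable[OF WD(1)[OF W(1)]]
    borel_measurable_integrable[OF WD(1)[OF W(2)]]
  have gh: "\<bar>g n x - h x\<bar> \<le> 2 * C" for n x using g(2)[of n x] g(4)[of x] by linarith
  have ghm: "(\<lambda>x. g n x - h x) \<in> borel_measurable borel" for n by measurable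
  have wv: "integrable lborel (\<lambda>x. w x - v x)" using s(2) WD(1)[OF W(2)] by simp
  have uw: "integrable lborel (\<lambda>x. u n x - w x)" for n using s(2) WD(1)[OF W(1)] by simp
  \<comment> \<open>Only the second summand pairs the load difference with a fixed integrable
    function; the first is bounded by \<open>2 * C\<close> times an L1 norm that tends to 0.\<close>
  have split: "(LBINT x. (g (t n) x - h x) * (u (t n) x - v x))
     = (LBINT x. (g (t n) x - h x) * (u (t n) x - w x)) + (LBINT x. (g (t n) x - h x) * (w x - v x))" for n
    using Bochner_Integration.integral_add[OF integrable_bounded_mult(1)[OF ghm gh uw] integrable_bounded_mult(1)[OF ghm gh wv], of "t n" "t n" "t n"]
    by (simp add: algebra_simps)
  have l1: "(\<lambda>n. LBINT x. (g (t n) x - h x) * (u (t n) x - w x)) \<longlonglongrightarrow> 0"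
  proof (rule Lim_null_comparison)
    show "(\<lambda>n. 2 * C * L1norm (\<lambda>x. u (t n) x - w x)) \<longlonglongrightarrow> 0"
      using tendsto_mult_right_zero[OF s(3), of "2 * C"] by (simp add: t_def)
    show "eventually (\<lambda>n. norm (LBINT x. (g (t n) x - h x) * (u (t n) x - w x))
        \<le> 2 * C * L1norm (\<lambda>x. u (t n) x - w x)) sequentially"
      using integrable_bounded_mult(2)[OF ghm gh uw] by simp
  qed
  have l2: "(\<lambda>n. LBINT x. (g (t n) x - h x) * (w x - v x)) \<longlonglongrightarrow> integral\<^sup>L lborel (\<lambda>x::'a. 0)"
  proof (rule integral_dominated_convergence[where w="\<lambda>x. 2 * C * \<bar>w x - v x\<bar>" and f="\<lambda>x. 0" and s="\<lambda>n x. (g (t n) x - h x) * (w x - v x)"])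
    show "integrable lborel (\<lambda>x. 2 * C * \<bar>w x - v x\<bar>)" using wv by simp
    show "AE x in lborel. (\<lambda>n. (g (t n) x - h x) * (w x - v x)) \<longlonglongrightarrow> 0"
      using lim
    proof eventually_elim
      case (elim x)
      have "(\<lambda>n. g (t n) x) \<longlonglongrightarrow> h x" using LIMSEQ_subseq_LIMSEQ[OF elim t] by (simp add: o_def)
      then show ?case using tendsto_mult_left_zero[OF LIM_zero] by blast
    qed
    show "AE x in lborel. norm ((g (t n) x - h x) * (w x - v x)) \<le> 2 * C * \<bar>w x - v x\<bar>" for n
      using gh by (auto simp: abs_mult intro!: AE_I2 mult_right_mono)
  qed measurable
  have "(\<lambda>n. LBINT x. (g (t n) x - h x) * (u (t n) x - v x)) \<longlonglongrightarrow> 0"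
    unfolding split using tendsto_add[OF l1 l2] by simp
  from EL_stable(2)[of "\<lambda>n. u (t n)" "\<lambda>n. G (t n)" "\<lambda>n. g (t n)", OF EL g this]
  show "\<exists>s. strict_mono s \<and> (\<lambda>n. L1norm (\<lambda>x. u (r (s n)) x - v x)) \<longlonglongrightarrow> 0"
    using s(1) by (auto simp: t_def)
qed

lemma EL_cong:
  assumes "EL u G g" "AE x in lborel. g x = h x" "g \<in> borel_measurable borel" "h \<in> borel_measurable borel"
  shows "EL u G h"
proof -
  have "(LBINT x. g x * \<psi> x) = (LBINT x. h x * \<psi> x)" if "C1c \<Omega> \<psi> D" for \<psi> D
  proof (rule integral_cong_AE)
    note [measurable] = assms(3,4) C1cD(5)[OF that]
    show "(\<lambda>x. g x * \<psi> x) \<in> borel_measurable lborel" "(\<lambda>x. h x * \<psi> x) \<in> borel_measurable lborel" by measurable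
    show "AE x in lborel. g x * \<psi> x = h x * \<psi> x" using assms(2) by eventually_elim simp
  qed
  then show ?thesis using assms(1) by (simp add: EL_def)
qed

lemma W_cell_error:
  assumes "W u G" "rho G \<le> K"
  shows "(\<integral>\<^sup>+x. ennreal \<bar>u x - cell_avg k u (cell (Suc k) x)\<bar> \<partial>lborel)
     \<le> ennreal (2 ^ DIM('a) * real DIM('a) * (vol + K) * inverse (real (Suc k)))"
    "\<bar>cell_avg k u c\<bar> \<le> real (Suc k) ^ DIM('a) * (radius * (vol + K))"
proof -
  have GM: "(LBINT x. norm (G x)) \<le> vol + K"
    using Lp_integrable(2)[OF WD(4)[OF assms(1)], of 1] assms(2) by simp
  have M0: "0 \<le> vol + K" by (rule order_trans[OF _ GM]) simp
  show "(\<integral>\<^sup>+x. ennreal \<bar>u x - cell_avg k u (cell (Suc k) x)\<bar> \<partial>lborel)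
     \<le> ennreal (2 ^ DIM('a) * real DIM('a) * (vol + K) * inverse (real (Suc k)))"
  proof (rule cell_avg_error[OF WD(1)[OF assms(1)] WD(2)[OF assms(1)] _ M0])
    show "L1norm (\<lambda>x. u (x + h) - u x) \<le> norm h * (vol + K)" for h
      using W_translation[OF assms(1), of h] mult_left_mono[OF GM, of "norm h"] by simp
  qed
  have "L1norm u \<le> radius * (vol + K)"
    using poincare[OF assms(1)] mult_left_mono[OF GM, of radius] radius(1) by linarith
  then show "\<bar>cell_avg k u c\<bar> \<le> real (Suc k) ^ DIM('a) * (radius * (vol + K))"
    using order_trans[OF cell_avg_le[OF WD(1)[OF assms(1)]] mult_left_mono] by (metis of_nat_0_le_iff zero_le_power)
qed

end

lemma L1_tendsto_by_nn:
  fixes f :: "nat \<Rightarrow> 'a::euclidean_space \<Rightarrow> real"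
  assumes m: "\<And>k. f k \<in> borel_measurable borel"
    and b: "\<And>k. (\<integral>\<^sup>+x. ennreal \<bar>f k x\<bar> \<partial>lborel) \<le> ennreal (c * inverse (real (Suc k)))"
  shows "integrable lborel (f k)" "(\<lambda>k. L1norm (f k)) \<longlonglongrightarrow> 0"
proof -
  note [measurable] = m
  show I: "integrable lborel (f k)" for k
  proof (rule integrableI_bounded)
    show "(\<integral>\<^sup>+x. ennreal (norm (f k x)) \<partial>lborel) < \<infinity>" using le_less_trans[OF b[of k]] by simp
  qed simp
  have "L1norm (f k) \<le> max 0 c * inverse (real (Suc k))" for k
  proof -
    have "ennreal (L1norm (f k)) = (\<integral>\<^sup>+x. ennreal \<bar>f k x\<bar> \<partial>lborel)"
      using I[of k] by (intro nn_integral_eq_integral[symmetric]) auto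
    also have "\<dots> \<le> ennreal (max 0 c * inverse (real (Suc k)))"
      by (rule order_trans[OF b]) (intro ennreal_leI mult_right_mono, auto)
    finally show ?thesis by (simp add: ennreal_le_iff del: of_nat_Suc)
  qed
  then have "eventually (\<lambda>k. norm (L1norm (f k)) \<le> max 0 c * inverse (real (Suc k))) sequentially"
    by (simp del: of_nat_Suc)
  then show "(\<lambda>k. L1norm (f k)) \<longlonglongrightarrow> 0"
    by (rule Lim_null_comparison) (rule tendsto_mult_right_zero[OF LIMSEQ_inverse_real_of_nat])
qed

lemma (in pspace) cell_avg_tendsto_L1:
  assumes W: "\<And>k. W (u k) (G k)" and K: "\<And>k. rho (G k) \<le> K" and U: "\<And>k. U k \<in> borel_measurable borel"
    "\<And>k x. x \<in> \<Omega> \<Longrightarrow> U k x = cell_avg k (u k) (cell (Suc k) x)" "\<And>k x. x \<notin> \<Omega> \<Longrightarrow> U k x = 0"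
  shows "integrable lborel (\<lambda>x. u k x - U k x)" "(\<lambda>k. L1norm (\<lambda>x. u k x - U k x)) \<longlonglongrightarrow> 0"
proof -
  have b: "(\<integral>\<^sup>+x. ennreal \<bar>u k x - U k x\<bar> \<partial>lborel)
    \<le> ennreal (2 ^ DIM('a) * real DIM('a) * (vol + K) * inverse (real (Suc k)))" for k
  proof (rule order_trans[OF nn_integral_mono W_cell_error(1)[OF W K]])
    show "ennreal \<bar>u k x - U k x\<bar> \<le> ennreal \<bar>u k x - cell_avg k (u k) (cell (Suc k) x)\<bar>" for x
      using U(2)[of x k] U(3)[of x k] WD(3)[OF W, of x k] by (cases "x \<in> \<Omega>") auto
  qed
  have m: "(\<lambda>x. u k x - U k x) \<in> borel_measurable borel" for k using U(1) WD(2)[OF W] by measurable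
  show "integrable lborel (\<lambda>x. u k x - U k x)" "(\<lambda>k. L1norm (\<lambda>x. u k x - U k x)) \<longlonglongrightarrow> 0"
    by (rule L1_tendsto_by_nn(1)[OF m b], rule L1_tendsto_by_nn(2)[OF m b])
qed

lemma L1_limit_unique:
  fixes a :: "nat \<Rightarrow> 'b \<Rightarrow> real"
  assumes i: "\<And>n. integrable M (a n)" "integrable M f" "integrable M g"
    and l: "(\<lambda>n. \<integral>x. \<bar>a n x - f x\<bar> \<partial>M) \<longlonglongrightarrow> 0" "(\<lambda>n. \<integral>x. \<bar>a n x - g x\<bar> \<partial>M) \<longlonglongrightarrow> 0"
  shows "AE x in M. f x = g x"
proof -
  have "(\<integral>x. \<bar>f x - g x\<bar> \<partial>M) \<le> (\<integral>x. \<bar>a n x - f x\<bar> \<partial>M) + (\<integral>x. \<bar>a n x - g x\<bar> \<partial>M)" for n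
  proof -
    have I: "integrable M (\<lambda>x. \<bar>a n x - f x\<bar>)" "integrable M (\<lambda>x. \<bar>a n x - g x\<bar>)" "integrable M (\<lambda>x. \<bar>f x - g x\<bar>)"
      using i by auto
    have "(\<integral>x. \<bar>f x - g x\<bar> \<partial>M) \<le> (\<integral>x. \<bar>a n x - f x\<bar> + \<bar>a n x - g x\<bar> \<partial>M)"
      by (intro integral_mono I Bochner_Integration.integrable_add) linarith
    then show ?thesis unfolding Bochner_Integration.integral_add[OF I(1,2)] .
  qed
  then have "(\<integral>x. \<bar>f x - g x\<bar> \<partial>M) \<le> 0"
    using LIMSEQ_le_const[OF tendsto_add[OF l]] by auto
  then have "(\<integral>x. \<bar>f x - g x\<bar> \<partial>M) = 0" by (simp add: order_antisym)
  moreover have "integrable M (\<lambda>x. \<bar>f x - g x\<bar>)" using i by auto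
  ultimately show ?thesis using integral_nonneg_eq_0_iff_AE[of M "\<lambda>x. \<bar>f x - g x\<bar>"] by simp
qed

lemma cell_avg_tendsto:
  fixes u :: "nat \<Rightarrow> 'a::euclidean_space \<Rightarrow> real"
  assumes "\<And>n. integrable lborel (u n)" "integrable lborel v" "(\<lambda>n. L1norm (\<lambda>x. u n x - v x)) \<longlonglongrightarrow> 0"
  shows "(\<lambda>n. cell_avg k (u n) c) \<longlonglongrightarrow> cell_avg k v c"
proof -
  have "(\<lambda>n. LBINT y. indicator {y. cell (Suc k) y = c} y * u n y) \<longlonglongrightarrow> (LBINT y. indicator {y. cell (Suc k) y = c} y * v y)"
    by (rule bounded_mult_tendsto[where C=1, OF _ _ assms(2,1,3)]) (auto simp: indicator_def)
  then show ?thesis unfolding cell_avg_def by (intro tendsto_mult tendsto_const)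
qed

text \<open>The right-hand sides are arbitrary operators on pairs of functions, so nonlocal
  dependence is allowed. Continuity is required for almost everywhere convergence, a mode that
  Luxemburg norms of truncated functions respect and that every L1 convergent sequence has along a
  subsequence.\<close>

locale coupled = P1: pspace \<Omega> p1 pm1 pp1 + P2: pspace \<Omega> p2 pm2 pp2
  for \<Omega> :: "'a::euclidean_space set" and p1 pm1 pp1 p2 pm2 pp2 +
  fixes N1 N2 :: "('a \<Rightarrow> real) \<Rightarrow> ('a \<Rightarrow> real) \<Rightarrow> 'a \<Rightarrow> real" and C :: real
  assumes N_meas: "\<lbrakk>U \<in> borel_measurable borel; V \<in> borel_measurable borel\<rbrakk> \<Longrightarrow> N1 U V \<in> borel_measurable borel"
      "\<lbrakk>U \<in> borel_measurable borel; V \<in> borel_measurable borel\<rbrakk> \<Longrightarrow> N2 U V \<in> borel_measurable borel"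
    and N_bound: "\<bar>N1 U V x\<bar> \<le> C" "\<bar>N2 U V x\<bar> \<le> C"
    and N_cont: "\<lbrakk>\<And>n. Us n \<in> borel_measurable borel; \<And>n. Vs n \<in> borel_measurable borel;
          U \<in> borel_measurable borel; V \<in> borel_measurable borel;
          AE x in lborel. (\<lambda>n. Us n x) \<longlonglongrightarrow> U x; AE x in lborel. (\<lambda>n. Vs n x) \<longlonglongrightarrow> V x\<rbrakk>
          \<Longrightarrow> AE x in lborel. (\<lambda>n. N1 (Us n) (Vs n) x) \<longlonglongrightarrow> N1 U V x"
      "\<lbrakk>\<And>n. Us n \<in> borel_measurable borel; \<And>n. Vs n \<in> borel_measurable borel;
          U \<in> borel_measurable borel; V \<in> borel_measurable borel;
          AE x in lborel. (\<lambda>n. Us n x) \<longlonglongrightarrow> U x; AE x in lborel. (\<lambda>n. Vs n x) \<longlonglongrightarrow> V x\<rbrakk>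
          \<Longrightarrow> AE x in lborel. (\<lambda>n. N2 (Us n) (Vs n) x) \<longlonglongrightarrow> N2 U V x"
begin

lemma C_nonneg: "0 \<le> C"
  using N_bound(1)[of undefined undefined undefined] by linarith

text \<open>The operators are fed step functions with one value per cube, so the fixed point problem
  lives in a cube of dimension \<open>2 * d\<close>. Continuity of the map combines
  \<open>N_cont\<close>, stability of the Dirichlet problem, and continuity of averages in
  L1.\<close>

lemma discrete_fixed_point:
  "\<exists>u G v H U V. U \<in> borel_measurable borel \<and> V \<in> borel_measurable borel \<and>
     P1.EL u G (N1 U V) \<and> P2.EL v H (N2 U V) \<and>
     (\<forall>x\<in>\<Omega>. U x = cell_avg k u (cell (Suc k) x) \<and> V x = cell_avg k v (cell (Suc k) x)) \<and>
     (\<forall>x. x \<notin> \<Omega> \<longrightarrow> U x = 0 \<and> V x = 0)"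
proof -
  obtain K1 where K1: "0 \<le> K1" "\<forall>u G g. g \<in> borel_measurable borel \<longrightarrow> (\<forall>x. \<bar>g x\<bar> \<le> C) \<longrightarrow> P1.EL u G g \<longrightarrow> P1.rho G \<le> K1"
    by (rule P1.EL_energy_bound[OF C_nonneg])
  obtain K2 where K2: "0 \<le> K2" "\<forall>u G g. g \<in> borel_measurable borel \<longrightarrow> (\<forall>x. \<bar>g x\<bar> \<le> C) \<longrightarrow> P2.EL u G g \<longrightarrow> P2.rho G \<le> K2"
    by (rule P2.EL_energy_bound[OF C_nonneg])
  \<comment> \<open>A bound for all averages of all solutions, from the uniform energy bound; the
    \<open>+ 1\<close> makes it positive.\<close>
  define B where "B = real (Suc k) ^ DIM('a) * (P1.radius * (P1.vol + max K1 K2)) + 1"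
  have z: "0 \<le> P1.radius * (P1.vol + max K1 K2)"
    by (intro mult_nonneg_nonneg add_nonneg_nonneg less_imp_le[OF P1.radius(1)] P1.vol_nonneg) (use K1(1) in auto)
  have B: "0 < B" unfolding B_def using mult_nonneg_nonneg[OF _ z, of "real (Suc k) ^ DIM('a)"] by simp
  define I where "I = cell (Suc k) ` \<Omega>"
  define d where "d = card I"
  have "finite I" unfolding I_def by (rule finite_cells[OF P1.bounded_domain])
  then obtain e where e: "bij_betw e {0..<d} I" unfolding d_def using ex_bij_betw_nat_finite by blast
  define Q where "Q i = {x. x \<in> \<Omega> \<and> cell (Suc k) x = e i}" for i
  have Qm[measurable]: "Q i \<in> sets borel" for i unfolding Q_def by measurable
  \<comment> \<open>Coordinates in the unit interval are rescaled to \<open>[- B, B]\<close>. Offset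
    0 reads the values for the first component, offset \<open>d\<close> those for the
    second.\<close>
  define step where "step off c x = (\<Sum>i<d. B * (2 * c (off + i) - 1) * indicator (Q i) x)" for off :: nat and c :: "nat \<Rightarrow> real" and x
  have step_m: "step off c \<in> borel_measurable borel" for off c unfolding step_def by measurable
  have step_in: "step off c x = B * (2 * c (off + i) - 1)" if x: "x \<in> \<Omega>" "cell (Suc k) x = e i" "i < d" for off c x i
  proof -
    have "step off c x = (\<Sum>j<d. if j = i then B * (2 * c (off + i) - 1) else 0)"
      unfolding step_def
    proof (rule sum.cong)
      fix j assume j: "j \<in> {..<d}"
      have "e j = e i \<longleftrightarrow> j = i" using e j that(3) by (auto simp: bij_betw_def inj_on_eq_iff)
      then show "B * (2 * c (off + j) - 1) * indicator (Q j) x = (if j = i then B * (2 * c (off + i) - 1) else 0)"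
        using x by (auto simp: Q_def indicator_def)
    qed simp
    then show ?thesis using that(3) by simp
  qed
  have step_out: "step off c x = 0" if "x \<notin> \<Omega>" for off c x
    using that by (simp add: step_def Q_def)
  have step_lim: "(\<lambda>n. step off (cs n) x) \<longlonglongrightarrow> step off c x" if "\<forall>j. (\<lambda>n. cs n j) \<longlonglongrightarrow> c j" for off cs c x
    unfolding step_def using that by (intro tendsto_intros) auto
  define h1 where "h1 c = N1 (step 0 c) (step d c)" for c
  define h2 where "h2 c = N2 (step 0 c) (step d c)" for c
  have hm: "h1 c \<in> borel_measurable borel" "h2 c \<in> borel_measurable borel" for c
    unfolding h1_def h2_def by (intro N_meas step_m)+
  have hb: "\<bar>h1 c x\<bar> \<le> C" "\<bar>h2 c x\<bar> \<le> C" for c x unfolding h1_def h2_def by (rule N_bound)+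
  have "\<exists>u G. P1.EL u G (h1 c)" "\<exists>u G. P2.EL u G (h2 c)" for c
    by (rule P1.EL_exists[OF hm(1) hb(1)], rule P2.EL_exists[OF hm(2) hb(2)])
  then obtain su sG sv sH where sol: "\<And>c. P1.EL (su c) (sG c) (h1 c)" "\<And>c. P2.EL (sv c) (sH c) (h2 c)"
    by metis
  have sW: "P1.W (su c) (sG c)" "P2.W (sv c) (sH c)" for c
    using sol by (auto simp: P1.EL_def P2.EL_def)
  have sK: "P1.rho (sG c) \<le> max K1 K2" "P2.rho (sH c) \<le> max K1 K2" for c
    using K1(2)[rule_format, OF hm(1) hb(1) sol(1)] K2(2)[rule_format, OF hm(2) hb(2) sol(2)] by (auto simp: le_max_iff_disj)
  have avgB: "\<bar>cell_avg k (su c) a\<bar> \<le> B" "\<bar>cell_avg k (sv c) a\<bar> \<le> B" for c a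
    using P1.W_cell_error(2)[OF sW(1) sK(1), of k c a] P2.W_cell_error(2)[OF sW(2) sK(2), of k c a]
    unfolding B_def by linarith+
  \<comment> \<open>The averages of the solutions, scaled back to the unit interval; a fixed point
    says that the step functions are the averages of the solutions they generate.\<close>
  define F where "F c i = (if i < d then cell_avg k (su c) (e i) / B + 1 else cell_avg k (sv c) (e (i - d)) / B + 1) / 2" for c i
  have "\<exists>c. (\<forall>j. 0 \<le> c j \<and> c j \<le> 1) \<and> (\<forall>i<2 * d. F c i = c i)"
  proof (rule brouwer_unit_cube)
    fix c :: "nat \<Rightarrow> real" and i
    have "- 1 \<le> t / B \<and> t / B \<le> 1" if "\<bar>t\<bar> \<le> B" for t
      using that B by (auto simp: field_simps abs_le_iff)
    from this[OF avgB(1)[of c "e i"]] this[OF avgB(2)[of c "e (i - d)"]]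
    show "0 \<le> F c i \<and> F c i \<le> 1" unfolding F_def by auto
  next
    fix cs :: "nat \<Rightarrow> nat \<Rightarrow> real" and c i assume l: "\<forall>j. (\<lambda>n. cs n j) \<longlonglongrightarrow> c j"
    note st = step_m step_m step_m step_m AE_I2[OF step_lim[OF l]] AE_I2[OF step_lim[OF l]]
    have hl: "AE x in lborel. (\<lambda>n. h1 (cs n) x) \<longlonglongrightarrow> h1 c x" "AE x in lborel. (\<lambda>n. h2 (cs n) x) \<longlonglongrightarrow> h2 c x"
      unfolding h1_def h2_def by (rule N_cont(1)[OF st], rule N_cont(2)[OF st])
    have "(\<lambda>n. L1norm (\<lambda>x. su (cs n) x - su c x)) \<longlonglongrightarrow> 0" "(\<lambda>n. L1norm (\<lambda>x. sv (cs n) x - sv c x)) \<longlonglongrightarrow> 0"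
      by (rule P1.EL_stable_AE[OF sol(1) sol(1) hm(1) hb(1) hm(1) hb(1) hl(1)],
          rule P2.EL_stable_AE[OF sol(2) sol(2) hm(2) hb(2) hm(2) hb(2) hl(2)])
    then have "(\<lambda>n. cell_avg k (su (cs n)) a) \<longlonglongrightarrow> cell_avg k (su c) a" "(\<lambda>n. cell_avg k (sv (cs n)) a) \<longlonglongrightarrow> cell_avg k (sv c) a" for a
      by (auto intro!: cell_avg_tendsto P1.WD(1)[OF sW(1)] P2.WD(1)[OF sW(2)])
    then show "(\<lambda>n. F (cs n) i) \<longlonglongrightarrow> F c i"
      unfolding F_def using B by (cases "i < d") (auto intro!: tendsto_intros)
  qed
  then obtain c where c: "\<forall>i<2 * d. F c i = c i" by blast
  have avg: "step 0 c x = cell_avg k (su c) (cell (Suc k) x)" "step d c x = cell_avg k (sv c) (cell (Suc k) x)"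
    if x: "x \<in> \<Omega>" for x
  proof -
    have "cell (Suc k) x \<in> I" using x by (auto simp: I_def)
    then obtain i where i: "i < d" "cell (Suc k) x = e i" using e by (auto simp: bij_betw_def)
    have "(cell_avg k (su c) (e i) / B + 1) / 2 = c i" "(cell_avg k (sv c) (e i) / B + 1) / 2 = c (d + i)"
      using c[rule_format, of i] c[rule_format, of "d + i"] i(1) by (auto simp: F_def)
    moreover have "B * (2 * ((y / B + 1) / 2) - 1) = y" for y using B by (simp add: field_simps)
    ultimately show "step 0 c x = cell_avg k (su c) (cell (Suc k) x)" "step d c x = cell_avg k (sv c) (cell (Suc k) x)"
      using step_in[OF x i(2,1), of 0 c] step_in[OF x i(2,1), of d c] i(2) by (metis add_0)+
  qed
  show ?thesis
    using step_m sol[of c] avg step_out unfolding h1_def h2_def by blast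
qed

text \<open>As the cubes shrink, solutions and their averages acquire common L1 limits. The limits
  are identified by solving the limit problem separately and comparing by stability, so no limit is
  taken inside the flux.\<close>

theorem coupled_solution: "\<exists>u G v H. P1.EL u G (N1 u v) \<and> P2.EL v H (N2 u v)"
proof -
  obtain u G v H U V where UV: "\<And>k. U k \<in> borel_measurable borel" "\<And>k. V k \<in> borel_measurable borel"
    and sol: "\<And>k. P1.EL (u k) (G k) (N1 (U k) (V k))" "\<And>k. P2.EL (v k) (H k) (N2 (U k) (V k))"
    and avg: "\<And>k x. x \<in> \<Omega> \<Longrightarrow> U k x = cell_avg k (u k) (cell (Suc k) x)" "\<And>k x. x \<in> \<Omega> \<Longrightarrow> V k x = cell_avg k (v k) (cell (Suc k) x)"
    and out: "\<And>k x. x \<notin> \<Omega> \<Longrightarrow> U k x = 0" "\<And>k x. x \<notin> \<Omega> \<Longrightarrow> V k x = 0"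
    using discrete_fixed_point by metis
  obtain K1 where K1: "0 \<le> K1" "\<forall>u G g. g \<in> borel_measurable borel \<longrightarrow> (\<forall>x. \<bar>g x\<bar> \<le> C) \<longrightarrow> P1.EL u G g \<longrightarrow> P1.rho G \<le> K1"
    by (rule P1.EL_energy_bound[OF C_nonneg])
  obtain K2 where K2: "0 \<le> K2" "\<forall>u G g. g \<in> borel_measurable borel \<longrightarrow> (\<forall>x. \<bar>g x\<bar> \<le> C) \<longrightarrow> P2.EL u G g \<longrightarrow> P2.rho G \<le> K2"
    by (rule P2.EL_energy_bound[OF C_nonneg])
  note hm = N_meas(1)[OF UV] N_meas(2)[OF UV]
  have W: "P1.W (u k) (G k)" "P2.W (v k) (H k)" for k using sol by (auto simp: P1.EL_def P2.EL_def)
  have GK: "P1.rho (G k) \<le> K1" "P2.rho (H k) \<le> K2" for k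
    using K1(2)[rule_format, OF hm(1) N_bound(1) sol(1)] K2(2)[rule_format, OF hm(2) N_bound(2) sol(2)] by auto
  note ui = P1.WD(1)[OF W(1)] and vi = P2.WD(1)[OF W(2)]
  note Ud = P1.cell_avg_tendsto_L1[OF W(1) GK(1) UV(1) avg(1) out(1)]
  note Vd = P2.cell_avg_tendsto_L1[OF W(2) GK(2) UV(2) avg(2) out(2)]
  obtain r1 u0 where r1: "strict_mono r1" "integrable lborel u0" "(\<lambda>n. L1norm (\<lambda>x. u (r1 n) x - u0 x)) \<longlonglongrightarrow> 0"
    by (rule P1.rellich[OF W(1) GK(1)])
  obtain r2 v0 where r2: "strict_mono r2" "integrable lborel v0" "(\<lambda>n. L1norm (\<lambda>x. v (r1 (r2 n)) x - v0 x)) \<longlonglongrightarrow> 0"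
    by (rule P2.rellich[of "\<lambda>n. v (r1 n)" "\<lambda>n. H (r1 n)", OF W(2) GK(2)])
  define r where "r n = r1 (r2 n)" for n
  have r: "strict_mono r" using r1(1) r2(1) by (simp add: r_def strict_mono_def)
  have l: "(\<lambda>n. L1norm (\<lambda>x. u (r n) x - u0 x)) \<longlonglongrightarrow> 0" "(\<lambda>n. L1norm (\<lambda>x. v (r n) x - v0 x)) \<longlonglongrightarrow> 0"
    "(\<lambda>n. L1norm (\<lambda>x. u (r n) x - U (r n) x)) \<longlonglongrightarrow> 0" "(\<lambda>n. L1norm (\<lambda>x. v (r n) x - V (r n) x)) \<longlonglongrightarrow> 0"
    using LIMSEQ_subseq_LIMSEQ[OF r1(3) r2(1)] r2(3) LIMSEQ_subseq_LIMSEQ[OF Ud(2) r] LIMSEQ_subseq_LIMSEQ[OF Vd(2) r]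
    by (simp_all add: r_def o_def)
  \<comment> \<open>All four errors are collected in one function, so that one subsequence carries
    the almost everywhere convergence of both families of averages.\<close>
  define h where "h n x = (\<bar>u (r n) x - u0 x\<bar> + \<bar>v (r n) x - v0 x\<bar>) + (\<bar>u (r n) x - U (r n) x\<bar> + \<bar>v (r n) x - V (r n) x\<bar>)" for n x
  have i: "integrable lborel (\<lambda>x. \<bar>u (r n) x - u0 x\<bar>)" "integrable lborel (\<lambda>x. \<bar>v (r n) x - v0 x\<bar>)"
    "integrable lborel (\<lambda>x. \<bar>u (r n) x - U (r n) x\<bar>)" "integrable lborel (\<lambda>x. \<bar>v (r n) x - V (r n) x\<bar>)" for n
    using ui vi r1(2) r2(2) Ud(1) Vd(1) by auto
  have hi: "integrable lborel (h n)" for n unfolding h_def by (intro Bochner_Integration.integrable_add i)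
  have h0: "0 \<le> h n x" for n x by (simp add: h_def)
  have "(LBINT x. h n x) = (L1norm (\<lambda>x. u (r n) x - u0 x) + L1norm (\<lambda>x. v (r n) x - v0 x))
     + (L1norm (\<lambda>x. u (r n) x - U (r n) x) + L1norm (\<lambda>x. v (r n) x - V (r n) x))" for n
    unfolding h_def by (simp only: Bochner_Integration.integral_add i Bochner_Integration.integrable_add)
  then have hl: "(\<lambda>n. LBINT x. h n x) \<longlonglongrightarrow> 0"
    using tendsto_add[OF tendsto_add[OF l(1,2)] tendsto_add[OF l(3,4)]] by simp
  obtain s g where s: "strict_mono s" "integrable lborel g"
      "AE x in lborel. (\<forall>k. h (s k) x \<le> g x) \<and> (\<lambda>k. h (s k) x) \<longlonglongrightarrow> 0"
    by (rule dominated_subseq[OF hi h0 hl])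
  define t where "t n = r (s n)" for n
  have UVl: "AE x in lborel. (\<lambda>n. U (t n) x) \<longlonglongrightarrow> u0 x" "AE x in lborel. (\<lambda>n. V (t n) x) \<longlonglongrightarrow> v0 x"
  proof -
    have "(\<lambda>n. U (t n) x) \<longlonglongrightarrow> u0 x \<and> (\<lambda>n. V (t n) x) \<longlonglongrightarrow> v0 x" if "(\<lambda>k. h (s k) x) \<longlonglongrightarrow> 0" for x
    proof
      have "\<bar>U (t n) x - u0 x\<bar> \<le> h (s n) x" "\<bar>V (t n) x - v0 x\<bar> \<le> h (s n) x" for n
        unfolding h_def t_def by linarith+
      then show "(\<lambda>n. U (t n) x) \<longlonglongrightarrow> u0 x" "(\<lambda>n. V (t n) x) \<longlonglongrightarrow> v0 x"
        by (auto intro!: LIM_zero_cancel Lim_null_comparison[OF _ that])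
    qed
    then show "AE x in lborel. (\<lambda>n. U (t n) x) \<longlonglongrightarrow> u0 x" "AE x in lborel. (\<lambda>n. V (t n) x) \<longlonglongrightarrow> v0 x"
      using s(3) by (auto elim: eventually_mono)
  qed
  have m0: "u0 \<in> borel_measurable borel" "v0 \<in> borel_measurable borel"
    using borel_measurable_integrable[OF r1(2)] borel_measurable_integrable[OF r2(2)] by auto
  note Nm0 = N_meas(1)[OF m0] N_meas(2)[OF m0]
  \<comment> \<open>The candidate: the solution whose load is computed from \<open>u0\<close> and
    \<open>v0\<close>. The approximate solutions converge to it as well, and L1 limits are unique up
    to null sets.\<close>
  obtain u' G' where u': "P1.EL u' G' (N1 u0 v0)" using P1.EL_exists[OF Nm0(1) N_bound(1)] by blast
  obtain v' H' where v': "P2.EL v' H' (N2 u0 v0)" using P2.EL_exists[OF Nm0(2) N_bound(2)] by blast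
  have W': "P1.W u' G'" "P2.W v' H'" using u' v' by (auto simp: P1.EL_def P2.EL_def)
  have "(\<lambda>n. L1norm (\<lambda>x. u (t n) x - u' x)) \<longlonglongrightarrow> 0"
    by (rule P1.EL_stable_AE[OF sol(1) u' hm(1) N_bound(1) Nm0(1) N_bound(1) N_cont(1)[OF UV m0 UVl]])
  from L1_limit_unique[of lborel "\<lambda>n. u (t n)", OF ui r1(2) P1.WD(1)[OF W'(1)] _ this]
  have eu: "AE x in lborel. u0 x = u' x" using LIMSEQ_subseq_LIMSEQ[OF l(1) s(1)] by (simp add: t_def o_def)
  have "(\<lambda>n. L1norm (\<lambda>x. v (t n) x - v' x)) \<longlonglongrightarrow> 0"
    by (rule P2.EL_stable_AE[OF sol(2) v' hm(2) N_bound(2) Nm0(2) N_bound(2) N_cont(2)[OF UV m0 UVl]])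
  from L1_limit_unique[of lborel "\<lambda>n. v (t n)", OF vi r2(2) P2.WD(1)[OF W'(2)] _ this]
  have ev: "AE x in lborel. v0 x = v' x" using LIMSEQ_subseq_LIMSEQ[OF l(2) s(1)] by (simp add: t_def o_def)
  note m' = P1.WD(2)[OF W'(1)] P2.WD(2)[OF W'(2)]
  note Nm' = N_meas(1)[OF m'] N_meas(2)[OF m']
  \<comment> \<open>For constant sequences \<open>N_cont\<close> says that the operators respect
    equality almost everywhere.\<close>
  have c': "AE x in lborel. (\<lambda>n::nat. u0 x) \<longlonglongrightarrow> u' x" "AE x in lborel. (\<lambda>n::nat. v0 x) \<longlonglongrightarrow> v' x"
    using eu ev by (auto elim: eventually_mono)
  have eN: "AE x in lborel. N1 u0 v0 x = N1 u' v' x" "AE x in lborel. N2 u0 v0 x = N2 u' v' x"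
    using N_cont(1)[OF m0 m' c'] N_cont(2)[OF m0 m' c'] by (simp_all add: LIMSEQ_const_iff)
  show ?thesis
    using P1.EL_cong[OF u' eN(1) Nm0(1) Nm'(1)] P2.EL_cong[OF v' eN(2) Nm0(2) Nm'(2)] by blast
qed

end

section \<open>The comparison principle\<close>

text \<open>Squaring the positive part removes the corner at 0, which makes it the basic C1 cutoff
  from which the later truncations are built.\<close>

lemma max0_square_derivative:
  "((\<lambda>t::real. (max 0 t)\<^sup>2) has_real_derivative 2 * max 0 t) (at t)"
proof -
  consider "t < 0" | "t = 0" | "0 < t" by linarith
  then show ?thesis
  proof cases
    case 1
    have "((\<lambda>t::real. 0) has_real_derivative 0) (at t)" by simp
    then have "((\<lambda>t::real. (max 0 t)\<^sup>2) has_real_derivative 0) (at t)"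
      by (rule has_field_derivative_transform_within_open[where S="{..<0}"]) (use 1 in auto)
    then show ?thesis using 1 by simp
  next
    case 2
    have "((\<lambda>h. ((max 0 (0 + h))\<^sup>2 - (max 0 0)\<^sup>2) / h) \<longlongrightarrow> 0) (at (0::real))"
    proof (rule Lim_null_comparison[where g="\<lambda>h. \<bar>h\<bar>"])
      show "eventually (\<lambda>h. norm (((max 0 (0 + h))\<^sup>2 - (max 0 0)\<^sup>2) / h) \<le> \<bar>h\<bar>) (at (0::real))"
        by (rule always_eventually) (auto simp: max_def power2_eq_square)
    qed (auto intro!: tendsto_eq_intros)
    then show ?thesis using 2 by (simp add: has_field_derivative_iff)
  next
    case 3
    have "((\<lambda>t::real. t\<^sup>2) has_real_derivative 2 * t) (at t)" by (auto intro!: derivative_eq_intros)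
    then have "((\<lambda>t::real. (max 0 t)\<^sup>2) has_real_derivative 2 * t) (at t)"
      by (rule has_field_derivative_transform_within_open[where S="{0<..}"]) (use 3 in auto)
    then show ?thesis using 3 by simp
  qed
qed

text \<open>\<open>z\<close> itself has no compact support. But where \<open>\<psi>\<close> vanishes
  the composition is \<open>\<beta> (z x)\<close>, which is zero off \<open>K\<close>, so the two
  supports together suffice.\<close>

lemma C1c_compose:
  fixes z :: "'a::euclidean_space \<Rightarrow> real"
  assumes b: "\<And>t. (\<beta> has_real_derivative \<beta>' t) (at t)" "continuous_on UNIV \<beta>'"
    and z: "\<And>x. (z has_derivative (\<lambda>h. Z x \<bullet> h)) (at x)" "continuous_on UNIV Z"
    and K: "compact K" "K \<subseteq> \<Omega>" "\<And>x. x \<notin> K \<Longrightarrow> \<beta> (z x) = 0"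
    and c: "C1c \<Omega> \<psi> D"
  shows "C1c \<Omega> (\<lambda>x. \<beta> (z x + \<sigma> * \<psi> x)) (\<lambda>x. \<beta>' (z x + \<sigma> * \<psi> x) *\<^sub>R (Z x + \<sigma> *\<^sub>R D x))"
proof -
  obtain L where L: "compact L" "L \<subseteq> \<Omega>" "\<forall>x. x \<notin> L \<longrightarrow> \<psi> x = 0" using c by (auto simp: C1c_def)
  have cz: "continuous_on UNIV z"
    by (intro continuous_at_imp_continuous_on ballI has_derivative_continuous[OF z(1)])
  have d: "((\<lambda>x. \<beta> (z x + \<sigma> * \<psi> x)) has_derivative (\<lambda>h. (\<beta>' (z x + \<sigma> * \<psi> x) *\<^sub>R (Z x + \<sigma> *\<^sub>R D x)) \<bullet> h)) (at x)" for x
  proof -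
    have "((\<lambda>x. z x + \<sigma> * \<psi> x) has_derivative (\<lambda>h. Z x \<bullet> h + \<sigma> * (D x \<bullet> h))) (at x)"
      by (intro derivative_intros z(1) C1cD(1)[OF c])
    from has_derivative_compose[OF this b(1)[unfolded has_field_derivative_def]]
    show ?thesis by (simp add: inner_add_left)
  qed
  have e: "continuous_on UNIV (\<lambda>x. \<beta>' (z x + \<sigma> * \<psi> x) *\<^sub>R (Z x + \<sigma> *\<^sub>R D x))"
    by (intro continuous_intros continuous_on_compose2[OF b(2)] cz z(2) C1cD(2,3)[OF c]) auto
  have e0: "\<forall>x. x \<notin> K \<union> L \<longrightarrow> \<beta> (z x + \<sigma> * \<psi> x) = 0" using K(3) L(3) by simp
  have k: "compact (K \<union> L)" "K \<union> L \<subseteq> \<Omega>" using K(1,2) L(1,2) by auto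
  have ex: "\<exists>K. compact K \<and> K \<subseteq> \<Omega> \<and> (\<forall>x. x \<notin> K \<longrightarrow> \<beta> (z x + \<sigma> * \<psi> x) = 0)"
    using k e0 by blast
  show ?thesis unfolding C1c_def by (rule conjI[OF allI[OF d] conjI[OF e ex]])
qed

lemma lipschitz_from_derivative:
  fixes \<beta> :: "real \<Rightarrow> real"
  assumes b: "\<And>t. (\<beta> has_real_derivative \<beta>' t) (at t)" "\<And>t. \<bar>\<beta>' t\<bar> \<le> L"
  shows "\<bar>\<beta> s - \<beta> t\<bar> \<le> L * \<bar>s - t\<bar>"
proof -
  have "norm (\<beta> s - \<beta> t) \<le> L * norm (s - t)"
    by (rule field_differentiable_bound[where S=UNIV and f'=\<beta>'])
       (use b in auto)
  then show ?thesis by simp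
qed

context pspace begin

lemma Lp_dominated:
  fixes F :: "'a \<Rightarrow> 'b::euclidean_space" and H :: "'a \<Rightarrow> 'c::euclidean_space"
  assumes "F \<in> borel_measurable borel" "\<And>x. x \<notin> \<Omega> \<Longrightarrow> F x = 0" "Lp H" "\<And>x. x \<in> \<Omega> \<Longrightarrow> norm (F x) \<le> norm (H x)"
  shows "Lp F"
proof -
  note [measurable] = assms(1)
  have "norm (norm (F x) powr p x) \<le> norm (norm (H x) powr p x)" for x
  proof (cases "x \<in> \<Omega>")
    case True
    then show ?thesis using assms(4)[of x] p_gt_1[of x] by (auto intro!: powr_mono2)
  qed (simp add: assms(2))
  then have "integrable lborel (\<lambda>x. norm (F x) powr p x)"
    by (intro Bochner_Integration.integrable_bound[OF LpD(3)[OF assms(3)]] AE_I2) auto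
  then show ?thesis using assms(1,2) by (simp add: Lp_def)
qed

text \<open>Used to leave the C1 truncations: the approximants of the positive part have gradients
  converging pointwise under a common majorant.\<close>

lemma W_dominated_limit:
  assumes W: "\<And>n. W (u n) (G n)"
    and m: "v \<in> borel_measurable borel" "H \<in> borel_measurable borel" "\<And>x. x \<notin> \<Omega> \<Longrightarrow> v x = 0" "\<And>x. x \<notin> \<Omega> \<Longrightarrow> H x = 0"
    and a: "integrable lborel a" "AE x in lborel. \<forall>n. \<bar>u n x\<bar> \<le> a x \<and> norm (G n x) powr p x \<le> a x"
    and l: "AE x in lborel. (\<lambda>n. u n x) \<longlonglongrightarrow> v x \<and> (\<lambda>n. G n x) \<longlonglongrightarrow> H x"
  shows "W v H"
proof -
  note [measurable] = m(1,2) WD(2)[OF W] WD(6)[OF W]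
  have lim: "AE x in lborel. \<bar>v x\<bar> \<le> a x \<and> norm (H x) powr p x \<le> a x"
    using a(2) l
  proof eventually_elim
    case (elim x)
    have "(\<lambda>n. norm (G n x) powr p x) \<longlonglongrightarrow> norm (H x) powr p x"
      using elim(2) p_gt_1[of x] by (intro tendsto_powr' tendsto_norm) auto
    then have "norm (H x) powr p x \<le> a x" by (rule LIMSEQ_le_const2) (use elim(1) in auto)
    moreover have "\<bar>v x\<bar> \<le> a x"
      by (rule LIMSEQ_le_const2[OF tendsto_rabs[OF conjunct1[OF elim(2)]]]) (use elim(1) in auto)
    ultimately show ?case by simp
  qed
  have vi: "integrable lborel v"
    by (rule Bochner_Integration.integrable_bound[OF a(1)], measurable) (use lim in eventually_elim, auto)
  have "integrable lborel (\<lambda>x. norm (H x) powr p x)"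
    by (rule Bochner_Integration.integrable_bound[OF a(1)], measurable) (use lim in eventually_elim, auto)
  then have HL: "Lp H" using m by (simp add: Lp_def)
  have "(\<lambda>n. L1norm (\<lambda>x. u n x - v x)) \<longlonglongrightarrow> integral\<^sup>L lborel (\<lambda>x::'a. 0)"
  proof (rule integral_dominated_convergence[where w="\<lambda>x. 2 * a x"])
    show "AE x in lborel. norm \<bar>u n x - v x\<bar> \<le> 2 * a x" for n
      using a(2) lim by eventually_elim (auto intro: order_trans[OF abs_triangle_ineq4] add_mono dest: spec[of _ n])
    show "AE x in lborel. (\<lambda>n. \<bar>u n x - v x\<bar>) \<longlonglongrightarrow> 0"
      using l by eventually_elim (auto intro!: tendsto_rabs_zero LIM_zero)
  qed (use a(1) in auto)
  moreover have "(\<lambda>n. rho (\<lambda>x. G n x - H x)) \<longlonglongrightarrow> integral\<^sup>L lborel (\<lambda>x::'a. 0)"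
    unfolding rho_def
  proof (rule integral_dominated_convergence[where w="\<lambda>x. 2 powr pp * (2 * a x)"])
    show "AE x in lborel. norm (norm (G n x - H x) powr p x) \<le> 2 powr pp * (2 * a x)" for n
      using a(2) lim
    proof eventually_elim
      case (elim x)
      have "norm (G n x - H x) powr p x \<le> 2 powr pp * (norm (G n x) powr p x + norm (H x) powr p x)"
        using p_gt_1[of x] p_le_pp by (intro norm_diff_powr_le) auto
      also have "\<dots> \<le> 2 powr pp * (a x + a x)" using elim by (intro mult_left_mono add_mono) auto
      finally show ?case by simp
    qed
    show "AE x in lborel. (\<lambda>n. norm (G n x - H x) powr p x) \<longlonglongrightarrow> 0"
      using l
    proof eventually_elim
      case (elim x)
      have "(\<lambda>n. norm (G n x - H x) powr p x) \<longlonglongrightarrow> 0 powr p x"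
        using elim p_gt_1[of x] by (intro tendsto_powr' tendsto_norm_zero LIM_zero) auto
      then show ?case by simp
    qed
  qed (use a(1) in auto)
  ultimately show ?thesis by (intro W_closed[OF W vi m(1,3) HL]) auto
qed

lemma bounded_on_domain:
  fixes Z :: "'a \<Rightarrow> 'b::real_normed_vector"
  assumes "continuous_on UNIV Z"
  obtains B where "0 \<le> B" "\<forall>x\<in>\<Omega>. norm (Z x) \<le> B"
proof -
  have "compact (closure \<Omega>)" using bounded_domain by (simp add: compact_closure)
  then have "bounded (Z ` closure \<Omega>)"
    using assms by (intro compact_imp_bounded compact_continuous_image) (auto intro: continuous_on_subset)
  then obtain B where "\<forall>y\<in>Z ` closure \<Omega>. norm y \<le> B" unfolding bounded_iff by blast
  then have "\<forall>x\<in>\<Omega>. norm (Z x) \<le> max 0 B" using closure_subset by (fastforce intro: max.coboundedI2)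
  then show thesis using that[of "max 0 B"] by auto
qed

lemma affine_Lp:
  assumes "W u G" "continuous_on UNIV Z"
  shows "Lp (\<lambda>x. indicator \<Omega> x *\<^sub>R (Z x + \<sigma> *\<^sub>R G x))"
proof -
  obtain B where B: "0 \<le> B" "\<forall>x\<in>\<Omega>. norm (Z x) \<le> B" by (rule bounded_on_domain[OF assms(2)])
  have [measurable]: "Z \<in> borel_measurable borel" using assms(2) by (rule borel_measurable_continuous_onI)
  have "Lp (\<lambda>x. indicator \<Omega> x *\<^sub>R Z x)"
    by (rule Lp_bounded[where B=B]) (use B in \<open>auto simp: indicator_def\<close>)
  from Lp_add(1)[OF this Lp_scale[OF WD(4)[OF assms(1)], of \<sigma>]]
  moreover have "(\<lambda>x. indicator \<Omega> x *\<^sub>R Z x + \<sigma> *\<^sub>R G x) = (\<lambda>x. indicator \<Omega> x *\<^sub>R (Z x + \<sigma> *\<^sub>R G x))"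
    using WD(5)[OF assms(1)] by (auto simp: indicator_def fun_eq_iff)
  ultimately show ?thesis by simp
qed

text \<open>Chain rule in the closure. The derivative \<open>\<beta>'\<close> is merely continuous
  and bounded, so the gradients converge by domination and not by a Lipschitz estimate; the
  approximants are returned because their truncated form is used again for
  \<open>W0\<close>.\<close>

lemma W_compose:
  fixes z :: "'a \<Rightarrow> real"
  assumes b: "\<And>t. (\<beta> has_real_derivative \<beta>' t) (at t)" "continuous_on UNIV \<beta>'" "\<And>t. \<bar>\<beta>' t\<bar> \<le> L"
    and z: "\<And>x. (z has_derivative (\<lambda>h. Z x \<bullet> h)) (at x)" "continuous_on UNIV Z"
    and K: "compact K" "K \<subseteq> \<Omega>" "\<And>x. x \<notin> K \<Longrightarrow> \<beta> (z x) = 0"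
    and W: "W u G"
  obtains \<psi> D where "\<forall>n. C1c \<Omega> (\<psi> n) (D n)"
    "(\<lambda>n. L1norm (\<lambda>x. \<beta> (z x + \<sigma> * \<psi> n x) - \<beta> (z x + \<sigma> * u x))) \<longlonglongrightarrow> 0"
    "(\<lambda>n. rho (\<lambda>x. \<beta>' (z x + \<sigma> * \<psi> n x) *\<^sub>R (Z x + \<sigma> *\<^sub>R D n x) - \<beta>' (z x + \<sigma> * u x) *\<^sub>R (Z x + \<sigma> *\<^sub>R G x))) \<longlonglongrightarrow> 0"
    "W (\<lambda>x. \<beta> (z x + \<sigma> * u x)) (\<lambda>x. \<beta>' (z x + \<sigma> * u x) *\<^sub>R (Z x + \<sigma> *\<^sub>R G x))"
proof -
  obtain \<psi> D g where 1: "\<forall>n. C1c \<Omega> (\<psi> n) (D n)" "(\<lambda>n. L1norm (\<lambda>x. \<psi> n x - u x)) \<longlonglongrightarrow> 0"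
    "(\<lambda>n. rho (\<lambda>x. D n x - G x)) \<longlonglongrightarrow> 0" "(\<lambda>n. LBINT x. norm (D n x - G x)) \<longlonglongrightarrow> 0"
    "integrable lborel g"
    "AE x in lborel. (\<forall>n. \<bar>\<psi> n x - u x\<bar> \<le> g x \<and> norm (D n x - G x) powr p x \<le> g x) \<and>
        (\<lambda>n. \<psi> n x) \<longlonglongrightarrow> u x \<and> (\<lambda>n. D n x) \<longlonglongrightarrow> G x"
    by (rule W_approx[OF W])
  have cz: "continuous_on UNIV z"
    by (intro continuous_at_imp_continuous_on ballI has_derivative_continuous[OF z(1)])
  have cb: "continuous_on UNIV \<beta>"
    by (intro continuous_at_imp_continuous_on ballI DERIV_isCont[OF b(1)])
  have L: "0 \<le> L" using b(3)[of 0] by linarith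
  have lip: "\<bar>\<beta> s - \<beta> t\<bar> \<le> L * \<bar>s - t\<bar>" for s t by (rule lipschitz_from_derivative[OF b(1,3)])
  have [measurable]: "z \<in> borel_measurable borel" "Z \<in> borel_measurable borel" "\<beta> \<in> borel_measurable borel" "\<beta>' \<in> borel_measurable borel"
    by (intro borel_measurable_continuous_onI cz z(2) cb b(2))+
  note [measurable] = WD(2)[OF W] WD(6)[OF W] C1cD(4,5)[OF 1(1)[rule_format]]
  have c: "C1c \<Omega> (\<lambda>x. \<beta> (z x + \<sigma> * \<psi> n x)) (\<lambda>x. \<beta>' (z x + \<sigma> * \<psi> n x) *\<^sub>R (Z x + \<sigma> *\<^sub>R D n x))" for n
    by (rule C1c_compose[OF b(1,2) z K 1(1)[rule_format]])
  have c0: "C1c \<Omega> (\<lambda>x. \<beta> (z x)) (\<lambda>x. \<beta>' (z x) *\<^sub>R Z x)"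
    using C1c_compose[OF b(1,2) z K C1c_zero, of 0] by simp
  define F where "F x = indicator \<Omega> x *\<^sub>R (Z x + \<sigma> *\<^sub>R G x)" for x
  have FL: "Lp F" unfolding F_def by (rule affine_Lp[OF W z(2)])
  define v where "v x = \<beta> (z x + \<sigma> * u x)" for x
  define H where "H x = \<beta>' (z x + \<sigma> * u x) *\<^sub>R (Z x + \<sigma> *\<^sub>R G x)" for x
  have vH0: "v x = 0" "H x = 0" if "x \<notin> \<Omega>" for x
    using WD(3,5)[OF W that] C1c_outside[OF c0 that] by (auto simp: v_def H_def)
  have LF: "norm (H x) \<le> norm (L *\<^sub>R F x)" for x
  proof (cases "x \<in> \<Omega>")
    case True
    then show ?thesis using b(3) L by (auto simp: H_def F_def intro!: mult_right_mono)
  qed (simp add: vH0)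
  have Hm: "H \<in> borel_measurable borel" unfolding H_def by measurable
  have HL: "Lp H"
    by (rule Lp_dominated[OF Hm vH0(2) Lp_scale[OF FL, of L] LF])
  have vm: "v \<in> borel_measurable borel" unfolding v_def by measurable
  have vi: "integrable lborel v"
  proof -
    have "integrable lborel (\<lambda>x. L * \<bar>\<sigma>\<bar> * \<bar>u x\<bar> + \<bar>\<beta> (z x)\<bar>)"
      using WD(1)[OF W] C1c_integrable(1)[OF bounded_domain c0] by simp
    moreover have "\<bar>v x\<bar> \<le> L * \<bar>\<sigma>\<bar> * \<bar>u x\<bar> + \<bar>\<beta> (z x)\<bar>" for x
      using lip[of "z x + \<sigma> * u x" "z x"] by (simp add: v_def abs_mult mult.assoc)
    ultimately show ?thesis
      using vm by (intro Bochner_Integration.integrable_bound[where g=v and f="\<lambda>x. L * \<bar>\<sigma>\<bar> * \<bar>u x\<bar> + \<bar>\<beta> (z x)\<bar>"] AE_I2)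
         (auto intro: order_trans[OF _ abs_ge_self])
  qed
  have t1: "(\<lambda>n. L1norm (\<lambda>x. \<beta> (z x + \<sigma> * \<psi> n x) - v x)) \<longlonglongrightarrow> 0"
  proof (rule tendsto_sandwich[OF _ _ tendsto_const])
    show "(\<lambda>n. (L * \<bar>\<sigma>\<bar>) * L1norm (\<lambda>x. \<psi> n x - u x)) \<longlonglongrightarrow> 0" by (rule tendsto_mult_right_zero[OF 1(2)])
    have "L1norm (\<lambda>x. \<beta> (z x + \<sigma> * \<psi> n x) - v x) \<le> (LBINT x. (L * \<bar>\<sigma>\<bar>) * \<bar>\<psi> n x - u x\<bar>)" for n
    proof (rule integral_mono)
      show "integrable lborel (\<lambda>x. \<bar>\<beta> (z x + \<sigma> * \<psi> n x) - v x\<bar>)" using vi C1c_integrable(1)[OF bounded_domain c] by simp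
      show "integrable lborel (\<lambda>x. (L * \<bar>\<sigma>\<bar>) * \<bar>\<psi> n x - u x\<bar>)"
        using WD(1)[OF W] C1c_integrable(1)[OF bounded_domain 1(1)[rule_format]] by simp
      show "\<bar>\<beta> (z x + \<sigma> * \<psi> n x) - v x\<bar> \<le> (L * \<bar>\<sigma>\<bar>) * \<bar>\<psi> n x - u x\<bar>" for x
        using lip[of "z x + \<sigma> * \<psi> n x" "z x + \<sigma> * u x"]
        by (simp add: v_def abs_mult mult.assoc flip: right_diff_distrib)
    qed
    then show "eventually (\<lambda>n. (L1norm (\<lambda>x. \<beta> (z x + \<sigma> * \<psi> n x) - v x)) \<le> (L * \<bar>\<sigma>\<bar>) * L1norm (\<lambda>x. \<psi> n x - u x)) sequentially"
      by simp
  qed simp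
  have t2: "(\<lambda>n. rho (\<lambda>x. \<beta>' (z x + \<sigma> * \<psi> n x) *\<^sub>R (Z x + \<sigma> *\<^sub>R D n x) - H x)) \<longlonglongrightarrow> integral\<^sup>L lborel (\<lambda>x::'a. 0)"
    unfolding rho_def
  proof (rule integral_dominated_convergence[where w="\<lambda>x. 2 powr pp * ((max 1 (L * \<bar>\<sigma>\<bar>)) powr pp * g x + norm ((2 * L) *\<^sub>R F x) powr p x)"])
    show "integrable lborel (\<lambda>x. 2 powr pp * ((max 1 (L * \<bar>\<sigma>\<bar>)) powr pp * g x + norm ((2 * L) *\<^sub>R F x) powr p x))"
      by (intro integrable_mult_right Bochner_Integration.integrable_add 1(5) LpD(3)[OF Lp_scale[OF FL]])
    show "AE x in lborel. norm (norm (\<beta>' (z x + \<sigma> * \<psi> n x) *\<^sub>R (Z x + \<sigma> *\<^sub>R D n x) - H x) powr p x)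
       \<le> 2 powr pp * ((max 1 (L * \<bar>\<sigma>\<bar>)) powr pp * g x + norm ((2 * L) *\<^sub>R F x) powr p x)" for n
      using 1(6)
    proof eventually_elim
      case (elim x)
      have g0: "norm (D n x - G x) powr p x \<le> g x" using elim by blast
      show ?case
      proof (cases "x \<in> \<Omega>")
        case False
        then have "g x \<ge> 0" using g0 powr_ge_zero order_trans by blast
        then show ?thesis by (simp only: C1c_outside(2)[OF c[of n] False] vH0(2)[OF False]) simp
      next
        case True
        define A where "A = \<beta>' (z x + \<sigma> * \<psi> n x) *\<^sub>R (Z x + \<sigma> *\<^sub>R D n x) - H x"
        \<comment> \<open>The first summand carries the error of the approximating gradients,
          dominated by \<open>g\<close>; the second multiplies the fixed field \<open>F\<close> by a
          difference of values of \<open>\<beta>'\<close>, which is at most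
          \<open>2 * L\<close>.\<close>
        have "A = (\<beta>' (z x + \<sigma> * \<psi> n x) * \<sigma>) *\<^sub>R (D n x - G x) + (\<beta>' (z x + \<sigma> * \<psi> n x) - \<beta>' (z x + \<sigma> * u x)) *\<^sub>R F x"
          using True by (simp add: A_def H_def F_def algebra_simps)
        also have "norm \<dots> \<le> (L * \<bar>\<sigma>\<bar>) * norm (D n x - G x) + (2 * L) * norm (F x)"
        proof (rule order_trans[OF norm_triangle_ineq add_mono])
          show "norm ((\<beta>' (z x + \<sigma> * \<psi> n x) * \<sigma>) *\<^sub>R (D n x - G x)) \<le> (L * \<bar>\<sigma>\<bar>) * norm (D n x - G x)"
            using b(3)[of "z x + \<sigma> * \<psi> n x"] by (auto simp: abs_mult intro!: mult_right_mono)
          show "norm ((\<beta>' (z x + \<sigma> * \<psi> n x) - \<beta>' (z x + \<sigma> * u x)) *\<^sub>R F x) \<le> (2 * L) * norm (F x)"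
            using b(3)[of "z x + \<sigma> * \<psi> n x"] b(3)[of "z x + \<sigma> * u x"] by (simp, intro mult_right_mono, linarith, simp)
        qed
        finally have "norm A \<le> (L * \<bar>\<sigma>\<bar>) * norm (D n x - G x) + norm ((2 * L) *\<^sub>R F x)" using L by simp
        then have "norm A powr p x \<le> ((L * \<bar>\<sigma>\<bar>) * norm (D n x - G x) + norm ((2 * L) *\<^sub>R F x)) powr p x"
          using p_gt_1[of x] by (intro powr_mono2) auto
        also have "\<dots> \<le> 2 powr pp * (((L * \<bar>\<sigma>\<bar>) * norm (D n x - G x)) powr p x + norm ((2 * L) *\<^sub>R F x) powr p x)"
          using L p_gt_1[of x] p_le_pp by (intro powr_add_le) auto
        also have "((L * \<bar>\<sigma>\<bar>) * norm (D n x - G x)) powr p x \<le> (max 1 (L * \<bar>\<sigma>\<bar>)) powr pp * g x"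
        proof -
          have "(L * \<bar>\<sigma>\<bar>) powr p x \<le> (max 1 (L * \<bar>\<sigma>\<bar>)) powr p x" using p_gt_1[of x] L by (intro powr_mono2) auto
          also have "\<dots> \<le> (max 1 (L * \<bar>\<sigma>\<bar>)) powr pp" using p_le_pp by (intro powr_mono) auto
          finally show ?thesis using g0 L by (subst powr_mult) (auto intro!: mult_mono)
        qed
        finally show ?thesis by (simp add: A_def)
      qed
    qed
    show "AE x in lborel. (\<lambda>n. norm (\<beta>' (z x + \<sigma> * \<psi> n x) *\<^sub>R (Z x + \<sigma> *\<^sub>R D n x) - H x) powr p x) \<longlonglongrightarrow> 0"
      using 1(6)
    proof eventually_elim
      case (elim x)
      have "isCont \<beta>' (z x + \<sigma> * u x)" using b(2) by (simp add: continuous_on_eq_continuous_at)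
      then have "(\<lambda>n. \<beta>' (z x + \<sigma> * \<psi> n x)) \<longlonglongrightarrow> \<beta>' (z x + \<sigma> * u x)"
        by (rule isCont_tendsto_compose) (intro tendsto_intros, use elim in blast)
      then have "(\<lambda>n. \<beta>' (z x + \<sigma> * \<psi> n x) *\<^sub>R (Z x + \<sigma> *\<^sub>R D n x)) \<longlonglongrightarrow> H x"
        unfolding H_def by (intro tendsto_intros) (use elim in auto)
      then have "(\<lambda>n. norm (\<beta>' (z x + \<sigma> * \<psi> n x) *\<^sub>R (Z x + \<sigma> *\<^sub>R D n x) - H x) powr p x) \<longlonglongrightarrow> 0 powr p x"
        using p_gt_1[of x] by (intro tendsto_powr' tendsto_norm_zero LIM_zero) auto
      then show ?case by simp
    qed
  qed (simp_all add: H_def)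
  have "W v H"
    by (rule W_closed[OF C1c_W[OF c] vi _ vH0(1) HL t1]) (use t2 in \<open>simp_all add: v_def\<close>)
  then show thesis
    using that[OF 1(1) t1[unfolded v_def] _ _] t2 unfolding v_def H_def by simp
qed

text \<open>The approximants \<open>sqrt (max 0 t ^ 2 + e ^ 2) - e\<close> are C1, vanish for
  \<open>t \<le> 0\<close>, lie below \<open>max 0 t\<close>, and have slope at most 1. Vanishing on
  the negative axis is what gives \<open>\<beta> (z x) = 0\<close> off \<open>K\<close>.\<close>

lemma W_positive_part:
  fixes z :: "'a \<Rightarrow> real"
  assumes z: "\<And>x. (z has_derivative (\<lambda>h. Z x \<bullet> h)) (at x)" "continuous_on UNIV Z"
    and K: "compact K" "K \<subseteq> \<Omega>" "\<And>x. x \<notin> K \<Longrightarrow> z x \<le> 0"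
    and W: "W u G"
  shows "W (\<lambda>x. max 0 (z x + \<sigma> * u x)) (\<lambda>x. if 0 < z x + \<sigma> * u x then Z x + \<sigma> *\<^sub>R G x else 0)"
proof -
  define e where "e n = inverse (real (Suc n))" for n
  have e: "0 < e n" for n by (simp add: e_def)
  define q where "q n t = (max 0 t)\<^sup>2 + (e n)\<^sup>2" for n and t :: real
  have q: "0 < q n t" for n t unfolding q_def using e[of n] by (simp add: add_nonneg_pos)
  define \<beta> where "\<beta> n t = sqrt (q n t) - e n" for n t
  define \<beta>' where "\<beta>' n t = max 0 t / sqrt (q n t)" for n t
  have der: "(\<beta> n has_real_derivative \<beta>' n t) (at t)" for n t
  proof -
    have "(q n has_real_derivative 2 * max 0 t) (at t)"
      unfolding q_def[abs_def] using DERIV_add[OF max0_square_derivative[of t] DERIV_const] by simp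
    from DERIV_diff[OF DERIV_chain2[OF DERIV_real_sqrt[OF q[of n t]] this] DERIV_const[of "e n"]]
    have "((\<lambda>t. sqrt (q n t) - e n) has_real_derivative (inverse (sqrt (q n t)) / 2) * (2 * max 0 t)) (at t)" by simp
    then show ?thesis unfolding \<beta>_def[abs_def] \<beta>'_def by (simp add: field_simps)
  qed
  have cb: "continuous_on UNIV (\<beta>' n)" for n
    unfolding \<beta>'_def[abs_def] q_def using q[of n] by (intro continuous_intros) (auto simp: q_def less_imp_neq[symmetric] intro: continuous_on_max)
  have mx: "max 0 t \<le> sqrt (q n t)" "sqrt (q n t) \<le> max 0 t + e n" for n t
  proof -
    show "max 0 t \<le> sqrt (q n t)" unfolding q_def by (rule real_le_rsqrt) simp
    show "sqrt (q n t) \<le> max 0 t + e n" unfolding q_def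
      by (rule real_le_lsqrt) (use e[of n] in \<open>auto simp: power2_sum\<close>)
  qed
  have bb: "\<bar>\<beta>' n t\<bar> \<le> 1" "0 \<le> \<beta> n t" "\<beta> n t \<le> max 0 t" for n t
  proof -
    show "\<bar>\<beta>' n t\<bar> \<le> 1" unfolding \<beta>'_def using mx(1)[of t n] q[of n t] by (simp add: divide_le_eq_1)
    have "e n \<le> sqrt (q n t)" unfolding q_def by (rule real_le_rsqrt) simp
    then show "0 \<le> \<beta> n t" by (simp add: \<beta>_def)
    show "\<beta> n t \<le> max 0 t" using mx(2)[of n t] by (simp add: \<beta>_def)
  qed
  have blim: "(\<lambda>n. \<beta> n t) \<longlonglongrightarrow> max 0 t" "(\<lambda>n. \<beta>' n t) \<longlonglongrightarrow> (if 0 < t then 1 else 0)" for t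
  proof -
    have e0: "e \<longlonglongrightarrow> 0" unfolding e_def[abs_def] by (rule LIMSEQ_inverse_real_of_nat)
    have sq: "(\<lambda>n. sqrt (q n t)) \<longlonglongrightarrow> sqrt ((max 0 t)\<^sup>2 + 0\<^sup>2)"
      unfolding q_def by (intro tendsto_intros e0)
    then have sq': "(\<lambda>n. sqrt (q n t)) \<longlonglongrightarrow> max 0 t" by simp
    show "(\<lambda>n. \<beta> n t) \<longlonglongrightarrow> max 0 t" unfolding \<beta>_def using tendsto_diff[OF sq' e0] by simp
    show "(\<lambda>n. \<beta>' n t) \<longlonglongrightarrow> (if 0 < t then 1 else 0)"
    proof (cases "0 < t")
      case True
      then have "(\<lambda>n. max 0 t / sqrt (q n t)) \<longlonglongrightarrow> max 0 t / max 0 t" by (intro tendsto_divide tendsto_const sq') auto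
      then show ?thesis using True by (simp add: \<beta>'_def)
    qed (simp add: \<beta>'_def)
  qed
  have cz: "continuous_on UNIV z"
    by (intro continuous_at_imp_continuous_on ballI has_derivative_continuous[OF z(1)])
  have [measurable]: "z \<in> borel_measurable borel" "Z \<in> borel_measurable borel"
    by (intro borel_measurable_continuous_onI cz z(2))+
  note [measurable] = WD(2)[OF W] WD(6)[OF W]
  have bz: "\<beta> n (z x) = 0" if "x \<notin> K" for n x
    using K(3)[OF that] bb(2,3)[of n "z x"] by (simp add: max_def split: if_splits)
  have Wn: "W (\<lambda>x. \<beta> n (z x + \<sigma> * u x)) (\<lambda>x. \<beta>' n (z x + \<sigma> * u x) *\<^sub>R (Z x + \<sigma> *\<^sub>R G x))" for n
    by (rule W_compose[OF der cb bb(1) z K(1,2) bz W])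
  obtain B where B: "0 \<le> B" "\<forall>x\<in>\<Omega>. norm (z x) \<le> B" by (rule bounded_on_domain[OF cz])
  define F where "F x = indicator \<Omega> x *\<^sub>R (Z x + \<sigma> *\<^sub>R G x)" for x
  have FL: "Lp F" unfolding F_def by (rule affine_Lp[OF W z(2)])
  have out: "z x \<le> 0" "u x = 0" "\<not> 0 < z x" if "x \<notin> \<Omega>" for x
  proof -
    have "x \<notin> K" using K(2) that by blast
    then show "z x \<le> 0" "u x = 0" "\<not> 0 < z x" using K(3) WD(3)[OF W that] by (auto simp: not_less)
  qed
  show ?thesis
  proof (rule W_dominated_limit[OF Wn, where a="\<lambda>x. (B * indicator \<Omega> x + \<bar>\<sigma>\<bar> * \<bar>u x\<bar>) + norm (F x) powr p x"])
    show "integrable lborel (\<lambda>x. (B * indicator \<Omega> x + \<bar>\<sigma>\<bar> * \<bar>u x\<bar>) + norm (F x) powr p x)"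
      using domain_indicator(1)[of B] WD(1)[OF W] LpD(3)[OF FL] by simp
    show "AE x in lborel. \<forall>n. \<bar>\<beta> n (z x + \<sigma> * u x)\<bar> \<le> (B * indicator \<Omega> x + \<bar>\<sigma>\<bar> * \<bar>u x\<bar>) + norm (F x) powr p x \<and>
        norm (\<beta>' n (z x + \<sigma> * u x) *\<^sub>R (Z x + \<sigma> *\<^sub>R G x)) powr p x \<le> (B * indicator \<Omega> x + \<bar>\<sigma>\<bar> * \<bar>u x\<bar>) + norm (F x) powr p x"
    proof (intro AE_I2 allI conjI)
      fix x n
      have "\<bar>\<beta> n (z x + \<sigma> * u x)\<bar> \<le> max 0 (z x + \<sigma> * u x)" using bb(2,3)[of n "z x + \<sigma> * u x"] by linarith
      also have "\<dots> \<le> B * indicator \<Omega> x + \<bar>\<sigma>\<bar> * \<bar>u x\<bar>"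
      proof (cases "x \<in> \<Omega>")
        case True
        have "\<sigma> * u x \<le> \<bar>\<sigma>\<bar> * \<bar>u x\<bar>" by (metis abs_ge_self abs_mult)
        then show ?thesis using True B by (auto simp: abs_le_iff)
      qed (simp add: out)
      finally show "\<bar>\<beta> n (z x + \<sigma> * u x)\<bar> \<le> (B * indicator \<Omega> x + \<bar>\<sigma>\<bar> * \<bar>u x\<bar>) + norm (F x) powr p x"
        by (smt (verit) powr_ge_zero)
      have "norm (\<beta>' n (z x + \<sigma> * u x) *\<^sub>R (Z x + \<sigma> *\<^sub>R G x)) \<le> norm (F x)"
      proof (cases "x \<in> \<Omega>")
        case True
        then show ?thesis using bb(1)[of n "z x + \<sigma> * u x"] by (simp add: F_def mult_left_le_one_le)
      qed (simp add: out \<beta>'_def)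
      then have "norm (\<beta>' n (z x + \<sigma> * u x) *\<^sub>R (Z x + \<sigma> *\<^sub>R G x)) powr p x \<le> norm (F x) powr p x"
        using p_gt_1[of x] by (intro powr_mono2) auto
      moreover have "0 \<le> B * indicator \<Omega> x + \<bar>\<sigma>\<bar> * \<bar>u x\<bar>" using B(1) by simp
      ultimately show "norm (\<beta>' n (z x + \<sigma> * u x) *\<^sub>R (Z x + \<sigma> *\<^sub>R G x)) powr p x \<le> (B * indicator \<Omega> x + \<bar>\<sigma>\<bar> * \<bar>u x\<bar>) + norm (F x) powr p x"
        by linarith
    qed
    show "AE x in lborel. (\<lambda>n. \<beta> n (z x + \<sigma> * u x)) \<longlonglongrightarrow> max 0 (z x + \<sigma> * u x) \<and>
        (\<lambda>n. \<beta>' n (z x + \<sigma> * u x) *\<^sub>R (Z x + \<sigma> *\<^sub>R G x)) \<longlonglongrightarrow> (if 0 < z x + \<sigma> * u x then Z x + \<sigma> *\<^sub>R G x else 0)"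
    proof (intro AE_I2 conjI blim(1))
      fix x
      show "(\<lambda>n. \<beta>' n (z x + \<sigma> * u x) *\<^sub>R (Z x + \<sigma> *\<^sub>R G x)) \<longlonglongrightarrow> (if 0 < z x + \<sigma> * u x then Z x + \<sigma> *\<^sub>R G x else 0)"
        using tendsto_scaleR[OF blim(2)[of "z x + \<sigma> * u x"] tendsto_const[of "Z x + \<sigma> *\<^sub>R G x"]] by (auto split: if_splits)
    qed
  qed (simp_all add: out)
qed

text \<open>The hypothesis on \<open>\<kappa>\<close> says that \<open>z\<close> solves the equation with right-hand side \<open>\<kappa>\<close> in the distributional sense.\<close>

lemma EL_comparison:
  fixes z :: "'a \<Rightarrow> real"
  assumes z: "\<And>x. (z has_derivative (\<lambda>h. Z x \<bullet> h)) (at x)" "continuous_on UNIV Z"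
    and K: "compact K" "K \<subseteq> \<Omega>" "\<And>x. x \<notin> K \<Longrightarrow> z x \<le> 0"
    and k: "\<kappa> \<in> borel_measurable borel" "\<And>x. \<bar>\<kappa> x\<bar> \<le> M"
      "\<And>\<psi> D. C1c \<Omega> \<psi> D \<Longrightarrow> (LBINT x. Vp (p x) (Z x) \<bullet> D x) = (LBINT x. \<kappa> x * \<psi> x)"
    and EL: "EL u G g" and g: "g \<in> borel_measurable borel" "\<And>x. \<bar>g x\<bar> \<le> C"
    and le: "AE x in lborel. u x < z x \<longrightarrow> \<kappa> x \<le> g x"
  shows "AE x in lborel. z x \<le> u x"
proof -
  have W: "W u G" using EL by (simp add: EL_def)
  \<comment> \<open>The excess of the subsolution over the solution is the test function; its
    gradient \<open>H\<close> is supported where \<open>u < z\<close>.\<close>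
  define \<phi> where "\<phi> x = max 0 (z x - u x)" for x
  define H where "H x = (if u x < z x then Z x - G x else 0)" for x
  have Wp: "W \<phi> H" using W_positive_part[OF z K W, of "-1"] by (simp add: \<phi>_def[abs_def] H_def[abs_def] cong: if_cong)
  \<comment> \<open>\<open>Z\<close> is defined on the whole space and need not vanish off \<Omega>;
    the cut field has a finite modular and agrees with \<open>Z\<close> in every pairing with a test
    gradient.\<close>
  define Y where "Y x = indicator \<Omega> x *\<^sub>R Z x" for x
  obtain B where B: "0 \<le> B" "\<forall>x\<in>\<Omega>. norm (Z x) \<le> B" by (rule bounded_on_domain[OF z(2)])
  have [measurable]: "Z \<in> borel_measurable borel" using z(2) by (rule borel_measurable_continuous_onI)
  have YL: "Lp Y" unfolding Y_def by (rule Lp_bounded[where B=B]) (use B in \<open>auto simp: indicator_def\<close>)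
  have YE: "Vp (p x) (Y x) \<bullet> D x = Vp (p x) (Z x) \<bullet> D x" if "x \<notin> \<Omega> \<longrightarrow> D x = 0" for D x
    using that by (cases "x \<in> \<Omega>") (auto simp: Y_def)
  have Yt: "(LBINT x. Vp (p x) (Y x) \<bullet> H x) = (LBINT x. \<kappa> x * \<phi> x)"
  proof -
    obtain \<psi> D g' where 1: "\<forall>n. C1c \<Omega> (\<psi> n) (D n)" "(\<lambda>n. L1norm (\<lambda>x. \<psi> n x - \<phi> x)) \<longlonglongrightarrow> 0"
      "(\<lambda>n. rho (\<lambda>x. D n x - H x)) \<longlonglongrightarrow> 0" "(\<lambda>n. LBINT x. norm (D n x - H x)) \<longlonglongrightarrow> 0"
      "integrable lborel g'"
      "AE x in lborel. (\<forall>n. \<bar>\<psi> n x - \<phi> x\<bar> \<le> g' x \<and> norm (D n x - H x) powr p x \<le> g' x) \<and>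
          (\<lambda>n. \<psi> n x) \<longlonglongrightarrow> \<phi> x \<and> (\<lambda>n. D n x) \<longlonglongrightarrow> H x"
      by (rule W_approx[OF Wp])
    have "(\<lambda>n. LBINT x. Vp (p x) (Y x) \<bullet> D n x) \<longlonglongrightarrow> (LBINT x. Vp (p x) (Y x) \<bullet> H x)"
      by (rule Vp_pairing_tendsto[OF YL WD(4)[OF Wp] C1c_Lp(1)[OF 1(1)[rule_format]] 1(3)])
    moreover have "(\<lambda>n. LBINT x. \<kappa> x * \<psi> n x) \<longlonglongrightarrow> (LBINT x. \<kappa> x * \<phi> x)"
      by (rule bounded_mult_tendsto[OF k(1,2) WD(1)[OF Wp] C1c_integrable(1)[OF bounded_domain 1(1)[rule_format]] 1(2)])
    moreover have "(LBINT x. Vp (p x) (Y x) \<bullet> D n x) = (LBINT x. \<kappa> x * \<psi> n x)" for n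
    proof -
      have "(\<lambda>x. Vp (p x) (Y x) \<bullet> D n x) = (\<lambda>x. Vp (p x) (Z x) \<bullet> D n x)"
        using C1c_outside(2)[OF 1(1)[rule_format]] by (intro ext YE) blast
      then show ?thesis using k(3)[OF 1(1)[rule_format, of n]] by simp
    qed
    ultimately show ?thesis using LIMSEQ_unique by simp
  qed
  have Gt: "(LBINT x. Vp (p x) (G x) \<bullet> H x) = (LBINT x. g x * \<phi> x)" by (rule EL_test[OF EL g Wp])
  note iY = Vp_pairing(1)[OF YL WD(4)[OF Wp]] and iG = Vp_pairing(1)[OF WD(4)[OF W] WD(4)[OF Wp]]
  note ik = integrable_bounded_mult(1)[OF k(1,2) WD(1)[OF Wp]] and ig = integrable_bounded_mult(1)[OF g WD(1)[OF Wp]]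
  have le0: "(LBINT x. Vp (p x) (Y x) \<bullet> H x - Vp (p x) (G x) \<bullet> H x) \<le> 0"
  proof -
    have "(LBINT x. Vp (p x) (Y x) \<bullet> H x - Vp (p x) (G x) \<bullet> H x) = (LBINT x. \<kappa> x * \<phi> x) - (LBINT x. g x * \<phi> x)"
      unfolding Bochner_Integration.integral_diff[OF iY iG] Yt Gt ..
    also have "\<dots> \<le> 0"
    proof -
      have "(LBINT x. \<kappa> x * \<phi> x) \<le> (LBINT x. g x * \<phi> x)"
      proof (rule integral_mono_AE[OF ik ig])
        show "AE x in lborel. \<kappa> x * \<phi> x \<le> g x * \<phi> x"
          using le
        proof eventually_elim
          case (elim x)
          then show ?case
            by (cases "u x < z x") (auto simp: \<phi>_def max_def intro!: mult_right_mono)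
        qed
      qed
      then show ?thesis by simp
    qed
    finally show ?thesis .
  qed
  have HY: "H x = (if u x < z x then Y x - G x else 0)" for x
  proof (cases "x \<in> \<Omega>")
    case False
    then have "z x \<le> 0" "u x = 0" using K WD(3)[OF W] by auto
    then show ?thesis by (simp add: H_def)
  qed (simp add: H_def Y_def)
  have eq: "Vp (p x) (Y x) \<bullet> H x - Vp (p x) (G x) \<bullet> H x = (if u x < z x then (Vp (p x) (Y x) - Vp (p x) (G x)) \<bullet> (Y x - G x) else 0)" for x
    by (simp add: HY inner_diff_left)
  define A where "A = rho Y + rho G"
  have small: "rho H \<le> \<epsilon> * A" if e: "0 < \<epsilon>" for \<epsilon>
  proof -
    obtain N where N: "0 \<le> N" "\<And>p (a::'a) b. pm \<le> p \<Longrightarrow> p \<le> pp \<Longrightarrow>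
      norm (a - b) powr p \<le> \<epsilon> * (norm a powr p + norm b powr p) + N * ((Vp p a - Vp p b) \<bullet> (a - b))"
      using uniform_monotonicity[OF pm_gt_1 e, where 'a='a and pp=pp] by blast
    have "rho H \<le> (LBINT x. \<epsilon> * (norm (Y x) powr p x + norm (G x) powr p x) + N * (Vp (p x) (Y x) \<bullet> H x - Vp (p x) (G x) \<bullet> H x))"
      unfolding rho_def
    proof (rule integral_mono[OF LpD(3)[OF WD(4)[OF Wp]]])
      show "integrable lborel (\<lambda>x. \<epsilon> * (norm (Y x) powr p x + norm (G x) powr p x) + N * (Vp (p x) (Y x) \<bullet> H x - Vp (p x) (G x) \<bullet> H x))"
        by (intro Bochner_Integration.integrable_add Bochner_Integration.integrable_diff integrable_mult_right iY iG LpD(3) YL WD(4)[OF W])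
      show "norm (H x) powr p x \<le> \<epsilon> * (norm (Y x) powr p x + norm (G x) powr p x) + N * (Vp (p x) (Y x) \<bullet> H x - Vp (p x) (G x) \<bullet> H x)" for x
        unfolding eq using N(2)[OF pm_le_p[of x] p_le_pp[of x], of "Y x" "G x"] e by (auto simp: HY)
    qed
    also have "\<dots> = \<epsilon> * A + N * (LBINT x. Vp (p x) (Y x) \<bullet> H x - Vp (p x) (G x) \<bullet> H x)"
      unfolding A_def rho_def using LpD(3)[OF YL] LpD(3)[OF WD(4)[OF W]] iY iG
      by (subst Bochner_Integration.integral_add) auto
    also have "\<dots> \<le> \<epsilon> * A" using N(1) le0 by (simp add: mult_nonneg_nonpos)
    finally show ?thesis .
  qed
  have "rho H = 0"
  proof (rule ccontr)
    assume "rho H \<noteq> 0"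
    then have r: "0 < rho H" using rho_nonneg[of H] by linarith
    have A: "0 \<le> A" unfolding A_def by simp
    have "rho H \<le> rho H / (2 * (A + 1)) * A" using small[of "rho H / (2 * (A + 1))"] r A by simp
    also have "\<dots> \<le> rho H / 2" using half_fraction_le[OF A, of "rho H"] r by simp
    finally show False using r by simp
  qed
  then have "AE x in lborel. \<phi> x = 0" by (rule W_rho_zero[OF Wp])
  then show ?thesis by eventually_elim (auto simp: \<phi>_def max_def split: if_splits)
qed

lemma EL_nonneg:
  assumes EL: "EL u G g" and g: "g \<in> borel_measurable borel" "\<And>x. \<bar>g x\<bar> \<le> C" "\<And>x. 0 \<le> g x"
  shows "AE x in lborel. 0 \<le> u x"
  by (rule EL_comparison[where z="\<lambda>_. 0" and Z="\<lambda>_. 0" and \<kappa>="\<lambda>_. 0" and K="{}" and M=0, OF _ _ _ _ _ _ _ _ EL g(1,2)])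
    (use g(3) in \<open>auto intro!: has_derivative_eq_rhs[OF has_derivative_const]\<close>)

text \<open>Test with the part of \<open>u\<close> above \<open>\<theta>\<close>. The load vanishes
  there, so the modular of the gradient of this part is zero, and Poincare's inequality removes the
  part itself.\<close>

lemma EL_upper_bound:
  assumes EL: "EL u G g" and g: "g \<in> borel_measurable borel" "\<And>x. \<bar>g x\<bar> \<le> C" and t: "0 < \<theta>"
    and g0: "\<And>x. \<theta> < u x \<Longrightarrow> g x = 0"
  shows "AE x in lborel. u x \<le> \<theta>"
proof -
  have W: "W u G" using EL by (simp add: EL_def)
  have Wp: "W (\<lambda>x. max 0 (- \<theta> + 1 * u x)) (\<lambda>x. if 0 < - \<theta> + 1 * u x then 0 + 1 *\<^sub>R G x else 0)"
    by (rule W_positive_part[where K="{}", OF _ _ _ _ _ W]) (use t in \<open>auto intro!: has_derivative_eq_rhs[OF has_derivative_const]\<close>)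
  define H where "H x = (if 0 < - \<theta> + 1 * u x then 0 + 1 *\<^sub>R G x else 0)" for x
  have "rho H = (LBINT x. Vp (p x) (G x) \<bullet> H x)"
    unfolding rho_def by (rule Bochner_Integration.integral_cong) (auto simp: H_def Vp_inner_self)
  also have "\<dots> = (LBINT x. g x * max 0 (- \<theta> + 1 * u x))"
    unfolding H_def by (rule EL_test[OF EL g Wp])
  also have "\<dots> = integral\<^sup>L lborel (\<lambda>x::'a. 0)"
    by (rule Bochner_Integration.integral_cong) (auto simp: max_def g0)
  finally have "rho H = 0" by simp
  from W_rho_zero[OF Wp] this have "AE x in lborel. max 0 (- \<theta> + 1 * u x) = 0" unfolding H_def by blast
  then show ?thesis by eventually_elim (auto simp: max_def split: if_splits)
qed

end

section \<open>The barrier\<close>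

lemma exp_quadratic_bounds:
  fixes s \<delta> :: real
  assumes "0 < \<delta>" "0 < s"
  shows "exp (- (\<delta> * s)) \<le> 2 / (\<delta>\<^sup>2 * s\<^sup>2)" "exp (- (\<delta> * s)) * s \<le> 1 / \<delta>" "exp (- (\<delta> * s)) * s\<^sup>2 \<le> 2 / \<delta>\<^sup>2"
proof -
  have ds: "0 < \<delta> * s" using assms by simp
  have q: "1 + \<delta> * s + (\<delta> * s)\<^sup>2 / 2 \<le> exp (\<delta> * s)" using exp_lower_Taylor_quadratic[of "\<delta> * s"] ds by simp
  have "(\<delta> * s)\<^sup>2 / 2 \<le> exp (\<delta> * s)" using q ds by linarith
  then have "(\<delta>\<^sup>2 * s\<^sup>2) * exp (- (\<delta> * s)) \<le> 2" by (simp add: exp_minus field_simps power_mult_distrib)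
  then show "exp (- (\<delta> * s)) \<le> 2 / (\<delta>\<^sup>2 * s\<^sup>2)" "exp (- (\<delta> * s)) * s\<^sup>2 \<le> 2 / \<delta>\<^sup>2"
    using assms by (simp_all add: field_simps)
  have "\<delta> * s \<le> exp (\<delta> * s)" using q by (smt (verit) zero_le_power2 divide_nonneg_pos)
  then show "exp (- (\<delta> * s)) * s \<le> 1 / \<delta>" using assms by (simp add: exp_minus field_simps)
qed

lemma has_derivative_norm_diff:
  fixes x x0 :: "'a::euclidean_space"
  assumes "x \<noteq> x0"
  shows "((\<lambda>x. norm (x - x0)) has_derivative (\<lambda>h. ((1 / norm (x - x0)) *\<^sub>R (x - x0)) \<bullet> h)) (at x)"
proof -
  have "((\<lambda>x. x - x0) has_derivative (\<lambda>h. h)) (at x)" by (auto intro!: derivative_eq_intros)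
  moreover have "(norm has_derivative (\<lambda>h. h \<bullet> sgn (x - x0))) (at (x - x0))" using assms by (intro has_derivative_norm) auto
  ultimately have "((\<lambda>x. norm (x - x0)) has_derivative (\<lambda>h. h \<bullet> sgn (x - x0))) (at x)"
    by (rule has_derivative_compose)
  then show ?thesis by (simp add: sgn_div_norm inner_commute divide_inverse)
qed

text \<open>Used where a function is glued to zero: a quadratic bound at the interface spares the
  computation of one-sided limits of derivatives.\<close>

lemma has_derivative_zero_quadratic:
  fixes f :: "'a::real_normed_vector \<Rightarrow> real"
  assumes "f x = 0" "\<And>y. \<bar>f y\<bar> \<le> C * (norm (y - x))\<^sup>2"
  shows "(f has_derivative (\<lambda>h. 0)) (at x)"
proof -
  have "((\<lambda>y. C * norm (y - x)) \<longlongrightarrow> C * norm (x - x)) (at x)" by (intro tendsto_intros)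
  then have "((\<lambda>y. C * norm (y - x)) \<longlongrightarrow> 0) (at x)" by simp
  then have "((\<lambda>y. f y / norm (y - x)) \<longlongrightarrow> 0) (at x)"
  proof (rule Lim_null_comparison[rotated])
    have "norm (f y / norm (y - x)) \<le> C * norm (y - x)" if "y \<noteq> x" for y
      using assms(2)[of y] that by (simp add: power2_eq_square field_simps)
    then show "eventually (\<lambda>y. norm (f y / norm (y - x)) \<le> C * norm (y - x)) (at x)"
      by (auto simp: eventually_at_filter)
  qed
  then show ?thesis unfolding has_derivative_at_within
    by (simp add: assms(1) divide_inverse mult.commute)
qed

text \<open>The radial profile of the barrier is \<open>g = exp (- h)\<close>, extended by zero to \<open>r \<le> r0\<close>. The growth
  \<open>a exp (K r)\<close> beats the logarithmic term produced by the variable exponent; the summand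
  \<open>1 / (r - r0)\<close> makes the extension flat, so that the flux is differentiable everywhere.\<close>

locale barrier = pspace \<Omega> p pm pp
  for \<Omega> :: "'a::euclidean_space set" and p pm pp +
  fixes P :: "'a \<Rightarrow> real" and DP :: "'a \<Rightarrow> 'a" and Lip :: real
    and x0 :: 'a and r0 R c :: real
  assumes P: "\<And>x. x \<in> \<Omega> \<Longrightarrow> (P has_derivative (\<lambda>h. DP x \<bullet> h)) (at x)" "continuous_on \<Omega> DP"
    "\<And>x. x \<in> \<Omega> \<Longrightarrow> norm (DP x) \<le> Lip" "\<And>x. x \<in> \<Omega> \<Longrightarrow> p x = P x"
    and r: "0 < r0" "2 * r0 < R" "cball x0 R \<subseteq> \<Omega>" and c: "0 < c"
begin

text \<open>The value gives \<open>(pm - 1) * Kc = \<bar>Lip\<bar> + 1\<close>: the derivative of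
  the growing part beats its contribution to the logarithmic term by one full copy of that
  part.\<close>

definition Kc :: real where "Kc = (\<bar>Lip\<bar> + 1) / (pm - 1)"
text \<open>The first entry absorbs what the singular summand and the dimension contribute at
  distance at least \<open>2 * r0\<close>; the entry 1 gives positivity; the entry
  \<open>ln (R / c)\<close> makes \<open>R * exp (- Ac)\<close> at most \<open>c\<close>, the
  prescribed height.\<close>

definition Ac :: real where
  "Ac = max ((pm - 1) / r0\<^sup>2 + \<bar>Lip\<bar> / r0 + real DIM('a) / r0) (max 1 (ln (R / c)))"
definition ht :: "real \<Rightarrow> real" where "ht t = Ac * exp (Kc * t) + 1 / (t - r0)"
definition ht' :: "real \<Rightarrow> real" where "ht' t = Ac * Kc * exp (Kc * t) - 1 / (t - r0)\<^sup>2"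
definition g :: "real \<Rightarrow> real" where "g t = (if r0 < t then exp (- ht t) else 0)"
definition G :: "real \<Rightarrow> real" where "G t = integral {0..t} g"
definition z :: "'a \<Rightarrow> real" where "z x = G R - G (norm (x - x0))"
text \<open>The gradient of \<open>z\<close>. The maximum in the denominator excludes division by
  zero at the centre and changes nothing, as \<open>g\<close> vanishes up to radius
  \<open>r0\<close>.\<close>

definition Z :: "'a \<Rightarrow> 'a" where "Z x = - (g (norm (x - x0)) / max r0 (norm (x - x0))) *\<^sub>R (x - x0)"
text \<open>Radial density of the flux, \<open>g powr (p - 1)\<close> divided by the distance to
  \<open>x0\<close>; the flux of \<open>Z\<close> is \<open>- E x\<close> times
  \<open>x - x0\<close>. The exponential form displays the logarithm that the gradient of
  \<open>p\<close> differentiates out.\<close>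

definition E :: "'a \<Rightarrow> real" where
  "E x = (if r0 < norm (x - x0) then exp (- ((p x - 1) * ht (norm (x - x0)) + ln (norm (x - x0)))) else 0)"
definition DE :: "'a \<Rightarrow> 'a" where
  "DE x = (- E x) *\<^sub>R (ht (norm (x - x0)) *\<^sub>R (indicator \<Omega> x *\<^sub>R DP x)
      + (((p x - 1) * ht' (norm (x - x0)) + 1 / norm (x - x0)) / norm (x - x0)) *\<^sub>R (x - x0))"
text \<open>The divergence of \<open>E x\<close> times \<open>x - x0\<close>, that is, minus the
  \<open>p(x)\<close>-Laplacian of \<open>z\<close>. A nonpositive value means that \<open>z\<close>
  is a subsolution for every nonnegative load.\<close>

definition \<kappa> :: "'a \<Rightarrow> real" where
  "\<kappa> x = indicator \<Omega> x * (DE x \<bullet> (x - x0) + real DIM('a) * E x)"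

lemma const_bounds: "0 < Kc" "1 \<le> Ac" "(pm - 1) * Kc = \<bar>Lip\<bar> + 1"
  "(pm - 1) / r0\<^sup>2 + \<bar>Lip\<bar> / r0 + real DIM('a) / r0 \<le> Ac" "ln (R / c) \<le> Ac" "0 < R"
  using pm_gt_1 r by (auto simp: Kc_def Ac_def)

lemma ht_lower: "r0 < t \<Longrightarrow> 1 / (t - r0) \<le> ht t" "r0 < t \<Longrightarrow> Ac \<le> ht t"
proof -
  assume t: "r0 < t"
  have "1 \<le> exp (Kc * t)" using const_bounds(1) t r(1) by simp
  then have "Ac * 1 \<le> Ac * exp (Kc * t)" using const_bounds(2) by (intro mult_left_mono) auto
  moreover have "0 < 1 / (t - r0)" using t by simp
  ultimately show "1 / (t - r0) \<le> ht t" "Ac \<le> ht t" using const_bounds(2) unfolding ht_def by linarith+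
qed

lemma ht_derivative: "r0 < t \<Longrightarrow> (ht has_real_derivative ht' t) (at t)"
  unfolding ht_def[abs_def] ht'_def
  by (auto intro!: derivative_eq_intros simp: power2_eq_square field_simps)

lemma g_nonneg: "0 \<le> g t" by (simp add: g_def)

lemma g_quadratic: "g t \<le> 2 * (t - r0)\<^sup>2"
proof (cases "r0 < t")
  case True
  have "exp (- ht t) \<le> exp (- (1 * (1 / (t - r0))))" using ht_lower(1)[OF True] by simp
  also have "\<dots> \<le> 2 / (1\<^sup>2 * (1 / (t - r0))\<^sup>2)" using True by (intro exp_quadratic_bounds) auto
  finally show ?thesis using True by (simp add: g_def power_divide)
qed (simp add: g_def)

lemma g_continuous: "continuous_on UNIV g"
proof (rule continuous_at_imp_continuous_on, intro ballI)
  fix t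
  consider "t < r0" | "t = r0" | "r0 < t" by linarith
  then show "isCont g t"
  proof cases
    case 1
    have "isCont g t \<longleftrightarrow> isCont (\<lambda>_. 0 :: real) t"
      by (rule isCont_cong) (use eventually_nhds_in_open[of "{..<r0}" t] 1 in \<open>auto simp: g_def elim!: eventually_mono\<close>)
    then show ?thesis by simp
  next
    case 2
    have "(\<lambda>s. 2 * (s - r0)\<^sup>2) \<midarrow>r0\<rightarrow> 2 * (r0 - r0)\<^sup>2" by (intro tendsto_intros)
    then have "(\<lambda>s. 2 * (s - r0)\<^sup>2) \<midarrow>r0\<rightarrow> 0" by simp
    then have "g \<midarrow>r0\<rightarrow> 0"
      by (rule Lim_null_comparison[rotated]) (use g_quadratic g_nonneg in auto)
    then show ?thesis using 2 by (simp add: isCont_def g_def)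
  next
    case 3
    have "isCont g t \<longleftrightarrow> isCont (\<lambda>t. exp (- ht t)) t"
      by (rule isCont_cong) (use eventually_nhds_in_open[of "{r0<..}" t] 3 in \<open>auto simp: g_def elim!: eventually_mono\<close>)
    then show ?thesis using DERIV_isCont[OF ht_derivative[OF 3]] by (auto intro!: continuous_intros)
  qed
qed

lemma g_integrable: "g integrable_on {a..b}"
  using continuous_on_subset[OF g_continuous] by (intro integrable_continuous_real) auto

lemma G_derivative: "0 < t \<Longrightarrow> (G has_real_derivative g t) (at t)"
proof -
  assume t: "0 < t"
  have "(G has_real_derivative g t) (at t within {0..t + 1})"
    unfolding G_def[abs_def]
    by (rule integral_has_real_derivative) (use t continuous_on_subset[OF g_continuous] in auto)
  moreover have "at t within {0..t + 1} = at t" using t by (intro at_within_interior) auto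
  ultimately show ?thesis by simp
qed

lemma G_diff: "0 \<le> s \<Longrightarrow> s \<le> t \<Longrightarrow> G t - G s = integral {s..t} g"
  unfolding G_def using Henstock_Kurzweil_Integration.integral_combine[of 0 s t g] g_integrable by simp

lemma G_mono: "0 \<le> s \<Longrightarrow> s \<le> t \<Longrightarrow> G s \<le> G t"
  using G_diff[of s t] integral_nonneg[OF g_integrable, of s t] g_nonneg by auto

lemma G_zero: "t \<le> r0 \<Longrightarrow> G t = 0"
proof -
  assume "t \<le> r0"
  then have "integral {0..t} g = integral {0..t} (\<lambda>_. 0)"
    by (intro Henstock_Kurzweil_Integration.integral_cong) (auto simp: g_def)
  then show ?thesis by (simp add: G_def)
qed

lemma z_derivative: "(z has_derivative (\<lambda>h. Z x \<bullet> h)) (at x)"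
proof (cases "norm (x - x0) < r0")
  case True
  have "((\<lambda>_. G R) has_derivative (\<lambda>h. 0)) (at x)" by simp
  then have "(z has_derivative (\<lambda>h. 0)) (at x)"
  proof (rule has_derivative_transform_within_open[where s="ball x0 r0"])
    show "x \<in> ball x0 r0" using True by (simp add: dist_norm norm_minus_commute)
    show "G R = z y" if "y \<in> ball x0 r0" for y
      using that G_zero[of "norm (y - x0)"] by (simp add: z_def dist_norm norm_minus_commute)
  qed simp
  moreover have "Z x = 0" using True by (simp add: Z_def g_def)
  ultimately show ?thesis by (simp add: has_derivative_eq_rhs)
next
  case False
  then have pos: "0 < norm (x - x0)" "x \<noteq> x0" and mx: "max r0 (norm (x - x0)) = norm (x - x0)" using r(1) by auto
  have "((\<lambda>x. G (norm (x - x0))) has_derivative (\<lambda>h. g (norm (x - x0)) * (((1 / norm (x - x0)) *\<^sub>R (x - x0)) \<bullet> h))) (at x)"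
    using has_derivative_compose[OF has_derivative_norm_diff[OF pos(2)] G_derivative[OF pos(1), unfolded has_field_derivative_def]] .
  from has_derivative_diff[OF has_derivative_const this]
  have "(z has_derivative (\<lambda>h. 0 - g (norm (x - x0)) * (((1 / norm (x - x0)) *\<^sub>R (x - x0)) \<bullet> h))) (at x)"
    unfolding z_def[abs_def] .
  then show ?thesis unfolding Z_def mx by (simp add: has_derivative_eq_rhs)
qed

lemma Z_continuous: "continuous_on UNIV Z"
  unfolding Z_def[abs_def]
  by (intro continuous_intros continuous_on_compose2[OF g_continuous]) (use r(1) in \<open>auto simp: max_def\<close>)

text \<open>The slope never exceeds \<open>exp (- Ac)\<close>, so the total drop over a radius
  \<open>R\<close> is at most \<open>R * exp (- Ac)\<close>, which \<open>Ac\<close> keeps below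
  \<open>c\<close>.\<close>

lemma z_le: "z x \<le> c"
proof -
  have "G R \<le> integral {0..R} (\<lambda>_. exp (- Ac))"
    unfolding G_def
  proof (rule integral_le[OF g_integrable])
    show "g t \<le> exp (- Ac)" for t using ht_lower(2)[of t] by (simp add: g_def)
  qed auto
  also have "\<dots> = R * exp (- Ac)" using const_bounds(6) by simp
  also have "\<dots> \<le> R * exp (- ln (R / c))" using const_bounds(5,6) by (intro mult_left_mono) auto
  also have "\<dots> = c" using const_bounds(6) c by (simp add: exp_minus)
  finally show ?thesis using G_mono[of 0 "norm (x - x0)"] G_zero[of 0] r(1) by (simp add: z_def)
qed

lemma z_pos: "norm (x - x0) < R \<Longrightarrow> 0 < z x"
proof -
  assume x: "norm (x - x0) < R"
  define s where "s = max r0 (norm (x - x0))"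
  have s: "s < R" "0 < s" "r0 \<le> s" "norm (x - x0) \<le> s" using x r by (auto simp: s_def)
  have "\<exists>t>s. t < R \<and> G R - G s = (R - s) * g t"
    by (rule MVT2) (use s G_derivative in auto)
  then obtain t where t: "s < t" "t < R" "G R - G s = (R - s) * g t" by blast
  have "0 < g t" using t(1) s(3) by (simp add: g_def)
  then have "0 < G R - G s" using t s by simp
  then show ?thesis using G_mono[OF _ s(4)] by (simp add: z_def)
qed

lemma z_nonpos: "R \<le> norm (x - x0) \<Longrightarrow> z x \<le> 0"
  using G_mono[of R "norm (x - x0)"] const_bounds(6) by (simp add: z_def)

lemma E_upper:
  assumes "r0 < norm (x - x0)"
  shows "E x \<le> exp (- ((pm - 1) * (1 / (norm (x - x0) - r0)))) / r0" "0 < E x"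
proof -
  define t where "t = norm (x - x0)"
  have t: "r0 < t" "0 < t" using assms r(1) by (auto simp: t_def)
  have "(pm - 1) * (1 / (t - r0)) \<le> (p x - 1) * ht t"
    using pm_le_p[of x] pm_gt_1 ht_lower(1)[OF t(1)] t by (intro mult_mono) auto
  moreover have "ln r0 \<le> ln t" using t r(1) by simp
  ultimately have "exp (- ((p x - 1) * ht t + ln t)) \<le> exp (- ((pm - 1) * (1 / (t - r0))) - ln r0)" by simp
  also have "\<dots> = exp (- ((pm - 1) * (1 / (t - r0)))) / r0" using r(1) by (simp add: exp_diff)
  finally show "E x \<le> exp (- ((pm - 1) * (1 / (norm (x - x0) - r0)))) / r0"
    using assms by (simp add: E_def t_def)
  show "0 < E x" using assms by (simp add: E_def)
qed

lemma E_quadratic: "\<bar>E x\<bar> \<le> 2 / ((pm - 1)\<^sup>2 * r0) * (norm (x - x0) - r0)\<^sup>2"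
proof (cases "r0 < norm (x - x0)")
  case True
  define s where "s = 1 / (norm (x - x0) - r0)"
  have s: "0 < s" using True by (simp add: s_def)
  have "E x \<le> (2 / ((pm - 1)\<^sup>2 * s\<^sup>2)) / r0"
    using E_upper(1)[OF True] exp_quadratic_bounds(1)[of "pm - 1" s] s pm_gt_1 r(1)
    unfolding s_def[symmetric] by (meson diff_gt_0_iff_gt divide_right_mono less_imp_le order_trans)
  also have "\<dots> = 2 / ((pm - 1)\<^sup>2 * r0) * (norm (x - x0) - r0)\<^sup>2"
    by (simp add: s_def power_divide)
  finally show ?thesis using E_upper(2)[OF True] by simp
qed (use r(1) in \<open>auto simp: E_def intro!: divide_nonneg_nonneg mult_nonneg_nonneg\<close>)

text \<open>Up to radius \<open>r0\<close> the quadratic bound gives derivative zero, also on the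
  sphere itself. Beyond it the formula is differentiated after replacing \<open>p\<close> by the
  differentiable \<open>P\<close>, which agrees with it only inside \<Omega>.\<close>

lemma E_derivative:
  assumes x: "x \<in> \<Omega>"
  shows "(E has_derivative (\<lambda>h. DE x \<bullet> h)) (at x)"
proof -
  consider "norm (x - x0) \<le> r0" | "r0 < norm (x - x0)" by linarith
  then show ?thesis
  proof cases
    case 1
    have E0: "E x = 0" using 1 by (simp add: E_def)
    have "\<bar>E y\<bar> \<le> 2 / ((pm - 1)\<^sup>2 * r0) * (norm (y - x))\<^sup>2" for y
    proof (cases "r0 < norm (y - x0)")
      case True
      have "norm (y - x0) - r0 \<le> norm (y - x)" using 1 norm_triangle_ineq[of "y - x" "x - x0"] by simp
      then have "(norm (y - x0) - r0)\<^sup>2 \<le> (norm (y - x))\<^sup>2" using True by (intro power_mono) auto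
      then have "2 / ((pm - 1)\<^sup>2 * r0) * (norm (y - x0) - r0)\<^sup>2 \<le> 2 / ((pm - 1)\<^sup>2 * r0) * (norm (y - x))\<^sup>2"
        using r(1) by (intro mult_left_mono) auto
      then show ?thesis using E_quadratic[of y] by linarith
    qed (use r(1) in \<open>simp add: E_def\<close>)
    from has_derivative_zero_quadratic[OF E0 this]
    show ?thesis using E0 by (simp add: DE_def has_derivative_eq_rhs)
  next
    case 2
    define t where "t = norm (x - x0)"
    have t: "r0 < t" "0 < t" "x \<noteq> x0" using 2 r(1) by (auto simp: t_def)
    define S where "S = \<Omega> \<inter> {y. r0 < norm (y - x0)}"
    have S: "open S" "x \<in> S" unfolding S_def using open_domain x 2
      by (auto intro!: open_Int open_Collect_less continuous_intros)
    note dn = has_derivative_norm_diff[OF t(3), folded t_def]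
    have dh: "((\<lambda>y. ht (norm (y - x0))) has_derivative (\<lambda>h. ht' t * (((1 / t) *\<^sub>R (x - x0)) \<bullet> h))) (at x)"
    proof -
      have "(ht has_derivative (*) (ht' t)) (at (norm (x - x0)))"
        using ht_derivative[OF t(1), unfolded has_field_derivative_def] by (simp add: t_def)
      from has_derivative_compose[OF dn this] show ?thesis .
    qed
    have dl: "((\<lambda>y. ln (norm (y - x0))) has_derivative (\<lambda>h. inverse t * (((1 / t) *\<^sub>R (x - x0)) \<bullet> h))) (at x)"
    proof -
      have "(ln has_derivative (*) (inverse t)) (at (norm (x - x0)))"
        using DERIV_ln[OF t(2), unfolded has_field_derivative_def] by (simp add: t_def)
      from has_derivative_compose[OF dn this] show ?thesis .
    qed
    have dq: "((\<lambda>y. (P y - 1) * ht (norm (y - x0)) + ln (norm (y - x0))) has_derivative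
       (\<lambda>h. ((P x - 1) * (ht' t * (((1 / t) *\<^sub>R (x - x0)) \<bullet> h)) + (DP x \<bullet> h - 0) * ht t) + inverse t * (((1 / t) *\<^sub>R (x - x0)) \<bullet> h))) (at x)"
      unfolding t_def by (intro has_derivative_add has_derivative_mult has_derivative_diff P(1)[OF x] has_derivative_const dh[unfolded t_def] dl[unfolded t_def])
    have dE: "((\<lambda>y. exp (- ((P y - 1) * ht (norm (y - x0)) + ln (norm (y - x0))))) has_derivative
       (\<lambda>h. exp (- ((P x - 1) * ht t + ln t)) * - (((P x - 1) * (ht' t * (((1 / t) *\<^sub>R (x - x0)) \<bullet> h)) + (DP x \<bullet> h - 0) * ht t) + inverse t * (((1 / t) *\<^sub>R (x - x0)) \<bullet> h)))) (at x)"
      using has_derivative_compose[OF has_derivative_minus[OF dq] DERIV_exp[unfolded has_field_derivative_def]] by (simp add: t_def)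
    have dEE: "(E has_derivative
       (\<lambda>h. exp (- ((P x - 1) * ht t + ln t)) * - (((P x - 1) * (ht' t * (((1 / t) *\<^sub>R (x - x0)) \<bullet> h)) + (DP x \<bullet> h - 0) * ht t) + inverse t * (((1 / t) *\<^sub>R (x - x0)) \<bullet> h)))) (at x)"
      by (rule has_derivative_transform_within_open[OF dE S]) (auto simp: E_def S_def P(4))
    have eE: "exp (- ((P x - 1) * ht t + ln t)) = E x" using 2 x by (simp add: E_def t_def P(4))
    show ?thesis
    proof (rule has_derivative_eq_rhs[OF dEE], intro ext)
      fix h
      show "exp (- ((P x - 1) * ht t + ln t)) * - (((P x - 1) * (ht' t * (((1 / t) *\<^sub>R (x - x0)) \<bullet> h)) + (DP x \<bullet> h - 0) * ht t) + inverse t * (((1 / t) *\<^sub>R (x - x0)) \<bullet> h)) = DE x \<bullet> h"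
        unfolding eE DE_def t_def[symmetric] using x t
        by (simp add: P(4) inner_add_left add_divide_distrib divide_inverse) (simp add: algebra_simps)
    qed
  qed
qed

lemma domain_radius: obtains d where "0 \<le> d" "\<forall>x\<in>\<Omega>. norm (x - x0) \<le> d"
proof -
  have "norm (x - x0) \<le> radius + norm x0" if "x \<in> \<Omega>" for x
    using radius(2) that norm_triangle_ineq4[of x x0] by (auto simp: subset_iff)
  then show thesis using that[of "radius + norm x0"] radius(1) by auto
qed

text \<open>With \<open>s = 1 / (t - r0)\<close> the profile and its derivative grow like
  \<open>s\<close> and the square of \<open>s\<close> near the inner sphere, while \<open>E\<close>
  carries \<open>exp (- ((pm - 1) * s))\<close>. All three products stay bounded.\<close>

lemma DE_bounded: obtains M where "0 \<le> M" "\<forall>x\<in>\<Omega>. norm (DE x) \<le> M" "\<forall>x. \<bar>E x\<bar> \<le> M"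
proof -
  obtain d where d: "0 \<le> d" "\<forall>x\<in>\<Omega>. norm (x - x0) \<le> d" by (rule domain_radius)
  define \<delta> where "\<delta> = pm - 1"
  have del: "0 < \<delta>" using pm_gt_1 by (simp add: \<delta>_def)
  define A where "A = Ac * exp (Kc * d)"
  have A0: "0 \<le> A" using const_bounds(2) by (simp add: A_def)
  define M where "M = ((A * \<bar>Lip\<bar> + pp * (Kc * A) + 1 / r0) + \<bar>Lip\<bar> * (1 / \<delta>) + pp * (2 / \<delta>\<^sup>2)) / r0"
  have M0: "0 \<le> M" using A0 del const_bounds(1) pp_gt_1 r(1) by (auto simp: M_def intro!: divide_nonneg_pos add_nonneg_nonneg mult_nonneg_nonneg)
  have "norm (DE x) \<le> M" if x: "x \<in> \<Omega>" for x
  proof (cases "r0 < norm (x - x0)")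
    case False
    then show ?thesis using M0 by (simp add: DE_def E_def)
  next
    case True
    define t where "t = norm (x - x0)"
    define s where "s = 1 / (t - r0)"
    have t: "r0 < t" "0 < t" "t \<le> d" and s: "0 < s" using True r(1) d(2) x by (auto simp: t_def s_def)
    have H0: "Ac * exp (Kc * t) \<le> A" "0 \<le> Ac * exp (Kc * t)" unfolding A_def using const_bounds(1,2) t by (auto intro!: mult_left_mono)
    have hb: "\<bar>ht t\<bar> \<le> A + s" unfolding ht_def s_def[symmetric] using H0 s by linarith
    have "Kc * (Ac * exp (Kc * t)) \<le> Kc * A" "0 \<le> Kc * (Ac * exp (Kc * t))"
      using H0 const_bounds(1) by (auto intro!: mult_left_mono mult_nonneg_nonneg)
    moreover have "1 / (t - r0)\<^sup>2 = s\<^sup>2" by (simp add: s_def power_divide)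
    then have "ht' t = Kc * (Ac * exp (Kc * t)) - s\<^sup>2" by (simp add: ht'_def)
    ultimately have hb': "\<bar>ht' t\<bar> \<le> Kc * A + s\<^sup>2" using zero_le_power2[of s] by linarith
    have p1: "0 < p x - 1" "p x - 1 \<le> pp" using p_gt_1[of x] p_le_pp[of x] by auto
    have n1: "norm (ht t *\<^sub>R (indicator \<Omega> x *\<^sub>R DP x)) \<le> (A + s) * \<bar>Lip\<bar>"
      using hb P(3)[OF x] x by (auto intro!: mult_mono)
    have n2: "norm ((((p x - 1) * ht' t + 1 / t) / t) *\<^sub>R (x - x0)) \<le> pp * (Kc * A + s\<^sup>2) + 1 / r0"
    proof -
      have "norm ((((p x - 1) * ht' t + 1 / t) / t) *\<^sub>R (x - x0)) = \<bar>(p x - 1) * ht' t + 1 / t\<bar>"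
        using t by (simp add: t_def[symmetric])
      also have "\<dots> \<le> (p x - 1) * \<bar>ht' t\<bar> + 1 / t" using t p1 abs_triangle_ineq[of "(p x - 1) * ht' t" "1 / t"] by (simp add: abs_mult)
      also have "\<dots> \<le> pp * (Kc * A + s\<^sup>2) + 1 / r0"
        using p1 hb' t r(1) by (intro add_mono mult_mono divide_left_mono) auto
      finally show ?thesis .
    qed
    define e where "e = exp (- (\<delta> * s))"
    have e: "E x \<le> e / r0" "0 < E x" "e \<le> 1" "0 < e" using E_upper[OF True] s del by (auto simp: e_def s_def t_def \<delta>_def)
    have "norm (DE x) = E x * norm (ht t *\<^sub>R (indicator \<Omega> x *\<^sub>R DP x) + (((p x - 1) * ht' t + 1 / t) / t) *\<^sub>R (x - x0))"
      unfolding DE_def t_def[symmetric] using e by simp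
    also have "\<dots> \<le> (e / r0) * ((A + s) * \<bar>Lip\<bar> + (pp * (Kc * A + s\<^sup>2) + 1 / r0))"
      using e by (intro mult_mono order_trans[OF norm_triangle_ineq add_mono[OF n1 n2]]) auto
    also have "\<dots> = (e * (A * \<bar>Lip\<bar> + pp * (Kc * A) + 1 / r0) + \<bar>Lip\<bar> * (e * s) + pp * (e * s\<^sup>2)) / r0"
      by (simp add: algebra_simps add_divide_distrib)
    also have "\<dots> \<le> M" unfolding M_def
    proof (intro divide_right_mono add_mono mult_left_mono)
      have "0 \<le> A * \<bar>Lip\<bar> + pp * (Kc * A) + 1 / r0" using A0 const_bounds(1) pp_gt_1 r(1) by (intro add_nonneg_nonneg mult_nonneg_nonneg) auto
      then show "e * (A * \<bar>Lip\<bar> + pp * (Kc * A) + 1 / r0) \<le> A * \<bar>Lip\<bar> + pp * (Kc * A) + 1 / r0"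
        using e by (intro mult_left_le_one_le) auto
      show "e * s \<le> 1 / \<delta>" "e * s\<^sup>2 \<le> 2 / \<delta>\<^sup>2" unfolding e_def by (rule exp_quadratic_bounds(2)[OF del s], rule exp_quadratic_bounds(3)[OF del s])
    qed (use r(1) pp_gt_1 in auto)
    finally show ?thesis .
  qed
  moreover have "\<bar>E x\<bar> \<le> 1 / r0" for x
  proof (cases "r0 < norm (x - x0)")
    case True
    have "exp (- ((pm - 1) * (1 / (norm (x - x0) - r0)))) / r0 \<le> 1 / r0"
      using True pm_gt_1 r(1) by (intro divide_right_mono) auto
    then show ?thesis using E_upper[OF True] by simp
  qed (use r(1) in \<open>simp add: E_def\<close>)
  ultimately show thesis using that[of "max M (1 / r0)"] M0 by (auto simp: le_max_iff_disj)
qed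

lemma Vp_Z: "Vp (p x) (Z x) = (- E x) *\<^sub>R (x - x0)"
proof (cases "r0 < norm (x - x0)")
  case True
  define t where "t = norm (x - x0)"
  have t: "r0 < t" "0 < t" "max r0 t = t" using True r(1) by (auto simp: t_def)
  have nZ: "norm (Z x) = exp (- ht t)" unfolding Z_def t_def[symmetric] using t by (simp add: t_def[symmetric] g_def)
  have "exp (- ht t) powr (p x - 2) * (exp (- ht t) / t) = E x"
  proof -
    have "- ((p x - 1) * ht t + ln t) = - ((p x - 2) * ht t) + (- ht t + - ln t)" by (simp add: algebra_simps)
    then have "E x = exp (- ((p x - 2) * ht t)) * (exp (- ht t) * exp (- ln t))"
      using True by (simp only: E_def t_def[symmetric] if_True exp_add)
    moreover have "exp (- ln t) = 1 / t" using t by (simp add: exp_minus inverse_eq_divide)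
    moreover have "exp (- ht t) powr (p x - 2) = exp (- ((p x - 2) * ht t))" by (simp add: powr_def)
    ultimately show ?thesis by simp
  qed
  then show ?thesis unfolding Vp_def nZ unfolding Z_def t_def[symmetric] t(3) using t by (simp add: g_def)
qed (simp add: Z_def g_def E_def)

lemma E_measurable [measurable]: "E \<in> borel_measurable borel"
  unfolding E_def[abs_def] ht_def by measurable

lemma DE_measurable [measurable]: "DE \<in> borel_measurable borel"
proof -
  have [measurable]: "(\<lambda>x. indicator \<Omega> x *\<^sub>R DP x) \<in> borel_measurable borel"
    by (rule borel_measurable_continuous_on_indicator[OF domain_measurable P(2)])
  show ?thesis unfolding DE_def[abs_def] ht_def ht'_def by measurable
qed

lemma kappa_bounded: obtains M where "0 \<le> M" "\<forall>x. \<bar>\<kappa> x\<bar> \<le> M"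
proof -
  obtain d where d: "0 \<le> d" "\<forall>x\<in>\<Omega>. norm (x - x0) \<le> d" by (rule domain_radius)
  obtain M where M: "0 \<le> M" "\<forall>x\<in>\<Omega>. norm (DE x) \<le> M" "\<forall>x. \<bar>E x\<bar> \<le> M" by (rule DE_bounded)
  have "\<bar>\<kappa> x\<bar> \<le> M * d + real DIM('a) * M" for x
  proof (cases "x \<in> \<Omega>")
    case True
    have "\<bar>DE x \<bullet> (x - x0)\<bar> \<le> norm (DE x) * norm (x - x0)" by (rule Cauchy_Schwarz_ineq2)
    also have "\<dots> \<le> M * d" using M d True by (intro mult_mono) auto
    finally have 1: "\<bar>DE x \<bullet> (x - x0)\<bar> \<le> M * d" .
    have 2: "\<bar>real DIM('a) * E x\<bar> \<le> real DIM('a) * M" using M(3) by (simp add: abs_mult mult_left_mono)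
    show ?thesis using True 1 2 abs_triangle_ineq[of "DE x \<bullet> (x - x0)" "real DIM('a) * E x"] by (simp add: \<kappa>_def)
  qed (use M d in \<open>simp add: \<kappa>_def\<close>)
  moreover have "0 \<le> M * d + real DIM('a) * M" using M d by simp
  ultimately show thesis using that by blast
qed

lemma kappa_measurable: "\<kappa> \<in> borel_measurable borel"
  unfolding \<kappa>_def[abs_def] by measurable

text \<open>Divided by \<open>E\<close>, the claim is that \<open>(p x - 1) * ht' * t\<close>
  outweighs the dimension and the term from the gradient of \<open>p\<close>, which is at most
  \<open>\<bar>Lip\<bar> * ht * t\<close>. The estimate \<open>key\<close> gives this with
  \<open>pm\<close> in place of \<open>p x\<close>; nonnegativity of \<open>ht'\<close> permits the
  replacement.\<close>

lemma kappa_nonpos: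
  assumes "2 * r0 \<le> norm (x - x0)"
  shows "\<kappa> x \<le> 0"
proof (cases "x \<in> \<Omega>")
  case x: True
  define t where "t = norm (x - x0)"
  have t: "2 * r0 \<le> t" "r0 < t" "0 < t" using assms r(1) by (auto simp: t_def)
  have E: "0 < E x" using E_upper(2)[of x] t by (simp add: t_def)
  define H0 where "H0 = Ac * exp (Kc * t)"
  define s where "s = 1 / (t - r0)"
  have H0: "Ac \<le> H0" using const_bounds(1,2) t unfolding H0_def by simp
  have s: "0 < s" "s \<le> 1 / r0" using t r(1) by (auto simp: s_def intro!: divide_left_mono)
  have s2: "s\<^sup>2 \<le> 1 / r0\<^sup>2" using power_mono[OF s(2), of 2] s(1) by (simp add: power_divide)
  have hh: "ht t = H0 + s" "ht' t = Kc * H0 - s\<^sup>2" by (simp_all add: ht_def ht'_def H0_def s_def power_divide)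
  have ht0: "0 \<le> ht t" using H0 const_bounds(2) s by (simp add: hh)
  have key: "\<bar>Lip\<bar> * ht t + real DIM('a) / r0 \<le> (pm - 1) * ht' t"
  proof -
    have "\<bar>Lip\<bar> * s \<le> \<bar>Lip\<bar> / r0" using mult_left_mono[OF s(2), of "\<bar>Lip\<bar>"] by simp
    moreover have "(pm - 1) * s\<^sup>2 \<le> (pm - 1) / r0\<^sup>2" using mult_left_mono[OF s2, of "pm - 1"] pm_gt_1 by simp
    moreover have "(pm - 1) * (Kc * H0) = \<bar>Lip\<bar> * H0 + H0" using const_bounds(3) by (simp add: mult.assoc[symmetric] distrib_right)
    ultimately show ?thesis using const_bounds(4) H0 unfolding hh by (simp add: right_diff_distrib distrib_left)
  qed
  have h'0: "0 \<le> ht' t"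
  proof -
    have "0 \<le> \<bar>Lip\<bar> * ht t + real DIM('a) / r0" using ht0 r(1) by simp
    then have "0 \<le> (pm - 1) * ht' t" using key by linarith
    then show ?thesis using pm_gt_1 by (simp add: zero_le_mult_iff)
  qed
  define y where "y = x - x0"
  have ny: "norm y = t" by (simp add: t_def y_def)
  have yy: "y \<bullet> y = t * t" by (simp add: t_def y_def dot_square_norm power2_eq_square)
  have "\<kappa> x = E x * (real DIM('a) - (ht t * (DP x \<bullet> (x - x0)) + ((p x - 1) * ht' t + 1 / t) * t))"
    unfolding \<kappa>_def DE_def t_def[symmetric] y_def[symmetric] using x t
    by (simp add: y_def[symmetric] ny inner_add_left inner_diff_left yy field_simps)
  also have "\<dots> \<le> E x * 0"
  proof (intro mult_left_mono)
    have "\<bar>DP x \<bullet> (x - x0)\<bar> \<le> \<bar>Lip\<bar> * t"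
    proof (rule order_trans[OF Cauchy_Schwarz_ineq2])
      show "norm (DP x) * norm (x - x0) \<le> \<bar>Lip\<bar> * t"
        unfolding t_def using P(3)[OF x] by (intro mult_right_mono) auto
    qed
    then have "- (\<bar>Lip\<bar> * t) \<le> DP x \<bullet> (x - x0)" by linarith
    then have 1: "- (ht t * (\<bar>Lip\<bar> * t)) \<le> ht t * (DP x \<bullet> (x - x0))" using mult_left_mono[OF _ ht0] by fastforce
    have 2: "(pm - 1) * ht' t * t \<le> (p x - 1) * ht' t * t"
      using pm_le_p[of x] h'0 t by (intro mult_right_mono) auto
    have 3: "(\<bar>Lip\<bar> * ht t + real DIM('a) / r0) * t \<le> (pm - 1) * ht' t * t"
      using key t by (intro mult_right_mono) auto
    have 4: "real DIM('a) \<le> real DIM('a) / r0 * t" using t r(1) by (simp add: field_simps)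
    have 5: "((p x - 1) * ht' t + 1 / t) * t = (p x - 1) * ht' t * t + 1" using t by (simp add: distrib_right)
    show "real DIM('a) - (ht t * (DP x \<bullet> (x - x0)) + ((p x - 1) * ht' t + 1 / t) * t) \<le> 0"
      unfolding 5 using 1 2 3 4 by (simp add: algebra_simps)
  qed (use E in simp)
  finally show ?thesis by simp
qed (simp add: \<kappa>_def)

text \<open>Divergence theorem for the field \<open>E * \<psi>\<close> times \<open>x - x0\<close>:
  its components are differentiable with compact support, so each derivative has integral zero, and
  the sum over the basis is the pointwise difference of both integrands.\<close>

lemma weak_identity:
  assumes cc: "C1c \<Omega> \<psi> D"
  shows "(LBINT x. Vp (p x) (Z x) \<bullet> D x) = (LBINT x. \<kappa> x * \<psi> x)"
proof -
  obtain K where K: "compact K" "K \<subseteq> \<Omega>" "\<forall>x. x \<notin> K \<longrightarrow> \<psi> x = 0" "\<forall>x. x \<notin> K \<longrightarrow> D x = 0"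
    by (rule C1c_support[OF cc])
  obtain B where B: "0 \<le> B" "\<forall>x. \<bar>\<psi> x\<bar> \<le> B" "\<forall>x. norm (D x) \<le> B" by (rule C1c_bounded[OF cc])
  obtain d where d: "0 \<le> d" "\<forall>x\<in>\<Omega>. norm (x - x0) \<le> d" by (rule domain_radius)
  obtain M where M: "0 \<le> M" "\<forall>x\<in>\<Omega>. norm (DE x) \<le> M" "\<forall>x. \<bar>E x\<bar> \<le> M" by (rule DE_bounded)
  \<comment> \<open>Off \<Omega> the factor \<open>E\<close> need not be differentiable;
    \<open>F\<close> is differentiable there because \<open>\<psi>\<close> vanishes near such
    points.\<close>
  define F where "F b x = (E x * \<psi> x) * ((x - x0) \<bullet> b)" for b x
  define DF where "DF b x = ((x - x0) \<bullet> b) *\<^sub>R (\<psi> x *\<^sub>R DE x + E x *\<^sub>R D x) + (E x * \<psi> x) *\<^sub>R b" for b x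
  have dF: "(F b has_derivative (\<lambda>h. DF b x \<bullet> h)) (at x)" for b x
  proof (cases "x \<in> \<Omega>")
    case True
    have "(F b has_derivative (\<lambda>h. (E x * \<psi> x) * ((h - 0) \<bullet> b) + (E x * (D x \<bullet> h) + (DE x \<bullet> h) * \<psi> x) * ((x - x0) \<bullet> b))) (at x)"
      unfolding F_def[abs_def]
      by (intro has_derivative_mult E_derivative[OF True] C1cD(1)[OF cc] has_derivative_inner_left has_derivative_diff has_derivative_ident has_derivative_const)
    then show ?thesis
      by (rule has_derivative_eq_rhs) (auto simp: DF_def inner_add_left inner_commute algebra_simps)
  next
    case False
    then have xK: "x \<in> - K" using K(2) by blast
    have "((\<lambda>_. 0) has_derivative (\<lambda>h. 0)) (at x)" by simp
    then have "(F b has_derivative (\<lambda>h. 0)) (at x)"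
      by (rule has_derivative_transform_within_open[where s="- K"]) (use xK K(1,3) in \<open>auto simp: F_def intro: compact_imp_closed\<close>)
    moreover have "DF b x = 0" using K(3,4) xK by (simp add: DF_def)
    ultimately show ?thesis by (simp add: has_derivative_eq_rhs)
  qed
  have bF: "norm (DF b x) \<le> d * (B * M + M * B) + M * B" if b: "b \<in> Basis" for b x
  proof (cases "x \<in> \<Omega>")
    case True
    have 1: "\<bar>(x - x0) \<bullet> b\<bar> \<le> d" using Basis_le_norm[OF b, of "x - x0"] d(2) True by force
    have 2: "norm (\<psi> x *\<^sub>R DE x + E x *\<^sub>R D x) \<le> B * M + M * B"
      using B M True by (intro order_trans[OF norm_triangle_ineq add_mono]) (auto intro!: mult_mono)
    have 3: "norm ((E x * \<psi> x) *\<^sub>R b) \<le> M * B" using B M b by (auto simp: abs_mult intro!: mult_mono)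
    have "norm (((x - x0) \<bullet> b) *\<^sub>R (\<psi> x *\<^sub>R DE x + E x *\<^sub>R D x)) \<le> d * (B * M + M * B)"
      using 1 2 d(1) unfolding norm_scaleR by (intro mult_mono) auto
    from order_trans[OF norm_triangle_ineq add_mono[OF this 3]] show ?thesis unfolding DF_def .
  next
    case False
    then have "x \<notin> K" using K(2) by blast
    then have "DF b x = 0" using K(3,4) by (simp add: DF_def)
    then show ?thesis using d(1) B(1) M(1) by simp
  qed
  have F0: "F b x = 0" if "x \<notin> \<Omega>" for b x using that K(2,3) by (auto simp: F_def)
  have I: "integrable lborel (\<lambda>x. DF b x \<bullet> b)" "(LBINT x. DF b x \<bullet> b) = 0" if "b \<in> Basis" for b
    by (rule difference_quotient_integral(1)[OF dF bF[OF that] bounded_domain F0], assumption,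
        rule difference_quotient_integral(2)[OF dF bF[OF that] bounded_domain F0], assumption)
  have sum: "(\<Sum>b\<in>Basis. DF b x \<bullet> b) = \<kappa> x * \<psi> x - Vp (p x) (Z x) \<bullet> D x" for x
  proof -
    have "(\<Sum>b\<in>Basis. DF b x \<bullet> b) = (\<Sum>b\<in>Basis. ((x - x0) \<bullet> b) * ((\<psi> x *\<^sub>R DE x + E x *\<^sub>R D x) \<bullet> b)) + (\<Sum>b\<in>(Basis::'a set). E x * \<psi> x)"
      unfolding sum.distrib[symmetric] DF_def by (intro sum.cong) (auto simp: inner_add_left inner_Basis)
    also have "(\<Sum>b\<in>Basis. ((x - x0) \<bullet> b) * ((\<psi> x *\<^sub>R DE x + E x *\<^sub>R D x) \<bullet> b)) = (x - x0) \<bullet> (\<psi> x *\<^sub>R DE x + E x *\<^sub>R D x)"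
      by (rule euclidean_inner[symmetric])
    also have "\<dots> + (\<Sum>b\<in>(Basis::'a set). E x * \<psi> x) = (DE x \<bullet> (x - x0) + real DIM('a) * E x) * \<psi> x - Vp (p x) (Z x) \<bullet> D x"
      unfolding Vp_Z by (simp add: inner_add_right inner_commute algebra_simps)
    also have "(DE x \<bullet> (x - x0) + real DIM('a) * E x) * \<psi> x = \<kappa> x * \<psi> x"
      using C1c_outside(1)[OF cc, of x] by (cases "x \<in> \<Omega>") (auto simp: \<kappa>_def)
    finally show ?thesis .
  qed
  have "(LBINT x. \<kappa> x * \<psi> x - Vp (p x) (Z x) \<bullet> D x) = 0"
    unfolding sum[symmetric] using I by (subst Bochner_Integration.integral_sum) auto
  moreover obtain M' where M': "0 \<le> M'" "\<forall>x. \<bar>\<kappa> x\<bar> \<le> M'" by (rule kappa_bounded)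
  have i1: "integrable lborel (\<lambda>x. \<kappa> x * \<psi> x)"
    by (rule integrable_bounded_mult(1)[OF kappa_measurable M'(2)[rule_format] C1c_integrable(1)[OF bounded_domain cc]])
  have "integrable lborel (\<lambda>x. \<kappa> x * \<psi> x - Vp (p x) (Z x) \<bullet> D x)"
    unfolding sum[symmetric] using I by auto
  from Bochner_Integration.integrable_diff[OF i1 this]
  have i2: "integrable lborel (\<lambda>x. Vp (p x) (Z x) \<bullet> D x)" by simp
  ultimately show ?thesis using i1 by simp
qed

end

section \<open>Mollification\<close>

text \<open>The standard smooth cutoff \<open>exp (- 1 / t)\<close> with a power of
  \<open>1 / t\<close> in front, so that derivatives remain linear combinations of members of the
  same family.\<close>

definition flat :: "nat \<Rightarrow> real \<Rightarrow> real" where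
  "flat k t = (if 0 < t then inverse t ^ k * exp (- inverse t) else 0)"

lemma power_le_fact_exp: "0 \<le> (y::real) \<Longrightarrow> y ^ n \<le> fact n * exp y"
proof -
  assume y: "0 \<le> y"
  have "y ^ n /\<^sub>R fact n \<le> (\<Sum>k. y ^ k /\<^sub>R fact k)"
    using sum_le_suminf[OF summable_exp_generic[of y], of "{n}"] y by simp
  then have "y ^ n / fact n \<le> exp y" by (simp add: exp_def divide_inverse mult.commute)
  then show ?thesis by (simp add: field_simps)
qed

lemma flat_nonneg: "0 \<le> flat k t" by (simp add: flat_def)

lemma flat_quadratic: "\<bar>flat k t\<bar> \<le> fact (k + 2) * t\<^sup>2"
proof (cases "0 < t")
  case True
  define y where "y = inverse t"
  have y: "0 < y" using True by (simp add: y_def)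
  have "y ^ k * y\<^sup>2 \<le> fact (k + 2) * exp y" using power_le_fact_exp[of y "k + 2"] y unfolding power_add by simp
  then have "y ^ k * exp (- y) * y\<^sup>2 \<le> fact (k + 2)"
    by (simp add: exp_minus field_simps)
  then have "y ^ k * exp (- y) * y\<^sup>2 * t\<^sup>2 \<le> fact (k + 2) * t\<^sup>2" by (intro mult_right_mono) auto
  moreover have "y\<^sup>2 * t\<^sup>2 = 1" using True by (simp add: y_def power_inverse)
  then have "y ^ k * exp (- y) * y\<^sup>2 * t\<^sup>2 = y ^ k * exp (- y)" by (simp only: mult.assoc mult_1_right)
  moreover have "0 \<le> y ^ k * exp (- y)" using y by simp
  ultimately show ?thesis using True by (simp add: flat_def y_def[symmetric] abs_of_nonneg)
qed (simp add: flat_def)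

lemma flat_derivative: "(flat k has_real_derivative (flat (k + 2) t - real k * flat (k + 1) t)) (at t)"
proof -
  consider "t < 0" | "t = 0" | "0 < t" by linarith
  then show ?thesis
  proof cases
    case 1
    have "((\<lambda>_. 0) has_real_derivative 0) (at t)" by simp
    then have "(flat k has_real_derivative 0) (at t)"
      by (rule has_field_derivative_transform_within_open[where S="{..<0}"]) (use 1 in \<open>auto simp: flat_def\<close>)
    then show ?thesis using 1 by (simp add: flat_def)
  next
    case 2
    have "(flat k has_derivative (\<lambda>h. 0)) (at 0)"
      by (rule has_derivative_zero_quadratic[where C="fact (k + 2)"]) (use flat_quadratic[of k] in \<open>simp_all add: flat_def[of k 0]\<close>)
    then have "(flat k has_real_derivative 0) (at 0)"
      unfolding has_field_derivative_def by (rule has_derivative_eq_rhs) auto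
    then show ?thesis using 2 by (simp add: flat_def)
  next
    case 3
    have "((\<lambda>t. inverse t ^ k * exp (- inverse t)) has_real_derivative
       (inverse t ^ k * (exp (- inverse t) * (inverse t ^ Suc (Suc 0))) + real k * (inverse t ^ (k - Suc 0) * - (inverse t ^ Suc (Suc 0))) * exp (- inverse t))) (at t)"
    proof -
      have i: "(inverse has_real_derivative - (inverse t ^ Suc (Suc 0))) (at t)" using DERIV_inverse[of t] 3 by simp
      from DERIV_mult[OF DERIV_power[OF i, of k] DERIV_chain2[OF DERIV_exp DERIV_minus[OF i]]]
      show ?thesis by (simp add: mult_ac add.commute)
    qed
    moreover have "inverse t ^ k * (exp (- inverse t) * (inverse t ^ Suc (Suc 0))) + real k * (inverse t ^ (k - Suc 0) * - (inverse t ^ Suc (Suc 0))) * exp (- inverse t)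
        = flat (k + 2) t - real k * flat (k + 1) t"
      using 3 by (cases k) (simp_all add: flat_def algebra_simps)
    ultimately have "((\<lambda>t. inverse t ^ k * exp (- inverse t)) has_real_derivative (flat (k + 2) t - real k * flat (k + 1) t)) (at t)"
      by simp
    then show ?thesis
      by (rule has_field_derivative_transform_within_open[where S="{0<..}"]) (use 3 in \<open>auto simp: flat_def\<close>)
  qed
qed

lemma flat_continuous: "continuous_on UNIV (flat k)"
  by (intro continuous_at_imp_continuous_on ballI DERIV_isCont[OF flat_derivative])

text \<open>The algebra generated by coordinates and radial cutoffs. It is closed under partial
  derivatives, so infinite smoothness follows from one differentiation step.\<close>

inductive bump_class :: "real \<Rightarrow> ('a::euclidean_space \<Rightarrow> real) \<Rightarrow> bool" for m where
  const: "bump_class m (\<lambda>x. c)"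
| coord: "bump_class m (\<lambda>x. x \<bullet> v)"
| bump: "bump_class m (\<lambda>x. flat k (1 - m * (x \<bullet> x)))"
| add: "bump_class m f \<Longrightarrow> bump_class m g \<Longrightarrow> bump_class m (\<lambda>x. f x + g x)"
| mult: "bump_class m f \<Longrightarrow> bump_class m g \<Longrightarrow> bump_class m (\<lambda>x. f x * g x)"

lemma bump_class_gradient:
  "bump_class m f \<Longrightarrow> \<exists>D. (\<forall>x. (f has_derivative (\<lambda>h. D x \<bullet> h)) (at x)) \<and> continuous_on UNIV D \<and> (\<forall>b. bump_class m (\<lambda>x. D x \<bullet> b))"
proof (induction rule: bump_class.induct)
  case (const c)
  show ?case by (rule exI[of _ "\<lambda>_. 0"]) (auto intro!: bump_class.const has_derivative_eq_rhs[OF has_derivative_const])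
next
  case (coord v)
  have "((\<lambda>x. x \<bullet> v) has_derivative (\<lambda>h. v \<bullet> h)) (at x)" for x :: 'a
    by (rule has_derivative_eq_rhs[OF has_derivative_inner_left[OF has_derivative_ident]]) (simp add: inner_commute)
  then show ?case by (intro exI[of _ "\<lambda>_. v"]) (auto intro: bump_class.const)
next
  case (bump k)
  define s where "s x = 1 - m * (x \<bullet> x)" for x :: 'a
  define D where "D x = ((- 2 * m) * (flat (k + 2) (s x) + (- real k) * flat (k + 1) (s x))) *\<^sub>R x" for x :: 'a
  have cs: "continuous_on UNIV s" unfolding s_def[abs_def] by (intro continuous_intros)
  have "((\<lambda>x. flat k (s x)) has_derivative (\<lambda>h. D x \<bullet> h)) (at x)" for x
  proof -
    have "(s has_derivative (\<lambda>h. 0 - m * (x \<bullet> h + h \<bullet> x))) (at x)" unfolding s_def[abs_def]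
      by (intro has_derivative_diff has_derivative_const has_derivative_mult_right has_derivative_inner has_derivative_ident)
    from has_derivative_compose[OF this flat_derivative[unfolded has_field_derivative_def]]
    show ?thesis by (rule has_derivative_eq_rhs) (auto simp: D_def inner_commute algebra_simps)
  qed
  moreover have "continuous_on UNIV D" unfolding D_def
    by (intro continuous_intros continuous_on_compose2[OF flat_continuous cs]) auto
  moreover have "bump_class m (\<lambda>x. D x \<bullet> b)" for b
    unfolding D_def s_def inner_scaleR_left by (intro bump_class.intros)
  ultimately show ?case unfolding s_def by blast
next
  case (add f g)
  then obtain D E where "\<forall>x. (f has_derivative (\<lambda>h. D x \<bullet> h)) (at x)" "continuous_on UNIV D" "\<forall>b. bump_class m (\<lambda>x. D x \<bullet> b)"
    "\<forall>x. (g has_derivative (\<lambda>h. E x \<bullet> h)) (at x)" "continuous_on UNIV E" "\<forall>b. bump_class m (\<lambda>x. E x \<bullet> b)" by blast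
  then show ?case
    by (intro exI[of _ "\<lambda>x. D x + E x"])
      (auto simp: inner_add_left intro!: continuous_intros bump_class.add has_derivative_add)
next
  case (mult f g)
  then obtain D E where 1: "\<forall>x. (f has_derivative (\<lambda>h. D x \<bullet> h)) (at x)" "continuous_on UNIV D" "\<forall>b. bump_class m (\<lambda>x. D x \<bullet> b)"
    "\<forall>x. (g has_derivative (\<lambda>h. E x \<bullet> h)) (at x)" "continuous_on UNIV E" "\<forall>b. bump_class m (\<lambda>x. E x \<bullet> b)" by blast
  have c: "continuous_on UNIV f" "continuous_on UNIV g"
    using 1(1,4) by (auto intro!: continuous_at_imp_continuous_on has_derivative_continuous)
  show ?case
  proof (intro exI[of _ "\<lambda>x. f x *\<^sub>R E x + g x *\<^sub>R D x"] conjI allI)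
    show "((\<lambda>x. f x * g x) has_derivative (\<lambda>h. (f x *\<^sub>R E x + g x *\<^sub>R D x) \<bullet> h)) (at x)" for x
      by (rule has_derivative_eq_rhs[OF has_derivative_mult[OF 1(1)[rule_format] 1(4)[rule_format]]])
         (auto simp: inner_add_left mult.commute)
    show "continuous_on UNIV (\<lambda>x. f x *\<^sub>R E x + g x *\<^sub>R D x)" by (intro continuous_intros c 1(2,5))
    show "bump_class m (\<lambda>x. (f x *\<^sub>R E x + g x *\<^sub>R D x) \<bullet> b)" for b
      unfolding inner_add_left inner_scaleR_left using 1 mult.hyps by (intro bump_class.add bump_class.mult) auto
  qed
qed

lemma grad_inner:
  assumes "f differentiable (at x)"
  shows "(f has_derivative (\<lambda>h. grad f x \<bullet> h)) (at x)"
proof -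
  have d: "(f has_derivative frechet_derivative f (at x)) (at x)" using assms frechet_derivative_works by blast
  then have l: "linear (frechet_derivative f (at x))" by (rule has_derivative_linear)
  have "frechet_derivative f (at x) h = grad f x \<bullet> h" for h
  proof -
    have "frechet_derivative f (at x) h = frechet_derivative f (at x) (\<Sum>b\<in>Basis. (h \<bullet> b) *\<^sub>R b)"
      by (simp add: euclidean_representation)
    also have "\<dots> = (\<Sum>b\<in>Basis. (h \<bullet> b) * frechet_derivative f (at x) b)"
      by (simp add: linear_sum[OF l] linear_scale[OF l])
    finally show ?thesis by (simp add: grad_def inner_sum_left inner_commute[of h] mult.commute)
  qed
  then show ?thesis using has_derivative_eq_rhs[OF d] by blast
qed

text \<open>A class of differentiable functions that is stable under partial derivatives contains
  all iterated ones.\<close>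

lemma smooth_fnI:
  assumes "f \<in> C" "\<And>f x. f \<in> C \<Longrightarrow> f differentiable (at x)"
    "\<And>f b. f \<in> C \<Longrightarrow> b \<in> Basis \<Longrightarrow> (\<lambda>x. frechet_derivative f (at x) b) \<in> C"
  shows "smooth_fn f"
proof -
  have "piter bs f \<in> C" if "set bs \<subseteq> Basis" for bs
    using that by (induction bs) (use assms in auto)
  then show ?thesis unfolding smooth_fn_def using assms(2) by blast
qed

lemma test_fn_C1c:
  assumes "test_fn \<Omega> \<phi>"
  shows "C1c \<Omega> \<phi> (grad \<phi>)"
proof -
  have s: "smooth_fn \<phi>" using assms by (simp add: test_fn_def)
  have d0: "\<phi> differentiable (at x)" for x using s[unfolded smooth_fn_def, rule_format, of "[]"] by simp
  have d1: "(\<lambda>x. frechet_derivative \<phi> (at x) b) differentiable (at x)" if "b \<in> Basis" for b x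
    using s[unfolded smooth_fn_def, rule_format, of "[b]"] that by simp
  have "continuous_on UNIV (grad \<phi>)"
    unfolding grad_def[abs_def]
    by (intro continuous_intros continuous_at_imp_continuous_on ballI differentiable_imp_continuous_within d1)
  moreover have "\<exists>K. compact K \<and> K \<subseteq> \<Omega> \<and> (\<forall>x. x \<notin> K \<longrightarrow> \<phi> x = 0)"
  proof (intro exI conjI allI impI)
    show "compact (closure {x. \<phi> x \<noteq> 0})" "closure {x. \<phi> x \<noteq> 0} \<subseteq> \<Omega>" using assms by (simp_all add: test_fn_def)
    show "\<phi> x = 0" if "x \<notin> closure {x. \<phi> x \<noteq> 0}" for x
      using that closure_subset[of "{x. \<phi> x \<noteq> 0}"] by blast
  qed
  ultimately show ?thesis unfolding C1c_def by (intro conjI allI grad_inner d0)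
qed

section \<open>Convolution and approximation by test functions\<close>

definition conv :: "('a::euclidean_space \<Rightarrow> real) \<Rightarrow> ('a \<Rightarrow> real) \<Rightarrow> 'a \<Rightarrow> real" where
  "conv \<eta> \<psi> x = (LBINT y. \<eta> (y - x) * \<psi> y)"

lemma integral_compact_support:
  fixes f :: "'a::euclidean_space \<Rightarrow> real"
  assumes "continuous_on UNIV f" "\<And>y. y \<notin> cbox a b \<Longrightarrow> f y = 0"
  shows "integrable lborel f" "(LBINT y. f y) = integral (cbox a b) f"
proof -
  have fm: "f \<in> borel_measurable borel" using assms(1) by (rule borel_measurable_continuous_onI)
  have "bounded (f ` cbox a b)" using assms(1)
    by (intro compact_imp_bounded compact_continuous_image) (auto intro: continuous_on_subset)
  then obtain B where "\<forall>y\<in>f ` cbox a b. norm y \<le> B" unfolding bounded_iff by blast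
  then have B: "norm (f y) \<le> B" if "y \<in> cbox a b" for y using that by blast
  have "norm (f y) \<le> max 0 B" for y
    using assms(2)[of y] B[of y] by (cases "y \<in> cbox a b") (auto simp: le_max_iff_disj)
  then show i: "integrable lborel f" by (intro integrable_bounded_support[OF fm bounded_cbox assms(2)]) auto
  have eq: "indicator (cbox a b) y *\<^sub>R f y = f y" for y using assms(2)[of y] by (auto simp: indicator_def)
  have "set_integrable lborel (cbox a b) f" unfolding set_integrable_def eq by (rule i)
  from set_borel_integral_eq_integral(2)[OF this]
  show "(LBINT y. f y) = integral (cbox a b) f" unfolding set_lebesgue_integral_def eq .
qed

lemma bounded_in_cbox: "bounded S \<Longrightarrow> \<exists>a b. S \<subseteq> cbox a (b :: 'a::euclidean_space)"
  by (meson bounded_subset_cbox_symmetric)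

text \<open>Differentiation under the integral over a box containing the support of
  \<open>\<psi>\<close>. The kernel is evaluated at \<open>y - x\<close>, hence the sign; the factor
  is written as a product so that the new kernel stays in the bump class.\<close>

lemma conv_derivative:
  fixes \<eta> :: "'a::euclidean_space \<Rightarrow> real"
  assumes e: "\<And>x. (\<eta> has_derivative (\<lambda>h. D x \<bullet> h)) (at x)" "continuous_on UNIV D"
    and p: "continuous_on UNIV \<psi>" "bounded S" "\<And>x. x \<notin> S \<Longrightarrow> \<psi> x = 0"
  shows "\<exists>L. (conv \<eta> \<psi> has_derivative L) (at x) \<and> (\<forall>b. L b = conv (\<lambda>z. (- 1) * (D z \<bullet> b)) \<psi> x)"
proof -
  obtain a b where ab: "S \<subseteq> cbox a b" using bounded_in_cbox[OF p(2)] by blast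
  have p0: "\<psi> y = 0" if "y \<notin> cbox a b" for y using that ab p(3) by blast
  have ce: "continuous_on UNIV \<eta>" by (intro continuous_at_imp_continuous_on ballI has_derivative_continuous[OF e(1)])
  define fx where "fx x y = blinfun_inner_left ((- \<psi> y) *\<^sub>R D (y - x))" for x y
  have fxa: "blinfun_apply (fx x y) h = - (D (y - x) \<bullet> h) * \<psi> y" for x y h
    by (simp add: fx_def inner_commute)
  have cfx: "continuous_on A (\<lambda>z. fx (fst z) (snd z))" for A
    unfolding fx_def
    by (intro bounded_linear.continuous_on[OF bounded_linear_blinfun_inner_left] continuous_intros
        continuous_on_compose2[OF e(2)] continuous_on_compose2[OF p(1)]) auto
  have cv: "conv \<eta> \<psi> = (\<lambda>x. integral (cbox a b) (\<lambda>y. \<eta> (y - x) * \<psi> y))"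
    unfolding conv_def[abs_def]
    by (intro ext integral_compact_support(2) continuous_intros continuous_on_compose2[OF ce] p(1)) (auto simp: p0)
  have der: "((\<lambda>x. integral (cbox a b) (\<lambda>y. \<eta> (y - x) * \<psi> y)) has_derivative integral (cbox a b) (fx x)) (at x within UNIV)"
  proof (rule leibniz_rule)
    fix x y :: 'a
    have "((\<lambda>x. y - x) has_derivative (\<lambda>h. 0 - h)) (at x)" by (intro derivative_intros)
    from has_derivative_mult_left[OF has_derivative_compose[OF this e(1)], of "\<psi> y"]
    show "((\<lambda>x. \<eta> (y - x) * \<psi> y) has_derivative blinfun_apply (fx x y)) (at x within UNIV)"
      by (rule has_derivative_eq_rhs) (auto simp: fxa)
  next
    show "(\<lambda>y. \<eta> (y - x) * \<psi> y) integrable_on cbox a b" for x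
      by (intro integrable_continuous continuous_intros continuous_on_compose2[OF ce] continuous_on_subset[OF p(1)]) auto
    show "continuous_on (UNIV \<times> cbox a b) (\<lambda>(x, t). fx x t)"
      using cfx[of "UNIV \<times> cbox a b"] by (simp add: case_prod_beta)
  qed auto
  have "integral (cbox a b) (fx x) h = conv (\<lambda>z. (- 1) * (D z \<bullet> h)) \<psi> x" for h
  proof -
    have cx: "continuous_on (cbox a b) (fx x)"
    proof -
      have "continuous_on (cbox a b) (\<lambda>y. (x, y))" by (intro continuous_intros)
      from continuous_on_compose2[OF cfx[of UNIV] this] show ?thesis by simp
    qed
    have "integral (cbox a b) (fx x) h = integral (cbox a b) (\<lambda>y. (- 1) * (D (y - x) \<bullet> h) * \<psi> y)"
      using blinfun_apply_integral[OF integrable_continuous[OF cx], of h] by (simp add: fxa)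
    also have "\<dots> = conv (\<lambda>z. (- 1) * (D z \<bullet> h)) \<psi> x" unfolding conv_def
      by (intro integral_compact_support(2)[symmetric] continuous_intros continuous_on_compose2[OF e(2)] p(1)) (auto simp: p0)
    finally show ?thesis .
  qed
  then show ?thesis using der unfolding cv by blast
qed

lemma conv_smooth:
  assumes "bump_class m \<eta>" "continuous_on UNIV \<psi>" "bounded S" "\<And>x. x \<notin> S \<Longrightarrow> \<psi> x = 0"
  shows "smooth_fn (conv \<eta> \<psi>)"
proof (rule smooth_fnI[where C="{conv \<eta> \<psi> | \<eta>. bump_class m \<eta>}"])
  show "conv \<eta> \<psi> \<in> {conv \<eta> \<psi> | \<eta>. bump_class m \<eta>}" using assms(1) by blast
next
  have *: "\<exists>D. (\<forall>b. bump_class m (\<lambda>x. (- 1) * (D x \<bullet> b))) \<and>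
      (\<forall>x. \<exists>L. (conv \<theta> \<psi> has_derivative L) (at x) \<and> (\<forall>b. L b = conv (\<lambda>z. (- 1) * (D z \<bullet> b)) \<psi> x))"
    if b: "bump_class m \<theta>" for \<theta>
  proof -
    obtain D where D: "\<forall>x. (\<theta> has_derivative (\<lambda>h. D x \<bullet> h)) (at x)" "continuous_on UNIV D" "\<forall>b. bump_class m (\<lambda>x. D x \<bullet> b)"
      using bump_class_gradient[OF b] by blast
    have "bump_class m (\<lambda>x. (- 1) * (D x \<bullet> b))" for b using D(3) by (intro bump_class.mult bump_class.const) auto
    then show ?thesis using conv_derivative[OF D(1)[rule_format] D(2) assms(2-4)] by blast
  qed
  fix f assume "f \<in> {conv \<eta> \<psi> | \<eta>. bump_class m \<eta>}"
  then obtain \<theta> where t: "f = conv \<theta> \<psi>" "bump_class m \<theta>" by blast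
  from *[OF t(2)] obtain D where D: "\<forall>b. bump_class m (\<lambda>x. (- 1) * (D x \<bullet> b))"
      "\<forall>x. \<exists>L. (f has_derivative L) (at x) \<and> (\<forall>b. L b = conv (\<lambda>z. (- 1) * (D z \<bullet> b)) \<psi> x)" unfolding t(1) by blast
  show "f differentiable (at x)" for x using D(2) by (auto simp: differentiable_def)
  fix b :: 'a assume "b \<in> Basis"
  have "frechet_derivative f (at x) b = conv (\<lambda>z. (- 1) * (D z \<bullet> b)) \<psi> x" for x
  proof -
    obtain L where L: "(f has_derivative L) (at x)" "\<forall>b. L b = conv (\<lambda>z. (- 1) * (D z \<bullet> b)) \<psi> x" using D(2) by blast
    show ?thesis using frechet_derivative_at[OF L(1)] L(2) by metis
  qed
  then show "(\<lambda>x. frechet_derivative f (at x) b) \<in> {conv \<eta> \<psi> | \<eta>. bump_class m \<eta>}" using D(1) by blast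
qed

lemma uniform_continuity_compact_support:
  fixes f :: "'a::euclidean_space \<Rightarrow> 'b::real_normed_vector"
  assumes "continuous_on UNIV f" "bounded S" "\<And>x. x \<notin> S \<Longrightarrow> f x = 0" "0 < \<delta>"
  obtains \<epsilon> where "0 < \<epsilon>" "\<forall>x y. norm (y - x) < \<epsilon> \<longrightarrow> norm (f y - f x) \<le> \<delta>"
proof -
  obtain R where R: "S \<subseteq> ball 0 R" using bounded_subset_ballD[OF assms(2), of 0] by blast
  have "uniformly_continuous_on (cball 0 (R + 1)) f"
    using assms(1) by (intro compact_uniformly_continuous) (auto intro: continuous_on_subset)
  then obtain e where e: "0 < e" "\<And>x y. x \<in> cball 0 (R + 1) \<Longrightarrow> y \<in> cball 0 (R + 1) \<Longrightarrow> dist y x < e \<Longrightarrow> dist (f y) (f x) < \<delta>"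
    using assms(4) unfolding uniformly_continuous_on_def by metis
  have "norm (f y - f x) \<le> \<delta>" if "norm (y - x) < min e 1" for x y
  proof (cases "x \<in> cball 0 (R + 1) \<and> y \<in> cball 0 (R + 1)")
    case True
    then show ?thesis using e(2)[of x y] that by (simp add: dist_norm)
  next
    case False
    have "norm x \<le> norm y + norm (y - x)" "norm y \<le> norm x + norm (y - x)"
      using norm_triangle_ineq4[of y "y - x"] norm_triangle_ineq[of x "y - x"] by simp_all
    then have "R < norm x" "R < norm y" using False that by auto
    then have "f x = 0" "f y = 0" using R assms(3) by fastforce+
    then show ?thesis using assms(4) by simp
  qed
  then show thesis using that[of "min e 1"] e(1) by auto
qed

text \<open>Mollification with a kernel narrow enough for uniform continuity of
  \<open>\<psi>\<close> and of its gradient, and for the support to remain in \<Omega>.\<close>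

lemma C1c_test_approx:
  fixes \<Omega> :: "'a::euclidean_space set"
  assumes O: "open \<Omega>" "bounded \<Omega>" and c: "C1c \<Omega> \<psi> D" and d: "0 < \<delta>"
  obtains \<phi> where "test_fn \<Omega> \<phi>" "\<forall>x. \<bar>\<phi> x - \<psi> x\<bar> \<le> \<delta>" "\<forall>x. norm (grad \<phi> x - D x) \<le> \<delta>"
proof -
  obtain K where K: "compact K" "K \<subseteq> \<Omega>" "\<forall>x. x \<notin> K \<longrightarrow> \<psi> x = 0" "\<forall>x. x \<notin> K \<longrightarrow> D x = 0" by (rule C1c_support[OF c])
  obtain B where B: "0 \<le> B" "\<forall>x. \<bar>\<psi> x\<bar> \<le> B" "\<forall>x. norm (D x) \<le> B" by (rule C1c_bounded[OF c])
  \<comment> \<open>Gradient errors are estimated coordinate by coordinate and summed, so each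
    coordinate may contribute \<open>\<delta> / N\<close>.\<close>
  define N where "N = real DIM('a)"
  have N: "1 \<le> N" using DIM_positive[where 'a='a] unfolding N_def by linarith
  have dN: "0 < \<delta> / N" "\<delta> / N \<le> \<delta>" using d N by (auto simp: field_simps)
  obtain e1 where e1: "0 < e1" "\<forall>x y. norm (y - x) < e1 \<longrightarrow> norm (\<psi> y - \<psi> x) \<le> \<delta> / N"
    by (rule uniform_continuity_compact_support[OF C1cD(3)[OF c] compact_imp_bounded[OF K(1)] K(3)[rule_format] dN(1)])
  obtain e2 where e2: "0 < e2" "\<forall>x y. norm (y - x) < e2 \<longrightarrow> norm (D y - D x) \<le> \<delta> / N"
    by (rule uniform_continuity_compact_support[OF C1cD(2)[OF c] compact_imp_bounded[OF K(1)] K(4)[rule_format] dN(1)])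
  obtain e3 where e3: "0 < e3" "(\<Union>x\<in>K. cball x e3) \<subseteq> \<Omega>"
    using compact_subset_open_imp_cball_epsilon_subset[OF K(1) O(1) K(2)] by blast
  \<comment> \<open>One radius for three purposes: \<open>e1\<close> for the function,
    \<open>e2\<close> for the gradient, \<open>e3\<close> for the distance of \<open>K\<close> to
    the complement of \<Omega>.\<close>
  define \<epsilon> where "\<epsilon> = min e1 (min e2 e3)"
  have eps: "0 < \<epsilon>" "\<epsilon> \<le> e1" "\<epsilon> \<le> e2" "\<epsilon> \<le> e3" using e1 e2 e3 by (auto simp: \<epsilon>_def)
  define m where "m = 1 / \<epsilon>\<^sup>2"
  define \<rho> where "\<rho> z = flat 0 (1 - m * (z \<bullet> z))" for z :: 'a
  have rb: "bump_class m \<rho>" unfolding \<rho>_def[abs_def] by (rule bump_class.bump)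
  have rpos: "0 < \<rho> z" if "norm z < \<epsilon>" for z
  proof -
    have "(norm z)\<^sup>2 < \<epsilon>\<^sup>2" using that eps by (intro power_strict_mono) auto
    then show ?thesis using eps by (simp add: \<rho>_def m_def flat_def dot_square_norm field_simps)
  qed
  have rzero: "\<rho> z = 0" if "\<epsilon> \<le> norm z" for z
  proof -
    have "\<epsilon>\<^sup>2 \<le> (norm z)\<^sup>2" using that eps by (intro power_mono) auto
    then show ?thesis using eps by (simp add: \<rho>_def m_def flat_def dot_square_norm field_simps not_less)
  qed
  have rnn: "0 \<le> \<rho> z" for z by (simp add: \<rho>_def flat_nonneg)
  have rc: "continuous_on UNIV \<rho>" unfolding \<rho>_def[abs_def]
    by (intro continuous_on_compose2[OF flat_continuous] continuous_intros) auto
  obtain a b where ab: "ball (0::'a) \<epsilon> \<subseteq> cbox a b" using bounded_in_cbox[OF bounded_ball] by blast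
  have rzero': "\<rho> z = 0" if "z \<notin> cbox a b" for z using that ab rzero[of z] by (force simp: not_le)
  have rI: "integrable lborel \<rho>" by (rule integral_compact_support(1)[OF rc rzero'])
  \<comment> \<open>Normalizing constant of the kernel. It is positive because the kernel is
    positive on a ball, which is not a null set.\<close>
  define c0 where "c0 = (LBINT z. \<rho> z)"
  have c0: "0 < c0"
  proof -
    have "c0 \<noteq> 0"
    proof
      assume "c0 = 0"
      then have "AE z in lborel. \<rho> z = 0" using integral_nonneg_eq_0_iff_AE[OF rI] rnn by (simp add: c0_def)
      then have "AE z in lborel. z \<notin> ball (0::'a) \<epsilon>" by eventually_elim (use rpos in force)
      then have "emeasure lborel (ball (0::'a) \<epsilon>) = 0" by (subst (asm) AE_iff_measurable[of "ball 0 \<epsilon>"]) auto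
      then have "ball (0::'a) \<epsilon> \<in> null_sets lborel" by (simp add: null_sets_def)
      then have "negligible (ball (0::'a) \<epsilon>)" by (simp add: negligible_iff_null_sets null_sets_completionI)
      then show False using open_not_negligible[of "ball (0::'a) \<epsilon>"] eps by simp
    qed
    moreover have "0 \<le> c0" unfolding c0_def using rnn by simp
    ultimately show ?thesis by simp
  qed
  define \<eta> where "\<eta> z = inverse c0 * \<rho> z" for z
  have eb: "bump_class m \<eta>" unfolding \<eta>_def[abs_def] by (intro bump_class.mult bump_class.const rb)
  have enn: "0 \<le> \<eta> z" for z using rnn c0 by (simp add: \<eta>_def)
  have e0: "\<eta> z = 0" if "\<epsilon> \<le> norm z" for z using rzero[OF that] by (simp add: \<eta>_def)
  have ec: "continuous_on UNIV \<eta>" unfolding \<eta>_def[abs_def] by (intro continuous_intros rc)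
  have em: "\<eta> \<in> borel_measurable borel" using ec by (rule borel_measurable_continuous_onI)
  have eI: "integrable lborel (\<lambda>y. \<eta> (y - x))" "(LBINT y. \<eta> (y - x)) = 1" for x
  proof -
    have "integrable lborel \<eta>" unfolding \<eta>_def[abs_def] using rI by simp
    then show "integrable lborel (\<lambda>y. \<eta> (y - x))"
      using lborel_integrable_translation[OF em, of "- x"] by simp
    have "(LBINT y. \<eta> (y - x)) = (LBINT z. \<eta> z)" using lborel_integral_translation[OF em, of "- x"] by simp
    also have "\<dots> = 1" unfolding \<eta>_def using c0 by (simp add: c0_def[symmetric])
    finally show "(LBINT y. \<eta> (y - x)) = 1" .
  qed
  have avg: "\<bar>(LBINT y. \<eta> (y - x) * f y) - f x\<bar> \<le> \<delta> / N"
    if f: "continuous_on UNIV f" "\<And>y. norm (y - x) < \<epsilon> \<Longrightarrow> \<bar>f y - f x\<bar> \<le> \<delta> / N" for f x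
  proof -
    obtain a' b' where ab': "ball x \<epsilon> \<subseteq> cbox a' b'" using bounded_in_cbox[OF bounded_ball] by blast
    have z: "\<eta> (y - x) * f y = 0" if "y \<notin> cbox a' b'" for y
      using that ab' e0[of "y - x"] by (force simp: dist_norm norm_minus_commute not_le)
    have I1: "integrable lborel (\<lambda>y. \<eta> (y - x) * f y)"
      by (rule integral_compact_support(1)[OF _ z]) (intro continuous_intros continuous_on_compose2[OF ec] f(1), auto)
    have I2: "integrable lborel (\<lambda>y. \<eta> (y - x) * f x)" using eI(1) by simp
    have eq: "(LBINT y. \<eta> (y - x) * f y) - f x = (LBINT y. \<eta> (y - x) * f y - \<eta> (y - x) * f x)"
      unfolding Bochner_Integration.integral_diff[OF I1 I2] using eI(2)[of x] by simp
    have "\<bar>LBINT y. \<eta> (y - x) * f y - \<eta> (y - x) * f x\<bar> \<le> L1norm (\<lambda>y. \<eta> (y - x) * f y - \<eta> (y - x) * f x)"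
      by (rule integral_abs_bound)
    also have "\<dots> \<le> (LBINT y. \<eta> (y - x) * (\<delta> / N))"
    proof (rule integral_mono)
      show "integrable lborel (\<lambda>y. \<bar>\<eta> (y - x) * f y - \<eta> (y - x) * f x\<bar>)" using I1 I2 by simp
      show "integrable lborel (\<lambda>y. \<eta> (y - x) * (\<delta> / N))" using eI(1) by (intro integrable_mult_left) auto
      show "\<bar>\<eta> (y - x) * f y - \<eta> (y - x) * f x\<bar> \<le> \<eta> (y - x) * (\<delta> / N)" for y
      proof (cases "norm (y - x) < \<epsilon>")
        case True
        have "\<bar>\<eta> (y - x) * f y - \<eta> (y - x) * f x\<bar> = \<eta> (y - x) * \<bar>f y - f x\<bar>"
          using enn[of "y - x"] by (simp add: abs_mult flip: right_diff_distrib)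
        also have "\<dots> \<le> \<eta> (y - x) * (\<delta> / N)" by (rule mult_left_mono[OF f(2)[OF True] enn])
        finally show ?thesis .
      qed (simp add: e0)
    qed
    also have "\<dots> = \<delta> / N" using eI(2)[of x] integral_mult_left_zero[of lborel "\<lambda>y. \<eta> (y - x)" "\<delta> / N"] by simp
    finally show ?thesis unfolding eq .
  qed
  define \<phi> where "\<phi> = conv \<eta> \<psi>"
  have sm: "smooth_fn \<phi>" unfolding \<phi>_def
    by (rule conv_smooth[OF eb C1cD(3)[OF c] compact_imp_bounded[OF K(1)] K(3)[rule_format]])
  have supp: "{x. \<phi> x \<noteq> 0} \<subseteq> {k + z | k z. k \<in> K \<and> z \<in> cball 0 \<epsilon>}"
  proof
    fix x assume "x \<in> {x. \<phi> x \<noteq> 0}"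
    then have "\<phi> x \<noteq> 0" by simp
    then have "\<exists>y. \<eta> (y - x) * \<psi> y \<noteq> 0"
    proof (rule contrapos_np)
      assume "\<not> (\<exists>y. \<eta> (y - x) * \<psi> y \<noteq> 0)"
      then have "(\<lambda>y. \<eta> (y - x) * \<psi> y) = (\<lambda>_. 0)" by (intro ext) blast
      then show "\<phi> x = 0" unfolding \<phi>_def conv_def by (metis integral_zero)
    qed
    then obtain y where y: "\<eta> (y - x) \<noteq> 0" "\<psi> y \<noteq> 0" by auto
    then have "y \<in> K" "norm (y - x) < \<epsilon>" using K(3) e0[of "y - x"] by (auto simp: not_le[symmetric])
    then have "x = y + (x - y)" "x - y \<in> cball 0 \<epsilon>" by (auto simp: norm_minus_commute)
    then show "x \<in> {k + z | k z. k \<in> K \<and> z \<in> cball 0 \<epsilon>}" using \<open>y \<in> K\<close> by blast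
  qed
  have cS: "compact {k + z | k z. k \<in> K \<and> z \<in> cball 0 \<epsilon>}" by (rule compact_sums[OF K(1) compact_cball])
  have cl: "closure {x. \<phi> x \<noteq> 0} \<subseteq> {k + z | k z. k \<in> K \<and> z \<in> cball 0 \<epsilon>}"
    by (rule closure_minimal[OF supp compact_imp_closed[OF cS]])
  also have "\<dots> \<subseteq> \<Omega>"
  proof clarify
    fix k z :: 'a assume k: "k \<in> K" and z: "z \<in> cball 0 \<epsilon>"
    then have "k + z \<in> cball k e3" using eps by (simp add: dist_norm)
    then show "k + z \<in> \<Omega>" using e3(2) k by blast
  qed
  finally have clO: "closure {x. \<phi> x \<noteq> 0} \<subseteq> \<Omega>" .
  have "compact (closure {x. \<phi> x \<noteq> 0})"
    using bounded_subset[OF compact_imp_bounded[OF cS] cl] closed_closure compact_eq_bounded_closed by blast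
  then have tf: "test_fn \<Omega> \<phi>" using sm clO by (simp add: test_fn_def)
  have "\<bar>\<phi> x - \<psi> x\<bar> \<le> \<delta>" for x
    using avg[OF C1cD(3)[OF c], of x] e1(2) eps(2) dN(2) unfolding \<phi>_def conv_def by fastforce
  moreover have "norm (grad \<phi> x - D x) \<le> \<delta>" for x
  proof -
    obtain De where De: "\<forall>x. (\<eta> has_derivative (\<lambda>h. De x \<bullet> h)) (at x)" "continuous_on UNIV De"
      using bump_class_gradient[OF eb] by blast
    obtain L where L: "(\<phi> has_derivative L) (at x)" "\<forall>b. L b = conv (\<lambda>z. (- 1) * (De z \<bullet> b)) \<psi> x"
      using conv_derivative[OF De(1)[rule_format] De(2) C1cD(3)[OF c] compact_imp_bounded[OF K(1)] K(3)[rule_format]]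
      unfolding \<phi>_def by blast
    \<comment> \<open>The product of kernel and function has a gradient with integral zero. This
      moves the derivative from the kernel to \<open>\<psi>\<close>, so the gradient of the
      mollification is the mollified gradient.\<close>
    define F where "F y = \<eta> (y - x) * \<psi> y" for y
    define DF where "DF y = \<eta> (y - x) *\<^sub>R D y + \<psi> y *\<^sub>R De (y - x)" for y
    have dF: "(F has_derivative (\<lambda>h. DF y \<bullet> h)) (at y)" for y
    proof -
      have "((\<lambda>y. y - x) has_derivative (\<lambda>h. h - 0)) (at y)" by (intro derivative_intros)
      from has_derivative_mult[OF has_derivative_compose[OF this De(1)[rule_format]] C1cD(1)[OF c]]
      show ?thesis unfolding F_def[abs_def] by (rule has_derivative_eq_rhs) (auto simp: DF_def inner_add_left mult.commute)
    qed
    have cDF: "continuous_on UNIV DF" unfolding DF_def[abs_def]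
      by (intro continuous_intros continuous_on_compose2[OF ec] continuous_on_compose2[OF De(2)] C1cD(2,3)[OF c]) auto
    have F0: "F y = 0" "DF y = 0" if "y \<notin> K" for y using K(3,4) that by (auto simp: F_def DF_def)
    have "bounded (DF ` K)" using cDF K(1) by (intro compact_imp_bounded compact_continuous_image) (auto intro: continuous_on_subset)
    then obtain B' where "\<forall>y\<in>DF ` K. norm y \<le> B'" unfolding bounded_iff by blast
    then have "norm (DF y) \<le> max 0 B'" for y using F0(2)[of y] by (cases "y \<in> K") (auto simp: le_max_iff_disj)
    from difference_quotient_integral(2)[OF dF this compact_imp_bounded[OF K(1)] F0(1)]
    have zero: "(LBINT y. DF y \<bullet> b) = 0" for b .
    have "grad \<phi> x \<bullet> b = (LBINT y. \<eta> (y - x) * (D y \<bullet> b))" for b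
    proof -
      have "\<exists>a b. K \<subseteq> cbox a b" using bounded_in_cbox[OF compact_imp_bounded[OF K(1)]] by blast
      then obtain a b' where ab: "K \<subseteq> cbox a b'" by blast
      have i1: "integrable lborel (\<lambda>y. \<eta> (y - x) * (D y \<bullet> b))"
        by (rule integral_compact_support(1)[where a=a and b=b'], intro continuous_intros continuous_on_compose2[OF ec] C1cD(2)[OF c])
           (use ab K(4) in auto)
      have i2: "integrable lborel (\<lambda>y. (De (y - x) \<bullet> b) * \<psi> y)"
        by (rule integral_compact_support(1)[where a=a and b=b'], intro continuous_intros continuous_on_compose2[OF De(2)] C1cD(3)[OF c])
           (use ab K(3) in auto)
      have "grad \<phi> x \<bullet> b = L b"
        using grad_inner[of \<phi> x] L(1) has_derivative_unique by (metis differentiable_def)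
      also have "\<dots> = - (LBINT y. (De (y - x) \<bullet> b) * \<psi> y)" using L(2) by (simp add: conv_def)
      also have "\<dots> = (LBINT y. \<eta> (y - x) * (D y \<bullet> b))"
      proof -
        have "(LBINT y. DF y \<bullet> b) = (LBINT y. \<eta> (y - x) * (D y \<bullet> b) + (De (y - x) \<bullet> b) * \<psi> y)"
          by (simp add: DF_def inner_add_left mult.commute)
        also have "\<dots> = (LBINT y. \<eta> (y - x) * (D y \<bullet> b)) + (LBINT y. (De (y - x) \<bullet> b) * \<psi> y)"
          by (rule Bochner_Integration.integral_add[OF i1 i2])
        finally show ?thesis using zero[of b] by simp
      qed
      finally show ?thesis .
    qed
    then have "\<bar>(grad \<phi> x - D x) \<bullet> b\<bar> \<le> \<delta> / N" if b: "b \<in> Basis" for b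
    proof -
      have cont: "continuous_on UNIV (\<lambda>y. D y \<bullet> b)" by (intro continuous_intros C1cD(2)[OF c])
      have "\<bar>D y \<bullet> b - D x \<bullet> b\<bar> \<le> \<delta> / N" if "norm (y - x) < \<epsilon>" for y
      proof -
        have "\<bar>(D y - D x) \<bullet> b\<bar> \<le> norm (D y - D x)" by (rule Basis_le_norm[OF b])
        also have "\<dots> \<le> \<delta> / N" using e2(2) eps(3) that by auto
        finally show ?thesis by (simp add: inner_diff_left)
      qed
      from avg[OF cont this] \<open>\<And>b. grad \<phi> x \<bullet> b = (LBINT y. \<eta> (y - x) * (D y \<bullet> b))\<close>
      show ?thesis by (simp add: inner_diff_left)
    qed
    then have "(\<Sum>b\<in>Basis. \<bar>(grad \<phi> x - D x) \<bullet> b\<bar>) \<le> (\<Sum>b\<in>(Basis::'a set). \<delta> / N)" by (intro sum_mono) auto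
    also have "\<dots> = \<delta>" using N by (simp add: N_def)
    finally show ?thesis using norm_le_l1[of "grad \<phi> x - D x"] by linarith
  qed
  ultimately show thesis using that tf by blast
qed

section \<open>Luxemburg norms and weak solutions\<close>

text \<open>A function equal almost everywhere to a Borel function is Lebesgue measurable by
  completeness. This is the bridge from \<open>lborel\<close>, where the analysis is done, to the
  completed measure of the definitions.\<close>

lemma lebesgue_measurable_AE:
  fixes F f :: "'a::euclidean_space \<Rightarrow> 'b::topological_space"
  assumes f: "f \<in> borel_measurable borel" and ae: "AE x in lebesgue. F x = f x"
  shows "F \<in> borel_measurable lebesgue"
proof (rule borel_measurableI)
  fix S :: "'b set" assume S: "open S"
  have "f -` S \<in> sets borel" using measurable_sets_borel[OF f] S by auto
  then have "f -` S \<in> sets lebesgue" by auto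
  then have "F -` S \<in> sets lebesgue"
    by (rule completion.in_sets_AE[rotated]) (use ae in \<open>auto elim: eventually_mono\<close>)
  then show "F -` S \<inter> space lebesgue \<in> sets lebesgue" by simp
qed

lemma lebesgue_set_integral:
  fixes F f :: "'a::euclidean_space \<Rightarrow> 'b::euclidean_space"
  assumes f: "integrable lborel f" "\<And>x. x \<notin> \<Omega> \<Longrightarrow> f x = 0"
    and ae: "AE x in lebesgue. x \<in> \<Omega> \<longrightarrow> F x = f x"
  shows "set_integrable lebesgue \<Omega> F" "(LINT x:\<Omega>|lebesgue. F x) = (LBINT x. f x)"
proof -
  have fb: "f \<in> borel_measurable borel" using borel_measurable_integrable[OF f(1)] by simp
  have ae': "AE x in lebesgue. indicator \<Omega> x *\<^sub>R F x = f x"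
    using ae by eventually_elim (use f(2) in \<open>auto simp: indicator_def\<close>)
  have Fm: "(\<lambda>x. indicator \<Omega> x *\<^sub>R F x) \<in> borel_measurable lebesgue" by (rule lebesgue_measurable_AE[OF fb ae'])
  have "f \<in> borel_measurable lborel" using fb by simp
  then have fm: "f \<in> borel_measurable lebesgue" by (rule measurable_completion)
  have fi: "integrable lebesgue f" using f(1) fb by (simp add: integrable_completion)
  show "set_integrable lebesgue \<Omega> F" unfolding set_integrable_def
    using integrable_cong_AE[OF Fm fm ae'] fi by simp
  have "(LINT x:\<Omega>|lebesgue. F x) = integral\<^sup>L lebesgue f" unfolding set_lebesgue_integral_def
    by (rule integral_cong_AE[OF Fm fm ae'])
  also have "\<dots> = (LBINT x. f x)" using fb by (intro integral_completion) simp
  finally show "(LINT x:\<Omega>|lebesgue. F x) = (LBINT x. f x)" .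
qed

text \<open>In the opposite direction: each coordinate of a Lebesgue measurable function has a Borel
  version, and finitely many exceptional null sets are merged.\<close>

lemma borel_version:
  fixes g :: "'a::euclidean_space \<Rightarrow> 'b::euclidean_space"
  assumes "set_borel_measurable lebesgue \<Omega> g" "\<Omega> \<in> sets borel"
  obtains g' where "g' \<in> borel_measurable borel" "\<forall>x. x \<notin> \<Omega> \<longrightarrow> g' x = 0" "AE x in lebesgue. x \<in> \<Omega> \<longrightarrow> g x = g' x"
proof -
  have [measurable]: "(\<lambda>x. indicator \<Omega> x *\<^sub>R g x) \<in> borel_measurable lebesgue"
    using assms(1) by (simp add: set_borel_measurable_def)
  have "\<exists>h\<in>borel_measurable lborel. AE x in lborel. (indicator \<Omega> x *\<^sub>R g x) \<bullet> b = h x" for b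
    by (rule completion_ex_borel_measurable_real) measurable
  then obtain h where h: "\<And>b. h b \<in> borel_measurable borel" "\<And>b. AE x in lborel. (indicator \<Omega> x *\<^sub>R g x) \<bullet> b = h b x"
    by (metis measurable_lborel2)
  note [measurable] = h(1) assms(2)
  define g' where "g' x = indicator \<Omega> x *\<^sub>R (\<Sum>b\<in>Basis. h b x *\<^sub>R b)" for x
  have "AE x in lborel. \<forall>b\<in>Basis. (indicator \<Omega> x *\<^sub>R g x) \<bullet> b = h b x"
    by (rule AE_finite_allI) (use h(2) in auto)
  then have "AE x in lborel. x \<in> \<Omega> \<longrightarrow> g x = g' x"
  proof eventually_elim
    case (elim x)
    have "(\<Sum>b\<in>Basis. (g x \<bullet> b) *\<^sub>R b) = (\<Sum>b\<in>Basis. h b x *\<^sub>R b)" if "x \<in> \<Omega>"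
      by (rule sum.cong) (use elim that in auto)
    then have "x \<in> \<Omega> \<Longrightarrow> g x = (\<Sum>b\<in>Basis. h b x *\<^sub>R b)" by (simp add: euclidean_representation)
    then show ?case by (simp add: g'_def)
  qed
  then have ae: "AE x in lebesgue. x \<in> \<Omega> \<longrightarrow> g x = g' x" by (rule AE_completion)
  show thesis
  proof
    show "g' \<in> borel_measurable borel" unfolding g'_def by measurable
  qed (use ae in \<open>auto simp: g'_def\<close>)
qed

lemma modular_cong:
  assumes "AE x in lebesgue. x \<in> \<Omega> \<longrightarrow> \<bar>w x\<bar> = \<bar>w' x\<bar>"
  shows "modular \<Omega> q w = modular \<Omega> q w'"
  unfolding modular_def
  by (rule nn_integral_cong_AE) (use assms in eventually_elim, auto simp: indicator_def)

lemma lux_cong: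
  assumes "AE x in lebesgue. x \<in> \<Omega> \<longrightarrow> \<bar>w x\<bar> = \<bar>w' x\<bar>"
  shows "lux \<Omega> q w = lux \<Omega> q w'"
proof -
  have "modular \<Omega> q (\<lambda>x. w x / l) = modular \<Omega> q (\<lambda>x. w' x / l)" for l
    by (rule modular_cong) (use assms in eventually_elim, auto simp: abs_divide)
  then show ?thesis by (simp add: lux_def)
qed

text \<open>A bounded C1 function with bounded derivative that is the identity on
  \<open>[- B, B]\<close>. Applied to approximants of a bounded function it makes them uniformly
  bounded without moving the limit. The square in the exponent makes the glueing at \<open>B\<close>
  differentiable.\<close>

lemma bounded_identity:
  fixes B :: real
  obtains \<tau> \<tau>' L where "\<forall>t. (\<tau> has_real_derivative \<tau>' t) (at t)" "continuous_on UNIV \<tau>'" "\<forall>t. \<bar>\<tau>' t\<bar> \<le> L"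
    "\<forall>t. \<bar>\<tau> t\<bar> \<le> L" "\<forall>t. \<bar>t\<bar> \<le> B \<longrightarrow> \<tau> t = t \<and> \<tau>' t = 1" "\<tau> 0 = 0"
proof -
  define m where "m t = max 0 (t\<^sup>2 - B\<^sup>2)" for t
  define \<tau> where "\<tau> t = t * exp (- (m t)\<^sup>2)" for t
  define \<tau>' where "\<tau>' t = exp (- (m t)\<^sup>2) * (1 - 4 * t\<^sup>2 * m t)" for t
  \<comment> \<open>With \<open>m t\<close> for the excess of the square of \<open>t\<close> over
    that of \<open>B\<close>, both \<open>m\<close> and its square times
    \<open>exp (- m ^ 2)\<close> are at most 1; \<open>L\<close> collects the resulting bounds for
    the function and its derivative.\<close>
  define L where "L = 1 + 4 * (1 + B\<^sup>2)"
  have d: "(\<tau> has_real_derivative \<tau>' t) (at t)" for t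
  proof -
    have "((\<lambda>t. t\<^sup>2 - B\<^sup>2) has_real_derivative 2 * t) (at t)" by (auto intro!: derivative_eq_intros)
    from DERIV_chain2[OF max0_square_derivative this]
    have "((\<lambda>t. (m t)\<^sup>2) has_real_derivative 2 * m t * (2 * t)) (at t)" unfolding m_def by simp
    from DERIV_mult[OF DERIV_ident DERIV_chain2[OF DERIV_exp DERIV_minus[OF this]]]
    show ?thesis unfolding \<tau>_def[abs_def] \<tau>'_def by (simp add: algebra_simps power2_eq_square)
  qed
  have cont: "continuous_on UNIV \<tau>'" unfolding \<tau>'_def[abs_def] m_def
    by (intro continuous_intros continuous_on_max)
  have m0: "0 \<le> m t" "t\<^sup>2 \<le> m t + B\<^sup>2" for t by (auto simp: m_def)
  have e2: "(m t)\<^sup>2 * exp (- (m t)\<^sup>2) \<le> 1" for t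
  proof -
    have "1 + (m t)\<^sup>2 \<le> exp ((m t)\<^sup>2)" by (rule exp_ge_add_one_self)
    then have "(m t)\<^sup>2 \<le> exp ((m t)\<^sup>2)" by linarith
    then show ?thesis by (simp add: exp_minus field_simps)
  qed
  have e1: "m t * exp (- (m t)\<^sup>2) \<le> 1" for t
  proof -
    have "m t \<le> 1 + (m t)\<^sup>2" using m0(1)[of t] zero_le_power2[of "m t - 1"] by (simp add: power2_diff)
    also have "\<dots> \<le> exp ((m t)\<^sup>2)" by (rule exp_ge_add_one_self)
    finally show ?thesis by (simp add: exp_minus field_simps)
  qed
  have b1: "\<bar>\<tau>' t\<bar> \<le> L" for t
  proof -
    define e where "e = exp (- (m t)\<^sup>2)"
    have e: "0 < e" "e \<le> 1" by (auto simp: e_def)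
    have "4 * t\<^sup>2 * m t * e \<le> 4 * (m t + B\<^sup>2) * m t * e"
      using m0[of t] e by (intro mult_right_mono mult_left_mono) auto
    also have "\<dots> = 4 * ((m t)\<^sup>2 * e) + 4 * B\<^sup>2 * (m t * e)" by (simp add: algebra_simps power2_eq_square)
    also have "\<dots> \<le> 4 * 1 + 4 * B\<^sup>2 * 1"
      using e1[of t] e2[of t] unfolding e_def[symmetric] by (intro add_mono mult_left_mono) auto
    finally have "4 * t\<^sup>2 * m t * e \<le> 4 * (1 + B\<^sup>2)" by simp
    moreover have "0 \<le> 4 * t\<^sup>2 * m t * e" using m0[of t] e by simp
    moreover have "\<tau>' t = e - 4 * t\<^sup>2 * m t * e" unfolding \<tau>'_def e_def by (simp add: algebra_simps)
    ultimately show ?thesis using e unfolding L_def by linarith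
  qed
  have b2: "\<bar>\<tau> t\<bar> \<le> L" for t
  proof -
    define e where "e = exp (- (m t)\<^sup>2)"
    have e: "0 < e" "e \<le> 1" by (auto simp: e_def)
    have "\<bar>t\<bar> \<le> 1 + t\<^sup>2" using zero_le_power2[of "\<bar>t\<bar> - 1"] zero_le_power2[of t] by (simp add: power2_eq_square algebra_simps)
    then have "\<bar>t\<bar> \<le> (1 + B\<^sup>2) + m t" using m0(2)[of t] by linarith
    then have "\<bar>t\<bar> * e \<le> ((1 + B\<^sup>2) + m t) * e" using e by (intro mult_right_mono) auto
    also have "\<dots> = (1 + B\<^sup>2) * e + m t * e" by (simp add: algebra_simps)
    also have "\<dots> \<le> (1 + B\<^sup>2) * 1 + 1" using e e1[of t] unfolding e_def[symmetric] by (intro add_mono mult_left_mono) auto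
    also have "\<dots> \<le> L" unfolding L_def by simp
    finally show ?thesis unfolding \<tau>_def e_def by (simp add: abs_mult)
  qed
  have id: "\<tau> t = t \<and> \<tau>' t = 1" if "\<bar>t\<bar> \<le> B" for t
  proof -
    have "t\<^sup>2 \<le> B\<^sup>2" using that by (simp add: abs_le_square_iff[symmetric])
    then have "m t = 0" by (simp add: m_def)
    then show ?thesis by (simp add: \<tau>_def \<tau>'_def)
  qed
  show thesis using that[of \<tau> \<tau>' L] d cont b1 b2 id by (simp add: \<tau>_def)
qed

section \<open>Modular, Luxemburg norm and the given Sobolev space\<close>

context pspace begin

lemma modular_eq_rho:
  assumes "Lp w" "\<And>x. x \<in> \<Omega> \<Longrightarrow> q x = p x"
  shows "modular \<Omega> q w = ennreal (rho w)"
proof -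
  have "modular \<Omega> q w = (\<integral>\<^sup>+x. ennreal (norm (w x) powr p x) \<partial>lebesgue)"
    unfolding modular_def
    by (rule nn_integral_cong) (use assms(2) LpD(2)[OF assms(1)] in \<open>auto simp: indicator_def\<close>)
  also have "\<dots> = (\<integral>\<^sup>+x. ennreal (norm (w x) powr p x) \<partial>lborel)" by (rule nn_integral_completion)
  also have "\<dots> = ennreal (rho w)" unfolding rho_def
    by (rule nn_integral_eq_integral[OF LpD(3)[OF assms(1)]]) simp
  finally show ?thesis .
qed

text \<open>Scaling estimates without homogeneity: the extreme exponents 1 and \<open>pp\<close>
  bound the power of \<open>l\<close>, in a direction that depends on whether \<open>l\<close>
  exceeds 1.\<close>

lemma rho_divide:
  fixes w :: "'a \<Rightarrow> real"
  assumes "Lp w" "0 < l"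
  shows "Lp (\<lambda>x. w x / l)" "l \<le> 1 \<Longrightarrow> rho (\<lambda>x. w x / l) \<le> l powr (- pp) * rho w" "1 \<le> l \<Longrightarrow> rho (\<lambda>x. w x / l) \<le> rho w / l"
    "l \<le> 1 \<Longrightarrow> rho w \<le> l * rho (\<lambda>x. w x / l)"
proof -
  show L: "Lp (\<lambda>x. w x / l)" using Lp_scale[OF assms(1), of "1 / l"] by simp
  have eq: "norm (w x / l) powr p x = l powr (- p x) * norm (w x) powr p x" for x
  proof -
    have "norm (w x / l) = norm (w x) / l" using assms(2) by simp
    then have "norm (w x / l) powr p x = norm (w x) powr p x / l powr p x"
      using assms(2) by (simp only: powr_divide)
    then show ?thesis by (simp add: powr_minus divide_inverse mult.commute)
  qed
  note I = LpD(3)[OF L] and J = LpD(3)[OF assms(1)]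
  show "rho (\<lambda>x. w x / l) \<le> l powr (- pp) * rho w" if "l \<le> 1"
    unfolding rho_def integral_mult_right_zero[symmetric]
  proof (rule integral_mono[OF I integrable_mult_right[OF J]])
    show "norm (w x / l) powr p x \<le> l powr (- pp) * norm (w x) powr p x" for x
      unfolding eq using that assms(2) p_le_pp[of x] by (intro mult_right_mono powr_mono') auto
  qed
  show "rho (\<lambda>x. w x / l) \<le> rho w / l" if "1 \<le> l"
  proof -
    have "rho (\<lambda>x. w x / l) \<le> (1 / l) * rho w"
      unfolding rho_def integral_mult_right_zero[symmetric]
    proof (rule integral_mono[OF I integrable_mult_right[OF J]])
      show "norm (w x / l) powr p x \<le> (1 / l) * norm (w x) powr p x" for x
      proof -
        have "l powr (- p x) \<le> l powr (- 1)" using that p_gt_1[of x] by (intro powr_mono) auto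
        then show ?thesis unfolding eq using assms(2) by (intro mult_right_mono) (auto simp: powr_minus_divide)
      qed
    qed
    then show ?thesis by simp
  qed
  show "rho w \<le> l * rho (\<lambda>x. w x / l)" if "l \<le> 1"
    unfolding rho_def integral_mult_right_zero[symmetric]
  proof (rule integral_mono[OF J integrable_mult_right[OF I]])
    show "norm (w x) powr p x \<le> l * norm (w x / l) powr p x" for x
    proof -
      have "l powr p x \<le> l powr 1" using that assms(2) p_gt_1[of x] by (intro powr_mono') auto
      then have "1 \<le> l * l powr (- p x)" using assms(2) by (simp add: powr_minus field_simps)
      then have "1 * norm (w x) powr p x \<le> (l * l powr (- p x)) * norm (w x) powr p x" by (intro mult_right_mono) auto
      then show ?thesis unfolding eq by simp
    qed
  qed
qed

lemma lux_set_nonempty: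
  assumes "Lp w" "\<And>x. x \<in> \<Omega> \<Longrightarrow> q x = p x"
  shows "{l. 0 < l \<and> modular \<Omega> q (\<lambda>x. w x / l) \<le> 1} \<noteq> {}"
proof -
  define l where "l = max 1 (rho w)"
  have l: "0 < l" "1 \<le> l" "rho w \<le> l" by (auto simp: l_def)
  have "rho (\<lambda>x. w x / l) \<le> rho w / l" by (rule rho_divide(3)[OF assms(1) l(1,2)])
  also have "\<dots> \<le> 1" using l by simp
  finally have "modular \<Omega> q (\<lambda>x. w x / l) \<le> 1"
    using modular_eq_rho[OF rho_divide(1)[OF assms(1) l(1)] assms(2)] by simp
  then show ?thesis using l(1) by blast
qed

lemma lux_Lp_nonneg:
  assumes "Lp w" "\<And>x. x \<in> \<Omega> \<Longrightarrow> q x = p x"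
  shows "0 \<le> lux \<Omega> q w"
  unfolding lux_def using lux_set_nonempty[OF assms] by (intro cInf_greatest) auto

lemma lux_Lp_le:
  assumes "Lp w" "\<And>x. x \<in> \<Omega> \<Longrightarrow> q x = p x" "0 < l" "l \<le> 1" "rho w \<le> l powr pp"
  shows "lux \<Omega> q w \<le> l"
proof -
  have "rho (\<lambda>x. w x / l) \<le> l powr (- pp) * rho w" by (rule rho_divide(2)[OF assms(1,3,4)])
  also have "\<dots> \<le> l powr (- pp) * l powr pp" using assms(5) by (intro mult_left_mono) auto
  also have "\<dots> = 1" using assms(3) by (simp add: powr_minus)
  finally have "modular \<Omega> q (\<lambda>x. w x / l) \<le> 1"
    using modular_eq_rho[OF rho_divide(1)[OF assms(1,3)] assms(2)] by simp
  then show ?thesis unfolding lux_def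
    using assms(3) by (intro cInf_lower bdd_belowI[of _ 0]) auto
qed

lemma lux_Lp_tendsto:
  assumes "\<And>n. Lp (w n)" "\<And>x. x \<in> \<Omega> \<Longrightarrow> q x = p x" "(\<lambda>n. rho (w n)) \<longlonglongrightarrow> 0"
  shows "(\<lambda>n. lux \<Omega> q (w n)) \<longlonglongrightarrow> 0"
proof (rule LIMSEQ_I)
  fix e :: real assume e: "0 < e"
  define l where "l = min 1 (e / 2)"
  have l: "0 < l" "l \<le> 1" "l < e" using e by (auto simp: l_def)
  have "eventually (\<lambda>n. rho (w n) < l powr pp) sequentially" using assms(3) by (rule order_tendstoD) (use l in simp)
  then obtain N where N: "\<And>n. n \<ge> N \<Longrightarrow> rho (w n) < l powr pp" unfolding eventually_sequentially by blast
  have "norm (lux \<Omega> q (w n) - 0) < e" if "n \<ge> N" for n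
    using lux_Lp_le[OF assms(1,2) l(1,2), of n] N[OF that] lux_Lp_nonneg[OF assms(1,2), of n] l(3) by simp
  then show "\<exists>no. \<forall>n\<ge>no. norm (lux \<Omega> q (w n) - 0) < e" by blast
qed

text \<open>A norm below \<open>d \<le> 1\<close> provides an admissible \<open>l < d\<close>, and
  then the modular is at most \<open>l\<close>, because shrinking by \<open>l\<close> gains at least
  one factor \<open>l\<close>.\<close>

lemma rho_tendsto_of_lux:
  assumes L: "\<And>n. Lp (w n)" "\<And>x. x \<in> \<Omega> \<Longrightarrow> q x = p x" "(\<lambda>n. lux \<Omega> q (w n)) \<longlonglongrightarrow> 0"
  shows "(\<lambda>n. rho (w n)) \<longlonglongrightarrow> 0"
proof (rule LIMSEQ_I)
  fix e :: real assume e: "0 < e"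
  define d where "d = min 1 e"
  have d: "0 < d" "d \<le> 1" "d \<le> e" using e by (auto simp: d_def)
  have "eventually (\<lambda>n. lux \<Omega> q (w n) < d) sequentially" using assms(3) by (rule order_tendstoD) (use d in simp)
  then obtain N where N: "\<And>n. n \<ge> N \<Longrightarrow> lux \<Omega> q (w n) < d" unfolding eventually_sequentially by blast
  have "norm (rho (w n) - 0) < e" if "n \<ge> N" for n
  proof -
    have "Inf {l. 0 < l \<and> modular \<Omega> q (\<lambda>x. w n x / l) \<le> 1} < d" using N[OF that] unfolding lux_def .
    from cInf_lessD[OF lux_set_nonempty[OF L(1)[of n] L(2)] this]
    obtain l where l: "0 < l" "modular \<Omega> q (\<lambda>x. w n x / l) \<le> 1" "l < d" by blast
    have "ennreal (rho (\<lambda>x. w n x / l)) \<le> 1"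
      using l(2) modular_eq_rho[OF rho_divide(1)[OF L(1) l(1)] L(2)] by simp
    then have "rho (\<lambda>x. w n x / l) \<le> 1" by simp
    then have "l * rho (\<lambda>x. w n x / l) \<le> l * 1" using l(1) by (intro mult_left_mono) auto
    then have "rho (w n) \<le> l" using rho_divide(4)[OF L(1) l(1), of n] l(3) d(2) by linarith
    then show ?thesis using l(3) d(3) by simp
  qed
  then show "\<exists>no. \<forall>n\<ge>no. norm (rho (w n) - 0) < e" by blast
qed

lemma Lp_norm:
  fixes G :: "'a \<Rightarrow> 'b::euclidean_space"
  assumes "Lp G" shows "Lp (\<lambda>x. norm (G x))" "rho (\<lambda>x. norm (G x)) = rho G"
proof -
  note [measurable] = LpD(1)[OF assms]
  show "Lp (\<lambda>x. norm (G x))" using assms by (simp add: Lp_def)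
  show "rho (\<lambda>x. norm (G x)) = rho G" by (simp add: rho_def)
qed

lemma borel_set_measurable: "f \<in> borel_measurable borel \<Longrightarrow> set_borel_measurable lebesgue \<Omega> (f :: 'a \<Rightarrow> 'b::euclidean_space)"
proof -
  assume [measurable]: "f \<in> borel_measurable borel"
  have "(\<lambda>x. indicator \<Omega> x *\<^sub>R f x) \<in> borel_measurable lborel" by measurable
  then show ?thesis unfolding set_borel_measurable_def by (rule measurable_completion)
qed

lemma Lp_in_Lvar:
  assumes "Lp w" "\<And>x. x \<in> \<Omega> \<Longrightarrow> q x = p x" shows "in_Lvar \<Omega> q w"
  unfolding in_Lvar_def using borel_set_measurable[OF LpD(1)[OF assms(1)]] modular_eq_rho[OF assms] by simp

text \<open>For uniformly bounded functions the modular is controlled by the L1 norm; this upgrades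
  the L1 convergence in \<open>W\<close> to the convergence required by \<open>W0\<close>.\<close>

lemma rho_bounded_le:
  fixes w :: "'a \<Rightarrow> real"
  assumes "Lp w" "\<And>x. \<bar>w x\<bar> \<le> M" "1 \<le> M"
  shows "rho w \<le> M powr pp * L1norm w"
  unfolding rho_def integral_mult_right_zero[symmetric]
proof (rule integral_mono[OF LpD(3)[OF assms(1)]])
  show "integrable lborel (\<lambda>x. M powr pp * \<bar>w x\<bar>)" using Lp_integrable(1)[OF assms(1)] by simp
  show "norm (w x) powr p x \<le> M powr pp * \<bar>w x\<bar>" for x
  proof -
    have "norm (w x) powr p x = \<bar>w x\<bar> powr (p x - 1) * \<bar>w x\<bar>" using powr_mult_self[of "\<bar>w x\<bar>" "p x"] by simp
    also have "\<bar>w x\<bar> powr (p x - 1) \<le> M powr (p x - 1)" using assms(2)[of x] p_gt_1[of x] by (intro powr_mono2) auto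
    also have "\<dots> \<le> M powr pp" using assms(3) p_le_pp[of x] by (intro powr_mono) auto
    finally show ?thesis by (simp add: mult_right_mono)
  qed
qed

lemma rho_uniform_le:
  fixes F :: "'a \<Rightarrow> 'b::euclidean_space"
  assumes "Lp F" "\<And>x. norm (F x) \<le> \<delta>" "\<delta> \<le> 1"
  shows "rho F \<le> \<delta> * vol"
proof -
  have d: "0 \<le> \<delta>" using assms(2)[of undefined] norm_ge_zero order_trans by blast
  have "rho F \<le> (LBINT x. \<delta> * indicator \<Omega> x)"
    unfolding rho_def
  proof (rule integral_mono[OF LpD(3)[OF assms(1)] domain_indicator(1)])
    show "norm (F x) powr p x \<le> \<delta> * indicator \<Omega> x" for x
    proof (cases "x \<in> \<Omega>")
      case True
      have "norm (F x) powr p x \<le> \<delta> powr p x" using assms(2)[of x] p_gt_1[of x] by (intro powr_mono2) auto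
      also have "\<dots> \<le> \<delta>" using powr_mono'[of 1 "p x" \<delta>] d assms(3) p_gt_1[of x] by simp
      finally show ?thesis using True by simp
    qed (simp add: LpD(2)[OF assms(1)])
  qed
  then show ?thesis unfolding domain_indicator(2) .
qed

lemma C1c_parts:
  assumes "C1c \<Omega> \<psi> D" "C1c \<Omega> \<phi> E"
  shows "(LBINT x. \<psi> x * (E x \<bullet> b)) = - (LBINT x. (D x \<bullet> b) * \<phi> x)"
proof -
  obtain B where B: "0 \<le> B" "\<forall>x. \<bar>\<psi> x\<bar> \<le> B" "\<forall>x. norm (D x) \<le> B" by (rule C1c_bounded[OF assms(1)])
  obtain B' where B': "0 \<le> B'" "\<forall>x. \<bar>\<phi> x\<bar> \<le> B'" "\<forall>x. norm (E x) \<le> B'" by (rule C1c_bounded[OF assms(2)])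
  have d: "((\<lambda>x. \<psi> x * \<phi> x) has_derivative (\<lambda>h. (\<psi> x *\<^sub>R E x + \<phi> x *\<^sub>R D x) \<bullet> h)) (at x)" for x
    by (rule has_derivative_eq_rhs[OF has_derivative_mult[OF C1cD(1)[OF assms(1)] C1cD(1)[OF assms(2)]]])
       (auto simp: inner_add_left mult.commute)
  have bd: "norm (\<psi> x *\<^sub>R E x + \<phi> x *\<^sub>R D x) \<le> B * B' + B' * B" for x
    by (rule order_trans[OF norm_triangle_ineq add_mono]) (use B B' in \<open>auto intro!: mult_mono\<close>)
  have "(LBINT x. (\<psi> x *\<^sub>R E x + \<phi> x *\<^sub>R D x) \<bullet> b) = 0"
    by (rule difference_quotient_integral(2)[OF d bd bounded_domain]) (simp add: C1c_outside(1)[OF assms(1)])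
  moreover have i1: "integrable lborel (\<lambda>x. \<psi> x * (E x \<bullet> b))"
    by (rule integrable_bounded_mult(1)[OF C1cD(5)[OF assms(1)] B(2)[rule_format]])
       (use C1c_integrable(2)[OF bounded_domain assms(2)] in auto)
  have i2: "integrable lborel (\<lambda>x. \<phi> x * (D x \<bullet> b))"
    by (rule integrable_bounded_mult(1)[OF C1cD(5)[OF assms(2)] B'(2)[rule_format]])
       (use C1c_integrable(2)[OF bounded_domain assms(1)] in auto)
  ultimately have "(LBINT x. \<psi> x * (E x \<bullet> b)) + (LBINT x. \<phi> x * (D x \<bullet> b)) = 0"
    using Bochner_Integration.integral_add[OF i1 i2] by (simp add: inner_add_left)
  then show ?thesis by (simp add: mult.commute)
qed

text \<open>Integration by parts holds for C1 approximants and passes to the limit, since a test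
  function and its gradient are bounded and both sequences converge in L1.\<close>

lemma W_weak_grad:
  assumes "W u G"
  shows "weak_grad \<Omega> u G"
  unfolding weak_grad_def
proof (intro conjI allI impI ballI)
  show "set_integrable lebesgue \<Omega> u" "set_integrable lebesgue \<Omega> G"
    by (rule lebesgue_set_integral(1)[OF WD(1)[OF assms] WD(3)[OF assms]], assumption, simp)
       (rule lebesgue_set_integral(1)[OF Lp_integrable(1)[OF WD(4)[OF assms]] WD(5)[OF assms]], assumption, simp)
  fix \<phi> and b :: 'a assume t: "test_fn \<Omega> \<phi>" and b: "b \<in> Basis"
  note cc = test_fn_C1c[OF t]
  obtain B where B: "0 \<le> B" "\<forall>x. \<bar>\<phi> x\<bar> \<le> B" "\<forall>x. norm (grad \<phi> x) \<le> B" by (rule C1c_bounded[OF cc])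
  obtain \<psi> D g where 1: "\<forall>n. C1c \<Omega> (\<psi> n) (D n)" "(\<lambda>n. L1norm (\<lambda>x. \<psi> n x - u x)) \<longlonglongrightarrow> 0"
    "(\<lambda>n. rho (\<lambda>x. D n x - G x)) \<longlonglongrightarrow> 0" "(\<lambda>n. LBINT x. norm (D n x - G x)) \<longlonglongrightarrow> 0"
    "integrable lborel g"
    "AE x in lborel. (\<forall>n. \<bar>\<psi> n x - u x\<bar> \<le> g x \<and> norm (D n x - G x) powr p x \<le> g x) \<and>
        (\<lambda>n. \<psi> n x) \<longlonglongrightarrow> u x \<and> (\<lambda>n. D n x) \<longlonglongrightarrow> G x"
    by (rule W_approx[OF assms])
  have gb: "\<bar>grad \<phi> x \<bullet> b\<bar> \<le> B" for x using Basis_le_norm[OF b, of "grad \<phi> x"] B(3) order_trans by blast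
  have gm: "(\<lambda>x. grad \<phi> x \<bullet> b) \<in> borel_measurable borel" using C1cD(4)[OF cc] by measurable
  note Gi = Lp_integrable(1)[OF WD(4)[OF assms]]
  note ci = C1c_integrable[OF bounded_domain 1(1)[rule_format]]
  have l1: "(\<lambda>n. LBINT x. (grad \<phi> x \<bullet> b) * \<psi> n x) \<longlonglongrightarrow> (LBINT x. (grad \<phi> x \<bullet> b) * u x)"
    by (rule bounded_mult_tendsto[OF gm gb WD(1)[OF assms] ci(1) 1(2)])
  have l2: "(\<lambda>n. LBINT x. \<phi> x * (D n x \<bullet> b)) \<longlonglongrightarrow> (LBINT x. \<phi> x * (G x \<bullet> b))"
  proof (rule bounded_mult_tendsto[OF C1cD(5)[OF cc] B(2)[rule_format]])
    show "integrable lborel (\<lambda>x. G x \<bullet> b)" "integrable lborel (\<lambda>x. D n x \<bullet> b)" for n using Gi ci(2) by auto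
    show "(\<lambda>n. L1norm (\<lambda>x. D n x \<bullet> b - G x \<bullet> b)) \<longlonglongrightarrow> 0"
    proof (rule tendsto_sandwich[OF _ _ tendsto_const 1(4)])
      have "L1norm (\<lambda>x. D n x \<bullet> b - G x \<bullet> b) \<le> (LBINT x. norm (D n x - G x))" for n
      proof (rule integral_mono)
        show "\<bar>D n x \<bullet> b - G x \<bullet> b\<bar> \<le> norm (D n x - G x)" for x using Basis_le_norm[OF b, of "D n x - G x"] by (simp add: inner_diff_left)
      qed (use Gi ci(2) in auto)
      then show "eventually (\<lambda>n. (L1norm (\<lambda>x. D n x \<bullet> b - G x \<bullet> b)) \<le> (LBINT x. norm (D n x - G x))) sequentially" by simp
    qed simp
  qed
  have "(LBINT x. (grad \<phi> x \<bullet> b) * \<psi> n x) = - (LBINT x. \<phi> x * (D n x \<bullet> b))" for n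
    using C1c_parts[OF 1(1)[rule_format] cc, of n b] by (simp add: mult.commute)
  then have eq: "(LBINT x. (grad \<phi> x \<bullet> b) * u x) = - (LBINT x. \<phi> x * (G x \<bullet> b))"
    using LIMSEQ_unique[OF l1] tendsto_minus[OF l2] by simp
  have i1: "integrable lborel (\<lambda>x. (grad \<phi> x \<bullet> b) * u x)" by (rule integrable_bounded_mult(1)[OF gm gb WD(1)[OF assms]])
  have i2: "integrable lborel (\<lambda>x. \<phi> x * (G x \<bullet> b))"
    by (rule integrable_bounded_mult(1)[OF C1cD(5)[OF cc] B(2)[rule_format]]) (use Gi in auto)
  have "(LINT x:\<Omega>|lebesgue. u x * (grad \<phi> x \<bullet> b)) = (LBINT x. (grad \<phi> x \<bullet> b) * u x)"
    by (rule lebesgue_set_integral(2)[OF i1]) (use WD(3)[OF assms] in \<open>auto simp: mult.commute\<close>)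
  moreover have "(LINT x:\<Omega>|lebesgue. (G x \<bullet> b) * \<phi> x) = (LBINT x. \<phi> x * (G x \<bullet> b))"
    by (rule lebesgue_set_integral(2)[OF i2]) (use WD(5)[OF assms] in \<open>auto simp: mult.commute\<close>)
  ultimately show "(LINT x:\<Omega>|lebesgue. u x * (grad \<phi> x \<bullet> b)) = - (LINT x:\<Omega>|lebesgue. (G x \<bullet> b) * \<phi> x)"
    using eq by simp
qed

lemma rho_tendsto_perturbation:
  fixes F F' :: "nat \<Rightarrow> 'a \<Rightarrow> 'b::euclidean_space"
  assumes L: "\<And>n. Lp (F n)" "\<And>n. Lp (F' n)" "Lp f" and d: "\<And>n x. norm (F n x - F' n x) \<le> inverse (real (Suc n))"
    and l: "(\<lambda>n. rho (\<lambda>x. F' n x - f x)) \<longlonglongrightarrow> 0"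
  shows "(\<lambda>n. rho (\<lambda>x. F n x - f x)) \<longlonglongrightarrow> 0"
proof (rule tendsto_sandwich[OF _ _ tendsto_const])
  show "(\<lambda>n. 2 powr pp * (inverse (real (Suc n)) * vol + rho (\<lambda>x. F' n x - f x))) \<longlonglongrightarrow> 0"
    using tendsto_mult_right_zero[OF tendsto_add_zero[OF tendsto_mult_left_zero[OF LIMSEQ_inverse_real_of_nat, of vol] l], of "2 powr pp"] by simp
  have "rho (\<lambda>x. F n x - f x) \<le> 2 powr pp * (inverse (real (Suc n)) * vol + rho (\<lambda>x. F' n x - f x))" for n
  proof -
    have L1: "Lp (\<lambda>x. F n x - F' n x)" by (rule Lp_diff(1)[OF L(1,2)])
    have "rho (\<lambda>x. (F n x - F' n x) + (F' n x - f x)) \<le> 2 powr pp * (rho (\<lambda>x. F n x - F' n x) + rho (\<lambda>x. F' n x - f x))"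
      by (rule Lp_add(2)[OF L1 Lp_diff(1)[OF L(2,3)]])
    also have "\<dots> \<le> 2 powr pp * (inverse (real (Suc n)) * vol + rho (\<lambda>x. F' n x - f x))"
      using rho_uniform_le[OF L1 d] by (intro mult_left_mono add_mono) (auto simp: inverse_le_1_iff)
    finally show ?thesis by simp
  qed
  then show "eventually (\<lambda>n. rho (\<lambda>x. F n x - f x) \<le> 2 powr pp * (inverse (real (Suc n)) * vol + rho (\<lambda>x. F' n x - f x))) sequentially" by simp
qed simp

text \<open>\<open>W0\<close> asks for approximation of the function in the Luxemburg norm and by
  smooth functions. Boundedness of \<open>u\<close> gives the first, by truncating the approximants
  with \<open>\<tau>\<close>; mollification with error \<open>inverse (Suc n)\<close> gives the
  second.\<close>

lemma W_W0:
  assumes W: "W u G" and B: "\<And>x. \<bar>u x\<bar> \<le> B" and q: "\<And>x. x \<in> \<Omega> \<Longrightarrow> q x = p x"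
  shows "W0 \<Omega> q u G"
proof -
  have Lu: "Lp u" by (rule Lp_bounded[OF WD(2)[OF W] WD(3)[OF W]]) (use B in auto)
  obtain \<tau> \<tau>' L where \<tau>: "\<forall>t. (\<tau> has_real_derivative \<tau>' t) (at t)" "continuous_on UNIV \<tau>'" "\<forall>t. \<bar>\<tau>' t\<bar> \<le> L"
    "\<forall>t. \<bar>\<tau> t\<bar> \<le> L" "\<forall>t. \<bar>t\<bar> \<le> B \<longrightarrow> \<tau> t = t \<and> \<tau>' t = 1" "\<tau> 0 = 0" by (rule bounded_identity)
  have z: "((\<lambda>x::'a. 0) has_derivative (\<lambda>h. 0 \<bullet> h)) (at x)" for x :: 'a
    by (rule has_derivative_eq_rhs[OF has_derivative_const]) auto
  obtain \<psi> D where 1: "\<forall>n. C1c \<Omega> (\<psi> n) (D n)"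
    "(\<lambda>n. L1norm (\<lambda>x. \<tau> (0 + 1 * \<psi> n x) - \<tau> (0 + 1 * u x))) \<longlonglongrightarrow> 0"
    "(\<lambda>n. rho (\<lambda>x. \<tau>' (0 + 1 * \<psi> n x) *\<^sub>R (0 + 1 *\<^sub>R D n x) - \<tau>' (0 + 1 * u x) *\<^sub>R (0 + 1 *\<^sub>R G x))) \<longlonglongrightarrow> 0"
    "W (\<lambda>x. \<tau> (0 + 1 * u x)) (\<lambda>x. \<tau>' (0 + 1 * u x) *\<^sub>R (0 + 1 *\<^sub>R G x))"
    by (rule W_compose[OF \<tau>(1)[rule_format] \<tau>(2) \<tau>(3)[rule_format] z continuous_on_const, of "{}" u G 1])
       (use \<tau>(6) W in auto)
  define \<psi>' where "\<psi>' n x = \<tau> (\<psi> n x)" for n x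
  define D' where "D' n x = \<tau>' (\<psi> n x) *\<^sub>R D n x" for n x
  have c: "C1c \<Omega> (\<psi>' n) (D' n)" for n
    using C1c_compose[OF \<tau>(1)[rule_format] \<tau>(2) z continuous_on_const, of "{}" \<Omega> "\<psi> n" "D n" 1] \<tau>(6) 1(1)
    by (simp add: \<psi>'_def[abs_def] D'_def[abs_def])
  have uid: "\<tau> (u x) = u x" "\<tau>' (u x) = 1" for x using \<tau>(5) B by auto
  have l1: "(\<lambda>n. L1norm (\<lambda>x. \<psi>' n x - u x)) \<longlonglongrightarrow> 0" using 1(2) by (simp add: \<psi>'_def uid)
  have l2: "(\<lambda>n. rho (\<lambda>x. D' n x - G x)) \<longlonglongrightarrow> 0" using 1(3) by (simp add: D'_def uid)
  have Ld: "Lp (\<lambda>x. \<psi>' n x - u x)" for n by (rule Lp_diff(1)[OF C1c_Lp(2)[OF c] Lu])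
  define M where "M = max 1 (L + B)"
  have l3: "(\<lambda>n. rho (\<lambda>x. \<psi>' n x - u x)) \<longlonglongrightarrow> 0"
  proof (rule tendsto_sandwich[OF _ _ tendsto_const tendsto_mult_right_zero[OF l1, of "M powr pp"]])
    have "\<bar>\<psi>' n x - u x\<bar> \<le> M" for n x
      using abs_triangle_ineq4[of "\<psi>' n x" "u x"] \<tau>(4)[rule_format, of "\<psi> n x"] B[of x] unfolding \<psi>'_def M_def by linarith
    then have "rho (\<lambda>x. \<psi>' n x - u x) \<le> M powr pp * L1norm (\<lambda>x. \<psi>' n x - u x)" for n
      by (intro rho_bounded_le[OF Ld]) (auto simp: M_def)
    then show "eventually (\<lambda>n. rho (\<lambda>x. \<psi>' n x - u x) \<le> M powr pp * L1norm (\<lambda>x. \<psi>' n x - u x)) sequentially" by simp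
  qed simp
  have "\<exists>\<phi>. test_fn \<Omega> \<phi> \<and> (\<forall>x. \<bar>\<phi> x - \<psi>' n x\<bar> \<le> inverse (real (Suc n))) \<and> (\<forall>x. norm (grad \<phi> x - D' n x) \<le> inverse (real (Suc n)))" for n
  proof -
    have "0 < inverse (real (Suc n))" by simp
    from C1c_test_approx[OF open_domain bounded_domain c[of n] this] show ?thesis by metis
  qed
  then obtain \<phi> where \<phi>: "\<And>n. test_fn \<Omega> (\<phi> n)" "\<And>n x. \<bar>\<phi> n x - \<psi>' n x\<bar> \<le> inverse (real (Suc n))"
     "\<And>n x. norm (grad (\<phi> n) x - D' n x) \<le> inverse (real (Suc n))" by metis
  note ct = test_fn_C1c[OF \<phi>(1)]
  have r1: "(\<lambda>n. rho (\<lambda>x. \<phi> n x - u x)) \<longlonglongrightarrow> 0"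
    by (rule rho_tendsto_perturbation[OF C1c_Lp(2)[OF ct] C1c_Lp(2)[OF c] Lu _ l3]) (use \<phi>(2) in simp)
  have r2: "(\<lambda>n. rho (\<lambda>x. grad (\<phi> n) x - G x)) \<longlonglongrightarrow> 0"
    by (rule rho_tendsto_perturbation[OF C1c_Lp(1)[OF ct] C1c_Lp(1)[OF c] WD(4)[OF W] \<phi>(3) l2])
  have La: "Lp (\<lambda>x. \<phi> n x - u x)" "Lp (\<lambda>x. grad (\<phi> n) x - G x)" for n
    using Lp_diff(1) C1c_Lp[OF ct] Lu WD(4)[OF W] by blast+
  have "(\<lambda>n. lux \<Omega> q (\<lambda>x. \<phi> n x - u x) + lux \<Omega> q (\<lambda>x. norm (grad (\<phi> n) x - G x))) \<longlonglongrightarrow> 0 + 0"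
    by (intro tendsto_add lux_Lp_tendsto La(1) r1 Lp_norm(1)[OF La(2)] q) (use r2 in \<open>simp_all add: Lp_norm(2)[OF La(2)]\<close>)
  then show ?thesis unfolding W0_def
    using Lp_in_Lvar[OF Lu q] borel_set_measurable[OF WD(6)[OF W]] Lp_in_Lvar[OF Lp_norm(1)[OF WD(4)[OF W]] q] W_weak_grad[OF W] \<phi>(1)
    by (auto intro!: exI[of _ \<phi>])
qed

lemma Lp_version:
  fixes w :: "'a \<Rightarrow> 'b::euclidean_space"
  assumes "set_borel_measurable lebesgue \<Omega> w" "modular \<Omega> q (\<lambda>x. norm (w x)) < \<infinity>" "\<And>x. x \<in> \<Omega> \<Longrightarrow> q x = p x"
  obtains w' where "Lp w'" "AE x in lebesgue. x \<in> \<Omega> \<longrightarrow> w x = w' x"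
proof -
  obtain w' where w': "w' \<in> borel_measurable borel" "\<forall>x. x \<notin> \<Omega> \<longrightarrow> w' x = 0" "AE x in lebesgue. x \<in> \<Omega> \<longrightarrow> w x = w' x"
    by (rule borel_version[OF assms(1) domain_measurable])
  note [measurable] = w'(1)
  have "modular \<Omega> q (\<lambda>x. norm (w x)) = modular \<Omega> q (\<lambda>x. norm (w' x))"
    by (rule modular_cong) (use w'(3) in eventually_elim, auto)
  also have "\<dots> = (\<integral>\<^sup>+x. ennreal (norm (w' x) powr p x) \<partial>lebesgue)"
    unfolding modular_def by (rule nn_integral_cong) (use assms(3) w'(2) in \<open>auto simp: indicator_def\<close>)
  also have "\<dots> = (\<integral>\<^sup>+x. ennreal (norm (w' x) powr p x) \<partial>lborel)" by (rule nn_integral_completion)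
  finally have "(\<integral>\<^sup>+x. ennreal (norm (w' x) powr p x) \<partial>lborel) < \<infinity>" using assms(2) by simp
  then have "integrable lborel (\<lambda>x. norm (w' x) powr p x)" by (intro integrableI_nonneg) auto
  then have "Lp w'" using w'(1,2) by (simp add: Lp_def)
  then show thesis by (rule that[OF _ w'(3)])
qed

text \<open>An arbitrary test pair from \<open>W0\<close> is replaced by Borel versions vanishing
  off \<Omega>. Norm convergence gives modular convergence and hence L1 convergence, so the versions
  belong to \<open>W\<close> and the equation may be tested with them.\<close>

lemma EL_weak_eq:
  assumes EL: "EL u G g" and g: "g \<in> borel_measurable borel" "\<And>x. \<bar>g x\<bar> \<le> C"
    and q: "\<And>x. x \<in> \<Omega> \<Longrightarrow> q x = p x" and T: "W0 \<Omega> q \<phi> g\<phi>"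
    and ae: "AE x in lebesgue. x \<in> \<Omega> \<longrightarrow> g0 x = g x"
  shows "weak_eq \<Omega> q G g0 \<phi> g\<phi>"
proof -
  have W: "W u G" using EL by (simp add: EL_def)
  have T1: "in_Lvar \<Omega> q \<phi>" "set_borel_measurable lebesgue \<Omega> g\<phi>" "in_Lvar \<Omega> q (\<lambda>x. norm (g\<phi> x))"
    using T by (auto simp: W0_def)
  obtain \<psi> where \<psi>: "\<And>n. test_fn \<Omega> (\<psi> n)"
     "(\<lambda>n. lux \<Omega> q (\<lambda>x. \<psi> n x - \<phi> x) + lux \<Omega> q (\<lambda>x. norm (grad (\<psi> n) x - g\<phi> x))) \<longlonglongrightarrow> 0"
    using T by (auto simp: W0_def)
  have "modular \<Omega> q (\<lambda>x. norm (\<phi> x)) < \<infinity>"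
    using T1(1) modular_cong[of \<Omega> "\<lambda>x. norm (\<phi> x)" \<phi> q] by (simp add: in_Lvar_def)
  then obtain \<phi>' where \<phi>': "Lp \<phi>'" "AE x in lebesgue. x \<in> \<Omega> \<longrightarrow> \<phi> x = \<phi>' x"
    using Lp_version[of \<phi> q] T1(1) q by (auto simp: in_Lvar_def)
  obtain H where H: "Lp H" "AE x in lebesgue. x \<in> \<Omega> \<longrightarrow> g\<phi> x = H x"
    using Lp_version[of g\<phi> q] T1(2,3) q by (auto simp: in_Lvar_def)
  note ct = test_fn_C1c[OF \<psi>(1)]
  have L1: "Lp (\<lambda>x. \<psi> n x - \<phi>' x)" and L2: "Lp (\<lambda>x. grad (\<psi> n) x - H x)" for n
    using Lp_diff(1) C1c_Lp[OF ct] \<phi>'(1) H(1) by blast+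
  have e1: "lux \<Omega> q (\<lambda>x. \<psi> n x - \<phi> x) = lux \<Omega> q (\<lambda>x. \<psi> n x - \<phi>' x)" for n
    by (rule lux_cong) (use \<phi>'(2) in eventually_elim, auto)
  have e2: "lux \<Omega> q (\<lambda>x. norm (grad (\<psi> n) x - g\<phi> x)) = lux \<Omega> q (\<lambda>x. norm (grad (\<psi> n) x - H x))" for n
    by (rule lux_cong) (use H(2) in eventually_elim, auto)
  note n1 = lux_Lp_nonneg[OF L1 q] and n2 = lux_Lp_nonneg[OF Lp_norm(1)[OF L2] q]
  have s: "(\<lambda>n. lux \<Omega> q (\<lambda>x. \<psi> n x - \<phi>' x) + lux \<Omega> q (\<lambda>x. norm (grad (\<psi> n) x - H x))) \<longlonglongrightarrow> 0"
    using \<psi>(2) by (simp add: e1 e2)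
  have s1: "(\<lambda>n. lux \<Omega> q (\<lambda>x. \<psi> n x - \<phi>' x)) \<longlonglongrightarrow> 0"
    by (rule tendsto_sandwich[OF _ _ tendsto_const s]) (use n1 n2 in auto)
  have s2: "(\<lambda>n. lux \<Omega> q (\<lambda>x. norm (grad (\<psi> n) x - H x))) \<longlonglongrightarrow> 0"
    by (rule tendsto_sandwich[OF _ _ tendsto_const s]) (use n1 n2 in auto)
  have r1: "(\<lambda>n. rho (\<lambda>x. \<psi> n x - \<phi>' x)) \<longlonglongrightarrow> 0" by (rule rho_tendsto_of_lux[OF L1 q s1])
  have r2: "(\<lambda>n. rho (\<lambda>x. grad (\<psi> n) x - H x)) \<longlonglongrightarrow> 0"
    using rho_tendsto_of_lux[OF Lp_norm(1)[OF L2] q s2] by (simp add: Lp_norm(2)[OF L2])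
  have "(\<lambda>n. L1norm (\<lambda>x. \<psi> n x - \<phi>' x)) \<longlonglongrightarrow> 0" using rho_tendsto_L1[OF L1 r1] by simp
  then have "\<exists>\<psi> D. (\<forall>n. C1c \<Omega> (\<psi> n) (D n)) \<and> (\<lambda>n. L1norm (\<lambda>x. \<psi> n x - \<phi>' x)) \<longlonglongrightarrow> 0 \<and>
      (\<lambda>n. rho (\<lambda>x. D n x - H x)) \<longlonglongrightarrow> 0"
    using ct r2 by (intro exI[of _ \<psi>] exI[of _ "\<lambda>n. grad (\<psi> n)"]) simp
  then have Wp: "W \<phi>' H" unfolding W_def
    using Lp_integrable(1)[OF \<phi>'(1)] LpD(1,2)[OF \<phi>'(1)] H(1) by simp
  have id: "(LBINT x. Vp (p x) (G x) \<bullet> H x) = (LBINT x. g x * \<phi>' x)" by (rule EL_test[OF EL g Wp])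
  have i1: "integrable lborel (\<lambda>x. Vp (p x) (G x) \<bullet> H x)" by (rule Vp_pairing(1)[OF WD(4)[OF W] H(1)])
  have i2: "integrable lborel (\<lambda>x. g x * \<phi>' x)" by (rule integrable_bounded_mult(1)[OF g WD(1)[OF Wp]])
  have a1: "AE x in lebesgue. x \<in> \<Omega> \<longrightarrow> norm (G x) powr (q x - 2) * (G x \<bullet> g\<phi> x) = Vp (p x) (G x) \<bullet> H x"
    using H(2) by eventually_elim (simp add: Vp_def q)
  have a2: "AE x in lebesgue. x \<in> \<Omega> \<longrightarrow> g0 x * \<phi> x = g x * \<phi>' x"
    using \<phi>'(2) ae by eventually_elim simp
  note s1 = lebesgue_set_integral[OF i1 _ a1] and s2 = lebesgue_set_integral[OF i2 _ a2]
  show ?thesis unfolding weak_eq_def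
    using s1 s2 id WD(5)[OF W] WD(3)[OF Wp] by simp
qed

end

lemma lux_exponent_cong:
  assumes "AE x in lebesgue. x \<in> \<Omega> \<longrightarrow> q x = q' x"
  shows "lux \<Omega> q w = lux \<Omega> q' w"
proof -
  have "modular \<Omega> q (\<lambda>x. w x / l) = modular \<Omega> q' (\<lambda>x. w x / l)" for l
    unfolding modular_def
    by (rule nn_integral_cong_AE) (use assms in eventually_elim, auto simp: indicator_def)
  then show ?thesis by (simp add: lux_def)
qed

text \<open>Clamping a Borel version makes the essential bounds hold at every point, which is the
  form the locales assume.\<close>

lemma exponent_version:
  assumes "open \<Omega>" "in_Linf \<Omega> q" "AE x in lebesgue. x \<in> \<Omega> \<longrightarrow> a \<le> q x"
  obtains q' B where "q' \<in> borel_measurable borel" "\<forall>x. a \<le> q' x \<and> q' x \<le> B" "AE x in lebesgue. x \<in> \<Omega> \<longrightarrow> q x = q' x"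
proof -
  have "\<Omega> \<in> sets borel" "set_borel_measurable lebesgue \<Omega> q" using assms by (auto simp: in_Linf_def)
  from borel_version[OF this(2,1)] obtain h where h: "h \<in> borel_measurable borel" "AE x in lebesgue. x \<in> \<Omega> \<longrightarrow> q x = h x" by metis
  obtain b where b: "AE x in lebesgue. x \<in> \<Omega> \<longrightarrow> \<bar>q x\<bar> \<le> b" using assms(2) by (auto simp: in_Linf_def)
  define q' where "q' x = max a (min (max a b) (h x))" for x
  show thesis
  proof
    show "q' \<in> borel_measurable borel" unfolding q'_def using h(1) by measurable
    show "\<forall>x. a \<le> q' x \<and> q' x \<le> max a b" by (auto simp: q'_def)
    show "AE x in lebesgue. x \<in> \<Omega> \<longrightarrow> q x = q' x"
      using h(2) b assms(3) by eventually_elim (auto simp: q'_def)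
  qed
qed

text \<open>The exponents inside the nonlocal norms may equal 1 and may be discontinuous, so they
  fall outside \<open>pspace\<close>. Only norms of bounded functions are studied here.\<close>

locale lvar =
  fixes \<Omega> :: "'a::euclidean_space set" and q :: "'a \<Rightarrow> real" and B :: real
  assumes open_domain: "open \<Omega>" and bounded_domain: "bounded \<Omega>"
    and q_measurable [measurable]: "q \<in> borel_measurable borel"
    and q_ge: "\<And>x. 1 \<le> q x" and q_le: "\<And>x. q x \<le> B"
begin

lemma domain_measurable [measurable]: "\<Omega> \<in> sets borel" using open_domain by (rule borel_open)

definition md :: "('a \<Rightarrow> real) \<Rightarrow> real" where
  "md v = (LBINT x. indicator \<Omega> x * \<bar>v x\<bar> powr q x)"

definition adm :: "('a \<Rightarrow> real) \<Rightarrow> real set" where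
  "adm w = {l. 0 < l \<and> modular \<Omega> q (\<lambda>x. w x / l) \<le> 1}"

lemma lux_eq: "lux \<Omega> q w = Inf (adm w)" by (simp add: lux_def adm_def)

lemma powr_q_le: "0 \<le> s \<Longrightarrow> s \<le> C \<Longrightarrow> s powr q x \<le> (1 + C) powr B"
proof -
  assume "0 \<le> s" "s \<le> C"
  then have "s powr q x \<le> (1 + C) powr q x" using q_ge[of x] by (intro powr_mono2) auto
  also have "\<dots> \<le> (1 + C) powr B" using \<open>0 \<le> s\<close> \<open>s \<le> C\<close> q_le[of x] by (intro powr_mono) auto
  finally show ?thesis .
qed

lemma md_integrable:
  assumes [measurable]: "v \<in> borel_measurable borel" and "\<And>x. \<bar>v x\<bar> \<le> C"
  shows "integrable lborel (\<lambda>x. indicator \<Omega> x * \<bar>v x\<bar> powr q x)"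
proof (rule Bochner_Integration.integrable_bound[OF integrable_scaled_indicator[OF bounded_domain domain_measurable, of "(1 + C) powr B"]])
  show "AE x in lborel. norm (indicator \<Omega> x * \<bar>v x\<bar> powr q x) \<le> norm ((1 + C) powr B * indicator \<Omega> x :: real)"
    using powr_q_le[of "\<bar>v x\<bar>" C for x] assms(2) by (auto simp: indicator_def)
qed measurable

lemma modular_md:
  assumes [measurable]: "v \<in> borel_measurable borel" and "\<And>x. \<bar>v x\<bar> \<le> C"
  shows "modular \<Omega> q v = ennreal (md v)"
proof -
  have "modular \<Omega> q v = (\<integral>\<^sup>+x. ennreal (indicator \<Omega> x * \<bar>v x\<bar> powr q x) \<partial>lebesgue)"
    unfolding modular_def by (rule nn_integral_cong) (auto simp: indicator_def)
  also have "\<dots> = (\<integral>\<^sup>+x. ennreal (indicator \<Omega> x * \<bar>v x\<bar> powr q x) \<partial>lborel)" by (rule nn_integral_completion)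
  also have "\<dots> = ennreal (md v)" unfolding md_def
    by (rule nn_integral_eq_integral[OF md_integrable[OF assms]]) simp
  finally show ?thesis .
qed

lemma modular_mono:
  assumes "\<And>x. x \<in> \<Omega> \<Longrightarrow> \<bar>w x\<bar> \<le> \<bar>w' x\<bar>"
  shows "modular \<Omega> q w \<le> modular \<Omega> q w'"
  unfolding modular_def
proof (rule nn_integral_mono)
  fix x show "indicator \<Omega> x * ennreal (\<bar>w x\<bar> powr q x) \<le> indicator \<Omega> x * ennreal (\<bar>w' x\<bar> powr q x)"
    using assms[of x] q_ge[of x] by (cases "x \<in> \<Omega>") (auto intro!: ennreal_leI powr_mono2)
qed

lemma adm_upward: "l \<in> adm w \<Longrightarrow> l \<le> l' \<Longrightarrow> l' \<in> adm w"
proof -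
  assume l: "l \<in> adm w" "l \<le> l'"
  have "modular \<Omega> q (\<lambda>x. w x / l') \<le> modular \<Omega> q (\<lambda>x. w x / l)"
    by (rule modular_mono) (use l in \<open>auto simp: adm_def intro!: divide_left_mono\<close>)
  then show ?thesis using l by (auto simp: adm_def)
qed

lemma adm_antimono: "(\<And>x. x \<in> \<Omega> \<Longrightarrow> \<bar>w x\<bar> \<le> \<bar>w' x\<bar>) \<Longrightarrow> adm w' \<subseteq> adm w"
proof
  fix l assume le: "\<And>x. x \<in> \<Omega> \<Longrightarrow> \<bar>w x\<bar> \<le> \<bar>w' x\<bar>" and l: "l \<in> adm w'"
  have "modular \<Omega> q (\<lambda>x. w x / l) \<le> modular \<Omega> q (\<lambda>x. w' x / l)"
    by (rule modular_mono) (use le l in \<open>auto simp: adm_def intro!: divide_right_mono\<close>)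
  then show "l \<in> adm w" using l by (auto simp: adm_def)
qed

lemma md_scale:
  assumes "v \<in> borel_measurable borel" "\<And>x. \<bar>v x\<bar> \<le> C" "0 \<le> t" "t \<le> 1"
  shows "md (\<lambda>x. t * v x) \<le> t * md v"
proof -
  have tC: "\<bar>t * v x\<bar> \<le> C" for x
  proof -
    have "\<bar>t * v x\<bar> \<le> 1 * \<bar>v x\<bar>" unfolding abs_mult using assms(3,4) by (intro mult_right_mono) auto
    then show ?thesis using assms(2)[of x] by simp
  qed
  have m: "(\<lambda>x. t * v x) \<in> borel_measurable borel" using assms(1) by measurable
  show ?thesis unfolding md_def integral_mult_right_zero[symmetric]
  proof (rule integral_mono[OF md_integrable[OF m tC] integrable_mult_right[OF md_integrable[OF assms(1,2)]]])
    fix x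
    have "t powr q x \<le> t" using powr_mono'[of 1 "q x" t] assms(3,4) q_ge[of x] by simp
    then have "t powr q x * \<bar>v x\<bar> powr q x \<le> t * \<bar>v x\<bar> powr q x" by (rule mult_right_mono) simp
    then show "indicator \<Omega> x * \<bar>t * v x\<bar> powr q x \<le> t * (indicator \<Omega> x * \<bar>v x\<bar> powr q x)"
      using assms(3) by (simp add: abs_mult powr_mult indicator_def)
  qed
qed

lemma adm_md:
  assumes "v \<in> borel_measurable borel" "\<And>x. \<bar>v x\<bar> \<le> C"
  shows "l \<in> adm v \<longleftrightarrow> 0 < l \<and> md (\<lambda>x. v x / l) \<le> 1"
proof (cases "0 < l")
  case True
  have "modular \<Omega> q (\<lambda>x. v x / l) = ennreal (md (\<lambda>x. v x / l))"
    by (rule modular_md[where C="C / l"]) (use assms True in \<open>auto simp: abs_divide divide_right_mono\<close>)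
  then show ?thesis using True by (simp add: adm_def)
qed (simp add: adm_def)

lemma adm_nonempty:
  assumes "\<And>x. x \<in> \<Omega> \<Longrightarrow> \<bar>w x\<bar> \<le> C"
  shows "adm w \<noteq> {}"
proof -
  define l where "l = 1 + \<bar>md (\<lambda>_. \<bar>C\<bar>)\<bar>"
  have l: "1 \<le> l" "md (\<lambda>_. \<bar>C\<bar>) \<le> l" by (auto simp: l_def)
  have "md (\<lambda>x. (1 / l) * \<bar>C\<bar>) \<le> (1 / l) * md (\<lambda>_. \<bar>C\<bar>)" by (rule md_scale[where C="\<bar>C\<bar>"]) (use l in auto)
  also have "\<dots> \<le> 1" using l by simp
  finally have "l \<in> adm (\<lambda>_. \<bar>C\<bar>)" using l(1) by (subst adm_md[where C="\<bar>C\<bar>"]) auto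
  moreover have "adm (\<lambda>_. \<bar>C\<bar>) \<subseteq> adm w" by (rule adm_antimono) (use assms in force)
  ultimately show ?thesis by blast
qed

lemma adm_bdd: "bdd_below (adm w)" by (rule bdd_belowI[of _ 0]) (auto simp: adm_def)

lemma lux_nonneg: "(\<And>x. x \<in> \<Omega> \<Longrightarrow> \<bar>w x\<bar> \<le> C) \<Longrightarrow> 0 \<le> lux \<Omega> q w"
  unfolding lux_eq by (rule cInf_greatest[OF adm_nonempty]) (auto simp: adm_def)

lemma lux_mono:
  assumes "\<And>x. x \<in> \<Omega> \<Longrightarrow> \<bar>w x\<bar> \<le> \<bar>w' x\<bar>" "\<And>x. x \<in> \<Omega> \<Longrightarrow> \<bar>w' x\<bar> \<le> C"
  shows "lux \<Omega> q w \<le> lux \<Omega> q w'"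
  unfolding lux_eq by (rule cInf_superset_mono[OF adm_nonempty[OF assms(2)] adm_bdd adm_antimono[OF assms(1)]])

text \<open>If \<open>l\<close> is below \<open>c\<close>, the integrand on the ball is at least
  \<open>c / l\<close>, as the exponent is at least 1; the modular is then at least
  \<open>c * m / l\<close>. Admissible \<open>l\<close> are therefore not below
  \<open>min c (c * m)\<close>.\<close>

lemma lux_positive:
  assumes w: "w \<in> borel_measurable borel" "\<And>x. \<bar>w x\<bar> \<le> C"
    and b: "0 < r" "ball x0 r \<subseteq> \<Omega>" "0 < c" "\<And>x. x \<in> ball x0 r \<Longrightarrow> c \<le> w x"
  shows "0 < lux \<Omega> q w"
proof -
  define m where "m = measure lborel (ball x0 r)"
  have m: "0 < m" unfolding m_def using b(1) content_ball_pos by simp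
  have "min c (c * m) \<le> Inf (adm w)"
  proof (rule cInf_greatest[OF adm_nonempty[OF w(2)]])
    fix l assume "l \<in> adm w"
    then have l: "0 < l" "md (\<lambda>x. w x / l) \<le> 1" using adm_md[OF w] by auto
    show "min c (c * m) \<le> l"
    proof (rule ccontr)
      assume "\<not> min c (c * m) \<le> l"
      then have lc: "l < c" "l < c * m" by auto
      have "(LBINT x. (c / l) * indicator (ball x0 r) x) \<le> md (\<lambda>x. w x / l)"
        unfolding md_def
      proof (rule integral_mono)
        show "integrable lborel (\<lambda>x. (c / l) * indicator (ball x0 r) x :: real)"
          by (rule integrable_scaled_indicator) auto
        show "integrable lborel (\<lambda>x. indicator \<Omega> x * \<bar>w x / l\<bar> powr q x)"
          by (rule md_integrable[where C="C / l"]) (use w l(1) in \<open>auto simp: abs_divide divide_right_mono\<close>)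
        show "(c / l) * indicator (ball x0 r) x \<le> indicator \<Omega> x * \<bar>w x / l\<bar> powr q x" for x
        proof (cases "x \<in> ball x0 r")
          case True
          have "1 \<le> c / l" using lc l by simp
          have "c / l = (c / l) powr 1" using b(3) l by simp
          also have "\<dots> \<le> (c / l) powr q x" using \<open>1 \<le> c / l\<close> q_ge[of x] by (intro powr_mono) auto
          also have "\<dots> \<le> \<bar>w x / l\<bar> powr q x" using b(3) b(4)[OF True] l(1) q_ge[of x]
            by (intro powr_mono2) (auto simp: abs_divide intro!: divide_right_mono)
          finally show ?thesis using True b(2) by auto
        qed simp
      qed
      also have "(LBINT x. (c / l) * indicator (ball x0 r) x) = (c / l) * m" unfolding m_def by simp
      finally have "(c / l) * m \<le> 1" using l(2) by linarith
      then have "c * m \<le> l" using l(1) by (simp add: field_simps)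
      then show False using lc(2) by simp
    qed
  qed
  moreover have "0 < min c (c * m)" using m b(3) by simp
  ultimately show ?thesis unfolding lux_eq by linarith
qed

lemma md_tendsto:
  assumes "\<And>n. v n \<in> borel_measurable borel" "w \<in> borel_measurable borel" "\<And>n x. \<bar>v n x\<bar> \<le> C" "\<And>x. \<bar>w x\<bar> \<le> C"
    "AE x in lborel. (\<lambda>n. v n x) \<longlonglongrightarrow> w x"
  shows "(\<lambda>n. md (v n)) \<longlonglongrightarrow> md w"
  unfolding md_def
proof (rule integral_dominated_convergence)
  note [measurable] = assms(1,2)
  show "(\<lambda>x. indicator \<Omega> x * \<bar>w x\<bar> powr q x) \<in> borel_measurable lborel"
    "\<And>n. (\<lambda>x. indicator \<Omega> x * \<bar>v n x\<bar> powr q x) \<in> borel_measurable lborel" by measurable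
  show "integrable lborel (\<lambda>x. (1 + C) powr B * indicator \<Omega> x)"
    by (rule integrable_scaled_indicator[OF bounded_domain domain_measurable])
  show "AE x in lborel. (\<lambda>n. indicator \<Omega> x * \<bar>v n x\<bar> powr q x) \<longlonglongrightarrow> indicator \<Omega> x * \<bar>w x\<bar> powr q x"
    using assms(5)
  proof eventually_elim
    case (elim x)
    show ?case using q_ge[of x] by (intro tendsto_mult tendsto_const tendsto_powr' tendsto_rabs elim) auto
  qed
  show "\<And>n. AE x in lborel. norm (indicator \<Omega> x * \<bar>v n x\<bar> powr q x) \<le> (1 + C) powr B * indicator \<Omega> x"
    using powr_q_le[OF abs_ge_zero assms(3)] by (auto simp: indicator_def)
qed

text \<open>For fixed \<open>l\<close> the modulars converge by domination. Admissibility is upward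
  closed, so strict inequalities of the limit modular on either side of the norm pass to late
  members and enclose their norms.\<close>

lemma lux_tendsto:
  assumes v: "\<And>n. v n \<in> borel_measurable borel" "w \<in> borel_measurable borel" "\<And>n x. \<bar>v n x\<bar> \<le> C" "\<And>x. \<bar>w x\<bar> \<le> C"
    "AE x in lborel. (\<lambda>n. v n x) \<longlonglongrightarrow> w x"
  shows "(\<lambda>n. lux \<Omega> q (v n)) \<longlonglongrightarrow> lux \<Omega> q w"
proof -
  have lim: "(\<lambda>n. md (\<lambda>x. v n x / l)) \<longlonglongrightarrow> md (\<lambda>x. w x / l)" if "0 < l" for l
  proof (rule md_tendsto[where C="C / l"])
    show "AE x in lborel. (\<lambda>n. v n x / l) \<longlonglongrightarrow> w x / l"
      using v(5) by eventually_elim (use that in \<open>auto intro!: tendsto_intros\<close>)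
  qed (use v that in \<open>auto simp: abs_divide divide_right_mono\<close>)
  show ?thesis
  proof (rule order_tendstoI)
    fix a assume a: "a < lux \<Omega> q w"
    show "eventually (\<lambda>n. a < lux \<Omega> q (v n)) sequentially"
    \<comment> \<open>If the midpoint is not positive then \<open>a\<close> is negative, and all
      norms exceed it because they are nonnegative.\<close>
    proof (cases "0 < (a + lux \<Omega> q w) / 2")
      case False
      have "0 \<le> lux \<Omega> q w" by (rule lux_nonneg[OF v(4)])
      moreover have "a + lux \<Omega> q w \<le> 0" using False by simp
      ultimately have "a < 0" using a by linarith
      then have "a < lux \<Omega> q (v n)" for n by (rule order_less_le_trans[OF _ lux_nonneg[OF v(3)]])
      then show ?thesis by simp
    next
      case True
      define l where "l = (a + lux \<Omega> q w) / 2"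
      have l: "0 < l" "a < l" "l < lux \<Omega> q w" using True a by (auto simp: l_def)
      have "l \<notin> adm w" using l(3) cInf_lower[OF _ adm_bdd, of l w] unfolding lux_eq by fastforce
      then have "1 < md (\<lambda>x. w x / l)" using adm_md[OF v(2,4)] l(1) by auto
      then have "eventually (\<lambda>n. 1 < md (\<lambda>x. v n x / l)) sequentially" by (rule order_tendstoD(1)[OF lim[OF l(1)]])
      then show ?thesis
      proof eventually_elim
        case (elim n)
        then have "l \<notin> adm (v n)" using adm_md[OF v(1)[of n] v(3)[of n]] by auto
        then have "l \<le> lux \<Omega> q (v n)" unfolding lux_eq
          by (intro cInf_greatest[OF adm_nonempty[OF v(3)]]) (metis adm_upward linear)
        then show ?case using l(2) by linarith
      qed
    qed
  next
    fix a assume a: "lux \<Omega> q w < a"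
    obtain l' where l': "l' \<in> adm w" "l' < a"
      using cInf_lessD[OF adm_nonempty[OF v(4)] a[unfolded lux_eq]] by blast
    \<comment> \<open>At the admissible \<open>l'\<close> the modular may equal 1. Enlarging to
      \<open>l\<close> contributes the factor \<open>l' / l < 1\<close>, which gives the strict
      inequality needed for stability under limits.\<close>
    define l where "l = (l' + a) / 2"
    have l0: "0 < l'" "md (\<lambda>x. w x / l') \<le> 1" using l'(1) adm_md[OF v(2,4)] by auto
    have l: "l' < l" "l < a" "0 < l" using l' l0 by (auto simp: l_def)
    have "md (\<lambda>x. (l' / l) * (w x / l')) \<le> (l' / l) * md (\<lambda>x. w x / l')"
      by (rule md_scale[where C="C / l'"]) (use v l l0 in \<open>auto simp: abs_divide divide_right_mono\<close>)
    also have "\<dots> \<le> (l' / l) * 1" using l0 l by (intro mult_left_mono) auto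
    also have "\<dots> < 1" using l by simp
    finally have "md (\<lambda>x. w x / l) < 1" using l0(1) by simp
    then have "eventually (\<lambda>n. md (\<lambda>x. v n x / l) < 1) sequentially" by (rule order_tendstoD(2)[OF lim[OF l(3)]])
    then show "eventually (\<lambda>n. lux \<Omega> q (v n) < a) sequentially"
    proof eventually_elim
      case (elim n)
      then have "l \<in> adm (v n)" using adm_md[OF v(1)[of n] v(3)[of n]] l(3) by auto
      then have "lux \<Omega> q (v n) \<le> l" unfolding lux_eq by (rule cInf_lower[OF _ adm_bdd])
      then show ?case using l(2) by linarith
    qed
  qed
qed

end

lemma (in pspace) EL_null_modification:
  assumes EL: "EL u G g" and u': "u' \<in> borel_measurable borel" "\<And>x. x \<notin> \<Omega> \<Longrightarrow> u' x = 0" "AE x in lborel. u x = u' x"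
  shows "EL u' G g"
proof -
  have W: "W u G" using EL by (simp add: EL_def)
  have [measurable]: "u \<in> borel_measurable borel" "u' \<in> borel_measurable borel" using WD(2)[OF W] u'(1) by auto
  have i: "integrable lborel u'"
    by (rule integrable_cong_AE_imp[OF WD(1)[OF W]]) (use u'(3) in auto)
  obtain \<psi> D where 1: "\<forall>n. C1c \<Omega> (\<psi> n) (D n)" "(\<lambda>n. L1norm (\<lambda>x. \<psi> n x - u x)) \<longlonglongrightarrow> 0"
        "(\<lambda>n. rho (\<lambda>x. D n x - G x)) \<longlonglongrightarrow> 0" using W unfolding W_def by blast
  have "L1norm (\<lambda>x. \<psi> n x - u x) = L1norm (\<lambda>x. \<psi> n x - u' x)" for n
  proof (rule integral_cong_AE)
    have [measurable]: "\<psi> n \<in> borel_measurable borel" using C1cD(5) 1(1) by blast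
    show "(\<lambda>x. \<bar>\<psi> n x - u x\<bar>) \<in> borel_measurable lborel" "(\<lambda>x. \<bar>\<psi> n x - u' x\<bar>) \<in> borel_measurable lborel" by measurable
    show "AE x in lborel. \<bar>\<psi> n x - u x\<bar> = \<bar>\<psi> n x - u' x\<bar>" using u'(3) by eventually_elim simp
  qed
  then have "(\<lambda>n. L1norm (\<lambda>x. \<psi> n x - u' x)) \<longlonglongrightarrow> 0" using 1(2) by simp
  then have "W u' G" unfolding W_def using i u'(1,2) WD(4)[OF W] 1(1,3) by blast
  then show ?thesis using EL by (simp add: EL_def)
qed

definition clip :: "('a \<Rightarrow> real) \<Rightarrow> real \<Rightarrow> ('a \<Rightarrow> real) \<Rightarrow> 'a \<Rightarrow> real" where
  "clip w \<theta> U x = max (w x) (min (U x) \<theta>)"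

section \<open>The barrier as a subsolution, and spreading of positivity\<close>

context barrier begin

lemma z_continuous: "continuous_on S z"
  using z_derivative by (intro continuous_at_imp_continuous_on) (blast intro: has_derivative_continuous)

lemma z_measurable [measurable]: "z \<in> borel_measurable borel"
  using z_continuous by (rule borel_measurable_continuous_onI)

lemma z_lower: assumes "0 \<le> s" "s < R" obtains m where "0 < m" "\<forall>x\<in>cball x0 s. m \<le> z x"
proof -
  have "\<exists>y\<in>cball x0 s. \<forall>x\<in>cball x0 s. z y \<le> z x"
    by (rule continuous_attains_inf) (use assms z_continuous in auto)
  then obtain y where y: "y \<in> cball x0 s" "\<forall>x\<in>cball x0 s. z y \<le> z x" by blast
  have "norm (y - x0) < R" using y(1) assms(2) by (simp add: dist_norm norm_minus_commute)
  then show thesis using that[of "z y"] y(2) z_pos by blast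
qed

text \<open>Outside the ball of radius \<open>2 * r0\<close> the barrier is a subsolution for every
  nonnegative load. The load has to be compared with \<open>\<kappa>\<close> only inside, and only
  where \<open>u\<close> is still below the barrier.\<close>

lemma barrier_below:
  assumes EL: "EL u Gu h" and h: "h \<in> borel_measurable borel" "\<And>x. \<bar>h x\<bar> \<le> C" "\<And>x. 0 \<le> h x"
    and le: "AE x in lborel. u x < z x \<longrightarrow> x \<in> ball x0 (2 * r0) \<longrightarrow> \<kappa> x \<le> h x"
  shows "AE x in lborel. z x \<le> u x"
proof -
  obtain M where M: "0 \<le> M" "\<forall>x. \<bar>\<kappa> x\<bar> \<le> M" by (rule kappa_bounded)
  show ?thesis
  proof (rule EL_comparison[OF z_derivative Z_continuous compact_cball r(3) _ kappa_measurable M(2)[rule_format] weak_identity EL h(1,2)])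
    show "x \<notin> cball x0 R \<Longrightarrow> z x \<le> 0" for x by (rule z_nonpos) (auto simp: dist_norm norm_minus_commute)
    show "AE x in lborel. u x < z x \<longrightarrow> \<kappa> x \<le> h x"
      using le
    proof eventually_elim
      case (elim x)
      show ?case
      proof (cases "x \<in> ball x0 (2 * r0)")
        case False
        then have "\<kappa> x \<le> 0" by (intro kappa_nonpos) (auto simp: dist_norm norm_minus_commute)
        then show ?thesis using h(3)[of x] by simp
      qed (use elim in auto)
    qed
  qed auto
qed

text \<open>The set of points with a positive local lower bound is open. It is relatively closed:
  near a point \<open>y\<close> of its complement a barrier is centred at a point \<open>x\<close>
  of the set, with height \<open>k\<close>, the lower bound of \<open>u\<close> near
  \<open>x\<close>. On the inner ball \<open>u \<ge> k \<ge> b.z\<close>, so the comparison has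
  nothing to check there, and positivity reaches \<open>y\<close>.\<close>

lemma strong_positivity:
  assumes conn: "connected \<Omega>" and EL: "EL u Gu h" and h: "h \<in> borel_measurable borel" "\<And>x. \<bar>h x\<bar> \<le> C" "\<And>x. 0 \<le> h x"
    and start: "0 < d" "ball x1 d \<subseteq> \<Omega>" "0 < m" "AE x in lborel. x \<in> ball x1 d \<longrightarrow> m \<le> u x"
  shows "AE x in lborel. x \<in> \<Omega> \<longrightarrow> 0 < u x"
proof -
  define S where "S = {x. \<exists>r>0. \<exists>c>0. ball x r \<subseteq> \<Omega> \<and> (AE y in lborel. y \<in> ball x r \<longrightarrow> c \<le> u y)}"
  have SI: "x \<in> S" if "0 < r" "0 < c" "ball x r \<subseteq> \<Omega>" "AE y in lborel. y \<in> ball x r \<longrightarrow> c \<le> u y" for x r c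
    unfolding S_def using that by blast
  have sub: "S \<subseteq> \<Omega>" unfolding S_def by force
  have opS: "open S"
    unfolding open_contains_ball
  proof
    fix x assume "x \<in> S"
    then obtain r c where rc: "0 < r" "0 < c" "ball x r \<subseteq> \<Omega>" "AE y in lborel. y \<in> ball x r \<longrightarrow> c \<le> u y"
      unfolding S_def by blast
    have "ball x r \<subseteq> S"
    proof
      fix y assume y: "y \<in> ball x r"
      have b: "ball y (r - dist x y) \<subseteq> ball x r"
      proof
        fix w assume "w \<in> ball y (r - dist x y)"
        then show "w \<in> ball x r" using dist_triangle[of x w y] by simp
      qed
      show "y \<in> S"
      proof (rule SI)
        show "0 < r - dist x y" using y by simp
        show "AE w in lborel. w \<in> ball y (r - dist x y) \<longrightarrow> c \<le> u w"
          using rc(4) by eventually_elim (use b in blast)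
      qed (use b rc in auto)
    qed
    then show "\<exists>e>0. ball x e \<subseteq> S" using rc(1) by blast
  qed
  have opC: "open (\<Omega> - S)"
    unfolding open_contains_ball
  proof
    fix y assume y: "y \<in> \<Omega> - S"
    obtain e where e: "0 < e" "ball y e \<subseteq> \<Omega>" using y open_domain openE by blast
    have "ball y (e / 4) \<inter> S = {}"
    proof (rule ccontr)
      assume "\<not> ?thesis"
      then obtain x where x: "dist y x < e / 4" "x \<in> S" by auto
      then obtain s k where sk: "0 < s" "0 < k" "ball x s \<subseteq> \<Omega>" "AE y in lborel. y \<in> ball x s \<longrightarrow> k \<le> u y"
        unfolding S_def by blast
      \<comment> \<open>The ball of radius \<open>2 * t\<close> about \<open>x\<close> lies where
        \<open>u \<ge> k\<close>, and it is smaller than the outer radius \<open>e / 2\<close> of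
        the barrier.\<close>
      define t where "t = min (s / 2) (e / 8)"
      have t: "0 < t" "2 * t \<le> s" "2 * t < e / 2" using sk(1) e(1) by (auto simp: t_def)
      have cb: "cball x (e / 2) \<subseteq> ball y e"
      proof
        fix w assume "w \<in> cball x (e / 2)"
        then show "w \<in> ball y e" using dist_triangle[of y w x] x(1) e(1) by simp
      qed
      interpret b: barrier \<Omega> p pm pp P DP Lip x t "e / 2" k
        by unfold_locales (use P t cb e(2) sk(2) in auto)
      have "AE x in lborel. b.z x \<le> u x"
      proof (rule b.barrier_below[OF EL h])
        show "AE w in lborel. u w < b.z w \<longrightarrow> w \<in> ball x (2 * t) \<longrightarrow> b.\<kappa> w \<le> h w"
          using sk(4)
        proof eventually_elim
          case (elim w)
          show ?case
          proof (intro impI)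
            assume "u w < b.z w" "w \<in> ball x (2 * t)"
            then show "b.\<kappa> w \<le> h w" using elim t(2) b.z_le[of w] by auto
          qed
        qed
      qed
      then have zu: "AE x in lborel. b.z x \<le> u x" .
      \<comment> \<open>Since \<open>x\<close> is closer to \<open>y\<close> than
        \<open>e / 4\<close>, the ball of radius \<open>e / 8\<close> about \<open>y\<close> stays
        within \<open>3 * e / 8\<close> of \<open>x\<close>, strictly inside the barrier.\<close>
      obtain m' where m': "0 < m'" "\<forall>w\<in>cball x (3 * e / 8). m' \<le> b.z w"
        by (rule b.z_lower[of "3 * e / 8"]) (use e(1) in auto)
      have b8: "ball y (e / 8) \<subseteq> cball x (3 * e / 8)"
      proof
        fix w assume "w \<in> ball y (e / 8)"
        then show "w \<in> cball x (3 * e / 8)" using dist_triangle[of x w y] x(1) by (simp add: dist_commute)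
      qed
      have mb: "m' \<le> b.z w" if "w \<in> ball y (e / 8)" for w using m'(2) b8 that by blast
      have "AE w in lborel. w \<in> ball y (e / 8) \<longrightarrow> m' \<le> u w"
        using zu by eventually_elim (use mb order_trans in blast)
      then have "y \<in> S" by (rule SI[rotated 3]) (use e m'(1) in \<open>auto simp: subset_iff\<close>)
      then show False using y by blast
    qed
    then show "\<exists>e>0. ball y e \<subseteq> \<Omega> - S"
      using e by (intro exI[of _ "e / 4"]) (auto simp: subset_iff disjoint_iff)
  qed
  have x1: "x1 \<in> S" using start by (intro SI[of d m])
  have "\<Omega> \<subseteq> S"
    using connectedD[OF conn opS opC] sub x1 by blast
  \<comment> \<open>Each point has its own null set; Lindelof's theorem leaves countably many of
    them.\<close>
  have "\<exists>F'. F' \<subseteq> {B. open B \<and> (AE y in lborel. y \<in> B \<longrightarrow> 0 < u y)} \<and> countable F' \<and>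
      \<Union>F' = \<Union>{B. open B \<and> (AE y in lborel. y \<in> B \<longrightarrow> 0 < u y)}"
    by (rule Lindelof[of "{B. open B \<and> (AE y in lborel. y \<in> B \<longrightarrow> 0 < u y)}"]) auto
  then obtain F' where F': "F' \<subseteq> {B. open B \<and> (AE y in lborel. y \<in> B \<longrightarrow> 0 < u y)}" "countable F'"
      "\<Union>F' = \<Union>{B. open B \<and> (AE y in lborel. y \<in> B \<longrightarrow> 0 < u y)}" by blast
  have cov: "\<Omega> \<subseteq> \<Union>F'"
  proof
    fix x assume "x \<in> \<Omega>"
    then have "x \<in> S" using \<open>\<Omega> \<subseteq> S\<close> by blast
    then obtain s k where sk: "0 < s" "0 < k" "ball x s \<subseteq> \<Omega>" "AE y in lborel. y \<in> ball x s \<longrightarrow> k \<le> u y"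
      unfolding S_def by blast
    have "AE y in lborel. y \<in> ball x s \<longrightarrow> 0 < u y" using sk(4) by eventually_elim (use sk(2) in auto)
    then show "x \<in> \<Union>F'" unfolding F'(3) using sk(1) by (intro UnionI[of "ball x s"]) auto
  qed
  have "AE y in lborel. \<forall>B\<in>F'. y \<in> B \<longrightarrow> 0 < u y"
    by (subst AE_ball_countable[OF F'(2)]) (use F'(1) in blast)
  then show ?thesis by eventually_elim (use cov in blast)
qed

text \<open>Where \<open>u\<close> lies below a positive part of the barrier the truncation replaces
  it by \<open>z\<close>, and where \<open>u\<close> exceeds \<open>\<theta>\<close> by
  \<open>\<theta>\<close>, a zero of \<open>f\<close>. Thus the load is large exactly where the
  lower comparison needs it and vanishes where the upper one does. The threshold depends on
  \<open>a0\<close> only, not on the factor \<open>a\<close> or on the solution.\<close>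

lemma truncated_solution:
  assumes conn: "connected \<Omega>" and c\<theta>: "c < \<theta>"
    and f: "continuous_on {0..\<theta>} f" "f 0 = 0" "f \<theta> = 0" "\<forall>t. 0 < t \<and> t < \<theta> \<longrightarrow> 0 < f t" and a0: "0 < a0"
  obtains lam0 where "0 < lam0"
    "\<forall>lam u Gu h a C. lam0 \<le> lam \<longrightarrow> EL u Gu h \<longrightarrow> h \<in> borel_measurable borel \<longrightarrow> (\<forall>x. \<bar>h x\<bar> \<le> C) \<longrightarrow>
       (\<forall>x. h x = lam * (indicator \<Omega> x * (f (clip (\<lambda>x. max 0 (z x)) \<theta> u x) * a x))) \<longrightarrow> (\<forall>x\<in>\<Omega>. a0 \<le> a x) \<longrightarrow>
       (AE x in lborel. max 0 (z x) \<le> u x \<and> u x \<le> \<theta> \<and> (x \<in> \<Omega> \<longrightarrow> 0 < u x))"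
proof -
  obtain M where M: "0 \<le> M" "\<forall>x. \<bar>\<kappa> x\<bar> \<le> M" by (rule kappa_bounded)
  obtain m where m: "0 < m" "\<forall>x\<in>cball x0 (2 * r0). m \<le> z x" by (rule z_lower[of "2 * r0"]) (use r in auto)
  have "m \<le> c" using m(2) r(1) z_le[of x0] by (metis centre_in_cball less_eq_real_def mult_pos_pos order_trans zero_less_numeral)
  have \<theta>0: "0 < \<theta>" using c c\<theta> by simp
  have "\<exists>y\<in>{m..c}. \<forall>x\<in>{m..c}. f y \<le> f x"
    by (rule continuous_attains_inf) (use \<open>m \<le> c\<close> m(1) c\<theta> in \<open>auto intro: continuous_on_subset[OF f(1)]\<close>)
  then obtain y where y: "y \<in> {m..c}" "\<forall>t\<in>{m..c}. f y \<le> f t" by blast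
  have fy: "0 < f y" using y(1) f(4) m(1) c\<theta> by auto
  have f0: "0 \<le> f t" if "0 \<le> t" "t \<le> \<theta>" for t
    using f(2,3,4) that by (cases "t = 0"; cases "t = \<theta>") (auto simp: less_eq_real_def)
  \<comment> \<open>On the inner ball the barrier takes values in \<open>[m, c]\<close>, where
    \<open>f\<close> is at least \<open>f y > 0\<close> because \<open>c < \<theta>\<close>. The
    product \<open>lam * f * a\<close> then dominates \<open>M\<close>, the bound for
    \<open>\<kappa>\<close>.\<close>
  define lam0 where "lam0 = M / (f y * a0) + 1"
  have lam0: "0 < lam0" using M(1) fy a0 by (auto simp: lam0_def intro!: add_nonneg_pos)
  show thesis
  proof (rule that[OF lam0], intro allI impI)
    fix lam C :: real and u h a :: "'a \<Rightarrow> real" and Gu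
    assume lam: "lam0 \<le> lam" and EL: "EL u Gu h" and h: "h \<in> borel_measurable borel" "\<forall>x. \<bar>h x\<bar> \<le> C"
      "\<forall>x. h x = lam * (indicator \<Omega> x * (f (clip (\<lambda>x. max 0 (z x)) \<theta> u x) * a x))" and a: "\<forall>x\<in>\<Omega>. a0 \<le> a x"
    have cl: "0 \<le> clip (\<lambda>x. max 0 (z x)) \<theta> u x" "clip (\<lambda>x. max 0 (z x)) \<theta> u x \<le> \<theta>" for x
      using z_le[of x] c\<theta> \<theta>0 by (auto simp: clip_def)
    have h0: "0 \<le> h x" for x
      using h(3)[rule_format, of x] f0[OF cl, of x] lam lam0 a a0 by (auto simp: indicator_def intro!: mult_nonneg_nonneg)
    have big: "\<kappa> x \<le> h x" if x: "u x < z x" "x \<in> ball x0 (2 * r0)" for x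
    proof -
      have xO: "x \<in> \<Omega>" using x(2) r by (auto simp: subset_iff)
      have zm: "m \<le> z x" "z x \<le> c" using m(2) x(2) z_le by auto
      then have "clip (\<lambda>x. max 0 (z x)) \<theta> u x = z x" using x(1) c\<theta> m(1) by (auto simp: clip_def)
      then have eq: "h x = lam * (f (z x) * a x)" using h(3)[rule_format, of x] xO by simp
      have "M = (M / (f y * a0)) * (f y * a0)" using fy a0 by simp
      also have "\<dots> \<le> lam * (f y * a0)" using lam fy a0 by (intro mult_right_mono) (auto simp: lam0_def)
      also have "\<dots> \<le> lam * (f (z x) * a x)"
        using y(2) zm xO a lam lam0 fy a0 by (intro mult_left_mono mult_mono) (auto intro: order_trans[OF less_imp_le])
      finally show ?thesis using M(2)[rule_format, of x] eq by simp
    qed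
    have A1: "AE x in lborel. z x \<le> u x"
      by (rule barrier_below[OF EL h(1) h(2)[rule_format] h0]) (use big in auto)
    have A2: "AE x in lborel. 0 \<le> u x" by (rule EL_nonneg[OF EL h(1) h(2)[rule_format] h0])
    have A3: "AE x in lborel. u x \<le> \<theta>"
    proof (rule EL_upper_bound[OF EL h(1) h(2)[rule_format] \<theta>0])
      fix x assume "\<theta> < u x"
      then have "clip (\<lambda>x. max 0 (z x)) \<theta> u x = \<theta>" using z_le[of x] c\<theta> \<theta>0 by (auto simp: clip_def)
      then show "h x = 0" using h(3)[rule_format, of x] f(3) by simp
    qed
    have A4: "AE x in lborel. x \<in> \<Omega> \<longrightarrow> 0 < u x"
    proof (rule strong_positivity[OF conn EL h(1) h(2)[rule_format] h0, of "2 * r0" x0 m])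
      show "AE x in lborel. x \<in> ball x0 (2 * r0) \<longrightarrow> m \<le> u x"
        using A1
      proof eventually_elim
        case (elim x)
        have "x \<in> ball x0 (2 * r0) \<Longrightarrow> m \<le> z x" using m(2) ball_subset_cball by blast
        then show ?case using elim by linarith
      qed
    qed (use r m in \<open>auto simp: subset_iff\<close>)
    show "AE x in lborel. max 0 (z x) \<le> u x \<and> u x \<le> \<theta> \<and> (x \<in> \<Omega> \<longrightarrow> 0 < u x)"
      using A1 A2 A3 A4 by eventually_elim auto
  qed
qed

end

section \<open>The nonlocal system\<close>

text \<open>One right-hand side of the system; it is instantiated twice with the roles of the
  components exchanged. \<open>w\<close> and \<open>\<theta>\<close> truncate the component being
  solved for, \<open>w'\<close> and \<open>\<theta>'\<close> the component inside the norms. The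
  ball on which \<open>w'\<close> is at least \<open>c\<close> keeps these norms away from
  0.\<close>

locale nonlocal_term = Q: lvar \<Omega> q Bq + R: lvar \<Omega> r Br
  for \<Omega> :: "'a::euclidean_space set" and q Bq r Br +
  fixes \<alpha> :: "'a \<Rightarrow> real" and Ba :: real and A :: "'a \<Rightarrow> real \<Rightarrow> real" and f :: "real \<Rightarrow> real"
    and w w' :: "'a \<Rightarrow> real" and \<theta> \<theta>' :: real and x0 :: 'a and d c :: real
  assumes alpha_measurable [measurable]: "\<alpha> \<in> borel_measurable borel" and alpha: "\<And>x. 0 \<le> \<alpha> x" "\<And>x. \<alpha> x \<le> Ba"
    and A_cont: "continuous_on (closure \<Omega> \<times> {0..}) (\<lambda>(x, t). A x t)"
    and A_pos: "\<And>x t. \<lbrakk>x \<in> closure \<Omega>; 0 < t; t \<le> lux \<Omega> r (\<lambda>_. \<theta>')\<rbrakk> \<Longrightarrow> 0 < A x t"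
    and f_cont: "continuous_on {0..\<theta>} f"
    and w_measurable [measurable]: "w \<in> borel_measurable borel" "w' \<in> borel_measurable borel"
    and w: "\<And>x. 0 \<le> w x" "\<And>x. w x \<le> \<theta>" "\<And>x. 0 \<le> w' x" "\<And>x. w' x \<le> \<theta>'"
    and w'_ball: "0 < d" "ball x0 d \<subseteq> \<Omega>" "0 < c" "\<And>x. x \<in> ball x0 d \<Longrightarrow> c \<le> w' x"
begin

definition a :: "('a \<Rightarrow> real) \<Rightarrow> 'a \<Rightarrow> real" where
  "a V x = lux \<Omega> q (clip w' \<theta>' V) powr \<alpha> x / A x (lux \<Omega> r (clip w' \<theta>' V))"

definition F :: "('a \<Rightarrow> real) \<Rightarrow> ('a \<Rightarrow> real) \<Rightarrow> 'a \<Rightarrow> real" where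
  "F U V x = indicator \<Omega> x * (f (clip w \<theta> U x) * a V x)"

lemma clip_bounds: "0 \<le> clip w \<theta> U x" "clip w \<theta> U x \<le> \<theta>" "0 \<le> clip w' \<theta>' V x" "clip w' \<theta>' V x \<le> \<theta>'"
    "w' x \<le> clip w' \<theta>' V x" "\<bar>clip w' \<theta>' V x\<bar> \<le> \<theta>'" "\<bar>w' x\<bar> \<le> \<theta>'" "\<bar>\<theta>'\<bar> \<le> \<theta>'"
  using w(1,2)[of x] w(3,4)[of x] by (auto simp: clip_def)

lemma lux_clip_bounds:
  "0 < lux \<Omega> q w'" "lux \<Omega> q w' \<le> lux \<Omega> q (clip w' \<theta>' V)" "lux \<Omega> q (clip w' \<theta>' V) \<le> lux \<Omega> q (\<lambda>_. \<theta>')"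
  "0 < lux \<Omega> r w'" "lux \<Omega> r w' \<le> lux \<Omega> r (clip w' \<theta>' V)" "lux \<Omega> r (clip w' \<theta>' V) \<le> lux \<Omega> r (\<lambda>_. \<theta>')"
proof -
  show "0 < lux \<Omega> q w'" by (rule Q.lux_positive[OF w_measurable(2) clip_bounds(7) w'_ball])
  show "0 < lux \<Omega> r w'" by (rule R.lux_positive[OF w_measurable(2) clip_bounds(7) w'_ball])
  have le: "\<bar>w' x\<bar> \<le> \<bar>clip w' \<theta>' V x\<bar>" "\<bar>clip w' \<theta>' V x\<bar> \<le> \<bar>\<theta>'\<bar>" for x
    using w(3)[of x] clip_bounds(3,4)[of V x] clip_bounds(5)[of x V] by auto
  show "lux \<Omega> q w' \<le> lux \<Omega> q (clip w' \<theta>' V)" by (rule Q.lux_mono[OF le(1) clip_bounds(6)])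
  show "lux \<Omega> r w' \<le> lux \<Omega> r (clip w' \<theta>' V)" by (rule R.lux_mono[OF le(1) clip_bounds(6)])
  show "lux \<Omega> q (clip w' \<theta>' V) \<le> lux \<Omega> q (\<lambda>_. \<theta>')" by (rule Q.lux_mono[OF le(2) clip_bounds(8)])
  show "lux \<Omega> r (clip w' \<theta>' V) \<le> lux \<Omega> r (\<lambda>_. \<theta>')" by (rule R.lux_mono[OF le(2) clip_bounds(8)])
qed

lemma A_continuous_section: "x \<in> closure \<Omega> \<Longrightarrow> continuous_on {0..} (A x)"
proof -
  assume x: "x \<in> closure \<Omega>"
  have "continuous_on {0..} (\<lambda>t. (\<lambda>(x, t). A x t) (x, t))"
    by (rule continuous_on_compose2[OF A_cont]) (use x in \<open>auto intro!: continuous_intros\<close>)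
  then show ?thesis by simp
qed

text \<open>The truncated norm stays in a compact interval of positive numbers that does not depend
  on \<open>V\<close>, so \<open>A\<close> has a positive minimum and a finite maximum over the
  closure of \<Omega> times this interval.\<close>

lemma a_bounds: obtains a0 a1 where "0 < a0" "\<forall>V. \<forall>x\<in>\<Omega>. a0 \<le> a V x" "\<forall>V. \<forall>x\<in>\<Omega>. a V x \<le> a1"
proof -
  define t0 t1 where "t0 = lux \<Omega> r w'" and "t1 = lux \<Omega> r (\<lambda>_. \<theta>')"
  have t: "0 < t0" "t0 \<le> t1" using lux_clip_bounds(4-6) unfolding t0_def t1_def by (blast intro: order_trans)+
  let ?K = "closure \<Omega> \<times> {t0..t1}"
  have K: "compact ?K" using Q.bounded_domain by (simp add: compact_Times)
  have "x0 \<in> closure \<Omega>" using w'_ball(1,2) closure_subset by fastforce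
  then have Kne: "?K \<noteq> {}" using t by auto
  have Kc: "continuous_on ?K (\<lambda>(x, t). A x t)" by (rule continuous_on_subset[OF A_cont]) (use t in auto)
  obtain z0 where z0: "z0 \<in> ?K" "\<forall>z\<in>?K. (\<lambda>(x, t). A x t) z0 \<le> (\<lambda>(x, t). A x t) z"
    using continuous_attains_inf[OF K Kne Kc] by blast
  obtain z1 where z1: "z1 \<in> ?K" "\<forall>z\<in>?K. (\<lambda>(x, t). A x t) z \<le> (\<lambda>(x, t). A x t) z1"
    using continuous_attains_sup[OF K Kne Kc] by blast
  define A0 A1 where "A0 = (\<lambda>(x, t). A x t) z0" and "A1 = (\<lambda>(x, t). A x t) z1"
  have A0: "0 < A0" using z0(1) A_pos[of "fst z0" "snd z0"] t unfolding A0_def t1_def by (cases z0) auto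
  have AB: "A0 \<le> A x s" "A x s \<le> A1" if "x \<in> \<Omega>" "t0 \<le> s" "s \<le> t1" for x s
    using z0(2)[rule_format, of "(x, s)"] z1(2)[rule_format, of "(x, s)"] that closure_subset[of \<Omega>]
    by (auto simp: A0_def A1_def)
  \<comment> \<open>Comparison with 1 fixes the direction in which the power is monotone in the
    exponent, so \<open>\<alpha> x\<close> can be replaced by its upper bound \<open>Ba\<close> on
    both sides.\<close>
  define e0 e1 where "e0 = min 1 (lux \<Omega> q w')" and "e1 = max 1 (lux \<Omega> q (\<lambda>_. \<theta>'))"
  have e: "0 < e0" "e0 \<le> 1" "1 \<le> e1" using lux_clip_bounds(1) by (auto simp: e0_def e1_def)
  have pw: "e0 powr Ba \<le> lux \<Omega> q (clip w' \<theta>' V) powr \<alpha> x" "lux \<Omega> q (clip w' \<theta>' V) powr \<alpha> x \<le> e1 powr Ba" for V x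
  proof -
    let ?s = "lux \<Omega> q (clip w' \<theta>' V)"
    have s: "e0 \<le> ?s" "?s \<le> e1" using lux_clip_bounds(2,3)[of V] by (auto simp: e0_def e1_def)
    have "e0 powr Ba \<le> e0 powr \<alpha> x" using e alpha by (intro powr_mono') auto
    also have "\<dots> \<le> ?s powr \<alpha> x" using s e alpha by (intro powr_mono2) auto
    finally show "e0 powr Ba \<le> ?s powr \<alpha> x" .
    have "?s powr \<alpha> x \<le> e1 powr \<alpha> x" using s e alpha by (intro powr_mono2) auto
    also have "\<dots> \<le> e1 powr Ba" using e alpha by (intro powr_mono) auto
    finally show "?s powr \<alpha> x \<le> e1 powr Ba" .
  qed
  have A01: "0 < A1" using AB[of x0 t0] w'_ball(1,2) t A0 by (auto simp: subset_iff)
  show thesis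
  proof (rule that[of "e0 powr Ba / A1" "e1 powr Ba / A0"])
    show "0 < e0 powr Ba / A1" using e A01 by simp
    have ab: "e0 powr Ba / A1 \<le> a V x \<and> a V x \<le> e1 powr Ba / A0" if "x \<in> \<Omega>" for V x
    proof -
      define s where "s = lux \<Omega> r (clip w' \<theta>' V)"
      have s: "A0 \<le> A x s" "A x s \<le> A1"
        using AB[OF that, of s] lux_clip_bounds(5,6)[of V] unfolding s_def t0_def t1_def by auto
      show ?thesis unfolding a_def s_def[symmetric] using s A0 pw[of V x] by (intro conjI frac_le) auto
    qed
    show "\<forall>V. \<forall>x\<in>\<Omega>. e0 powr Ba / A1 \<le> a V x" "\<forall>V. \<forall>x\<in>\<Omega>. a V x \<le> e1 powr Ba / A0" using ab by blast+
  qed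
qed

lemma F_bound: obtains K where "0 \<le> K" "\<forall>U V x. \<bar>F U V x\<bar> \<le> K"
proof -
  obtain a0 a1 where ab: "0 < a0" "\<forall>V. \<forall>x\<in>\<Omega>. a0 \<le> a V x" "\<forall>V. \<forall>x\<in>\<Omega>. a V x \<le> a1" by (rule a_bounds)
  have "bounded (f ` {0..\<theta>})" by (intro compact_imp_bounded compact_continuous_image f_cont compact_Icc)
  then obtain B where B: "0 < B" "\<forall>t\<in>{0..\<theta>}. \<bar>f t\<bar> \<le> B" unfolding bounded_pos by auto
  show thesis
  proof (rule that[of "B * \<bar>a1\<bar>"])
    show "\<forall>U V x. \<bar>F U V x\<bar> \<le> B * \<bar>a1\<bar>"
    proof (intro allI)
      fix U V x
      show "\<bar>F U V x\<bar> \<le> B * \<bar>a1\<bar>"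
      proof (cases "x \<in> \<Omega>")
        case True
        have "a0 \<le> a V x" "a V x \<le> a1" using ab True by blast+
        then have "\<bar>a V x\<bar> \<le> \<bar>a1\<bar>" using ab(1) by linarith
        then show ?thesis using B clip_bounds(1,2)[of U x] True by (auto simp: F_def abs_mult intro!: mult_mono)
      qed (use B in \<open>simp add: F_def\<close>)
    qed
  qed (use B in simp)
qed

lemma F_measurable:
  assumes [measurable]: "U \<in> borel_measurable borel"
  shows "F U V \<in> borel_measurable borel"
proof -
  \<comment> \<open>\<open>f\<close> is continuous only on \<open>[0, \<theta>]\<close>; composed
    with the projection onto this interval it is Borel on the whole line and unchanged on clipped
    values.\<close>
  define f' where "f' t = f (max 0 (min t \<theta>))" for t
  have "0 \<le> \<theta>" using w(1,2) order_trans by blast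
  then have "continuous_on UNIV f'" unfolding f'_def[abs_def]
    by (intro continuous_on_compose2[OF f_cont]) (auto intro!: continuous_intros)
  then have [measurable]: "f' \<in> borel_measurable borel" by (rule borel_measurable_continuous_onI)
  define s where "s = lux \<Omega> r (clip w' \<theta>' V)"
  have s: "0 \<le> s" using lux_clip_bounds(4) lux_clip_bounds(5)[of V] by (simp add: s_def)
  have "continuous_on \<Omega> (\<lambda>x. (\<lambda>(x, t). A x t) (x, s))"
    by (rule continuous_on_compose2[OF A_cont]) (use s closure_subset[of \<Omega>] in \<open>auto intro!: continuous_intros\<close>)
  then have [measurable]: "(\<lambda>x. indicator \<Omega> x *\<^sub>R A x s) \<in> borel_measurable borel"
    by (intro borel_measurable_continuous_on_indicator[OF Q.domain_measurable]) simp
  have [measurable]: "clip w \<theta> U \<in> borel_measurable borel" unfolding clip_def[abs_def] by measurable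
  have "F U V x = indicator \<Omega> x * (f' (clip w \<theta> U x) * (lux \<Omega> q (clip w' \<theta>' V) powr \<alpha> x / (indicator \<Omega> x *\<^sub>R A x s)))" for x
    using clip_bounds(1,2)[of U x] by (simp add: F_def a_def s_def f'_def indicator_def)
  then have "F U V = (\<lambda>x. indicator \<Omega> x * (f' (clip w \<theta> U x) * (lux \<Omega> q (clip w' \<theta>' V) powr \<alpha> x / (indicator \<Omega> x *\<^sub>R A x s))))" by blast
  also have "\<dots> \<in> borel_measurable borel" by measurable
  finally show ?thesis .
qed

lemma clip_tendsto: "(\<lambda>n. Us n x) \<longlonglongrightarrow> U x \<Longrightarrow> (\<lambda>n. clip w \<theta> (Us n) x) \<longlonglongrightarrow> clip w \<theta> U x"
    "(\<lambda>n. Us n x) \<longlonglongrightarrow> U x \<Longrightarrow> (\<lambda>n. clip w' \<theta>' (Us n) x) \<longlonglongrightarrow> clip w' \<theta>' U x"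
  unfolding clip_def by (intro tendsto_intros; assumption)+

lemma F_tendsto:
  assumes [measurable]: "\<And>n. Vs n \<in> borel_measurable borel" "V \<in> borel_measurable borel"
    and U: "AE x in lborel. (\<lambda>n. Us n x) \<longlonglongrightarrow> U x" and V: "AE x in lborel. (\<lambda>n. Vs n x) \<longlonglongrightarrow> V x"
  shows "AE x in lborel. (\<lambda>n. F (Us n) (Vs n) x) \<longlonglongrightarrow> F U V x"
proof -
  have m: "clip w' \<theta>' (Vs n) \<in> borel_measurable borel" "clip w' \<theta>' V \<in> borel_measurable borel" for n
    unfolding clip_def[abs_def] by measurable
  have ae: "AE x in lborel. (\<lambda>n. clip w' \<theta>' (Vs n) x) \<longlonglongrightarrow> clip w' \<theta>' V x"
    using V by eventually_elim (rule clip_tendsto(2))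
  have lq: "(\<lambda>n. lux \<Omega> q (clip w' \<theta>' (Vs n))) \<longlonglongrightarrow> lux \<Omega> q (clip w' \<theta>' V)"
    by (rule Q.lux_tendsto[OF m clip_bounds(6) clip_bounds(6) ae])
  have lr: "(\<lambda>n. lux \<Omega> r (clip w' \<theta>' (Vs n))) \<longlonglongrightarrow> lux \<Omega> r (clip w' \<theta>' V)"
    by (rule R.lux_tendsto[OF m clip_bounds(6) clip_bounds(6) ae])
  have p: "0 < lux \<Omega> q (clip w' \<theta>' V)" "0 < lux \<Omega> r (clip w' \<theta>' V)" for V
    using lux_clip_bounds(1,4) lux_clip_bounds(2,5)[of V] by linarith+
  show ?thesis
    using U
  proof eventually_elim
    case (elim x)
    show ?case
    proof (cases "x \<in> \<Omega>")
      case True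
      then have xc: "x \<in> closure \<Omega>" using closure_subset by blast
      have "(\<lambda>n. f (clip w \<theta> (Us n) x)) \<longlonglongrightarrow> f (clip w \<theta> U x)"
        by (rule continuous_on_tendsto_compose[OF f_cont clip_tendsto(1)[of Us x U, OF elim]]) (use clip_bounds in auto)
      moreover have "(\<lambda>n. A x (lux \<Omega> r (clip w' \<theta>' (Vs n)))) \<longlonglongrightarrow> A x (lux \<Omega> r (clip w' \<theta>' V))"
        by (rule continuous_on_tendsto_compose[OF A_continuous_section[OF xc] lr]) (use less_imp_le[OF p(2)] in simp_all)
      moreover have "(\<lambda>n. lux \<Omega> q (clip w' \<theta>' (Vs n)) powr \<alpha> x) \<longlonglongrightarrow> lux \<Omega> q (clip w' \<theta>' V) powr \<alpha> x"
        using p(1)[of V] by (intro tendsto_powr lq tendsto_const) auto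
      moreover have "A x (lux \<Omega> r (clip w' \<theta>' V)) \<noteq> 0"
        using A_pos[OF xc p(2)[of V] lux_clip_bounds(6)] by simp
      ultimately show ?thesis unfolding F_def a_def by (intro tendsto_mult tendsto_divide tendsto_const)
    qed (simp add: F_def)
  qed
qed

text \<open>Once both components lie between barrier and \<open>\<theta>\<close>, the truncation is
  the identity almost everywhere. Luxemburg norms do not see null sets, so changed representatives
  and Borel versions of the exponents are allowed.\<close>

lemma F_unclipped:
  assumes U: "AE x in lborel. w x \<le> U x \<and> U x \<le> \<theta> \<and> U x = U' x" and V: "AE x in lborel. w' x \<le> V x \<and> V x \<le> \<theta>' \<and> V x = V' x"
    and q0: "AE x in lebesgue. x \<in> \<Omega> \<longrightarrow> q0 x = q x" and r0: "AE x in lebesgue. x \<in> \<Omega> \<longrightarrow> r0 x = r x"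
    and \<alpha>0: "AE x in lebesgue. x \<in> \<Omega> \<longrightarrow> \<alpha>0 x = \<alpha> x"
  shows "AE x in lebesgue. x \<in> \<Omega> \<longrightarrow> lam * f (U' x) * lux \<Omega> q0 V' powr \<alpha>0 x / A x (lux \<Omega> r0 V') = lam * F U V x"
proof -
  have ae: "AE x in lebesgue. x \<in> \<Omega> \<longrightarrow> \<bar>V' x\<bar> = \<bar>clip w' \<theta>' V x\<bar>"
    using AE_completion[OF V] by eventually_elim (auto simp: clip_def)
  have eq: "lux \<Omega> q0 V' = lux \<Omega> q (clip w' \<theta>' V)" "lux \<Omega> r0 V' = lux \<Omega> r (clip w' \<theta>' V)"
    using lux_cong[OF ae] lux_exponent_cong[OF q0] lux_exponent_cong[OF r0] by simp_all
  show ?thesis unfolding eq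
    using AE_completion[OF U] \<alpha>0 by eventually_elim (auto simp: F_def a_def clip_def)
qed

end

section \<open>Reduction of the given data, and assembly of the coupled system\<close>

lemma C1_exponent:
  assumes dom: "open \<Omega>" "bounded \<Omega>" "\<Omega> \<noteq> {}" and p: "C1_closure \<Omega> p" "1 < Inf (p ` \<Omega>)"
  obtains p' pm pp P DP Lip where "pspace \<Omega> p' pm pp" "\<forall>x\<in>\<Omega>. p x = p' x"
    "\<forall>x\<in>\<Omega>. (P has_derivative (\<lambda>h. DP x \<bullet> h)) (at x)" "continuous_on \<Omega> DP" "\<forall>x\<in>\<Omega>. norm (DP x) \<le> (Lip :: real)" "\<forall>x\<in>\<Omega>. p' x = P x"
proof -
  obtain U P where U: "open U" "closure \<Omega> \<subseteq> U" "Ck_on 1 U P" "\<forall>x\<in>closure \<Omega>. P x = p x"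
    using p(1) unfolding C1_closure_def by blast
  have sub: "\<Omega> \<subseteq> closure \<Omega>" by (rule closure_subset)
  have df: "P differentiable (at x)" if "x \<in> U" for x
    using U(3) that unfolding Ck_on_def by (metis (no_types) empty_set empty_subsetI length_0_conv less_numeral_extra(1) list.size(3) piter.simps(1))
  have cd: "continuous_on U (\<lambda>x. frechet_derivative P (at x) b)" if "b \<in> Basis" for b
  proof -
    have "continuous_on U (piter [b] P)" using U(3) that unfolding Ck_on_def by (auto dest: spec[of _ "[b]"])
    then show ?thesis by simp
  qed
  have hd: "(P has_derivative (\<lambda>h. grad P x \<bullet> h)) (at x)" if "x \<in> U" for x
    using df[OF that] grad_inner frechet_derivative_works by fastforce
  have cg: "continuous_on U (grad P)" unfolding grad_def[abs_def] by (intro continuous_intros cd)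
  have cP: "continuous_on U P" using df by (intro continuous_at_imp_continuous_on) (auto intro: differentiable_imp_continuous_within)
  have K: "compact (closure \<Omega>)" using dom(2) by simp
  have "bounded (grad P ` closure \<Omega>)"
    by (intro compact_imp_bounded compact_continuous_image K continuous_on_subset[OF cg U(2)])
  then obtain Lip where Lip: "\<forall>x\<in>closure \<Omega>. norm (grad P x) \<le> Lip" unfolding bounded_iff by auto
  have "bounded (P ` closure \<Omega>)"
    by (intro compact_imp_bounded compact_continuous_image K continuous_on_subset[OF cP U(2)])
  then obtain B where B: "\<forall>x\<in>closure \<Omega>. \<bar>P x\<bar> \<le> B" unfolding bounded_iff by auto
  define pm where "pm = Inf (p ` \<Omega>)"
  have lo: "pm \<le> p x" if "x \<in> \<Omega>" for x unfolding pm_def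
  proof (rule cInf_lower)
    show "bdd_below (p ` \<Omega>)" by (rule bdd_belowI[of _ "- B"]) (use B U(4) sub in force)
  qed (use that in simp)
  have up: "p x \<le> B" if "x \<in> \<Omega>" for x using B U(4) sub that by force
  define p' where "p' x = (if x \<in> \<Omega> then P x else pm)" for x
  have peq: "\<forall>x\<in>\<Omega>. p x = p' x" using U(4) sub by (auto simp: p'_def)
  have "p' \<in> borel_measurable borel" unfolding p'_def[abs_def]
    by (rule borel_measurable_continuous_on_if) (use dom(1) continuous_on_subset[OF cP] U(2) sub in auto)
  then have "pspace \<Omega> p' pm (max B pm)"
    using dom p(2) lo up peq by unfold_locales (auto simp: p'_def pm_def le_max_iff_disj)
  then show thesis
    by (rule that[where P=P and DP="grad P" and Lip=Lip])
       (use peq hd Lip U(2) sub continuous_on_subset[OF cg] in \<open>auto simp: p'_def subset_iff\<close>)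
qed

text \<open>A weak solution must be positive at every point of \<Omega>, whereas comparison gives
  this almost everywhere. On the exceptional null set the value is reset to \<open>\<theta>\<close>,
  and off \<Omega> to 0.\<close>

lemma (in pspace) EL_positive_version:
  assumes EL: "EL u G g" and \<theta>: "0 < \<theta>" and u: "AE x in lborel. z x \<le> u x \<and> u x \<le> \<theta> \<and> (x \<in> \<Omega> \<longrightarrow> 0 < u x)"
    and q: "\<And>x. x \<in> \<Omega> \<Longrightarrow> q x = p x"
  obtains u' where "EL u' G g" "W0 \<Omega> q u' G" "in_Linf \<Omega> u'" "\<forall>x\<in>\<Omega>. 0 < u' x"
    "AE x in lborel. z x \<le> u x \<and> u x \<le> \<theta> \<and> u x = u' x"
proof -
  have W: "W u G" using EL by (simp add: EL_def)
  note [measurable] = WD(2)[OF W]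
  define u' where "u' x = (if x \<in> \<Omega> then if 0 < u x \<and> u x \<le> \<theta> then u x else \<theta> else 0)" for x
  have m: "u' \<in> borel_measurable borel" unfolding u'_def[abs_def] by measurable
  have ae: "AE x in lborel. z x \<le> u x \<and> u x \<le> \<theta> \<and> u x = u' x"
    using u by eventually_elim (use WD(3)[OF W] in \<open>auto simp: u'_def\<close>)
  have EL': "EL u' G g"
    by (rule EL_null_modification[OF EL m]) (use ae in \<open>auto simp: u'_def elim: eventually_mono\<close>)
  have b: "\<bar>u' x\<bar> \<le> \<theta>" for x using \<theta> by (auto simp: u'_def)
  show thesis
  proof (rule that[OF EL' _ _ _ ae])
    show "W0 \<Omega> q u' G" using EL' W_W0[OF _ b q] by (simp add: EL_def)
    show "in_Linf \<Omega> u'" unfolding in_Linf_def using borel_set_measurable[OF m] b by blast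
    show "\<forall>x\<in>\<Omega>. 0 < u' x" using \<theta> by (simp add: u'_def)
  qed
qed

theorem theorem4p3:
  fixes \<Omega> :: "'a::euclidean_space set"
    and p1 p2 q1 q2 r1 r2 \<alpha>1 \<alpha>2 :: "'a \<Rightarrow> real"
    and f1 f2 :: "real \<Rightarrow> real" and A :: "'a \<Rightarrow> real \<Rightarrow> real" and \<theta>1 \<theta>2 :: real
  assumes N: "DIM('a) > 1"
    and dom: "open \<Omega>" "connected \<Omega>" "bounded \<Omega>" "\<Omega> \<noteq> {}" "C2_boundary \<Omega>"
    and p1: "C1_closure \<Omega> p1" "1 < Inf (p1 ` \<Omega>)" "Sup (p1 ` \<Omega>) < real DIM('a)"
    and p2: "C1_closure \<Omega> p2" "1 < Inf (p2 ` \<Omega>)" "Sup (p2 ` \<Omega>) < real DIM('a)"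
    and r1: "in_Linf \<Omega> r1" "AE x in lebesgue. x \<in> \<Omega> \<longrightarrow> 1 \<le> r1 x"
    and r2: "in_Linf \<Omega> r2" "AE x in lebesgue. x \<in> \<Omega> \<longrightarrow> 1 \<le> r2 x"
    and q1: "in_Linf \<Omega> q1" "AE x in lebesgue. x \<in> \<Omega> \<longrightarrow> 1 \<le> q1 x"
    and q2: "in_Linf \<Omega> q2" "AE x in lebesgue. x \<in> \<Omega> \<longrightarrow> 1 \<le> q2 x"
    and \<alpha>1: "in_Linf \<Omega> \<alpha>1" "AE x in lebesgue. x \<in> \<Omega> \<longrightarrow> 0 \<le> \<alpha>1 x"
    and \<alpha>2: "in_Linf \<Omega> \<alpha>2" "AE x in lebesgue. x \<in> \<Omega> \<longrightarrow> 0 \<le> \<alpha>2 x"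
    and \<theta>: "0 < \<theta>1" "0 < \<theta>2"
    and f1: "continuous_on {0..\<theta>1} f1" "f1 0 = 0" "f1 \<theta>1 = 0" "\<forall>t. 0 < t \<and> t < \<theta>1 \<longrightarrow> 0 < f1 t"
    and f2: "continuous_on {0..\<theta>2} f2" "f2 0 = 0" "f2 \<theta>2 = 0" "\<forall>t. 0 < t \<and> t < \<theta>2 \<longrightarrow> 0 < f2 t"
    and A_cont: "continuous_on (closure \<Omega> \<times> {0..}) (\<lambda>(x, t). A x t)"
    and A_pos: "\<forall>x\<in>closure \<Omega>. \<forall>t. 0 < t \<and> t \<le> max (lux \<Omega> r2 (\<lambda>_. \<theta>1)) (lux \<Omega> r1 (\<lambda>_. \<theta>2))
                   \<longrightarrow> 0 < A x t"
  shows "\<exists>lam0>0. \<forall>lam\<ge>lam0. \<exists>u v. pos_weak_solution \<Omega> p1 p2 q1 q2 r1 r2 \<alpha>1 \<alpha>2 A f1 f2 lam u v"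
proof -
  obtain s1 pm1 pp1 P1 DP1 L1 where e1: "pspace \<Omega> s1 pm1 pp1" "\<forall>x\<in>\<Omega>. p1 x = s1 x"
    "\<forall>x\<in>\<Omega>. (P1 has_derivative (\<lambda>h. DP1 x \<bullet> h)) (at x)" "continuous_on \<Omega> DP1" "\<forall>x\<in>\<Omega>. norm (DP1 x) \<le> L1" "\<forall>x\<in>\<Omega>. s1 x = P1 x"
    by (rule C1_exponent[OF dom(1,3,4) p1(1,2)])
  obtain s2 pm2 pp2 P2 DP2 L2 where e2: "pspace \<Omega> s2 pm2 pp2" "\<forall>x\<in>\<Omega>. p2 x = s2 x"
    "\<forall>x\<in>\<Omega>. (P2 has_derivative (\<lambda>h. DP2 x \<bullet> h)) (at x)" "continuous_on \<Omega> DP2" "\<forall>x\<in>\<Omega>. norm (DP2 x) \<le> L2" "\<forall>x\<in>\<Omega>. s2 x = P2 x"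
    by (rule C1_exponent[OF dom(1,3,4) p2(1,2)])
  obtain Q1 Bq1 where Q1: "Q1 \<in> borel_measurable borel" "\<forall>x. 1 \<le> Q1 x \<and> Q1 x \<le> Bq1" "AE x in lebesgue. x \<in> \<Omega> \<longrightarrow> q1 x = Q1 x"
    by (rule exponent_version[OF dom(1) q1])
  obtain Q2 Bq2 where Q2: "Q2 \<in> borel_measurable borel" "\<forall>x. 1 \<le> Q2 x \<and> Q2 x \<le> Bq2" "AE x in lebesgue. x \<in> \<Omega> \<longrightarrow> q2 x = Q2 x"
    by (rule exponent_version[OF dom(1) q2])
  obtain R1 Br1 where R1: "R1 \<in> borel_measurable borel" "\<forall>x. 1 \<le> R1 x \<and> R1 x \<le> Br1" "AE x in lebesgue. x \<in> \<Omega> \<longrightarrow> r1 x = R1 x"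
    by (rule exponent_version[OF dom(1) r1])
  obtain R2 Br2 where R2: "R2 \<in> borel_measurable borel" "\<forall>x. 1 \<le> R2 x \<and> R2 x \<le> Br2" "AE x in lebesgue. x \<in> \<Omega> \<longrightarrow> r2 x = R2 x"
    by (rule exponent_version[OF dom(1) r2])
  obtain a1 Ba1 where a1: "a1 \<in> borel_measurable borel" "\<forall>x. 0 \<le> a1 x \<and> a1 x \<le> Ba1" "AE x in lebesgue. x \<in> \<Omega> \<longrightarrow> \<alpha>1 x = a1 x"
    by (rule exponent_version[OF dom(1) \<alpha>1])
  obtain a2 Ba2 where a2: "a2 \<in> borel_measurable borel" "\<forall>x. 0 \<le> a2 x \<and> a2 x \<le> Ba2" "AE x in lebesgue. x \<in> \<Omega> \<longrightarrow> \<alpha>2 x = a2 x"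
    by (rule exponent_version[OF dom(1) \<alpha>2])
  obtain x0 where x0: "x0 \<in> \<Omega>" using dom(4) by blast
  obtain R where R: "0 < R" "cball x0 R \<subseteq> \<Omega>" using dom(1) x0 open_contains_cball by blast
  interpret S1: pspace \<Omega> s1 pm1 pp1 by (rule e1(1))
  interpret S2: pspace \<Omega> s2 pm2 pp2 by (rule e2(1))
  \<comment> \<open>Inner radius \<open>R / 4\<close> satisfies \<open>2 * (R / 4) < R\<close>;
    height \<open>\<theta>1 / 2\<close> stays strictly below \<open>\<theta>1\<close>, where
    \<open>f1\<close> is positive. Both barriers share a centre, so one ball serves the lower bounds
    of both norms.\<close>
  interpret B1: barrier \<Omega> s1 pm1 pp1 P1 DP1 L1 x0 "R / 4" R "\<theta>1 / 2"
    by unfold_locales (use e1 R \<theta> in auto)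
  interpret B2: barrier \<Omega> s2 pm2 pp2 P2 DP2 L2 x0 "R / 4" R "\<theta>2 / 2"
    by unfold_locales (use e2 R \<theta> in auto)
  define w1 w2 where "w1 = (\<lambda>x. max 0 (B1.z x))" and "w2 = (\<lambda>x. max 0 (B2.z x))"
  have wm: "w1 \<in> borel_measurable borel" "w2 \<in> borel_measurable borel" unfolding w1_def w2_def by measurable
  have wb: "0 \<le> w1 x" "w1 x \<le> \<theta>1" "0 \<le> w2 x" "w2 x \<le> \<theta>2" for x
    using B1.z_le[of x] B2.z_le[of x] \<theta> by (auto simp: w1_def w2_def)
  obtain m1 where m1: "0 < m1" "\<forall>x\<in>cball x0 (R / 2). m1 \<le> B1.z x" by (rule B1.z_lower[of "R / 2"]) (use R in auto)
  obtain m2 where m2: "0 < m2" "\<forall>x\<in>cball x0 (R / 2). m2 \<le> B2.z x" by (rule B2.z_lower[of "R / 2"]) (use R in auto)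
  have wl: "m1 \<le> w1 x" "m2 \<le> w2 x" if "x \<in> ball x0 (R / 2)" for x
    using m1(2) m2(2) that ball_subset_cball[of x0 "R / 2"] unfolding w1_def w2_def by (meson max.coboundedI2 subsetD)+
  have bO: "ball x0 (R / 2) \<subseteq> \<Omega>" using R by (auto simp: subset_iff)
  have le: "lux \<Omega> R1 (\<lambda>_. \<theta>2) \<le> max (lux \<Omega> r2 (\<lambda>_. \<theta>1)) (lux \<Omega> r1 (\<lambda>_. \<theta>2))"
     "lux \<Omega> R2 (\<lambda>_. \<theta>1) \<le> max (lux \<Omega> r2 (\<lambda>_. \<theta>1)) (lux \<Omega> r1 (\<lambda>_. \<theta>2))"
    using lux_exponent_cong[OF R1(3)] lux_exponent_cong[OF R2(3)] by simp_all
  have A1: "0 < A x t" if "x \<in> closure \<Omega>" "0 < t" "t \<le> lux \<Omega> R1 (\<lambda>_. \<theta>2)" for x t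
    using A_pos that(1,2) order_trans[OF that(3) le(1)] by blast
  have A2: "0 < A x t" if "x \<in> closure \<Omega>" "0 < t" "t \<le> lux \<Omega> R2 (\<lambda>_. \<theta>1)" for x t
    using A_pos that(1,2) order_trans[OF that(3) le(2)] by blast
  interpret T1: nonlocal_term \<Omega> Q1 Bq1 R1 Br1 a1 Ba1 A f1 w1 w2 \<theta>1 \<theta>2 x0 "R / 2" m2
    by unfold_locales (use dom Q1 R1 a1 A_cont A1 f1 wm wb R m2 wl bO in auto)
  interpret T2: nonlocal_term \<Omega> Q2 Bq2 R2 Br2 a2 Ba2 A f2 w2 w1 \<theta>2 \<theta>1 x0 "R / 2" m1
    by unfold_locales (use dom Q2 R2 a2 A_cont A2 f2 wm wb R m1 wl bO in auto)
  \<comment> \<open>These lower bounds depend on the barriers and on \<open>\<theta>1\<close>,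
    \<open>\<theta>2\<close>, but not on \<open>lam\<close>. The threshold for \<open>lam\<close>
    can therefore be fixed before the system is solved.\<close>
  obtain k1 K1 where k1: "0 < k1" "\<forall>V. \<forall>x\<in>\<Omega>. k1 \<le> T1.a V x" "\<forall>V. \<forall>x\<in>\<Omega>. T1.a V x \<le> K1" by (rule T1.a_bounds)
  obtain k2 K2 where k2: "0 < k2" "\<forall>V. \<forall>x\<in>\<Omega>. k2 \<le> T2.a V x" "\<forall>V. \<forall>x\<in>\<Omega>. T2.a V x \<le> K2" by (rule T2.a_bounds)
  obtain C1 where C1: "0 \<le> C1" "\<forall>U V x. \<bar>T1.F U V x\<bar> \<le> C1" by (rule T1.F_bound)
  obtain C2 where C2: "0 \<le> C2" "\<forall>U V x. \<bar>T2.F U V x\<bar> \<le> C2" by (rule T2.F_bound)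
  have half: "\<theta>1 / 2 < \<theta>1" "\<theta>2 / 2 < \<theta>2" using \<theta> by auto
  obtain l1 where l1: "0 < l1"
    "\<forall>lam u G h a C. l1 \<le> lam \<longrightarrow> S1.EL u G h \<longrightarrow> h \<in> borel_measurable borel \<longrightarrow> (\<forall>x. \<bar>h x\<bar> \<le> C) \<longrightarrow>
       (\<forall>x. h x = lam * (indicator \<Omega> x * (f1 (clip (\<lambda>x. max 0 (B1.z x)) \<theta>1 u x) * a x))) \<longrightarrow> (\<forall>x\<in>\<Omega>. k1 \<le> a x) \<longrightarrow>
       (AE x in lborel. max 0 (B1.z x) \<le> u x \<and> u x \<le> \<theta>1 \<and> (x \<in> \<Omega> \<longrightarrow> 0 < u x))"
    by (rule B1.truncated_solution[OF dom(2) half(1) f1 k1(1)])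
  obtain l2 where l2: "0 < l2"
    "\<forall>lam u G h a C. l2 \<le> lam \<longrightarrow> S2.EL u G h \<longrightarrow> h \<in> borel_measurable borel \<longrightarrow> (\<forall>x. \<bar>h x\<bar> \<le> C) \<longrightarrow>
       (\<forall>x. h x = lam * (indicator \<Omega> x * (f2 (clip (\<lambda>x. max 0 (B2.z x)) \<theta>2 u x) * a x))) \<longrightarrow> (\<forall>x\<in>\<Omega>. k2 \<le> a x) \<longrightarrow>
       (AE x in lborel. max 0 (B2.z x) \<le> u x \<and> u x \<le> \<theta>2 \<and> (x \<in> \<Omega> \<longrightarrow> 0 < u x))"
    by (rule B2.truncated_solution[OF dom(2) half(2) f2 k2(1)])
  show ?thesis
  proof (intro exI[of _ "max l1 l2"] conjI allI impI)
    show "0 < max l1 l2" using l1(1) by simp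
    fix lam assume "max l1 l2 \<le> lam"
    then have lam: "l1 \<le> lam" "l2 \<le> lam" "0 \<le> lam" using l1(1) by auto
    \<comment> \<open>In the second equation the unknown comes last, so \<open>T2.F\<close> receives
      its arguments in exchanged order.\<close>
    define N1 N2 where "N1 U V x = lam * T1.F U V x" and "N2 U V x = lam * T2.F V U x" for U V x
    define C where "C = max (lam * C1) (lam * C2)"
    have Nb: "\<bar>N1 U V x\<bar> \<le> C" "\<bar>N2 U V x\<bar> \<le> C" for U V x
    proof -
      have "\<bar>N1 U V x\<bar> \<le> lam * C1" "\<bar>N2 U V x\<bar> \<le> lam * C2"
        unfolding N1_def N2_def abs_mult using lam(3) C1(2) C2(2) by (auto intro!: mult_mono)
      then show "\<bar>N1 U V x\<bar> \<le> C" "\<bar>N2 U V x\<bar> \<le> C" unfolding C_def by linarith+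
    qed
    have Nm: "U \<in> borel_measurable borel \<Longrightarrow> N1 U V \<in> borel_measurable borel"
      "V \<in> borel_measurable borel \<Longrightarrow> N2 U V \<in> borel_measurable borel" for U V
      unfolding N1_def[abs_def] N2_def[abs_def] using T1.F_measurable[of U V] T2.F_measurable[of V U] by simp_all
    interpret coupled \<Omega> s1 pm1 pp1 s2 pm2 pp2 N1 N2 C
    proof unfold_locales
      fix Us Vs :: "nat \<Rightarrow> 'a \<Rightarrow> real" and U V :: "'a \<Rightarrow> real"
      assume m: "\<And>n. Us n \<in> borel_measurable borel" "\<And>n. Vs n \<in> borel_measurable borel"
        "U \<in> borel_measurable borel" "V \<in> borel_measurable borel"
        and ae: "AE x in lborel. (\<lambda>n. Us n x) \<longlonglongrightarrow> U x" "AE x in lborel. (\<lambda>n. Vs n x) \<longlonglongrightarrow> V x"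
      show "AE x in lborel. (\<lambda>n. N1 (Us n) (Vs n) x) \<longlonglongrightarrow> N1 U V x"
        using T1.F_tendsto[OF m(2,4) ae] unfolding N1_def by eventually_elim (rule tendsto_mult_left)
      show "AE x in lborel. (\<lambda>n. N2 (Us n) (Vs n) x) \<longlonglongrightarrow> N2 U V x"
        using T2.F_tendsto[OF m(1,3) ae(2,1)] unfolding N2_def by eventually_elim (rule tendsto_mult_left)
    qed (use Nb Nm in auto)
    obtain u G v H where sol: "S1.EL u G (N1 u v)" "S2.EL v H (N2 u v)" using coupled_solution by blast
    have um: "u \<in> borel_measurable borel" "v \<in> borel_measurable borel"
      using sol S1.WD(2) S2.WD(2) by (auto simp: S1.EL_def S2.EL_def)
    have g1: "N1 u v \<in> borel_measurable borel" and g2: "N2 u v \<in> borel_measurable borel" using Nm um by auto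
    have "AE x in lborel. max 0 (B1.z x) \<le> u x \<and> u x \<le> \<theta>1 \<and> (x \<in> \<Omega> \<longrightarrow> 0 < u x)"
      by (rule l1(2)[folded w1_def, rule_format, OF lam(1) sol(1) g1 Nb(1), of "T1.a v"])
         (use k1(2) in \<open>auto simp: N1_def T1.F_def\<close>)
    then have u: "AE x in lborel. w1 x \<le> u x \<and> u x \<le> \<theta>1 \<and> (x \<in> \<Omega> \<longrightarrow> 0 < u x)" unfolding w1_def .
    have "AE x in lborel. max 0 (B2.z x) \<le> v x \<and> v x \<le> \<theta>2 \<and> (x \<in> \<Omega> \<longrightarrow> 0 < v x)"
      by (rule l2(2)[folded w2_def, rule_format, OF lam(2) sol(2) g2 Nb(2), of "T2.a u"])
         (use k2(2) in \<open>auto simp: N2_def T2.F_def\<close>)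
    then have v: "AE x in lborel. w2 x \<le> v x \<and> v x \<le> \<theta>2 \<and> (x \<in> \<Omega> \<longrightarrow> 0 < v x)" unfolding w2_def .
    obtain u' where u': "S1.EL u' G (N1 u v)" "W0 \<Omega> p1 u' G" "in_Linf \<Omega> u'" "\<forall>x\<in>\<Omega>. 0 < u' x"
        "AE x in lborel. w1 x \<le> u x \<and> u x \<le> \<theta>1 \<and> u x = u' x"
      by (rule S1.EL_positive_version[OF sol(1) \<theta>(1) u e1(2)[rule_format]])
    obtain v' where v': "S2.EL v' H (N2 u v)" "W0 \<Omega> p2 v' H" "in_Linf \<Omega> v'" "\<forall>x\<in>\<Omega>. 0 < v' x"
        "AE x in lborel. w2 x \<le> v x \<and> v x \<le> \<theta>2 \<and> v x = v' x"
      by (rule S2.EL_positive_version[OF sol(2) \<theta>(2) v e2(2)[rule_format]])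
    have ae1: "AE x in lebesgue. x \<in> \<Omega> \<longrightarrow> lam * f1 (u' x) * lux \<Omega> q1 v' powr \<alpha>1 x / A x (lux \<Omega> r1 v') = N1 u v x"
      unfolding N1_def by (rule T1.F_unclipped[OF u'(5) v'(5) Q1(3) R1(3) a1(3)])
    have ae2: "AE x in lebesgue. x \<in> \<Omega> \<longrightarrow> lam * f2 (v' x) * lux \<Omega> q2 u' powr \<alpha>2 x / A x (lux \<Omega> r2 u') = N2 u v x"
      unfolding N2_def by (rule T2.F_unclipped[OF v'(5) u'(5) Q2(3) R2(3) a2(3)])
    have "pos_weak_solution \<Omega> p1 p2 q1 q2 r1 r2 \<alpha>1 \<alpha>2 A f1 f2 lam u' v'"
      unfolding pos_weak_solution_def
    proof (rule exI[of _ G], rule exI[of _ H], intro conjI allI impI)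
      show "weak_eq \<Omega> p1 G (\<lambda>x. lam * f1 (u' x) * lux \<Omega> q1 v' powr \<alpha>1 x / A x (lux \<Omega> r1 v')) \<phi> g\<phi>"
        if "W0 \<Omega> p1 \<phi> g\<phi>" for \<phi> g\<phi>
        by (rule S1.EL_weak_eq[OF u'(1) g1 Nb(1) e1(2)[rule_format] that ae1])
      show "weak_eq \<Omega> p2 H (\<lambda>x. lam * f2 (v' x) * lux \<Omega> q2 u' powr \<alpha>2 x / A x (lux \<Omega> r2 u')) \<phi> g\<phi>"
        if "W0 \<Omega> p2 \<phi> g\<phi>" for \<phi> g\<phi>
        by (rule S2.EL_weak_eq[OF v'(1) g2 Nb(2) e2(2)[rule_format] that ae2])
    qed (use u' v' in auto)
    then show "\<exists>u v. pos_weak_solution \<Omega> p1 p2 q1 q2 r1 r2 \<alpha>1 \<alpha>2 A f1 f2 lam u v" by blast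
  qed
qed

end
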